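(* Let $A\subseteq B$ be a ring extension. Assume that $A$ is subintegrally closed in $B$. Then: (1) $M\mathcal{I}(A,B)\cong M\mathcal{I}(A[T],B[T])$, where $T$ is an indeterminate. (2) $M\mathcal{I}(A,B)$ is a torsion-free abelian group if $B$ is a seminormal ring. (3) $M\mathcal{I}(A,B)$ is a free abelian group if $B$ is a seminormal ring and $A$ is Hensel local. (4) $M\mathcal{I}(A,B)=0$ if $B$ is a seminormal domain and $A$ is Hensel local.
   Context: All rings are commutative with $1$ and ring homomorphisms are unitary; $X$ is an indeterminate. For a ring extension $A\subseteq B$, an $A$-submodule $I$ of $B$ is invertible if there is an $A$-submodule $J$ of $B$ with $IJ=A$; $\mathcal{I}(A,B)$ is the group, under multiplication, of invertible $A$-submodules of $B$. $M\mathcal{I}(A,B)$ denotes the cokernel of the natural map $\mathcal{I}(A,B)\to\mathcal{I}(A[X,X^{-1}],B[X,X^{-1}])$, $I\mapsto I A[X,X^{-1}]$; "$=0$" means that this group is trivial. $A$ is subintegrally closed in $B$ if whenever $b\in B$ and $b^2,b^3\in A$ then $b\in A$. A ring $R$ is seminormal if whenever $b,c\in R$ and $b^3=c^2$, there exists $a\in R$ with $b=a^2$ and $c=a^3$. A local ring $A$ is Hensel if every finite $A$-algebra is a direct product of local rings. *)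

theory Defs
  imports "HOL-Algebra.Algebra"
begin

text \<open>A ring extension \<open>A \<subseteq> B\<close> is given by a ring \<open>B\<close> and a subset \<open>A\<close> with
  \<open>subcring A B\<close>; the ring \<open>A\<close> itself is then \<open>B\<lparr>carrier := A\<rparr>\<close>.\<close>

section \<open>Polynomial and Laurent polynomial extensions\<close>

definition poly_sub :: "'a set \<Rightarrow> ('a, 'b) ring_scheme \<Rightarrow> (nat \<Rightarrow> 'a) set" where
  "poly_sub A B = carrier (UP (B\<lparr>carrier := A\<rparr>))"

text \<open>\<open>LP R\<close> is \<open>R[X, X\<^sup>-\<^sup>1]\<close>: a Laurent polynomial is its finitely supported family of
  coefficients, as for \<open>UP\<close> but indexed by the integers.\<close>

definition LP :: "('a, 'b) ring_scheme \<Rightarrow> (int \<Rightarrow> 'a) ring" where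
  "LP R =
    \<lparr>carrier = {p. (\<forall>n. p n \<in> carrier R) \<and> finite {n. p n \<noteq> \<zero>\<^bsub>R\<^esub>}},
     monoid.mult = (\<lambda>p q n. \<Oplus>\<^bsub>R\<^esub>i \<in> {i. p i \<noteq> \<zero>\<^bsub>R\<^esub>}. p i \<otimes>\<^bsub>R\<^esub> q (n - i)),
     one = (\<lambda>n. if n = 0 then \<one>\<^bsub>R\<^esub> else \<zero>\<^bsub>R\<^esub>),
     ring.zero = (\<lambda>n. \<zero>\<^bsub>R\<^esub>),
     ring.add = (\<lambda>p q n. p n \<oplus>\<^bsub>R\<^esub> q n)\<rparr>"

definition LP_sub :: "'a set \<Rightarrow> ('a, 'b) ring_scheme \<Rightarrow> (int \<Rightarrow> 'a) set" where
  "LP_sub A B = carrier (LP (B\<lparr>carrier := A\<rparr>))"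

definition LP_const :: "('a, 'b) ring_scheme \<Rightarrow> 'a \<Rightarrow> int \<Rightarrow> 'a" where
  "LP_const R a = (\<lambda>n. if n = 0 then a else \<zero>\<^bsub>R\<^esub>)"

section \<open>Invertible submodules\<close>

text \<open>The library predicate \<open>subalgebra A I B\<close> only says that \<open>I\<close> is an additive subgroup
  of \<open>B\<close> closed under multiplication by \<open>A\<close>, i.e. an \<open>A\<close>-submodule of \<open>B\<close>;
  \<open>ideal_prod B I J\<close> is the set of finite nonempty sums of products \<open>i j\<close>, which for
  submodules is the product \<open>I J\<close>.\<close>

definition invertible_submodule :: "'a set \<Rightarrow> ('a, 'b) ring_scheme \<Rightarrow> 'a set \<Rightarrow> bool" where
  "invertible_submodule A B I \<longleftrightarrow>
     subalgebra A I B \<and> (\<exists>J. subalgebra A J B \<and> ideal_prod B I J = A)"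

definition inv_submodules :: "'a set \<Rightarrow> ('a, 'b) ring_scheme \<Rightarrow> 'a set monoid" where
  "inv_submodules A B =
    \<lparr>carrier = {I. invertible_submodule A B I}, monoid.mult = ideal_prod B, one = A\<rparr>"

definition LP_extend :: "'a set \<Rightarrow> ('a, 'b) ring_scheme \<Rightarrow> 'a set \<Rightarrow> (int \<Rightarrow> 'a) set" where
  "LP_extend A B I = ideal_prod (LP B) (LP_const B ` I) (LP_sub A B)"

definition MI :: "'a set \<Rightarrow> ('a, 'b) ring_scheme \<Rightarrow> (int \<Rightarrow> 'a) set set monoid" where
  "MI A B = inv_submodules (LP_sub A B) (LP B) Mod
              (LP_extend A B ` carrier (inv_submodules A B))"

section \<open>Conditions on rings\<close>

definition subintegrally_closed :: "'a set \<Rightarrow> ('a, 'b) ring_scheme \<Rightarrow> bool" where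
  "subintegrally_closed A B \<longleftrightarrow>
     (\<forall>b \<in> carrier B. b [^]\<^bsub>B\<^esub> (2::nat) \<in> A \<and> b [^]\<^bsub>B\<^esub> (3::nat) \<in> A \<longrightarrow> b \<in> A)"

definition seminormal :: "('a, 'b) ring_scheme \<Rightarrow> bool" where
  "seminormal R \<longleftrightarrow>
     (\<forall>b \<in> carrier R. \<forall>c \<in> carrier R. b [^]\<^bsub>R\<^esub> (3::nat) = c [^]\<^bsub>R\<^esub> (2::nat) \<longrightarrow>
        (\<exists>a \<in> carrier R. b = a [^]\<^bsub>R\<^esub> (2::nat) \<and> c = a [^]\<^bsub>R\<^esub> (3::nat)))"

definition local_ring :: "('a, 'b) ring_scheme \<Rightarrow> bool" where
  "local_ring R \<longleftrightarrow> cring R \<and> (\<exists>!M. maximalideal M R)"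

definition finite_algebra ::
    "('a, 'b) ring_scheme \<Rightarrow> ('c, 'd) ring_scheme \<Rightarrow> ('a \<Rightarrow> 'c) \<Rightarrow> bool" where
  "finite_algebra R C \<phi> \<longleftrightarrow>
     cring C \<and> \<phi> \<in> ring_hom R C \<and>
     (\<exists>F. finite F \<and> F \<subseteq> carrier C \<and>
        (\<forall>c \<in> carrier C. \<exists>r \<in> F \<rightarrow> carrier R. c = (\<Oplus>\<^bsub>C\<^esub>x \<in> F. \<phi> (r x) \<otimes>\<^bsub>C\<^esub> x)))"

text \<open>HOL cannot quantify over carrier types inside a definition. Nothing is lost with
  algebras carried by lists over the carrier type of \<open>R\<close>: if a finite algebra has \<open>n\<close>
  generators, choosing a coordinate vector for each element injects it into the lists of
  length \<open>n\<close> (see \<open>hensel_localD\<close> below). The same bound applies to the factors, which are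
  quotients of the algebra. The zero algebra is the empty product.\<close>

definition hensel_local :: "('a, 'b) ring_scheme \<Rightarrow> bool" where
  "hensel_local R \<longleftrightarrow>
     local_ring R \<and>
     (\<forall>(C :: 'a list ring) \<phi>. finite_algebra R C \<phi> \<longrightarrow>
        (\<exists>Ls :: 'a list ring list. (\<forall>L \<in> set Ls. local_ring L) \<and> C \<simeq> RDirProd_list Ls))"

section \<open>Conditions on abelian groups\<close>

definition torsion_free_abelian :: "('a, 'b) monoid_scheme \<Rightarrow> bool" where
  "torsion_free_abelian G \<longleftrightarrow>
     comm_group G \<and>
     (\<forall>x \<in> carrier G. \<forall>n::nat. n > 0 \<and> x [^]\<^bsub>G\<^esub> n = \<one>\<^bsub>G\<^esub> \<longrightarrow> x = \<one>\<^bsub>G\<^esub>)"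

text \<open>A basis of \<open>G\<close> is a subset of \<open>G\<close>, so index sets over the carrier type suffice.\<close>

definition free_abelian :: "('a, 'b) monoid_scheme \<Rightarrow> bool" where
  "free_abelian G \<longleftrightarrow> comm_group G \<and> (\<exists>S :: 'a set. G \<cong> free_Abelian_group S)"

section \<open>Finite algebras over arbitrary carrier types\<close>

lemma hensel_localD:
  fixes R :: "('a, 'b) ring_scheme" and C :: "('c, 'd) ring_scheme"
  assumes R: "hensel_local R" and fin: "finite_algebra R C \<phi>"
  shows "\<exists>Ls :: 'a list ring list. (\<forall>L \<in> set Ls. local_ring L) \<and> C \<simeq> RDirProd_list Ls"
proof -
  from fin have C: "cring C" and phi: "\<phi> \<in> ring_hom R C"
    by (auto simp: finite_algebra_def)
  interpret C: cring C by (rule C)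
  obtain F where F: "finite F" "F \<subseteq> carrier C"
    and gen: "\<forall>c \<in> carrier C. \<exists>r \<in> F \<rightarrow> carrier R. c = (\<Oplus>\<^bsub>C\<^esub>x \<in> F. \<phi> (r x) \<otimes>\<^bsub>C\<^esub> x)"
    using fin by (auto simp: finite_algebra_def)
  from gen obtain r where rF: "\<And>c. c \<in> carrier C \<Longrightarrow> r c \<in> F \<rightarrow> carrier R"
    and rc: "\<And>c. c \<in> carrier C \<Longrightarrow> c = (\<Oplus>\<^bsub>C\<^esub>x \<in> F. \<phi> (r c x) \<otimes>\<^bsub>C\<^esub> x)"
    by metis
  obtain xs where xs: "set xs = F" using F(1) finite_list by blast
  define f where "f = (\<lambda>c. map (r c) xs)"
  have phiF: "\<phi> (r c x) \<in> carrier C" if "c \<in> carrier C" "x \<in> F" for c x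
    using rF[OF that(1)] that(2) phi by (auto simp: ring_hom_def)
  have inj: "inj_on f (carrier C)"
  proof (rule inj_onI)
    fix c d assume c: "c \<in> carrier C" and d: "d \<in> carrier C" and "f c = f d"
    then have eq: "\<forall>x \<in> F. r c x = r d x" using xs by (auto simp: f_def)
    have "(\<Oplus>\<^bsub>C\<^esub>x \<in> F. \<phi> (r c x) \<otimes>\<^bsub>C\<^esub> x) = (\<Oplus>\<^bsub>C\<^esub>x \<in> F. \<phi> (r d x) \<otimes>\<^bsub>C\<^esub> x)"
      by (rule C.finsum_cong') (use eq phiF[OF d] F in auto)
    then show "c = d" using rc[OF c] rc[OF d] by simp
  qed
  define D :: "'a list ring" where "D = image_ring f C"
  have iso0: "f \<in> ring_iso C (image_ring f C)"
    using inj_imp_image_ring_iso[OF inj] .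
  have iso: "f \<in> ring_iso C D"
    using iso0 by (simp add: D_def)
  have hom: "f \<in> ring_hom C D" and bij: "f ` carrier C = carrier D"
    using iso by (auto simp: ring_iso_def bij_betw_def)
  have "cring (D\<lparr>ring.zero := f \<zero>\<^bsub>C\<^esub>\<rparr>)"
    using C.ring_iso_imp_img_cring[OF iso] .
  moreover have "f \<zero>\<^bsub>C\<^esub> = \<zero>\<^bsub>D\<^esub>"
    by (simp add: D_def image_ring_zero)
  ultimately have D: "cring D" by simp
  interpret D: cring D by (rule D)
  interpret f: ring_hom_cring C D f by unfold_locales (rule hom)
  have "finite_algebra R D (f \<circ> \<phi>)"
    unfolding finite_algebra_def
  proof (intro conjI exI[of _ "f ` F"] ballI)
    show "cring D" by (rule D)
    show "f \<circ> \<phi> \<in> ring_hom R D" using ring_hom_trans[OF phi hom] .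
    show "finite (f ` F)" using F by simp
    show "f ` F \<subseteq> carrier D" using F bij by auto
    fix d assume "d \<in> carrier D"
    then obtain c where c: "c \<in> carrier C" and dc: "d = f c" using bij by auto
    have injF: "inj_on f F" using inj F inj_on_subset by blast
    define s where "s = (\<lambda>y. r c (inv_into F f y))"
    have s: "s (f x) = r c x" if "x \<in> F" for x using injF that by (simp add: s_def)
    have "d = f (\<Oplus>\<^bsub>C\<^esub>x \<in> F. \<phi> (r c x) \<otimes>\<^bsub>C\<^esub> x)" using rc[OF c] dc by simp
    also have "\<dots> = (\<Oplus>\<^bsub>D\<^esub>x \<in> F. f (\<phi> (r c x) \<otimes>\<^bsub>C\<^esub> x))"
      using phiF[OF c] F by (subst f.hom_finsum) (auto simp: o_def Pi_def subset_iff)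
    also have "\<dots> = (\<Oplus>\<^bsub>D\<^esub>x \<in> F. (f \<circ> \<phi>) (s (f x)) \<otimes>\<^bsub>D\<^esub> f x)"
      by (rule D.finsum_cong') (use phiF[OF c] F s in \<open>auto simp: subset_iff\<close>)
    also have "\<dots> = (\<Oplus>\<^bsub>D\<^esub>y \<in> f ` F. (f \<circ> \<phi>) (s y) \<otimes>\<^bsub>D\<^esub> y)"
      by (rule D.finsum_reindex[symmetric]) (use phiF[OF c] F s injF in \<open>auto simp: subset_iff\<close>)
    finally have "d = (\<Oplus>\<^bsub>D\<^esub>y \<in> f ` F. (f \<circ> \<phi>) (s y) \<otimes>\<^bsub>D\<^esub> y)" .
    moreover have "s \<in> f ` F \<rightarrow> carrier R" using s rF[OF c] by auto
    ultimately show "\<exists>s \<in> f ` F \<rightarrow> carrier R. d = (\<Oplus>\<^bsub>D\<^esub>y \<in> f ` F. (f \<circ> \<phi>) (s y) \<otimes>\<^bsub>D\<^esub> y)"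
      by blast
  qed
  then obtain Ls :: "'a list ring list"
    where Ls: "\<forall>L \<in> set Ls. local_ring L" "D \<simeq> RDirProd_list Ls"
    using R unfolding hensel_local_def by blast
  then obtain g where "g \<in> ring_iso D (RDirProd_list Ls)" by (auto simp: is_ring_iso_def)
  then have "g \<circ> f \<in> ring_iso C (RDirProd_list Ls)" using ring_iso_set_trans[OF iso] by blast
  with Ls(1) show ?thesis by (auto simp: is_ring_iso_def)
qed

end

theory Submission
  imports Defs
begin

text \<open>Evaluation at \<open>X = 1\<close> splits \<open>\<I>(A, B) \<rightarrow> \<I>(A[X, X\<^sup>-\<^sup>1], B[X, X\<^sup>-\<^sup>1])\<close>, so \<open>MI A B\<close> is the group of
  invertible modules that become trivial at \<open>X = 1\<close>. The coefficients of generators of such a module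
  and of its inverse generate a ring \<open>S\<close> finite over \<open>A\<close> (Dedekind-Mertens). Modulo a prime of \<open>S\<close>
  over a prime \<open>p\<close> of \<open>A\<close>, the module is generated by a monomial \<open>X\<^sup>k\<close>. If \<open>k\<close> depends on \<open>p\<close> only,
  then the conductor of \<open>A\<close> in \<open>S\<close>, which is radical because \<open>A\<close> is subintegrally closed, must be
  the unit ideal, and the module is trivial. This applies to torsion elements, and, over \<open>A[T]\<close>, to
  the kernel of \<open>T \<mapsto> 1\<close> after exchanging the roles of the two variables. If \<open>A\<close> is Hensel
  local, then \<open>S\<close> is a product of local rings and the idempotents of \<open>S\<close> yield a unit that
  generates the module and is a monomial modulo each prime of \<open>B\<close>. The exponents identify \<open>MI A B\<close>
  with a ring, modulo constants, of bounded integer-valued functions on the primes of \<open>B\<close> that is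
  spanned by characteristic functions; such rings have a basis containing \<open>1\<close> (Noebeling).\<close>

section \<open>Ideals of a subring of a commutative ring\<close>

text \<open>The obstacle is that an exponent \<open>k\<close> belongs to a prime \<open>q\<close> of
  \<open>S\<close>, not to its contraction \<open>p\<close>: an idempotent \<open>e\<close> of
  \<open>S\<close> gives the unit \<open>e X + (1 - e)\<close>, with exponent 1 at some primes and 0
  at others. Every application excludes or repairs this. For polynomials, the absence of negative
  exponents forbids two different values over one \<open>p\<close>. For torsion elements, an
  \<open>m\<close>-th power has its coefficients in \<open>A\<close>, and a finitely supported
  function cannot be invariant under a nonzero shift. Over a Hensel local base, a unit built from
  idempotents makes the exponents vanish at the maximal ideals, and the comparison of residue rings
  carries this over to all primes. That \<open>A[X,1/X]\<close> inherits subintegral closedness,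
  which the exchange of variables requires, follows from the polynomial case itself. Computations
  take place in type-class rings, where Laurent polynomials are finitely supported maps. A ring with
  a carrier is replaced by a type-class ring that maps onto it with kernel \<open>N\<close>, and
  \<open>A\<close> by its preimage, so \<open>N\<close> stands for zero throughout.\<close>

definition ring_subset :: "'u::comm_ring_1 set \<Rightarrow> bool" where
  "ring_subset S \<longleftrightarrow> 1 \<in> S \<and> (\<forall>x\<in>S. \<forall>y\<in>S. x - y \<in> S \<and> x * y \<in> S)"

text \<open>The base ring is a parameter because ideals of \<open>A\<close> and of a larger ring
  \<open>S\<close> are compared inside one ambient type; contraction of a prime is then plain
  intersection with \<open>A\<close>.\<close>

definition ideal_in :: "'u::comm_ring_1 set \<Rightarrow> 'u set \<Rightarrow> bool" where
  "ideal_in S I \<longleftrightarrow>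
     I \<subseteq> S \<and> 0 \<in> I \<and> (\<forall>x\<in>I. \<forall>y\<in>I. x + y \<in> I) \<and> (\<forall>s\<in>S. \<forall>x\<in>I. s * x \<in> I)"

definition prime_in :: "'u::comm_ring_1 set \<Rightarrow> 'u set \<Rightarrow> bool" where
  "prime_in S P \<longleftrightarrow>
     ideal_in S P \<and> 1 \<notin> P \<and> (\<forall>x\<in>S. \<forall>y\<in>S. x * y \<in> P \<longrightarrow> x \<in> P \<or> y \<in> P)"

definition maximal_in :: "'u::comm_ring_1 set \<Rightarrow> 'u set \<Rightarrow> bool" where
  "maximal_in S M \<longleftrightarrow>
     ideal_in S M \<and> 1 \<notin> M \<and> (\<forall>I. ideal_in S I \<and> M \<subseteq> I \<and> 1 \<notin> I \<longrightarrow> I = M)"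

lemma ring_subset_UNIV [simp]: "ring_subset UNIV"
  by (simp add: ring_subset_def)

context
  fixes S :: "'u::comm_ring_1 set"
  assumes S: "ring_subset S"
begin

lemma ring_subset_one: "1 \<in> S"
  using S by (simp add: ring_subset_def)

lemma ring_subset_diff: "x \<in> S \<Longrightarrow> y \<in> S \<Longrightarrow> x - y \<in> S"
  using S by (simp add: ring_subset_def)

lemma ring_subset_mult: "x \<in> S \<Longrightarrow> y \<in> S \<Longrightarrow> x * y \<in> S"
  using S by (simp add: ring_subset_def)

lemma ring_subset_zero: "0 \<in> S"
  using ring_subset_diff[OF ring_subset_one ring_subset_one] by simp

lemma ring_subset_uminus: "x \<in> S \<Longrightarrow> - x \<in> S"
  using ring_subset_diff[OF ring_subset_zero, of x] by simp

lemma ring_subset_add: "x \<in> S \<Longrightarrow> y \<in> S \<Longrightarrow> x + y \<in> S"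
  using ring_subset_diff[OF _ ring_subset_uminus, of x y] by simp

lemma ring_subset_power: "x \<in> S \<Longrightarrow> x ^ n \<in> S"
  by (induction n) (auto intro: ring_subset_one ring_subset_mult)

lemma ring_subset_sum: "(\<And>i. i \<in> I \<Longrightarrow> f i \<in> S) \<Longrightarrow> sum f I \<in> S"
  by (induction I rule: infinite_finite_induct) (auto intro: ring_subset_zero ring_subset_add)

lemma ring_subset_prod: "(\<And>i. i \<in> I \<Longrightarrow> f i \<in> S) \<Longrightarrow> prod f I \<in> S"
  by (induction I rule: infinite_finite_induct) (auto intro: ring_subset_one ring_subset_mult)

lemmas ring_subset_closed = ring_subset_one ring_subset_zero ring_subset_diff ring_subset_mult
  ring_subset_uminus ring_subset_add ring_subset_power ring_subset_sum ring_subset_prod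

end

context
  fixes S I :: "'u::comm_ring_1 set"
  assumes S: "ring_subset S" and I: "ideal_in S I"
begin

lemma ideal_in_subset: "x \<in> I \<Longrightarrow> x \<in> S"
  using I by (auto simp: ideal_in_def)

lemma ideal_in_zero: "0 \<in> I"
  using I by (auto simp: ideal_in_def)

lemma ideal_in_add: "x \<in> I \<Longrightarrow> y \<in> I \<Longrightarrow> x + y \<in> I"
  using I by (auto simp: ideal_in_def)

lemma ideal_in_lmult: "s \<in> S \<Longrightarrow> x \<in> I \<Longrightarrow> s * x \<in> I"
  using I by (auto simp: ideal_in_def)

lemma ideal_in_rmult: "s \<in> S \<Longrightarrow> x \<in> I \<Longrightarrow> x * s \<in> I"
  using ideal_in_lmult[of s x] by (simp add: mult.commute)

lemma ideal_in_uminus: "x \<in> I \<Longrightarrow> - x \<in> I"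
  using ideal_in_lmult[of "-1" x] ring_subset_uminus[OF S ring_subset_one[OF S]] by simp

lemma ideal_in_diff: "x \<in> I \<Longrightarrow> y \<in> I \<Longrightarrow> x - y \<in> I"
  using ideal_in_add[OF _ ideal_in_uminus, of x y] by simp

lemma ideal_in_sum: "(\<And>i. i \<in> K \<Longrightarrow> f i \<in> I) \<Longrightarrow> sum f K \<in> I"
  by (induction K rule: infinite_finite_induct) (auto intro: ideal_in_zero ideal_in_add)

lemmas ideal_in_closed = ideal_in_zero ideal_in_add ideal_in_lmult ideal_in_rmult
  ideal_in_uminus ideal_in_diff ideal_in_sum

end

section \<open>Prime and maximal ideals and their existence\<close>

lemma prime_in_ideal: "prime_in S P \<Longrightarrow> ideal_in S P"
  by (simp add: prime_in_def)

lemma maximal_in_ideal: "maximal_in S M \<Longrightarrow> ideal_in S M"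
  by (simp add: maximal_in_def)

lemma prime_in_power:
  assumes S: "ring_subset S" and P: "prime_in S P" and x: "x \<in> S" and xn: "x ^ n \<in> P"
  shows "x \<in> P"
  using xn
proof (induction n)
  case 0 then show ?case using P by (simp add: prime_in_def)
next
  case (Suc n) then show ?case
    using P x ring_subset_power[OF S x] by (auto simp: prime_in_def)
qed

lemma prime_in_prod:
  assumes S: "ring_subset S" and P: "prime_in S P"
    and f: "\<And>i. i \<in> I \<Longrightarrow> f i \<in> S - P"
  shows "prod f I \<in> S - P"
  using f
proof (induction I rule: infinite_finite_induct)
  case (insert i I)
  then have "f i \<in> S - P" "prod f I \<in> S - P" by auto
  then have "f i * prod f I \<in> S" "f i * prod f I \<notin> P"
    using P ring_subset_mult[OF S] by (auto simp: prime_in_def)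
  with insert show ?case by simp
qed (use P ring_subset_one[OF S] in \<open>auto simp: prime_in_def\<close>)

lemma ideal_in_adjoin:
  assumes S: "ring_subset S" and I: "ideal_in S I" and x: "x \<in> S"
  shows "ideal_in S {i + s * x |i s. i \<in> I \<and> s \<in> S}" (is "ideal_in S ?J")
    and "I \<subseteq> {i + s * x |i s. i \<in> I \<and> s \<in> S}" and "x \<in> {i + s * x |i s. i \<in> I \<and> s \<in> S}"
proof -
  note cl = ring_subset_closed[OF S] ideal_in_closed[OF S I] ideal_in_subset[OF S I]
  have "?J \<subseteq> S"
  proof clarify
    fix i s assume "i \<in> I" "s \<in> S"
    then show "i + s * x \<in> S"
      using x by (intro ring_subset_add[OF S] ring_subset_mult[OF S] ideal_in_subset[OF S I, of i])
  qed
  moreover have "0 \<in> ?J"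
  proof -
    have "0 = 0 + 0 * x" "0 \<in> I" "0 \<in> S" by (auto intro: cl)
    then show ?thesis by blast
  qed
  moreover have "a + b \<in> ?J" if "a \<in> ?J" "b \<in> ?J" for a b
  proof -
    from that obtain i s j t where "a = i + s * x" "b = j + t * x" "i \<in> I" "j \<in> I" "s \<in> S" "t \<in> S"
      by auto
    then have "a + b = (i + j) + (s + t) * x" "i + j \<in> I" "s + t \<in> S"
      by (auto simp: algebra_simps intro: cl)
    then show ?thesis by blast
  qed
  moreover have "c * a \<in> ?J" if "a \<in> ?J" "c \<in> S" for a c
  proof -
    from that obtain i s where "a = i + s * x" "i \<in> I" "s \<in> S" by auto
    then have "c * a = c * i + (c * s) * x" "c * i \<in> I" "c * s \<in> S"
      using that by (auto simp: algebra_simps intro: cl)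
    then show ?thesis by blast
  qed
  ultimately show "ideal_in S ?J" by (auto simp: ideal_in_def)
  show "I \<subseteq> ?J"
  proof
    fix i assume "i \<in> I"
    moreover have "i = i + 0 * x" "0 \<in> S" by (auto intro: cl)
    ultimately show "i \<in> ?J" by blast
  qed
  have "x = 0 + 1 * x" "0 \<in> I" "1 \<in> S" by (auto intro: cl)
  then show "x \<in> ?J" by blast
qed

text \<open>Zorn's lemma for ideals that contain \<open>I\<close> and miss a set \<open>T\<close>;
  \<open>T = {1}\<close> yields maximal ideals, a multiplicative \<open>T\<close> yields
  primes.\<close>

lemma exists_maximal_avoiding:
  assumes I: "ideal_in S I" and dis: "T \<inter> I = {}"
  obtains P where "ideal_in S P" "I \<subseteq> P" "T \<inter> P = {}"
    "\<And>J. ideal_in S J \<Longrightarrow> P \<subseteq> J \<Longrightarrow> T \<inter> J = {} \<Longrightarrow> J = P"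
proof -
  let ?F = "{J. ideal_in S J \<and> I \<subseteq> J \<and> T \<inter> J = {}}"
  have "\<exists>P\<in>?F. \<forall>J\<in>?F. P \<subseteq> J \<longrightarrow> J = P"
  proof (rule subset_Zorn)
    fix C assume C: "subset.chain ?F C"
    show "\<exists>U\<in>?F. \<forall>J\<in>C. J \<subseteq> U"
    proof (cases "C = {}")
      case True
      then show ?thesis using I dis by auto
    next
      case False
      have CF: "J \<in> C \<Longrightarrow> ideal_in S J \<and> I \<subseteq> J \<and> T \<inter> J = {}" for J
        using C unfolding subset_chain_def by blast
      have chain: "J \<in> C \<Longrightarrow> K \<in> C \<Longrightarrow> J \<subseteq> K \<or> K \<subseteq> J" for J K
        using C unfolding subset_chain_def by blast
      have "x + y \<in> \<Union>C" if "x \<in> \<Union>C" "y \<in> \<Union>C" for x y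
      proof -
        from that obtain J K where "J \<in> C" "K \<in> C" "x \<in> J" "y \<in> K" by blast
        then obtain L where "L \<in> C" "x \<in> L" "y \<in> L" using chain[of J K] by auto
        then show ?thesis using CF[of L] by (auto simp: ideal_in_def)
      qed
      moreover have "s * x \<in> \<Union>C" if "s \<in> S" "x \<in> \<Union>C" for s x
      proof -
        from that(2) obtain J where "J \<in> C" "x \<in> J" by auto
        moreover then have "s * x \<in> J" using CF[of J] that(1) by (auto simp: ideal_in_def)
        ultimately show ?thesis by blast
      qed
      moreover obtain J where "J \<in> C" using False by auto
      then have "0 \<in> \<Union>C" "I \<subseteq> \<Union>C" using CF[of J] by (auto simp: ideal_in_def)
      moreover have "\<Union>C \<subseteq> S"
      proof
        fix x assume "x \<in> \<Union>C"
        then obtain J where "J \<in> C" "x \<in> J" by auto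
        then show "x \<in> S" using CF[of J] by (auto simp: ideal_in_def)
      qed
      moreover have "T \<inter> \<Union>C = {}" using CF by blast
      ultimately have "\<Union>C \<in> ?F" by (auto simp: ideal_in_def)
      then show ?thesis by blast
    qed
  qed
  then obtain P where "P \<in> ?F" "\<forall>J\<in>?F. P \<subseteq> J \<longrightarrow> J = P" by blast
  then show ?thesis using that[of P] by auto
qed

text \<open>Krull's argument: for \<open>x\<close> and \<open>y\<close> outside a maximal avoiding
  ideal \<open>P\<close>, both \<open>P + S x\<close> and \<open>P + S y\<close> meet
  \<open>T\<close>. The product of the two witnesses is again in \<open>T\<close>, but it would lie
  in \<open>P\<close> if \<open>x * y\<close> did.\<close>

lemma exists_prime_avoiding:
  assumes S: "ring_subset S" and I: "ideal_in S I" and dis: "T \<inter> I = {}"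
    and T: "1 \<in> T" "\<And>x y. x \<in> T \<Longrightarrow> y \<in> T \<Longrightarrow> x * y \<in> T"
  obtains P where "prime_in S P" "I \<subseteq> P" "T \<inter> P = {}"
proof -
  obtain P where P: "ideal_in S P" "I \<subseteq> P" "T \<inter> P = {}"
    and max: "\<And>J. ideal_in S J \<Longrightarrow> P \<subseteq> J \<Longrightarrow> T \<inter> J = {} \<Longrightarrow> J = P"
    using exists_maximal_avoiding[OF I dis] by blast
  note cl = ring_subset_closed[OF S] ideal_in_closed[OF S P(1)] ideal_in_subset[OF S P(1)]
  have meets: "\<exists>i s. i \<in> P \<and> s \<in> S \<and> i + s * x \<in> T" if x: "x \<in> S" "x \<notin> P" for x
  proof (rule ccontr)
    assume "\<not> ?thesis"
    then have "{i + s * x |i s. i \<in> P \<and> s \<in> S} = P"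
      using ideal_in_adjoin[OF S P(1) x(1)] by (intro max) auto
    then show False using ideal_in_adjoin(3)[OF S P(1) x(1)] x by auto
  qed
  have "x \<in> P \<or> y \<in> P" if xy: "x \<in> S" "y \<in> S" "x * y \<in> P" for x y
  proof (rule ccontr)
    assume "\<not> ?thesis"
    then obtain i s j t where ij: "i \<in> P" "s \<in> S" "i + s * x \<in> T" "j \<in> P" "t \<in> S" "j + t * y \<in> T"
      using meets[of x] meets[of y] xy by blast
    have "(i + s * x) * (j + t * y) = i * (j + t * y) + (s * x) * j + (s * t) * (x * y)"
      by (simp add: algebra_simps)
    also have "\<dots> \<in> P"
    proof (intro ideal_in_add[OF S P(1)])
      have "j + t * y \<in> S"
        using ij xy
        by (intro ring_subset_add[OF S] ring_subset_mult[OF S] ideal_in_subset[OF S P(1), of j])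
      then show "i * (j + t * y) \<in> P" using ij by (intro ideal_in_rmult[OF S P(1)])
      show "(s * x) * j \<in> P" "(s * t) * (x * y) \<in> P"
        using ij xy by (auto intro!: ideal_in_lmult[OF S P(1)] ring_subset_mult[OF S])
    qed
    finally show False using T(2)[OF ij(3) ij(6)] P(3) by auto
  qed
  then have "prime_in S P" using P T by (auto simp: prime_in_def)
  then show ?thesis using that P by blast
qed

lemma exists_maximal_in:
  assumes I: "ideal_in S I" and "1 \<notin> I"
  obtains M where "maximal_in S M" "I \<subseteq> M"
proof -
  have "{1} \<inter> I = {}" using assms by auto
  from exists_maximal_avoiding[OF I this]
  obtain M where M: "ideal_in S M" "I \<subseteq> M" "{1} \<inter> M = {}"
    and max: "\<And>J. ideal_in S J \<Longrightarrow> M \<subseteq> J \<Longrightarrow> {1} \<inter> J = {} \<Longrightarrow> J = M"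
    by metis
  have "maximal_in S M" using M max by (auto simp: maximal_in_def)
  then show ?thesis using that M by blast
qed

lemma maximal_in_unit:
  assumes S: "ring_subset S" and M: "maximal_in S M" and x: "x \<in> S" "x \<notin> M"
  obtains m s where "m \<in> M" "s \<in> S" "m + s * x = 1"
proof -
  note J = ideal_in_adjoin[OF S maximal_in_ideal[OF M] x(1)]
  have "1 \<in> {i + s * x |i s. i \<in> M \<and> s \<in> S}"
  proof (rule ccontr)
    assume "1 \<notin> {i + s * x |i s. i \<in> M \<and> s \<in> S}"
    then have "{i + s * x |i s. i \<in> M \<and> s \<in> S} = M"
      using M J(1,2) unfolding maximal_in_def by blast
    then show False using J(3) x by auto
  qed
  then show ?thesis using that by auto
qed

lemma maximal_in_prime:
  assumes S: "ring_subset S" and M: "maximal_in S M"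
  shows "prime_in S M"
proof -
  note I = maximal_in_ideal[OF M]
  have "y \<in> M" if xy: "x \<in> S" "y \<in> S" "x * y \<in> M" "x \<notin> M" for x y
  proof -
    obtain m s where ms: "m \<in> M" "s \<in> S" "m + s * x = 1"
      using maximal_in_unit[OF S M xy(1,4)] .
    have "y = (m + s * x) * y" using ms(3) by simp
    also have "\<dots> = m * y + s * (x * y)" by (simp add: algebra_simps)
    also have "\<dots> \<in> M"
      using ms xy by (auto intro!: ideal_in_add[OF S I] intro: ideal_in_lmult[OF S I] ideal_in_rmult[OF S I])
    finally show ?thesis .
  qed
  then show ?thesis using M by (auto simp: prime_in_def maximal_in_def)
qed

text \<open>Zorn's lemma is applied to multiplicative sets rather than to descending chains of
  primes: the complement of a maximal multiplicative set disjoint from \<open>I\<close> is a minimal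
  prime over \<open>I\<close>.\<close>

lemma exists_minimal_prime:
  assumes S: "ring_subset S" and I: "ideal_in S I" and "1 \<notin> I"
  obtains P where "prime_in S P" "I \<subseteq> P" "\<And>Q. prime_in S Q \<Longrightarrow> I \<subseteq> Q \<Longrightarrow> Q \<subseteq> P \<Longrightarrow> Q = P"
proof -
  let ?F = "{T. T \<subseteq> S \<and> 1 \<in> T \<and> (\<forall>x\<in>T. \<forall>y\<in>T. x * y \<in> T) \<and> T \<inter> I = {}}"
  have "\<exists>T\<in>?F. \<forall>U\<in>?F. T \<subseteq> U \<longrightarrow> U = T"
  proof (rule subset_Zorn)
    fix C assume C: "subset.chain ?F C"
    show "\<exists>U\<in>?F. \<forall>J\<in>C. J \<subseteq> U"
    proof (cases "C = {}")
      case True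
      have "{1} \<in> ?F" using assms ring_subset_one[OF S] by auto
      then show ?thesis using True by blast
    next
      case False
      have CF: "J \<in> C \<Longrightarrow> J \<in> ?F" for J
        using C unfolding subset_chain_def by blast
      have chain: "J \<in> C \<Longrightarrow> K \<in> C \<Longrightarrow> J \<subseteq> K \<or> K \<subseteq> J" for J K
        using C unfolding subset_chain_def by blast
      have "x * y \<in> \<Union>C" if "x \<in> \<Union>C" "y \<in> \<Union>C" for x y
      proof -
        from that obtain J K where "J \<in> C" "K \<in> C" "x \<in> J" "y \<in> K" by blast
        then obtain L where "L \<in> C" "x \<in> L" "y \<in> L" using chain[of J K] by auto
        then show ?thesis using CF[of L] by auto
      qed
      moreover obtain J where "J \<in> C" using False by auto
      then have "1 \<in> \<Union>C" using CF[of J] by auto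
      moreover have "\<Union>C \<subseteq> S" "\<Union>C \<inter> I = {}"
        using CF by (blast dest: CF)+
      ultimately have "\<Union>C \<in> ?F" by auto
      then show ?thesis by blast
    qed
  qed
  then obtain T where T: "T \<in> ?F" and max: "\<forall>U\<in>?F. T \<subseteq> U \<longrightarrow> U = T" ..
  have T': "T \<inter> I = {}" "1 \<in> T" "\<And>x y. x \<in> T \<Longrightarrow> y \<in> T \<Longrightarrow> x * y \<in> T" "T \<subseteq> S"
    using T by auto
  obtain P where P: "prime_in S P" "I \<subseteq> P" "T \<inter> P = {}"
    using exists_prime_avoiding[OF S I T'(1-3)] .
  have compl: "S - Q \<in> ?F" if "prime_in S Q" "I \<subseteq> Q" for Q
    using that ring_subset_one[OF S] ring_subset_mult[OF S] by (auto simp: prime_in_def)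
  have TP: "T \<subseteq> S - P" using T' P by auto
  have "Q = P" if Q: "prime_in S Q" "I \<subseteq> Q" "Q \<subseteq> P" for Q
  proof -
    have "S - Q = T" using bspec[OF max compl[OF Q(1,2)]] TP Q(3) by (metis (no_types, lifting) Diff_mono order_refl order_trans)
    moreover have "S - P = T" using bspec[OF max compl[OF P(1,2)]] TP by metis
    moreover have "Q \<subseteq> S" "P \<subseteq> S" using Q P by (auto simp: prime_in_def ideal_in_def)
    ultimately show ?thesis by auto
  qed
  then show ?thesis using that P by blast
qed

section \<open>Laurent polynomials\<close>

abbreviation coef :: "('i \<Rightarrow>\<^sub>0 'u::zero) \<Rightarrow> 'i \<Rightarrow> 'u" where
  "coef \<equiv> Poly_Mapping.lookup"

text \<open>The type \<open>int \<Rightarrow>\<^sub>0 'u\<close> with convolution is the Laurent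
  polynomial ring over the ambient ring; Laurent rings of subrings and extensions of ideals appear
  inside it as sets.\<close>

definition coeffs_in :: "'u::comm_ring_1 set \<Rightarrow> (int \<Rightarrow>\<^sub>0 'u) set" where
  "coeffs_in S = {f. \<forall>k. coef f k \<in> S}"

definition at_one :: "(int \<Rightarrow>\<^sub>0 'u::comm_ring_1) \<Rightarrow> 'u" where
  "at_one f = (\<Sum>k\<in>Poly_Mapping.keys f. coef f k)"

abbreviation shift :: "int \<Rightarrow> (int \<Rightarrow>\<^sub>0 'u::comm_ring_1)" where
  "shift k \<equiv> Poly_Mapping.single k 1"

abbreviation const :: "'u::comm_ring_1 \<Rightarrow> (int \<Rightarrow>\<^sub>0 'u)" where
  "const a \<equiv> Poly_Mapping.single 0 a"

lemma coeffs_inI: "(\<And>k. coef f k \<in> S) \<Longrightarrow> f \<in> coeffs_in S"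
  by (simp add: coeffs_in_def)

lemma coeffs_inD: "f \<in> coeffs_in S \<Longrightarrow> coef f k \<in> S"
  by (simp add: coeffs_in_def)

lemma coeffs_in_mono: "S \<subseteq> T \<Longrightarrow> coeffs_in S \<subseteq> coeffs_in T"
  by (auto simp: coeffs_in_def)

lemma coef_mult_superset:
  fixes f g :: "int \<Rightarrow>\<^sub>0 'u::comm_ring_1"
  assumes "finite S" and "Poly_Mapping.keys f \<subseteq> S"
  shows "coef (f * g) n = (\<Sum>i\<in>S. coef f i * coef g (n - i))"
proof -
  have inner: "(\<Sum>q. coef g q when n = i + q) = coef g (n - i)" for i
  proof -
    have "(\<lambda>q. coef g q when n = i + q) = (\<lambda>q. coef g q when q = n - i)"
      by (auto simp: fun_eq_iff when_def)
    then show ?thesis by (simp only: Sum_any_when_equal)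
  qed
  have "coef (f * g) n = (\<Sum>i. coef f i * coef g (n - i))"
    by (simp add: lookup_mult inner)
  also have "\<dots> = (\<Sum>i\<in>S. coef f i * coef g (n - i))"
    using assms by (intro Sum_any.expand_superset) (fastforce simp: in_keys_iff)+
  finally show ?thesis .
qed

lemmas coef_mult_keys = coef_mult_superset[OF finite_keys order_refl]

lemma coef_single_mult [simp]:
  fixes f :: "int \<Rightarrow>\<^sub>0 'u::comm_ring_1"
  shows "coef (Poly_Mapping.single k a * f) n = a * coef f (n - k)"
  by (subst coef_mult_superset[of "{k}"]) (auto split: if_splits)

lemma at_one_superset:
  assumes "finite S" and "Poly_Mapping.keys f \<subseteq> S"
  shows "at_one f = (\<Sum>i\<in>S. coef f i)"
  unfolding at_one_def using assms by (intro sum.mono_neutral_left) (auto simp: in_keys_iff)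

lemma at_one_add: "at_one (f + g) = at_one f + at_one g"
proof -
  let ?S = "Poly_Mapping.keys f \<union> Poly_Mapping.keys g"
  show ?thesis using keys_add[of f g]
    by (simp add: at_one_superset[of ?S] lookup_add sum.distrib)
qed

lemma at_one_zero [simp]: "at_one 0 = 0"
  by (simp add: at_one_def)

lemma at_one_uminus: "at_one (- f) = - at_one f"
  using at_one_add[of f "- f"] by (simp add: eq_neg_iff_add_eq_0 add.commute)

lemma at_one_diff: "at_one (f - g) = at_one f - at_one g"
  using at_one_add[of f "- g"] by (simp add: at_one_uminus)

lemma at_one_sum: "at_one (sum f I) = (\<Sum>i\<in>I. at_one (f i))"
  by (induction I rule: infinite_finite_induct) (auto simp: at_one_add)

lemma at_one_single [simp]: "at_one (Poly_Mapping.single k a) = a"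
  by (subst at_one_superset[of "{k}"]) auto

lemma at_one_one [simp]: "at_one 1 = 1"
  using at_one_single[of 0 1] by (simp only: single_one)

lemma at_one_mult: "at_one (f * g) = at_one f * at_one g"
proof -
  let ?K = "Poly_Mapping.keys f" and ?L = "Poly_Mapping.keys g"
  let ?S = "(\<lambda>(i, j). i + j) ` (?K \<times> ?L)"
  have "at_one (f * g) = (\<Sum>n\<in>?S. coef (f * g) n)"
    using keys_mult[of f g] by (intro at_one_superset) force+
  also have "\<dots> = (\<Sum>n\<in>?S. \<Sum>i\<in>?K. coef f i * coef g (n - i))"
    by (simp add: coef_mult_keys)
  also have "\<dots> = (\<Sum>i\<in>?K. \<Sum>n\<in>?S. coef f i * coef g (n - i))"
    by (rule sum.swap)
  also have "\<dots> = (\<Sum>i\<in>?K. coef f i * at_one g)"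
  proof (rule sum.cong)
    fix i assume i: "i \<in> ?K"
    have "(\<Sum>n\<in>?S. coef g (n - i)) = (\<Sum>j\<in>(\<lambda>n. n - i) ` ?S. coef g j)"
      by (subst sum.reindex) (auto simp: inj_on_def)
    also have "\<dots> = at_one g"
    proof (rule at_one_superset[symmetric])
      show "?L \<subseteq> (\<lambda>n. n - i) ` ?S"
      proof
        fix j assume "j \<in> ?L"
        then have "i + j \<in> ?S" using i by auto
        then show "j \<in> (\<lambda>n. n - i) ` ?S" by (rule rev_image_eqI) simp
      qed
    qed auto
    finally show "(\<Sum>n\<in>?S. coef f i * coef g (n - i)) = coef f i * at_one g"
      by (simp add: sum_distrib_left[symmetric])
  qed simp
  also have "\<dots> = at_one f * at_one g" by (simp add: at_one_def sum_distrib_right)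
  finally show ?thesis .
qed

lemma at_one_power: "at_one (f ^ n) = at_one f ^ n"
  by (induction n) (auto simp: at_one_mult)

lemma ring_subset_coeffs_in:
  assumes S: "ring_subset S"
  shows "ring_subset (coeffs_in S)"
proof -
  have "f * g \<in> coeffs_in S" if "f \<in> coeffs_in S" "g \<in> coeffs_in S" for f g
    using that by (auto simp: coeffs_in_def coef_mult_keys intro!: ring_subset_closed[OF S])
  moreover have "1 \<in> coeffs_in S"
    by (auto simp: coeffs_in_def lookup_one when_def intro: ring_subset_closed[OF S])
  ultimately show ?thesis
    by (auto simp: ring_subset_def) (auto simp: coeffs_in_def lookup_minus intro: ring_subset_closed[OF S])
qed

lemma ideal_in_coeffs_in:
  assumes S: "ring_subset S" and I: "ideal_in S I"
  shows "ideal_in (coeffs_in S) (coeffs_in I)"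
  using ideal_in_subset[OF S I]
  by (auto simp: ideal_in_def coeffs_in_def coef_mult_keys lookup_add
      intro!: ideal_in_zero[OF S I] ideal_in_add[OF S I] ideal_in_sum[OF S I] ideal_in_lmult[OF S I])

lemma single_in_coeffs_in:
  assumes "0 \<in> S" "a \<in> S" shows "Poly_Mapping.single k a \<in> coeffs_in S"
  using assms by (auto simp: coeffs_in_def lookup_single when_def)

lemma at_one_in:
  assumes "ring_subset S" "f \<in> coeffs_in S" shows "at_one f \<in> S"
  using assms by (auto simp: at_one_def coeffs_in_def intro: ring_subset_sum)

lemma at_one_in_ideal:
  assumes "ring_subset S" "ideal_in S I" "f \<in> coeffs_in I" shows "at_one f \<in> I"
  using assms by (auto simp: at_one_def coeffs_in_def intro: ideal_in_sum)

lemma shift_mult_shift: "shift k * shift l = shift (k + l)"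
  by (simp add: mult_single)

text \<open>All but one term of the convolution are absorbed by \<open>I\<close>. A prime
  \<open>I\<close> serves for extreme coefficients modulo a prime, \<open>I = {0}\<close> for
  leading and constant coefficients.\<close>

lemma coef_mult_isolated:
  fixes f g :: "int \<Rightarrow>\<^sub>0 'u::comm_ring_1"
  assumes S: "ring_subset S" and I: "ideal_in S I" and f: "f \<in> coeffs_in S" and g: "g \<in> coeffs_in S"
    and iso: "\<And>i. i \<noteq> k \<Longrightarrow> coef f i \<in> I \<or> coef g (n - i) \<in> I"
  shows "coef (f * g) n - coef f k * coef g (n - k) \<in> I"
proof -
  let ?S = "insert k (Poly_Mapping.keys f)"
  have "coef (f * g) n = (\<Sum>i\<in>?S. coef f i * coef g (n - i))"
    by (rule coef_mult_superset) auto
  also have "\<dots> = coef f k * coef g (n - k) + (\<Sum>i\<in>?S - {k}. coef f i * coef g (n - i))"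
    by (subst sum.remove[of _ k]) auto
  finally have "coef (f * g) n - coef f k * coef g (n - k) = (\<Sum>i\<in>?S - {k}. coef f i * coef g (n - i))"
    by simp
  also have "\<dots> \<in> I"
  proof (rule ideal_in_sum[OF S I])
    fix i assume "i \<in> ?S - {k}"
    then have "coef f i \<in> I \<or> coef g (n - i) \<in> I" using iso by auto
    then show "coef f i * coef g (n - i) \<in> I"
      using ideal_in_lmult[OF S I coeffs_inD[OF f]] ideal_in_rmult[OF S I coeffs_inD[OF g]] by blast
  qed
  finally show ?thesis .
qed

section \<open>Laurent polynomials modulo a prime\<close>

definition supp_mod :: "'u::comm_ring_1 set \<Rightarrow> (int \<Rightarrow>\<^sub>0 'u) \<Rightarrow> int set" where
  "supp_mod P f = {k. coef f k \<notin> P}"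

lemma finite_supp_mod: "0 \<in> P \<Longrightarrow> finite (supp_mod P f)"
  by (rule finite_subset[OF _ finite_keys[of f]]) (auto simp: supp_mod_def in_keys_iff)

lemma supp_mod_empty: "supp_mod P f = {} \<longleftrightarrow> f \<in> coeffs_in P"
  by (auto simp: supp_mod_def coeffs_in_def)

context
  fixes S P :: "'u::comm_ring_1 set"
  assumes S: "ring_subset S" and P: "prime_in S P"
begin

text \<open>At either end only one pair of exponents contributes modulo \<open>P\<close>, and the
  product of the two extreme coefficients is nonzero because \<open>S/P\<close> is a domain.\<close>

lemma extreme_coef:
  assumes f: "f \<in> coeffs_in S" "f \<notin> coeffs_in P" and g: "g \<in> coeffs_in S" "g \<notin> coeffs_in P"
  shows "coef (f * g) (Max (supp_mod P f) + Max (supp_mod P g)) \<notin> P"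
    and "coef (f * g) (Min (supp_mod P f) + Min (supp_mod P g)) \<notin> P"
proof -
  note I = prime_in_ideal[OF P]
  have fin: "finite (supp_mod P h)" for h by (intro finite_supp_mod ideal_in_zero[OF S I])
  have ne: "supp_mod P f \<noteq> {}" "supp_mod P g \<noteq> {}" using f g supp_mod_empty by auto
  have key: "coef (f * g) (k + l) \<notin> P"
    if k: "k \<in> supp_mod P f" and l: "l \<in> supp_mod P g"
      and iso: "\<And>i. i \<noteq> k \<Longrightarrow> i \<notin> supp_mod P f \<or> k + l - i \<notin> supp_mod P g" for k l
  proof
    assume *: "coef (f * g) (k + l) \<in> P"
    have "coef (f * g) (k + l) - coef f k * coef g (k + l - k) \<in> P"
      using iso by (intro coef_mult_isolated[OF S I f(1) g(1)]) (auto simp: supp_mod_def)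
    from ideal_in_diff[OF S I * this] have "coef f k * coef g l \<in> P" by simp
    then show False using P k l coeffs_inD[OF f(1)] coeffs_inD[OF g(1)]
      by (auto simp: prime_in_def supp_mod_def)
  qed
  show "coef (f * g) (Max (supp_mod P f) + Max (supp_mod P g)) \<notin> P"
  proof (rule key)
    fix i assume i: "i \<noteq> Max (supp_mod P f)"
    show "i \<notin> supp_mod P f \<or> Max (supp_mod P f) + Max (supp_mod P g) - i \<notin> supp_mod P g"
    proof (rule ccontr)
      assume "\<not> ?thesis"
      then have "i \<le> Max (supp_mod P f)" "Max (supp_mod P f) + Max (supp_mod P g) - i \<le> Max (supp_mod P g)"
        using fin by auto
      with i show False by linarith
    qed
  qed (use fin ne in auto)
  show "coef (f * g) (Min (supp_mod P f) + Min (supp_mod P g)) \<notin> P"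
  proof (rule key)
    fix i assume i: "i \<noteq> Min (supp_mod P f)"
    show "i \<notin> supp_mod P f \<or> Min (supp_mod P f) + Min (supp_mod P g) - i \<notin> supp_mod P g"
    proof (rule ccontr)
      assume "\<not> ?thesis"
      then have "i \<ge> Min (supp_mod P f)" "Min (supp_mod P f) + Min (supp_mod P g) - i \<ge> Min (supp_mod P g)"
        using fin by auto
      with i show False by linarith
    qed
  qed (use fin ne in auto)
qed

lemma coeffs_in_prime:
  assumes "f \<in> coeffs_in S" "g \<in> coeffs_in S" "f * g \<in> coeffs_in P"
  shows "f \<in> coeffs_in P \<or> g \<in> coeffs_in P"
  using extreme_coef(1)[of f g] assms by (auto dest: coeffs_inD)

text \<open>A divisor of a nonzero constant over a domain is a monomial: the highest exponents of
  \<open>f\<close> and \<open>g\<close> add up to 0 and so do the lowest, which leaves no width to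
  either. The constant \<open>t\<close> represents a unit of the residue field after denominators
  have been cleared.\<close>

lemma monomial_mod_prime:
  assumes f: "f \<in> coeffs_in S" and g: "g \<in> coeffs_in S" and t: "t \<in> S" "t \<notin> P"
    and fg: "f * g - const t \<in> coeffs_in P"
  obtains k where "\<And>j. j \<noteq> k \<Longrightarrow> coef f j \<in> P"
proof -
  note I = prime_in_ideal[OF P]
  note cI = ideal_in_closed[OF ring_subset_coeffs_in[OF S] ideal_in_coeffs_in[OF S I]]
  have fin: "finite (supp_mod P h)" for h by (intro finite_supp_mod ideal_in_zero[OF S I])
  have ct: "const t \<notin> coeffs_in P"
    using t by (metis coeffs_inD lookup_single_eq)
  have fgP: "f * g \<notin> coeffs_in P"
  proof
    assume "f * g \<in> coeffs_in P"
    from cI(6)[OF this fg] ct show False by simp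
  qed
  have fP: "f \<notin> coeffs_in P" using fgP cI(4)[OF g] by blast
  have gP: "g \<notin> coeffs_in P" using fgP cI(3)[OF f] by blast
  have ne: "supp_mod P f \<noteq> {}" "supp_mod P g \<noteq> {}" using fP gP supp_mod_empty by auto
  have z: "n = 0" if "coef (f * g) n \<notin> P" for n
  proof (rule ccontr)
    assume "n \<noteq> 0"
    then show False using coeffs_inD[OF fg, of n] that by (simp add: lookup_minus lookup_single when_def)
  qed
  have "Max (supp_mod P f) + Max (supp_mod P g) = 0" "Min (supp_mod P f) + Min (supp_mod P g) = 0"
    using extreme_coef[OF f fP g gP] z by auto
  moreover have "Min (supp_mod P f) \<le> Max (supp_mod P f)" "Min (supp_mod P g) \<le> Max (supp_mod P g)"
    using ne fin by auto
  ultimately have eq: "Min (supp_mod P f) = Max (supp_mod P f)" by linarith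
  have "coef f j \<in> P" if "j \<noteq> Max (supp_mod P f)" for j
  proof (rule ccontr)
    assume "coef f j \<notin> P"
    then have "j \<in> supp_mod P f" by (simp add: supp_mod_def)
    then have "Min (supp_mod P f) \<le> j" "j \<le> Max (supp_mod P f)" using fin by auto
    with eq that show False by linarith
  qed
  then show ?thesis using that by blast
qed

end

section \<open>The fibre of an invertible module over a prime\<close>

lemma const_mult: "const (a * b) = const a * const b"
  by (simp add: mult_single)

text \<open>Laurent polynomials over the residue field of \<open>p\<close> form a Euclidean domain,
  with the width of the support as size. An element of least width generates the image of
  \<open>H\<close>; factors from \<open>A - p\<close> clear the denominators of the
  quotients.\<close>

lemma pseudo_division:
  fixes A p :: "'u::comm_ring_1 set"
  assumes A: "ring_subset A" and p: "prime_in A p"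
    and H: "ideal_in (coeffs_in A) H" and Hp: "\<not> H \<subseteq> coeffs_in p"
  obtains h where "h \<in> H" "h \<notin> coeffs_in p"
    "\<And>m. m \<in> H \<Longrightarrow> \<exists>t\<in>A - p. \<exists>k\<in>coeffs_in A. const t * m - k * h \<in> coeffs_in p"
proof -
  note RA = ring_subset_coeffs_in[OF A]
  note I = prime_in_ideal[OF p]
  note Ip = ideal_in_coeffs_in[OF A I]
  define wd where "wd f = nat (Max (supp_mod p f) - Min (supp_mod p f))" for f
  have fin: "finite (supp_mod p h)" for h by (intro finite_supp_mod ideal_in_zero[OF A I])
  have "\<exists>h. h \<in> H \<and> h \<notin> coeffs_in p" using Hp by blast
  then obtain h where h: "h \<in> H" "h \<notin> coeffs_in p"
    and least: "\<And>m. m \<in> H \<Longrightarrow> m \<notin> coeffs_in p \<Longrightarrow> wd h \<le> wd m"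
    using ex_has_least_nat[of "\<lambda>h. h \<in> H \<and> h \<notin> coeffs_in p" _ wd] by blast
  have hA: "h \<in> coeffs_in A" using h H by (auto simp: ideal_in_def)
  have ne: "supp_mod p m \<noteq> {}" if "m \<notin> coeffs_in p" for m using that supp_mod_empty by auto
  define a where "a = Min (supp_mod p h)"
  define b where "b = Max (supp_mod p h)"
  define t where "t = coef h b"
  have ab: "a \<in> supp_mod p h" "b \<in> supp_mod p h" "a \<le> b"
    using fin ne[OF h(2)] by (auto simp: a_def b_def)
  have hab: "coef h j \<in> p" if "j < a \<or> b < j" for j
  proof (rule ccontr)
    assume "coef h j \<notin> p"
    then have "j \<in> supp_mod p h" by (simp add: supp_mod_def)
    then have "a \<le> j" "j \<le> b" using fin by (auto simp: a_def b_def)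
    with that show False by linarith
  qed
  have t: "t \<in> A" "t \<notin> p" using ab coeffs_inD[OF hA] by (auto simp: t_def supp_mod_def)
  have "\<exists>u\<in>A - p. \<exists>k\<in>coeffs_in A. const u * m - k * h \<in> coeffs_in p" if "m \<in> H" for m
    using that
  proof (induction "wd m" arbitrary: m rule: less_induct)
    case less
    have mA: "m \<in> coeffs_in A" using less.prems H by (auto simp: ideal_in_def)
    show ?case
    proof (cases "m \<in> coeffs_in p")
      case True
      then have "const 1 * m - 0 * h \<in> coeffs_in p" by simp
      moreover have "0 \<in> coeffs_in A" by (rule ring_subset_zero[OF RA])
      moreover have "1 \<in> A - p" using p ring_subset_one[OF A] by (auto simp: prime_in_def)
      ultimately show ?thesis by blast
    next
      case False
      define K where "K = Max (supp_mod p m)"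
      define L where "L = Min (supp_mod p m)"
      have KL: "K \<in> supp_mod p m" "L \<in> supp_mod p m" "L \<le> K"
        using fin ne[OF False] by (auto simp: K_def L_def)
      have mKL: "coef m j \<in> p" if "j < L \<or> K < j" for j
      proof (rule ccontr)
        assume "coef m j \<notin> p"
        then have "j \<in> supp_mod p m" by (simp add: supp_mod_def)
        then have "L \<le> j" "j \<le> K" using fin by (auto simp: K_def L_def)
        with that show False by linarith
      qed
      \<comment> \<open>The shifted multiple of \<open>h\<close> cancels the top term of
        \<open>t * m\<close>. As \<open>h\<close> is no wider than \<open>m\<close>, its lowest
        exponent stays at or above \<open>L\<close>, so the support modulo \<open>p\<close> shrinks
        strictly.\<close>
      define q where "q = Poly_Mapping.single (K - b) (coef m K)"
      define m' where "m' = const t * m - q * h"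
      have qA: "q \<in> coeffs_in A"
        unfolding q_def by (intro single_in_coeffs_in ring_subset_zero[OF A] coeffs_inD[OF mA])
      have ctA: "const u \<in> coeffs_in A" if "u \<in> A" for u
        using that by (intro single_in_coeffs_in ring_subset_zero[OF A])
      have RAl: "ideal_in (coeffs_in A) H" by (rule H)
      have m'H: "m' \<in> H" unfolding m'_def
        by (intro ideal_in_diff[OF RA H] ideal_in_lmult[OF RA H] less.prems h qA ctA t)
      have wle: "b - a \<le> K - L"
        using least[OF less.prems False] KL ab by (simp add: wd_def K_def L_def a_def b_def)
      have c': "coef m' j = t * coef m j - coef m K * coef h (j - (K - b))" for j
        by (simp add: m'_def q_def lookup_minus)
      have m'p: "coef m' j \<in> p" if j: "j < L \<or> K \<le> j" for j
      proof (cases "j = K")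
        case True
        then have "coef m' j = 0" by (simp add: c' t_def)
        then show ?thesis using ideal_in_zero[OF A I] by simp
      next
        case False
        then have "coef m j \<in> p" using j by (intro mKL) auto
        moreover have "coef h (j - (K - b)) \<in> p" using j False wle by (intro hab) auto
        ultimately show ?thesis unfolding c'
          by (intro ideal_in_diff[OF A I] ideal_in_lmult[OF A I] t coeffs_inD[OF mA])
      qed
      have "\<exists>u\<in>A - p. \<exists>k\<in>coeffs_in A. const u * m' - k * h \<in> coeffs_in p"
      proof (cases "m' \<in> coeffs_in p")
        case True
        then have "const 1 * m' - 0 * h \<in> coeffs_in p" by simp
        moreover have "0 \<in> coeffs_in A" by (rule ring_subset_zero[OF RA])
        moreover have "1 \<in> A - p" using p ring_subset_one[OF A] by (auto simp: prime_in_def)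
        ultimately show ?thesis by blast
      next
        case m'np: False
        have range: "L \<le> j \<and> j < K" if "j \<in> supp_mod p m'" for j
        proof -
          have "\<not> (j < L \<or> K \<le> j)" using m'p[of j] that unfolding supp_mod_def by blast
          then show ?thesis by linarith
        qed
        have "Max (supp_mod p m') < K" "L \<le> Min (supp_mod p m')"
             "Min (supp_mod p m') \<le> Max (supp_mod p m')"
          using fin ne[OF m'np] range by auto
        then have "wd m' < wd m" by (simp add: wd_def K_def[symmetric] L_def[symmetric])
        then show ?thesis using less.hyps m'H by blast
      qed
      then obtain u k where uk: "u \<in> A" "u \<notin> p" "k \<in> coeffs_in A"
        and r: "const u * m' - k * h \<in> coeffs_in p" by blast
      have "const (u * t) * m - (const u * q + k) * h = const u * m' - k * h"
        by (simp add: m'_def algebra_simps const_mult)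
      then have "const (u * t) * m - (const u * q + k) * h \<in> coeffs_in p" using r by simp
      moreover have "u * t \<in> A - p"
        using uk t p ring_subset_mult[OF A] by (auto simp: prime_in_def)
      moreover have "const u * q + k \<in> coeffs_in A"
        by (intro ring_subset_add[OF RA] ring_subset_mult[OF RA] ctA uk qA)
      ultimately show ?thesis by blast
    qed
  qed
  then show ?thesis using that h by blast
qed

lemma ideal_in_restrict:
  assumes A: "ring_subset A" and AS: "A \<subseteq> S" and q: "prime_in S q"
  shows "prime_in A (q \<inter> A)"
proof -
  have "ideal_in A (q \<inter> A)"
    using AS q by (auto simp: prime_in_def ideal_in_def intro: ring_subset_closed[OF A])
  moreover have "x \<in> q \<or> y \<in> q" if "x \<in> A" "y \<in> A" "x * y \<in> q" for x y
    using q AS that unfolding prime_in_def by blast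
  ultimately show ?thesis using q by (auto simp: prime_in_def)
qed

text \<open>Over the residue field of \<open>p\<close> the module spanned by the \<open>f i\<close> is principal, because
  Laurent polynomials over a field form a principal ideal domain; modulo each prime \<open>q\<close>
  over \<open>p\<close> its generator is a unit, hence a monomial, and the normalisation at \<open>X = 1\<close> makes its
  coefficient lie in \<open>A\<close>.\<close>

lemma fibre_monomial:
  fixes A S N p :: "'u::comm_ring_1 set" and f g :: "nat \<Rightarrow> (int \<Rightarrow>\<^sub>0 'u)"
  assumes A: "ring_subset A" and S: "ring_subset S" and AS: "A \<subseteq> S"
    and p: "prime_in A p" and N: "N \<subseteq> p"
    and f: "\<And>i. i < n \<Longrightarrow> f i \<in> coeffs_in S" and g: "\<And>i. i < n \<Longrightarrow> g i \<in> coeffs_in S"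
    and fg: "\<And>i j. i < n \<Longrightarrow> j < n \<Longrightarrow> f i * g j \<in> coeffs_in A"
    and one: "(\<Sum>i<n. f i * g i) - 1 \<in> coeffs_in N"
    and f1: "\<And>i. i < n \<Longrightarrow> at_one (f i) \<in> A"
  obtains t w where "t \<in> A" "t \<notin> p" "\<And>i. i < n \<Longrightarrow> w i \<in> coeffs_in A"
    "\<And>q. prime_in S q \<Longrightarrow> q \<inter> A = p \<Longrightarrow> \<exists>k. \<forall>i<n. const t * f i - shift k * w i \<in> coeffs_in q"
proof -
  note RA = ring_subset_coeffs_in[OF A] and RS = ring_subset_coeffs_in[OF S]
  note Ip = prime_in_ideal[OF p]
  note Ipc = ideal_in_coeffs_in[OF A Ip]
  have ASc: "coeffs_in A \<subseteq> coeffs_in S" using AS by (rule coeffs_in_mono)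
  have ctA: "const u \<in> coeffs_in A" if "u \<in> A" for u
    using that by (intro single_in_coeffs_in ring_subset_zero[OF A])
  have "\<exists>j<n. f j * g j \<notin> coeffs_in p"
  proof (rule ccontr)
    assume "\<not> ?thesis"
    then have "(\<Sum>i<n. f i * g i) \<in> coeffs_in p" by (intro ideal_in_sum[OF RA Ipc]) auto
    moreover have "(\<Sum>i<n. f i * g i) - 1 \<in> coeffs_in p" using one coeffs_in_mono[OF N] by blast
    ultimately have "(\<Sum>i<n. f i * g i) - ((\<Sum>i<n. f i * g i) - 1) \<in> coeffs_in p"
      by (rule ideal_in_diff[OF RA Ipc])
    then have "(1 :: int \<Rightarrow>\<^sub>0 'u) \<in> coeffs_in p" by simp
    from coeffs_inD[OF this, of 0] show False using p by (simp add: prime_in_def)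
  qed
  \<comment> \<open>Multiplication by this \<open>g j0\<close> moves the module spanned by the
    \<open>f i\<close> into \<open>A[X,1/X]\<close>, and since \<open>f j0 * g j0\<close> survives
    modulo \<open>p\<close>, the factor can be cancelled again modulo every prime over
    \<open>p\<close>.\<close>
  then obtain j0 where j0: "j0 < n" "f j0 * g j0 \<notin> coeffs_in p" by blast
  define g1 where "g1 = g j0"
  define H where "H = {\<Sum>i<n. a i * (f i * g1) |a. \<forall>i<n. a i \<in> coeffs_in A}"
  have g1S: "g1 \<in> coeffs_in S" using g j0 by (simp add: g1_def)
  have fg1: "f i * g1 \<in> coeffs_in A" if "i < n" for i using fg that j0 by (simp add: g1_def)
  have H_ideal: "ideal_in (coeffs_in A) H"
    unfolding ideal_in_def
  proof (intro conjI ballI)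
    show "H \<subseteq> coeffs_in A"
      using fg1 by (auto simp: H_def intro!: ring_subset_sum[OF RA] intro: ring_subset_mult[OF RA])
    have "0 = (\<Sum>i<n. 0 * (f i * g1))" "\<forall>i<n. 0 \<in> coeffs_in A"
      by (auto intro: ring_subset_zero[OF RA])
    then show "0 \<in> H" unfolding H_def by (intro CollectI exI[of _ "\<lambda>_. 0"]) simp
    fix x assume "x \<in> H"
    then obtain a where a: "x = (\<Sum>i<n. a i * (f i * g1))" "\<forall>i<n. a i \<in> coeffs_in A"
      by (auto simp: H_def)
    { fix y assume "y \<in> H"
      then obtain b where b: "y = (\<Sum>i<n. b i * (f i * g1))" "\<forall>i<n. b i \<in> coeffs_in A"
        by (auto simp: H_def)
      have "x + y = (\<Sum>i<n. (a i + b i) * (f i * g1))"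
        by (simp add: a b sum.distrib distrib_right)
      moreover have "\<forall>i<n. a i + b i \<in> coeffs_in A" using a b by (auto intro: ring_subset_add[OF RA])
      ultimately show "x + y \<in> H" unfolding H_def by (intro CollectI exI[of _ "\<lambda>i. a i + b i"]) simp }
    { fix s assume s: "s \<in> coeffs_in A"
      have "s * x = (\<Sum>i<n. (s * a i) * (f i * g1))"
        by (simp add: a sum_distrib_left mult.assoc)
      moreover have "\<forall>i<n. s * a i \<in> coeffs_in A" using a s by (auto intro: ring_subset_mult[OF RA])
      ultimately show "s * x \<in> H" unfolding H_def by (intro CollectI exI[of _ "\<lambda>i. s * a i"]) simp }
  qed
  have fgH: "f i * g1 \<in> H" if i: "i < n" for i
  proof -
    have "(\<Sum>l<n. (if l = i then 1 else 0) * (f l * g1)) = (\<Sum>l<n. if l = i then f l * g1 else 0)"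
      by (rule sum.cong) auto
    also have "\<dots> = f i * g1" using i by simp
    finally show ?thesis unfolding H_def
      using ring_subset_zero[OF RA] ring_subset_one[OF RA]
      by (intro CollectI exI[of _ "\<lambda>l. if l = i then 1 else 0"]) simp
  qed
  have "\<not> H \<subseteq> coeffs_in p" using fgH[OF j0(1)] j0(2) by (auto simp: g1_def)
  then obtain h where h: "h \<in> H" "h \<notin> coeffs_in p"
    and div: "\<And>m. m \<in> H \<Longrightarrow> \<exists>t\<in>A - p. \<exists>k\<in>coeffs_in A. const t * m - k * h \<in> coeffs_in p"
    using pseudo_division[OF A p H_ideal] by metis
  obtain a where a: "h = (\<Sum>i<n. a i * (f i * g1))" "\<And>i. i < n \<Longrightarrow> a i \<in> coeffs_in A"
    using h(1) by (auto simp: H_def)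
  have "\<forall>i\<in>{..<n}. \<exists>t k. t \<in> A - p \<and> k \<in> coeffs_in A \<and> const t * (f i * g1) - k * h \<in> coeffs_in p"
  proof
    fix i assume "i \<in> {..<n}"
    then have "i < n" by simp
    from div[OF fgH[OF this]]
    show "\<exists>t k. t \<in> A - p \<and> k \<in> coeffs_in A \<and> const t * (f i * g1) - k * h \<in> coeffs_in p"
      by blast
  qed
  from bchoice[OF this] obtain t where
    "\<forall>i\<in>{..<n}. \<exists>k. t i \<in> A - p \<and> k \<in> coeffs_in A \<and> const (t i) * (f i * g1) - k * h \<in> coeffs_in p" ..
  from bchoice[OF this] obtain k where "\<forall>i\<in>{..<n}. t i \<in> A - p \<and> k i \<in> coeffs_in A \<and>
    const (t i) * (f i * g1) - k i * h \<in> coeffs_in p" ..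
  then have t: "\<And>i. i < n \<Longrightarrow> t i \<in> A - p" and k: "\<And>i. i < n \<Longrightarrow> k i \<in> coeffs_in A"
    and tk: "\<And>i. i < n \<Longrightarrow> const (t i) * (f i * g1) - k i * h \<in> coeffs_in p"
    by simp_all
  \<comment> \<open>A common denominator: \<open>T * f i * g1\<close> is congruent to
    \<open>K i * h\<close> for all \<open>i\<close> at once.\<close>
  define T where "T = prod t {..<n}"
  define r where "r i = prod t ({..<n} - {i})" for i
  have T: "T \<in> A - p" unfolding T_def using t by (intro prime_in_prod[OF A p]) auto
  have rA: "r i \<in> A" for i unfolding r_def using t by (intro ring_subset_prod[OF A]) auto
  have Tr: "T = r i * t i" if "i < n" for i
    using that by (simp add: T_def r_def prod.remove[of "{..<n}" i] mult.commute)
  define K where "K i = const (r i) * k i" for i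
  have KA: "K i \<in> coeffs_in A" if "i < n" for i
    unfolding K_def using that by (intro ring_subset_mult[OF RA] ctA rA k)
  have TK: "const T * (f i * g1) - K i * h \<in> coeffs_in p" if i: "i < n" for i
  proof -
    have "const T * (f i * g1) - K i * h = const (r i) * (const (t i) * (f i * g1) - k i * h)"
      by (simp add: K_def Tr[OF i] algebra_simps const_mult)
    also have "\<dots> \<in> coeffs_in p" by (intro ideal_in_lmult[OF RA Ipc] ctA rA tk i)
    finally show ?thesis .
  qed
  \<comment> \<open>Over the residue field \<open>F\<close> generates the module spanned by the
    \<open>f i\<close>, and \<open>G\<close> is \<open>T\<close> times the inverse of
    \<open>F\<close>. Modulo a prime over \<open>p\<close>, \<open>F\<close> will turn out to be
    \<open>c X^m\<close> with \<open>c = F(1)\<close>, whence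
    \<open>T * f i = f i * F * G = X^m * w i\<close> there.\<close>
  define F where "F = (\<Sum>i<n. a i * f i)"
  define G where "G = (\<Sum>i<n. K i * g i)"
  define c where "c = at_one F"
  define w where "w i = const c * (f i * G)" for i
  have hF: "h = F * g1" by (simp add: a F_def sum_distrib_right mult.assoc)
  have FS: "F \<in> coeffs_in S" unfolding F_def
    using a f ASc by (intro ring_subset_sum[OF RS] ring_subset_mult[OF RS]) auto
  have GS: "G \<in> coeffs_in S" unfolding G_def
    using KA g ASc by (intro ring_subset_sum[OF RS] ring_subset_mult[OF RS]) auto
  have cA: "c \<in> A" unfolding c_def F_def at_one_sum at_one_mult
    using a(2) f1 at_one_in[OF A a(2)] by (intro ring_subset_sum[OF A] ring_subset_mult[OF A]) auto
  have fGA: "f i * G \<in> coeffs_in A" if "i < n" for i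
  proof -
    have "f i * G = (\<Sum>j<n. K j * (f i * g j))" by (simp add: G_def sum_distrib_left ac_simps)
    also have "\<dots> \<in> coeffs_in A"
      using ring_subset_mult[OF RA KA fg[OF that]] by (intro ring_subset_sum[OF RA]) auto
    finally show ?thesis .
  qed
  have wA: "w i \<in> coeffs_in A" if "i < n" for i
    unfolding w_def by (intro ring_subset_mult[OF RA] ctA cA fGA that)
  have "\<exists>m. \<forall>i<n. const T * f i - shift m * w i \<in> coeffs_in q"
    if q: "prime_in S q" and qp: "q \<inter> A = p" for q
  proof -
    note Iq = prime_in_ideal[OF q]
    note Iqc = ideal_in_coeffs_in[OF S Iq]
    note cl = ideal_in_closed[OF RS Iqc] ring_subset_closed[OF RS]
    have pq: "coeffs_in p \<subseteq> coeffs_in q" using qp by (intro coeffs_in_mono) auto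
    have Nq: "coeffs_in N \<subseteq> coeffs_in q" using qp N by (intro coeffs_in_mono) auto
    have Tq: "T \<in> S" "T \<notin> q" using T qp AS by auto
    have CTS: "const T \<in> coeffs_in S" using ctA T ASc by auto
    define \<nu> where "\<nu> = (\<Sum>i<n. f i * g i) - 1"
    have \<nu>: "\<nu> \<in> coeffs_in q" using one Nq by (auto simp: \<nu>_def)
    \<comment> \<open>Modulo \<open>N\<close>, \<open>T * g1\<close> equals
      \<open>T * g1 * (\<Sum> f i * g i)\<close>, and each \<open>T * f i * g1\<close> may be
      replaced by \<open>K i * h = K i * F * g1\<close>.\<close>
    have "g1 * (const T - F * G) = (\<Sum>i<n. (const T * (f i * g1) - K i * h) * g i) - const T * g1 * \<nu>"
      by (simp add: \<nu>_def hF G_def algebra_simps sum_distrib_left sum_distrib_right sum_subtractf)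
    also have "\<dots> \<in> coeffs_in q"
    proof (intro ideal_in_diff[OF RS Iqc] ideal_in_sum[OF RS Iqc])
      show "const T * g1 * \<nu> \<in> coeffs_in q"
        by (intro ideal_in_lmult[OF RS Iqc] ring_subset_mult[OF RS] CTS g1S \<nu>)
      show "(const T * (f i * g1) - K i * h) * g i \<in> coeffs_in q" if "i \<in> {..<n}" for i
        using that TK pq g by (intro ideal_in_rmult[OF RS Iqc]) auto
    qed
    finally have "g1 \<in> coeffs_in q \<or> const T - F * G \<in> coeffs_in q"
      using CTS FS GS g1S by (intro coeffs_in_prime[OF S q]) (auto intro: ring_subset_closed[OF RS])
    moreover have "g1 \<notin> coeffs_in q"
    proof
      assume "g1 \<in> coeffs_in q"
      then have "f j0 * g1 \<in> coeffs_in q" using f j0 by (intro ideal_in_lmult[OF RS Iqc]) auto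
      then have "f j0 * g1 \<in> coeffs_in p" using fg1[OF j0(1)] qp by (auto simp: coeffs_in_def)
      then show False using j0 by (simp add: g1_def)
    qed
    ultimately have TFG: "const T - F * G \<in> coeffs_in q" by blast
    have "F * G - const T \<in> coeffs_in q" using ideal_in_uminus[OF RS Iqc TFG] by simp
    then obtain m where m: "\<And>j. j \<noteq> m \<Longrightarrow> coef F j \<in> q"
      using monomial_mod_prime[OF S q FS GS Tq] by metis
    \<comment> \<open>The value at \<open>X = 1\<close> is the sum of the coefficients, and all of
      them except the one at \<open>m\<close> vanish modulo \<open>q\<close>. The coefficient of the
      monomial is thus represented by \<open>c \<in> A\<close>, independently of
      \<open>q\<close>.\<close>
    have cm: "coef F m - c \<in> q"
    proof -
      let ?K = "insert m (Poly_Mapping.keys F)"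
      have "c = (\<Sum>j\<in>?K. coef F j)" unfolding c_def by (intro at_one_superset) auto
      also have "\<dots> = coef F m + (\<Sum>j\<in>?K - {m}. coef F j)" by (subst sum.remove[of _ m]) auto
      finally have "coef F m - c = - (\<Sum>j\<in>?K - {m}. coef F j)" by simp
      also have "\<dots> \<in> q" using m by (intro ideal_in_uminus[OF S Iq] ideal_in_sum[OF S Iq]) auto
      finally show ?thesis .
    qed
    have Fm: "F - shift m * const c \<in> coeffs_in q"
    proof (rule coeffs_inI)
      fix j
      show "coef (F - shift m * const c) j \<in> q"
        using m[of j] cm by (cases "j = m") (auto simp: lookup_minus lookup_single when_def)
    qed
    have "const T * f i - shift m * w i \<in> coeffs_in q" if i: "i < n" for i
    proof -
      have fGS: "f i * G \<in> coeffs_in S" using fGA[OF i] ASc by auto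
      have "const T * f i - shift m * w i = f i * (const T - F * G) + (F - shift m * const c) * (f i * G)"
        by (simp add: w_def algebra_simps)
      also have "\<dots> \<in> coeffs_in q"
        by (intro ideal_in_add[OF RS Iqc] ideal_in_lmult[OF RS Iqc] ideal_in_rmult[OF RS Iqc] TFG Fm f i fGS)
      finally show ?thesis .
    qed
    then show ?thesis by blast
  qed
  then show ?thesis using that[of T w] T wA by blast
qed

section \<open>Finite extensions\<close>

text \<open>The coefficients are taken from a subring in some places and from an ideal
  \<open>J\<close> in others; in the latter case the span is \<open>J\<close> times the module
  generated by \<open>Z\<close>.\<close>

inductive_set span_over :: "'u::comm_ring_1 set \<Rightarrow> 'u set \<Rightarrow> 'u set" for A Z where
  zero: "0 \<in> span_over A Z"
| step: "a \<in> A \<Longrightarrow> z \<in> Z \<Longrightarrow> x \<in> span_over A Z \<Longrightarrow> a * z + x \<in> span_over A Z"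

lemma span_over_add: "x \<in> span_over A Z \<Longrightarrow> y \<in> span_over A Z \<Longrightarrow> x + y \<in> span_over A Z"
  by (induction rule: span_over.induct) (auto simp: add.assoc intro: span_over.step)

lemma span_over_lmult:
  assumes "\<And>a. a \<in> A \<Longrightarrow> s * a \<in> A"
  shows "x \<in> span_over A Z \<Longrightarrow> s * x \<in> span_over A Z"
proof (induction rule: span_over.induct)
  case (step a z x)
  have "s * (a * z + x) = (s * a) * z + s * x" by (simp add: algebra_simps)
  then show ?case using step assms by (auto intro: span_over.step)
qed (simp add: span_over.zero)

lemma span_over_base: "1 \<in> A \<Longrightarrow> z \<in> Z \<Longrightarrow> z \<in> span_over A Z"
  using span_over.step[of 1 A z Z 0] by (simp add: span_over.zero)

lemma span_over_least:
  assumes "0 \<in> M" "\<And>x y. x \<in> M \<Longrightarrow> y \<in> M \<Longrightarrow> x + y \<in> M"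
    and "\<And>a z. a \<in> A \<Longrightarrow> z \<in> Z \<Longrightarrow> a * z \<in> M"
  shows "span_over A Z \<subseteq> M"
proof
  fix x assume "x \<in> span_over A Z"
  then show "x \<in> M" by (induction rule: span_over.induct) (use assms in auto)
qed

lemma span_over_mono: "A \<subseteq> A' \<Longrightarrow> Z \<subseteq> Z' \<Longrightarrow> span_over A Z \<subseteq> span_over A' Z'"
proof
  fix x assume sub: "A \<subseteq> A'" "Z \<subseteq> Z'" and "x \<in> span_over A Z"
  from this(3) show "x \<in> span_over A' Z'"
    by (induction rule: span_over.induct) (use sub in \<open>auto intro: span_over.intros\<close>)
qed

lemma span_over_sum:
  "(\<And>i. i \<in> I \<Longrightarrow> f i \<in> span_over A Z) \<Longrightarrow> sum f I \<in> span_over A Z"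
  by (induction I rule: infinite_finite_induct) (auto intro: span_over.zero span_over_add)

lemma span_over_coefficients:
  assumes A: "ring_subset A" and Z: "finite Z" and x: "x \<in> span_over A Z"
  obtains c where "\<And>z. c z \<in> A" "x = (\<Sum>z\<in>Z. c z * z)"
proof -
  have "\<exists>c. (\<forall>z. c z \<in> A) \<and> x = (\<Sum>z\<in>Z. c z * z)" using x
  proof (induction rule: span_over.induct)
    case zero
    show ?case using ring_subset_zero[OF A] by (intro exI[of _ "\<lambda>_. 0"]) auto
  next
    case (step a z x)
    then obtain c where c: "\<forall>z. c z \<in> A" "x = (\<Sum>z\<in>Z. c z * z)" by blast
    have "(\<Sum>y\<in>Z. (c y + (if y = z then a else 0)) * y)
        = (\<Sum>y\<in>Z. c y * y) + (\<Sum>y\<in>Z. if y = z then a * z else 0)"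
      unfolding sum.distrib[symmetric] by (rule sum.cong) (auto simp: distrib_right)
    also have "\<dots> = a * z + x" using Z step c by simp
    finally show ?case using c step ring_subset_zero[OF A]
      by (intro exI[of _ "\<lambda>y. c y + (if y = z then a else 0)"]) (auto intro: ring_subset_add[OF A])
  qed
  then show ?thesis using that by blast
qed

lemma span_over_insert:
  assumes S: "ring_subset S" and J: "ideal_in S J" and y: "y \<in> span_over J (insert z Z)"
  obtains a y' where "a \<in> J" "y' \<in> span_over J Z" "y = y' + a * z"
proof -
  have "\<exists>a y'. a \<in> J \<and> y' \<in> span_over J Z \<and> y = y' + a * z" using y
  proof (induction rule: span_over.induct)
    case zero
    then show ?case using ideal_in_zero[OF S J] span_over.zero by fastforce
  next
    case (step b x y)
    then obtain a y' where *: "a \<in> J" "y' \<in> span_over J Z" "y = y' + a * z" by blast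
    show ?case
    proof (cases "x = z")
      case True
      then have "b * x + y = y' + (b + a) * z" using * by (simp add: algebra_simps)
      then show ?thesis using * step ideal_in_add[OF S J] by blast
    next
      case False
      then have "x \<in> Z" using step by simp
      then have "b * x + y' \<in> span_over J Z" using * step by (intro span_over.step)
      moreover have "b * x + y = (b * x + y') + a * z" using * by (simp add: algebra_simps)
      ultimately
      show ?thesis using * by blast
    qed
  qed
  then show ?thesis using that by blast
qed

text \<open>Generators are eliminated one at a time, without determinants: modulo
  \<open>P + R z0\<close> the induction hypothesis deals with \<open>Z\<close>, and what remains is
  a single relation for \<open>z0\<close> whose coefficient lies in \<open>1 + J\<close>.\<close>

lemma nakayama:
  assumes R: "ring_subset R" and J: "ideal_in R J" and "finite Z"
    and P: "0 \<in> P" "\<And>x y. x \<in> P \<Longrightarrow> y \<in> P \<Longrightarrow> x + y \<in> P" "\<And>r x. r \<in> R \<Longrightarrow> x \<in> P \<Longrightarrow> r * x \<in> P"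
    and "\<And>z. z \<in> Z \<Longrightarrow> \<exists>y\<in>span_over J Z. z - y \<in> P"
  shows "\<exists>r\<in>R. r - 1 \<in> J \<and> (\<forall>z\<in>Z. r * z \<in> P)"
  using assms(3-7)
proof (induction Z arbitrary: P rule: finite_induct)
  case empty
  then show ?case using ring_subset_one[OF R] ideal_in_zero[OF R J] by (intro bexI[of _ 1]) auto
next
  case (insert z0 Z)
  note P = insert.prems(1-3)
  note clJ = ideal_in_zero[OF R J] ideal_in_add[OF R J] ideal_in_lmult[OF R J] ideal_in_rmult[OF R J]
    ideal_in_diff[OF R J] ideal_in_uminus[OF R J]
  have JR: "a \<in> R" if "a \<in> J" for a using that by (rule ideal_in_subset[OF R J])
  define P' where "P' = {x + r * z0 |x r. x \<in> P \<and> r \<in> R}"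
  have "\<exists>r\<in>R. r - 1 \<in> J \<and> (\<forall>z\<in>Z. r * z \<in> P')"
  proof (rule insert.IH)
    have "0 = 0 + 0 * z0" "0 \<in> P" "0 \<in> R" using P ring_subset_zero[OF R] by auto
    then show "0 \<in> P'" unfolding P'_def by blast
    show "x + y \<in> P'" if "x \<in> P'" "y \<in> P'" for x y
    proof -
      from that obtain p r q s where
        "x = p + r * z0" "y = q + s * z0" "p \<in> P" "q \<in> P" "r \<in> R" "s \<in> R" by (auto simp: P'_def)
      then have "x + y = (p + q) + (r + s) * z0" "p + q \<in> P" "r + s \<in> R"
        using P by (auto simp: algebra_simps intro: ring_subset_add[OF R])
      then show ?thesis unfolding P'_def by blast
    qed
    show "s * x \<in> P'" if "s \<in> R" "x \<in> P'" for s x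
    proof -
      from that obtain p r where "x = p + r * z0" "p \<in> P" "r \<in> R" by (auto simp: P'_def)
      then have "s * x = s * p + (s * r) * z0" "s * p \<in> P" "s * r \<in> R"
        using P(3)[OF that(1), of p] that ring_subset_mult[OF R that(1), of r]
        by (auto simp: distrib_left mult.assoc)
      then show ?thesis unfolding P'_def by blast
    qed
    show "\<exists>y\<in>span_over J Z. z - y \<in> P'" if z: "z \<in> Z" for z
    proof -
      obtain y where y: "y \<in> span_over J (insert z0 Z)" "z - y \<in> P"
        using insert.prems(4)[of z] z by auto
      obtain a y' where a: "a \<in> J" "y' \<in> span_over J Z" "y = y' + a * z0"
        using span_over_insert[OF R J y(1)] .
      have "z - y' = (z - y) + a * z0" using a by simp
      then have "z - y' \<in> P'" using a y JR unfolding P'_def by blast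
      then show ?thesis using a by blast
    qed
  qed
  then obtain r where r: "r \<in> R" "r - 1 \<in> J" and rZ: "\<And>z. z \<in> Z \<Longrightarrow> r * z \<in> P'" by blast
  have red: "\<exists>p b. p \<in> P \<and> b \<in> J \<and> r * y = p + b * z0" if "y \<in> span_over J Z" for y
    using that
  proof (induction rule: span_over.induct)
    case zero
    then show ?case using P(1) clJ(1) by force
  next
    case (step j z y)
    then obtain p b where pb: "p \<in> P" "b \<in> J" "r * y = p + b * z0" by blast
    obtain q s where qs: "q \<in> P" "s \<in> R" "r * z = q + s * z0"
      using rZ[OF step.hyps(2)] by (auto simp: P'_def)
    have "r * (j * z + y) = j * (r * z) + r * y" by (simp add: algebra_simps)
    also have "\<dots> = (j * q + p) + (j * s + b) * z0" by (simp add: qs pb algebra_simps)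
    finally have "r * (j * z + y) = (j * q + p) + (j * s + b) * z0" .
    moreover have "j * q + p \<in> P" using P qs pb JR[OF step.hyps(1)] by auto
    moreover have "j * s + b \<in> J" using step.hyps qs pb by (auto intro!: clJ(2) intro: clJ(4))
    ultimately show ?case by blast
  qed
  obtain y where y: "y \<in> span_over J (insert z0 Z)" "z0 - y \<in> P"
    using insert.prems(4)[of z0] by auto
  obtain a y' where a: "a \<in> J" "y' \<in> span_over J Z" "y = y' + a * z0"
    using span_over_insert[OF R J y(1)] .
  obtain p b where pb: "p \<in> P" "b \<in> J" "r * y' = p + b * z0" using red[OF a(2)] by blast
  \<comment> \<open>Modulo \<open>P\<close>, \<open>r * z0 = r * y' + r * a * z0 = c * z0\<close>.
    Hence \<open>r - c\<close> annihilates \<open>z0\<close> and \<open>(r - c) * r\<close>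
    annihilates all generators.\<close>
  define c where "c = r * a + b"
  have c: "c \<in> J" unfolding c_def using r a pb by (auto intro!: clJ(2) intro: clJ(3))
  have "(r - c) * z0 = r * (z0 - y) + (r * y' - b * z0)" by (simp add: c_def a algebra_simps)
  also have "\<dots> = r * (z0 - y) + p" using pb by simp
  also have "\<dots> \<in> P" using P y r pb by auto
  finally have z0P: "(r - c) * z0 \<in> P" .
  have rcR: "r - c \<in> R" using r c JR by (auto intro: ring_subset_diff[OF R])
  have "(r - c) * r \<in> R" using rcR r by (intro ring_subset_mult[OF R])
  moreover have "(r - c) * r - 1 \<in> J"
  proof -
    have "(r - c) * r - 1 = r * (r - 1) + (r - 1) - r * c" by (simp add: algebra_simps)
    also have "\<dots> \<in> J" using r c by (auto intro!: clJ(2) clJ(5) intro: clJ(3))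
    finally show ?thesis .
  qed
  moreover have "(r - c) * r * z \<in> P" if "z \<in> insert z0 Z" for z
  proof (cases "z = z0")
    case True
    have "(r - c) * r * z = r * ((r - c) * z0)" using True by (simp add: ac_simps)
    then show ?thesis using P(3)[OF r(1) z0P] by simp
  next
    case False
    then obtain q s where qs: "q \<in> P" "s \<in> R" "r * z = q + s * z0"
      using rZ[of z] \<open>z \<in> insert z0 Z\<close> by (auto simp: P'_def)
    have "(r - c) * r * z = (r - c) * (r * z)" by (simp add: mult.assoc)
    also have "\<dots> = (r - c) * q + s * ((r - c) * z0)" by (simp add: qs(3) distrib_left mult.left_commute)
    also have "\<dots> \<in> P" using P qs z0P rcR by auto
    finally show ?thesis .
  qed
  ultimately show ?case by blast
qed

section \<open>The Dedekind-Mertens lemma\<close>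

text \<open>Generators of the \<open>m\<close>-th power of the module spanned by \<open>F\<close>;
  with \<open>F\<close> the coefficients of a polynomial, this is a power of its content.\<close>

primrec prods :: "nat \<Rightarrow> 'u::comm_ring_1 set \<Rightarrow> 'u set" where
  "prods 0 F = {1}"
| "prods (Suc m) F = {x * y |x y. x \<in> F \<and> y \<in> prods m F}"

lemma prods_mono: "F \<subseteq> F' \<Longrightarrow> prods m F \<subseteq> prods m F'"
  by (induction m) auto

lemma finite_prods: "finite F \<Longrightarrow> finite (prods m F)"
proof (induction m)
  case (Suc m)
  have "prods (Suc m) F = (\<lambda>(x, y). x * y) ` (F \<times> prods m F)" by auto
  then show ?case using Suc by simp
qed simp

lemma prods_in_ring_subset: "ring_subset S \<Longrightarrow> F \<subseteq> S \<Longrightarrow> prods m F \<subseteq> S"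
  by (induction m) (auto intro: ring_subset_one ring_subset_mult)

lemma prods_insert:
  assumes "x \<in> prods (Suc m) F" and "F \<subseteq> insert c F'"
  shows "x \<in> prods (Suc m) F' \<or> (\<exists>y\<in>prods m F. x = c * y)"
  using assms(1)
proof (induction m arbitrary: x)
  case 0
  then show ?case using assms(2) by auto
next
  case (Suc m)
  then obtain a y where ay: "a \<in> F" "y \<in> prods (Suc m) F" "x = a * y"
    by (simp only: prods.simps(2)[of "Suc m"]) blast
  show ?case
  proof (cases "a = c")
    case True
    then show ?thesis using ay by blast
  next
    case False
    then have a: "a \<in> F'" using assms(2) ay by auto
    from Suc.IH[OF ay(2)] show ?thesis
    proof
      assume "y \<in> prods (Suc m) F'"
      then have "x \<in> prods (Suc (Suc m)) F'"
        using a ay(3) by (subst prods.simps(2)) blast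
      then show ?thesis ..
    next
      assume "\<exists>z\<in>prods m F. y = c * z"
      then obtain z where z: "z \<in> prods m F" "y = c * z" by blast
      have "a * z \<in> prods (Suc m) F" using z ay by auto
      moreover have "x = c * (a * z)" by (simp add: ay z ac_simps)
      ultimately show ?thesis by blast
    qed
  qed
qed

lemma card_keys_diff_single:
  "k \<in> Poly_Mapping.keys f \<Longrightarrow>
    Poly_Mapping.keys (f - Poly_Mapping.single k (coef f k)) = Poly_Mapping.keys f - {k}"
  for f :: "int \<Rightarrow>\<^sub>0 'u::comm_ring_1"
  by (auto simp: in_keys_iff lookup_minus lookup_single when_def split: if_splits)

lemma zero_in_range_coef: "0 \<in> range (coef (f :: int \<Rightarrow>\<^sub>0 'u::comm_ring_1))"
proof -
  obtain k where "k \<notin> Poly_Mapping.keys f"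
    using ex_new_if_finite[OF infinite_UNIV_int finite_keys] by blast
  then have "0 = coef f k" by (simp add: in_keys_iff)
  then show ?thesis by blast
qed

text \<open>In terms of contents: \<open>c(f)^(m+1) c(g)\<close> lies in
  \<open>c(f)^m c(f g)\<close> if \<open>g\<close> has at most \<open>m + 1\<close> terms. An
  additive group \<open>Z\<close> replaces the right-hand side, since the induction passes to
  \<open>{z. a * z \<in> Z}\<close> and the application takes a module over \<open>A\<close>. The
  outer induction is on \<open>m\<close>, which bounds the terms of \<open>g\<close>, the inner one
  on the terms of \<open>f\<close>.\<close>

lemma dedekind_mertens:
  fixes f g :: "int \<Rightarrow>\<^sub>0 'u::comm_ring_1"
  assumes "card (Poly_Mapping.keys g) \<le> Suc m"
    and "0 \<in> Z" "\<And>x y. x \<in> Z \<Longrightarrow> y \<in> Z \<Longrightarrow> x - y \<in> Z"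
    and "\<And>x k. x \<in> prods m (range (coef f)) \<Longrightarrow> x * coef (f * g) k \<in> Z"
    and "x \<in> prods (Suc m) (range (coef f))"
  shows "x * coef g j \<in> Z"
  using assms
proof (induction m arbitrary: f g Z x j rule: less_induct)
  case (less m)
  note outer = less.IH
  from less.prems show ?case
  proof (induction "card (Poly_Mapping.keys f)" arbitrary: f x j rule: less_induct)
    case inner: less
    note Z = inner.prems(2,3) and hyp = inner.prems(4)
    let ?F = "range (coef f)"
    show ?case
    proof (cases "f = 0 \<or> g = 0")
      case True
      then show ?thesis using inner.prems(5) Z(1) by auto
    next
      case False
      then have ne: "Poly_Mapping.keys f \<noteq> {}" "Poly_Mapping.keys g \<noteq> {}" by auto
      define n where "n = Max (Poly_Mapping.keys f)"
      define l where "l = Max (Poly_Mapping.keys g)"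
      have nl: "n \<in> Poly_Mapping.keys f" "l \<in> Poly_Mapping.keys g"
        using ne by (auto simp: n_def l_def)
      have above: "coef f i = 0" if "i > n" for i
        using that Max_ge[OF finite_keys, of i f] unfolding n_def in_keys_iff by linarith
      have above': "coef g i = 0" if "i > l" for i
        using that Max_ge[OF finite_keys, of i g] unfolding l_def in_keys_iff by linarith
      define a where "a = coef f n"
      define b where "b = coef g l"
      have "coef (f * g) (n + l) - coef f n * coef g (n + l - n) \<in> {0}"
      proof (rule coef_mult_isolated[of UNIV])
        fix i assume "i \<noteq> n"
        then show "coef f i \<in> {0} \<or> coef g (n + l - i) \<in> {0}"
          using above[of i] above'[of "n + l - i"] by (cases "i > n") auto
      qed (auto simp: ideal_in_def coeffs_in_def)
      then have top: "coef (f * g) (n + l) = a * b" by (simp add: a_def b_def)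
      have aF: "a \<in> ?F" by (simp add: a_def)
      \<comment> \<open>Products that contain the leading coefficient \<open>a\<close> of
        \<open>f\<close>. At the leading exponent of \<open>g\<close> they are governed by the top
        coefficient \<open>a * b\<close> of \<open>f * g\<close>; at other exponents the leading
        term of \<open>g\<close> is dropped and the outer induction is used.\<close>
      have step2: "y * a * coef g j \<in> Z" if y: "y \<in> prods m ?F" for y j
      proof (cases "j = l")
        case True
        then show ?thesis using hyp[OF y, of "n + l"] by (simp add: top b_def mult.assoc)
      next
        case False
        define g' where "g' = g - Poly_Mapping.single l b"
        have g': "Poly_Mapping.keys g' = Poly_Mapping.keys g - {l}"
          unfolding g'_def b_def by (rule card_keys_diff_single[OF nl(2)])
        have gj: "coef g' j = coef g j" using False by (simp add: g'_def lookup_minus lookup_single when_def)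
        show ?thesis
        proof (cases m)
          case 0
          then have "card (Poly_Mapping.keys g') = 0" using inner.prems(1) nl g' by simp
          then have "Poly_Mapping.keys g' = {}" by simp
          then have "coef g' j = 0" using in_keys_iff[of j g'] by auto
          then show ?thesis using gj Z by simp
        next
          case (Suc m')
          have "y * coef g' j \<in> {z. a * z \<in> Z}"
          proof (rule outer)
            show "m' < m" using Suc by simp
            show "card (Poly_Mapping.keys g') \<le> Suc m'" using inner.prems(1) nl g' Suc by simp
            show "0 \<in> {z. a * z \<in> Z}" using Z by simp
            show "u - v \<in> {z. a * z \<in> Z}" if "u \<in> {z. a * z \<in> Z}" "v \<in> {z. a * z \<in> Z}" for u v
              using that Z by (simp add: right_diff_distrib)
            show "y \<in> prods (Suc m') (range (coef f))" using y Suc by simp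
            fix u k assume u: "u \<in> prods m' (range (coef f))"
            have "f * g' = f * g - Poly_Mapping.single l b * f" by (simp add: g'_def algebra_simps)
            then have e: "coef (f * g') k = coef (f * g) k - b * coef f (k - l)"
              by (simp add: lookup_minus)
            \<comment> \<open>Dropping the leading term of \<open>g\<close> changes the product by
              \<open>b * coef f (k - l)\<close>. Multiplied by \<open>a * u\<close>, this is
              \<open>coef f (k - l) * u\<close> times the top coefficient \<open>a * b\<close>,
              again covered by the hypothesis.\<close>
            have "a * u \<in> prods m ?F" "coef f (k - l) * u \<in> prods m ?F" using u aF Suc by auto
            then have "a * u * coef (f * g) k - coef f (k - l) * u * coef (f * g) (n + l) \<in> Z"
              by (intro Z hyp)
            then show "u * coef (f * g') k \<in> {z. a * z \<in> Z}"
              by (simp add: e top top[unfolded add.commute[of n l]] algebra_simps)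
          qed
          then show ?thesis using gj by (simp add: ac_simps)
        qed
      qed
      \<comment> \<open>The remaining products avoid \<open>a\<close>, so \<open>f\<close> may lose
        its leading term; \<open>step2\<close> controls the change in the coefficients of the
        product.\<close>
      define f' where "f' = f - Poly_Mapping.single n a"
      have f': "Poly_Mapping.keys f' = Poly_Mapping.keys f - {n}"
        unfolding f'_def a_def by (rule card_keys_diff_single[OF nl(1)])
      have cf': "coef f' i = (if i = n then 0 else coef f i)" for i
        by (simp add: f'_def lookup_minus lookup_single when_def a_def)
      have F': "range (coef f') \<subseteq> ?F" using zero_in_range_coef[of f] cf' by auto
      have FF': "?F \<subseteq> insert a (range (coef f'))"
      proof
        fix c assume "c \<in> ?F"
        then obtain i where "c = coef f i" by auto
        then have "c = a \<or> c = coef f' i" using cf'[of i] by (auto simp: a_def)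
        then show "c \<in> insert a (range (coef f'))" by auto
      qed
      from prods_insert[OF inner.prems(5) FF'] show ?thesis
      proof
        assume x: "x \<in> prods (Suc m) (range (coef f'))"
        show ?thesis
        proof (rule inner.hyps)
          show "card (Poly_Mapping.keys f') < card (Poly_Mapping.keys f)"
            unfolding f' using nl by (intro psubset_card_mono) auto
          fix u k assume "u \<in> prods m (range (coef f'))"
          then have u: "u \<in> prods m ?F" using prods_mono[OF F'] by auto
          have "f' * g = f * g - Poly_Mapping.single n a * g" by (simp add: f'_def algebra_simps)
          then have e: "coef (f' * g) k = coef (f * g) k - a * coef g (k - n)"
            by (simp add: lookup_minus)
          have "u * coef (f * g) k - u * a * coef g (k - n) \<in> Z"
            by (intro Z hyp step2 u)
          then show "u * coef (f' * g) k \<in> Z" by (simp add: e algebra_simps)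
        qed (use inner.prems Z x in auto)
      next
        assume "\<exists>y\<in>prods m ?F. x = a * y"
        then obtain y where "y \<in> prods m ?F" "x = a * y" by blast
        then show ?thesis using step2[of y j] by (simp add: ac_simps)
      qed
    qed
  qed
qed

section \<open>The ring of coefficients of an invertible module\<close>

text \<open>\<open>N\<close> is an ideal of the ambient ring contained in \<open>A\<close>: the ambient ring stands for a
  cover of \<open>B\<close> with kernel \<open>N\<close>, and all identities in \<open>B\<close> become identities modulo \<open>N\<close>.\<close>

locale invertible_pair =
  fixes A N :: "'u::comm_ring_1 set" and f g :: "nat \<Rightarrow> (int \<Rightarrow>\<^sub>0 'u)" and n :: nat
  assumes A: "ring_subset A" and N: "ideal_in UNIV N" and NA: "N \<subseteq> A"
    and fg: "\<And>i j. i < n \<Longrightarrow> j < n \<Longrightarrow> f i * g j \<in> coeffs_in A"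
    and one: "(\<Sum>i<n. f i * g i) - 1 \<in> coeffs_in N"
    and f1: "\<And>i. i < n \<Longrightarrow> at_one (f i) \<in> A"
    and g1: "\<And>i. i < n \<Longrightarrow> at_one (g i) \<in> A"

text \<open>The \<open>f i\<close> are shifted until their supports are disjoint. One Laurent
  polynomial then carries all coefficients, and the Dedekind-Mertens lemma for a single pair
  suffices.\<close>

lemma merge_coefficients:
  fixes f :: "nat \<Rightarrow> (int \<Rightarrow>\<^sub>0 'u::comm_ring_1)"
  shows "\<exists>d. \<forall>i<n. range (coef (f i)) \<subseteq> range (coef (\<Sum>i<n. shift (d i) * f i))"
proof (induction n)
  case (Suc n)
  then obtain d where d: "\<forall>i<n. range (coef (f i)) \<subseteq> range (coef (\<Sum>i<n. shift (d i) * f i))" by blast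
  define G where "G = (\<Sum>i<n. shift (d i) * f i)"
  define a where "a = Max (insert 0 (Poly_Mapping.keys G))"
  define b where "b = Min (insert 0 (Poly_Mapping.keys (f n)))"
  \<comment> \<open>The shifted \<open>f n\<close> starts at \<open>a + 1\<close> or later, above
    the support of \<open>G\<close>. The inserted 0 keeps \<open>Max\<close> and \<open>Min\<close>
    meaningful for zero polynomials.\<close>
  define e where "e = a - b + 1"
  have a: "coef G k = 0" if "k > a" for k
  proof (rule ccontr)
    assume "coef G k \<noteq> 0"
    then have "k \<in> insert 0 (Poly_Mapping.keys G)" by (simp add: in_keys_iff)
    then have "k \<le> a" unfolding a_def by (intro Max_ge) auto
    then show False using that by simp
  qed
  have b: "coef (f n) k = 0" if "k < b" for k
  proof (rule ccontr)
    assume "coef (f n) k \<noteq> 0"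
    then have "k \<in> insert 0 (Poly_Mapping.keys (f n))" by (simp add: in_keys_iff)
    then have "b \<le> k" unfolding b_def by (intro Min_le) auto
    then show False using that by simp
  qed
  define d' where "d' = d(n := e)"
  have sum: "(\<Sum>i<Suc n. shift (d' i) * f i) = G + shift e * f n"
    by (simp add: d'_def G_def)
  let ?H = "G + shift e * f n"
  have "range (coef G) \<subseteq> range (coef ?H)"
  proof
    fix v assume "v \<in> range (coef G)"
    then obtain k where k: "v = coef G k" by auto
    show "v \<in> range (coef ?H)"
    proof (cases "v = 0")
      case True
      then show ?thesis using zero_in_range_coef by simp
    next
      case False
      then have "k \<le> a" using a[of k] k by force
      then have "coef ?H k = v" using k b[of "k - e"] by (simp add: lookup_add e_def)
      then show ?thesis by auto
    qed
  qed
  moreover have "range (coef (f n)) \<subseteq> range (coef ?H)"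
  proof
    fix v assume "v \<in> range (coef (f n))"
    then obtain k where k: "v = coef (f n) k" by auto
    show "v \<in> range (coef ?H)"
    proof (cases "v = 0")
      case True
      then show ?thesis using zero_in_range_coef by simp
    next
      case False
      then have "k \<ge> b" using b[of k] k by force
      then have "coef ?H (k + e) = v" using k a[of "k + e"] by (simp add: lookup_add e_def)
      then show ?thesis by auto
    qed
  qed
  ultimately have "\<forall>i<Suc n. range (coef (f i)) \<subseteq> range (coef (\<Sum>i<Suc n. shift (d' i) * f i))"
    unfolding sum using d unfolding G_def[symmetric] less_Suc_eq by (metis order_trans)
  then show ?case by blast
qed simp

context invertible_pair
begin

text \<open>By Dedekind-Mertens the module \<open>M\<close> spanned by the \<open>E\<close>-fold
  products of coefficients of \<open>F\<close> is stable under products of one coefficient of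
  \<open>F\<close> and one of \<open>G\<close>. The relation
  \<open>\<Sum> f i(1) * g i(1) = 1\<close> modulo \<open>N\<close>, whose factors lie in
  \<open>A\<close>, turns this into stability under the coefficients of \<open>F\<close> alone, up
  to \<open>N\<close>, and puts an element congruent to 1 into \<open>M\<close>. So
  \<open>A + M\<close> is a ring.\<close>

lemma finite_coefficient_ring:
  obtains S Z where "ring_subset S" "A \<subseteq> S" "finite Z" "S = span_over A Z"
    "\<And>i. i < n \<Longrightarrow> f i \<in> coeffs_in S" "\<And>i. i < n \<Longrightarrow> g i \<in> coeffs_in S"
    "\<And>T. ring_subset T \<Longrightarrow> A \<subseteq> T \<Longrightarrow> (\<And>i. i < n \<Longrightarrow> f i \<in> coeffs_in T) \<Longrightarrow> S \<subseteq> T"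
proof -
  note RA = ring_subset_coeffs_in[OF A]
  note U = ring_subset_UNIV
  have NI: "a * x \<in> N" "x * a \<in> N" if "x \<in> N" for a x
    using ideal_in_lmult[OF U N _ that] ideal_in_rmult[OF U N _ that] by auto
  obtain d where d: "\<And>i. i < n \<Longrightarrow> range (coef (f i)) \<subseteq> range (coef (\<Sum>i<n. shift (d i) * f i))"
    using merge_coefficients[of n f] by blast
  obtain e where e: "\<And>i. i < n \<Longrightarrow> range (coef (g i)) \<subseteq> range (coef (\<Sum>i<n. shift (e i) * g i))"
    using merge_coefficients[of n g] by blast
  define F where "F = (\<Sum>i<n. shift (d i) * f i)"
  define G where "G = (\<Sum>i<n. shift (e i) * g i)"
  define W where "W = range (coef F)"
  define E where "E = card (Poly_Mapping.keys G)"
  define M where "M = span_over A (prods E W)"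
  \<comment> \<open>Modulo \<open>N\<close> the generator 1 is already in \<open>M\<close>; it is
    adjoined so that \<open>A\<close>, and with it \<open>N\<close>, lies in
    \<open>S\<close>.\<close>
  define S where "S = span_over A (insert 1 (prods E W))"
  have shA: "shift k \<in> coeffs_in A" for k
    by (intro single_in_coeffs_in ring_subset_zero[OF A] ring_subset_one[OF A])
  have FG: "F * G \<in> coeffs_in A"
  proof -
    have "F * G = (\<Sum>i<n. \<Sum>j<n. shift (d i) * shift (e j) * (f i * g j))"
      by (simp add: F_def G_def sum_product ac_simps)
    also have "\<dots> \<in> coeffs_in A"
      using ring_subset_mult[OF RA ring_subset_mult[OF RA shA shA] fg]
      by (intro ring_subset_sum[OF RA]) auto
    finally show ?thesis .
  qed
  have fW: "coef (f i) k \<in> W" if "i < n" for i k using d[OF that] by (auto simp: W_def F_def)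
  have gW: "coef (g i) k \<in> range (coef G)" if "i < n" for i k using e[OF that] by (auto simp: G_def)
  have "finite (coef F ` Poly_Mapping.keys F)" by simp
  moreover have "W \<subseteq> insert 0 (coef F ` Poly_Mapping.keys F)"
    by (auto simp: W_def image_iff in_keys_iff)
  ultimately have finW: "finite W" by (meson finite_insert finite_subset)
  have M_lmult: "a * x \<in> M" if "a \<in> A" "x \<in> M" for a x
    using that unfolding M_def by (intro span_over_lmult) (auto intro: ring_subset_mult[OF A])
  have M_add: "x + y \<in> M" if "x \<in> M" "y \<in> M" for x y
    using that unfolding M_def by (rule span_over_add)
  have M0: "0 \<in> M" unfolding M_def by (rule span_over.zero)
  have M_diff: "x - y \<in> M" if "x \<in> M" "y \<in> M" for x y
    using M_add[OF that(1) M_lmult[of "- 1" y]] that ring_subset_uminus[OF A ring_subset_one[OF A]] by simp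
  have M_sum: "sum h I \<in> M" if "\<And>i. i \<in> I \<Longrightarrow> h i \<in> M" for h :: "'b \<Rightarrow> 'u" and I
    using that unfolding M_def by (rule span_over_sum)
  have prodsM: "x \<in> M" if "x \<in> prods E W" for x
    unfolding M_def by (rule span_over_base[OF ring_subset_one[OF A] that])
  have S_lmult: "a * x \<in> S" if "a \<in> A" "x \<in> S" for a x
    using that unfolding S_def by (intro span_over_lmult) (auto intro: ring_subset_mult[OF A])
  have S_add: "x + y \<in> S" if "x \<in> S" "y \<in> S" for x y
    using that unfolding S_def by (rule span_over_add)
  have S_diff: "x - y \<in> S" if "x \<in> S" "y \<in> S" for x y
    using S_add[OF that(1) S_lmult[of "- 1" y]] that ring_subset_uminus[OF A ring_subset_one[OF A]] by simp
  have S_sum: "sum h I \<in> S" if "\<And>i. i \<in> I \<Longrightarrow> h i \<in> S" for h :: "'b \<Rightarrow> 'u" and I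
    using that unfolding S_def by (rule span_over_sum)
  have MS: "M \<subseteq> S" unfolding M_def S_def by (rule span_over_mono) auto
  have S1: "1 \<in> S" unfolding S_def by (rule span_over_base[OF ring_subset_one[OF A]]) simp
  have AS: "A \<subseteq> S" using S_lmult[OF _ S1] by auto
  have NS: "N \<subseteq> S" using NA AS by blast
  have stab: "w * c * x \<in> M" if w: "w \<in> W" and c: "c \<in> range (coef G)" and x: "x \<in> M" for w c x
    using x unfolding M_def
  proof (induction rule: span_over.induct)
    case (step a z x)
    obtain j where j: "c = coef G j" using c by auto
    have "w * z \<in> prods (Suc E) W" using step w by auto
    \<comment> \<open>The element \<open>w * z\<close> is an \<open>(E + 1)\<close>-fold product,
      and \<open>G\<close> has \<open>E\<close> terms, within the bound \<open>E + 1\<close> of the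
      lemma.\<close>
    then have "w * z * coef G j \<in> M"
    proof (intro dedekind_mertens[of G E M F])
      fix y k assume "y \<in> prods E (range (coef F))"
      then show "y * coef (F * G) k \<in> M"
        using M_lmult[OF coeffs_inD[OF FG] prodsM, of y k] by (simp add: W_def mult.commute)
    qed (use M0 M_diff in \<open>auto simp: E_def W_def\<close>)
    then have "a * (w * z * c) \<in> M" using M_lmult[OF step(1), of "w * z * c"] j by simp
    then have "a * (w * z * c) + w * c * x \<in> M" using M_add step.IH by (simp add: M_def)
    then show ?case by (simp add: M_def algebra_simps)
  qed (simp add: span_over.zero)
  have stab_g1: "w * at_one (g i) * x \<in> M" if "w \<in> W" "i < n" "x \<in> M" for w i x
    unfolding at_one_def sum_distrib_left sum_distrib_right
    using that gW by (intro M_sum stab) auto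
  have stab_f1: "at_one (f i) * c * x \<in> M" if "c \<in> range (coef G)" "i < n" "x \<in> M" for c i x
    unfolding at_one_def sum_distrib_left sum_distrib_right
    using that fW by (intro M_sum stab) auto
  define s where "s = (\<Sum>i<n. at_one (f i) * at_one (g i))"
  have sN: "s - 1 \<in> N"
    using at_one_in_ideal[OF U N one] by (simp add: s_def at_one_diff at_one_sum at_one_mult)
  have sW: "s \<in> span_over A W"
  proof -
    have "at_one (f i) * at_one (g i) \<in> span_over A W" if "i < n" for i
    proof -
      have "at_one (f i) \<in> span_over A W" unfolding at_one_def
        using fW that by (intro span_over_sum span_over_base[OF ring_subset_one[OF A]]) auto
      then have "at_one (g i) * at_one (f i) \<in> span_over A W"
        by (rule span_over_lmult[OF ring_subset_mult[OF A g1[OF that]], rotated])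
      then show ?thesis by (simp add: mult.commute)
    qed
    then show ?thesis unfolding s_def by (intro span_over_sum) auto
  qed
  have pow: "s ^ m \<in> span_over A (prods m W)" for m
  proof (induction m)
    case 0
    show ?case using span_over_base[OF ring_subset_one[OF A], of 1 "{1}"] by simp
  next
    case (Suc m)
    have "x * y \<in> span_over A (prods (Suc m) W)" if x: "x \<in> span_over A W" and y: "y \<in> span_over A (prods m W)" for x y
      using x
    proof (induction rule: span_over.induct)
      case (step a w x)
      have "w * y \<in> span_over A (prods (Suc m) W)" using y
      proof (induction rule: span_over.induct)
        case (step b z y)
        have "b * (w * z) + w * y \<in> span_over A (prods (Suc m) W)"
          using step \<open>w \<in> W\<close> by (intro span_over.step) auto
        then show ?case by (simp add: algebra_simps)
      qed (simp add: span_over.zero)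
      then have "a * (w * y) \<in> span_over A (prods (Suc m) W)"
        by (rule span_over_lmult[OF ring_subset_mult[OF A step(1)], rotated])
      then have "a * (w * y) + x * y \<in> span_over A (prods (Suc m) W)"
        by (rule span_over_add[OF _ step.IH])
      then show ?case by (simp add: algebra_simps)
    qed (simp add: span_over.zero)
    then show ?case using sW Suc by simp
  qed
  have powN: "s ^ m - 1 \<in> N" for m
  proof (induction m)
    case 0 then show ?case using ideal_in_zero[OF U N] by simp
  next
    case (Suc m)
    have "s ^ Suc m - 1 = s * (s ^ m - 1) + (s - 1)" by (simp add: algebra_simps)
    then show ?case using ideal_in_add[OF U N NI(1)[OF Suc] sN] by (simp only:)
  qed
  \<comment> \<open>As \<open>s\<close> is an \<open>A\<close>-combination of \<open>W\<close>
    congruent to 1, its \<open>E\<close>-th power is an \<open>A\<close>-combination of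
    \<open>E\<close>-fold products congruent to 1.\<close>
  define x0 where "x0 = s ^ E"
  have x0: "x0 \<in> M" "x0 - 1 \<in> N" using pow[of E] powN[of E] by (auto simp: x0_def M_def)
  have SMN: "\<exists>y\<in>M. x - y \<in> N" if "x \<in> S" for x
    using that unfolding S_def
  proof (induction rule: span_over.induct)
    case zero
    then show ?case using M0 ideal_in_zero[OF U N] by force
  next
    case (step a z x)
    then obtain y where y: "y \<in> M" "x - y \<in> N" by blast
    show ?case
    proof (cases "z = 1")
      case True
      have "a * x0 + y \<in> M" using M_lmult[of a x0] M_add step x0 y by auto
      moreover have "a * z + x - (a * x0 + y) = (x - y) - a * (x0 - 1)" using True by (simp add: algebra_simps)
      then have "a * z + x - (a * x0 + y) \<in> N"
        using ideal_in_diff[OF U N y(2) NI(1)[OF x0(2)]] by (simp only:)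
      ultimately show ?thesis by blast
    next
      case False
      then have "z \<in> prods E W" using step by simp
      then have "a * z + y \<in> M" using M_lmult[of a z] M_add step prodsM y by auto
      moreover have "a * z + x - (a * z + y) \<in> N" using y by simp
      ultimately show ?thesis by blast
    qed
  qed
  have WS: "w * x \<in> S" if w: "w \<in> W" and x: "x \<in> S" for w x
  proof -
    obtain y where y: "y \<in> M" "x - y \<in> N" using SMN[OF x] by blast
    \<comment> \<open>The factor \<open>w\<close> is replaced by \<open>s * w\<close>, which splits
      into terms where \<open>w\<close> meets coefficients of \<open>G\<close>; both corrections lie
      in \<open>N\<close>.\<close>
    have "w * x = (\<Sum>i<n. at_one (f i) * (w * at_one (g i) * y)) - (s - 1) * (w * y) + (x - y) * w"
      by (simp add: s_def sum_distrib_left sum_distrib_right algebra_simps)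
    also have "\<dots> \<in> S"
    proof (intro S_add S_diff)
      show "(\<Sum>i<n. at_one (f i) * (w * at_one (g i) * y)) \<in> S"
        using S_lmult[OF f1 subsetD[OF MS stab_g1[OF w _ y(1)]]] by (intro S_sum) auto
      show "(s - 1) * (w * y) \<in> S" using NI[OF sN] NS by blast
      show "(x - y) * w \<in> S" using NI[OF y(2)] NS by blast
    qed
    finally show ?thesis .
  qed
  have prodsS: "z * x \<in> S" if "z \<in> prods m W" "x \<in> S" for z x m
    using that
  proof (induction m arbitrary: z)
    case (Suc m)
    then obtain w y where "z = w * y" "w \<in> W" "y \<in> prods m W" by auto
    then show ?case using WS[of w "y * x"] Suc by (simp add: mult.assoc)
  qed simp
  have S_mult: "x * y \<in> S" if x: "x \<in> S" and y: "y \<in> S" for x y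
    using x unfolding S_def
  proof (induction rule: span_over.induct)
    case (step a z x)
    have "z * y \<in> S" using step(2) y prodsS[of z E y] by auto
    then have "a * (z * y) \<in> S" using S_lmult[OF step(1)] by auto
    then have "a * (z * y) + x * y \<in> S" using S_add step.IH by (auto simp: S_def)
    then show ?case by (simp add: S_def algebra_simps)
  qed (simp add: span_over.zero)
  have RS: "ring_subset S" unfolding ring_subset_def using S1 S_diff S_mult by auto
  have gS: "coef (g i) k \<in> S" if i: "i < n" for i k
  proof -
    let ?c = "coef (g i) k"
    have c: "?c \<in> range (coef G)" by (rule gW[OF i])
    \<comment> \<open>Multiplication by \<open>f l(1) * ?c\<close> maps \<open>M\<close> into
      itself, and \<open>x0 \<in> M\<close> is congruent to 1. Summation against
      \<open>g l(1)\<close> then recovers \<open>?c\<close>.\<close>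
    have fc: "at_one (f l) * ?c \<in> S" if l: "l < n" for l
    proof -
      have "at_one (f l) * ?c = at_one (f l) * ?c * x0 - (x0 - 1) * (at_one (f l) * ?c)"
        by (simp add: algebra_simps)
      also have "\<dots> \<in> S"
        using stab_f1[OF c l x0(1)] MS NI[OF x0(2)] NS by (intro S_diff) auto
      finally show ?thesis .
    qed
    have "?c = (\<Sum>l<n. at_one (g l) * (at_one (f l) * ?c)) - (s - 1) * ?c"
      by (simp add: s_def sum_distrib_right sum_distrib_left algebra_simps)
    also have "\<dots> \<in> S"
    proof (intro S_diff S_sum)
      show "(s - 1) * ?c \<in> S" using NI[OF sN] NS by blast
      show "at_one (g l) * (at_one (f l) * ?c) \<in> S" if "l \<in> {..<n}" for l
        using S_lmult[OF g1 fc] that by auto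
    qed
    finally show ?thesis .
  qed
  show ?thesis
  proof (rule that[OF RS AS _ S_def])
    show "finite (insert 1 (prods E W))" using finite_prods[OF finW] by simp
    show "f i \<in> coeffs_in S" if "i < n" for i
      using WS[OF fW[OF that] S1] by (auto intro: coeffs_inI)
    show "g i \<in> coeffs_in S" if "i < n" for i
      using gS[OF that] by (auto intro: coeffs_inI)
    fix T assume T: "ring_subset T" "A \<subseteq> T" "\<And>i. i < n \<Longrightarrow> f i \<in> coeffs_in T"
    have "F \<in> coeffs_in T" unfolding F_def
      using T(3) shA coeffs_in_mono[OF T(2)]
      by (intro ring_subset_sum[OF ring_subset_coeffs_in[OF T(1)]]
          ring_subset_mult[OF ring_subset_coeffs_in[OF T(1)]]) auto
    then have "W \<subseteq> T" by (auto simp: W_def coeffs_in_def)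
    then have "prods E W \<subseteq> T" by (rule prods_in_ring_subset[OF T(1)])
    then show "S \<subseteq> T" unfolding S_def using T(2) ring_subset_one[OF T(1)]
      by (intro span_over_least ring_subset_zero[OF T(1)] ring_subset_add[OF T(1)] ring_subset_mult[OF T(1)]) auto
  qed
qed

end

section \<open>When the coefficient ring equals the base ring\<close>

lemma power_diff_in_ideal:
  assumes R: "ring_subset R" and I: "ideal_in R I" and x: "x \<in> R" and y: "y \<in> R" and xy: "x - y \<in> I"
  shows "x ^ m - y ^ m \<in> I"
proof (induction m)
  case (Suc m)
  have "x ^ Suc m - y ^ Suc m = x * (x ^ m - y ^ m) + y ^ m * (x - y)" by (simp add: algebra_simps)
  also have "\<dots> \<in> I"
    using Suc by (intro ideal_in_add[OF R I] ideal_in_lmult[OF R I] x xy ring_subset_power[OF R y])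
  finally show ?case .
qed (simp add: ideal_in_zero[OF R I])

text \<open>The coefficient at \<open>j\<close> agrees modulo \<open>I\<close> with those at
  \<open>j + m c\<close> for all natural \<open>m\<close>, and finite support makes one of these
  zero.\<close>

lemma shift_invariant_vanishes:
  fixes v :: "int \<Rightarrow>\<^sub>0 'u::comm_ring_1"
  assumes R: "ring_subset R" and I: "ideal_in R I" and c: "c \<noteq> 0"
    and inv: "\<And>j. coef v j - coef v (j + c) \<in> I"
  shows "v \<in> coeffs_in I"
proof (rule coeffs_inI)
  fix j
  have *: "coef v j - coef v (j + int m * c) \<in> I" for m
  proof (induction m)
    case (Suc m)
    have "coef v j - coef v (j + int (Suc m) * c)
        = (coef v j - coef v (j + int m * c)) + (coef v (j + int m * c) - coef v ((j + int m * c) + c))"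
      by (simp add: algebra_simps)
    also have "\<dots> \<in> I" by (intro ideal_in_add[OF R I] Suc inv)
    finally show ?case .
  qed (simp add: ideal_in_zero[OF R I])
  have "inj (\<lambda>m. j + int m * c)" using c by (auto simp: inj_on_def)
  then have "infinite (range (\<lambda>m. j + int m * c))" using finite_imageD by blast
  then have "\<not> range (\<lambda>m. j + int m * c) \<subseteq> Poly_Mapping.keys v"
    using finite_subset[OF _ finite_keys] by blast
  then obtain m where "j + int m * c \<notin> Poly_Mapping.keys v" by blast
  then show "coef v j \<in> I" using *[of m] by (simp add: in_keys_iff)
qed

definition subintegrally_closed_set :: "'u::comm_ring_1 set \<Rightarrow> bool" where
  "subintegrally_closed_set A \<longleftrightarrow> (\<forall>b. b ^ 2 \<in> A \<and> b ^ 3 \<in> A \<longrightarrow> b \<in> A)"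

lemma subintegrally_closed_setD:
  "subintegrally_closed_set A \<Longrightarrow> b ^ 2 \<in> A \<Longrightarrow> b ^ 3 \<in> A \<Longrightarrow> b \<in> A"
  unfolding subintegrally_closed_set_def by blast

context invertible_pair
begin

text \<open>Leastness is the means by which a property of the coefficients of the \<open>f i\<close>
  spreads to all of \<open>S\<close>; it serves for denominators and for the comparison of residue
  rings.\<close>

definition coefficient_ring where
  "coefficient_ring S Z \<longleftrightarrow> ring_subset S \<and> A \<subseteq> S \<and> finite Z \<and> S = span_over A Z \<and>
     (\<forall>i<n. f i \<in> coeffs_in S \<and> g i \<in> coeffs_in S) \<and>
     (\<forall>T. ring_subset T \<and> A \<subseteq> T \<and> (\<forall>i<n. f i \<in> coeffs_in T) \<longrightarrow> S \<subseteq> T)"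

lemma exists_coefficient_ring: "\<exists>S Z. coefficient_ring S Z"
proof (rule finite_coefficient_ring)
  fix S Z
  assume "ring_subset S" "A \<subseteq> S" "finite Z" "S = span_over A Z"
    "\<And>i. i < n \<Longrightarrow> f i \<in> coeffs_in S" "\<And>i. i < n \<Longrightarrow> g i \<in> coeffs_in S"
    "\<And>T. ring_subset T \<Longrightarrow> A \<subseteq> T \<Longrightarrow> (\<And>i. i < n \<Longrightarrow> f i \<in> coeffs_in T) \<Longrightarrow> S \<subseteq> T"
  then have "coefficient_ring S Z" unfolding coefficient_ring_def by (intro conjI) simp_all
  then show ?thesis by blast
qed

lemma coefficient_ringD:
  assumes "coefficient_ring S Z"
  shows "ring_subset S" "A \<subseteq> S" "finite Z" "S = span_over A Z"
    "\<And>i. i < n \<Longrightarrow> f i \<in> coeffs_in S" "\<And>i. i < n \<Longrightarrow> g i \<in> coeffs_in S"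
    "\<And>T. ring_subset T \<Longrightarrow> A \<subseteq> T \<Longrightarrow> (\<And>i. i < n \<Longrightarrow> f i \<in> coeffs_in T) \<Longrightarrow> S \<subseteq> T"
  using assms by (auto simp: coefficient_ring_def)

text \<open>For given \<open>p\<close> one pair \<open>t\<close>, \<open>w\<close> works at all
  primes \<open>q\<close> over \<open>p\<close>, and only \<open>k\<close> varies with
  \<open>q\<close>. Uniqueness of \<open>k\<close> for fixed \<open>p\<close>, \<open>t\<close>,
  \<open>w\<close> is the condition to be verified in each application.\<close>

definition residue_shift where
  "residue_shift p t w S q k \<longleftrightarrow>
     prime_in A p \<and> N \<subseteq> p \<and> t \<in> A \<and> t \<notin> p \<and> (\<forall>i<n. w i \<in> coeffs_in A) \<and>
     prime_in S q \<and> q \<inter> A = p \<and> (\<forall>i<n. const t * f i - shift k * w i \<in> coeffs_in q)"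

lemma residue_shift_coef:
  assumes "residue_shift p t w S q k" "i < n"
  shows "t * coef (f i) j - coef (w i) (j - k) \<in> q"
proof -
  have "coef (const t * f i - shift k * w i) j \<in> q"
    using assms by (auto simp: residue_shift_def intro: coeffs_inD)
  then show ?thesis by (simp add: lookup_minus)
qed

text \<open>Otherwise \<open>\<Sum> f i * g i\<close>, and with it 1, would have all coefficients in
  \<open>I\<close>.\<close>

lemma coefficients_not_in_proper_ideal:
  assumes S: "ring_subset S" and I: "ideal_in S I" "1 \<notin> I" "N \<subseteq> I"
    and g: "\<And>i. i < n \<Longrightarrow> g i \<in> coeffs_in S"
  shows "\<exists>i<n. f i \<notin> coeffs_in I"
proof (rule ccontr)
  note RS = ring_subset_coeffs_in[OF S] and Ic = ideal_in_coeffs_in[OF S I(1)]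
  assume "\<not> ?thesis"
  then have f: "\<And>i. i < n \<Longrightarrow> f i \<in> coeffs_in I" by blast
  have "(\<Sum>i<n. f i * g i) \<in> coeffs_in I"
    using f g by (intro ideal_in_sum[OF RS Ic] ideal_in_rmult[OF RS Ic]) auto
  moreover have "(\<Sum>i<n. f i * g i) - 1 \<in> coeffs_in I" using one coeffs_in_mono[OF I(3)] by blast
  ultimately have "(\<Sum>i<n. f i * g i) - ((\<Sum>i<n. f i * g i) - 1) \<in> coeffs_in I"
    by (rule ideal_in_diff[OF RS Ic])
  then have "(1 :: int \<Rightarrow>\<^sub>0 'u) \<in> coeffs_in I" by simp
  from coeffs_inD[OF this, of 0] show False using I by simp
qed

text \<open>The conductor of \<open>A\<close> in \<open>S\<close> is a radical ideal of \<open>S\<close>; at a minimal prime \<open>p\<close> over it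
  the previous congruences can be lifted, which puts an element outside \<open>p\<close> into the conductor.\<close>

lemma coefficient_ring_trivial:
  assumes subint: "subintegrally_closed_set A"
    and cr: "coefficient_ring S Z"
    and uniq: "\<And>p t w q k q' k'. residue_shift p t w S q k \<Longrightarrow> residue_shift p t w S q' k' \<Longrightarrow> k = k'"
  shows "S = A"
proof -
  note S = coefficient_ringD(1)[OF cr] and AS = coefficient_ringD(2)[OF cr]
    and Z = coefficient_ringD(3,4)[OF cr] and fS = coefficient_ringD(5)[OF cr]
    and gS = coefficient_ringD(6)[OF cr] and least = coefficient_ringD(7)[OF cr]
  note clS = ring_subset_closed[OF S] and clA = ring_subset_closed[OF A]
  define c where "c = {a \<in> A. \<forall>s\<in>S. a * s \<in> A}"
  have c_mult: "s * a \<in> c" if "s \<in> S" "a \<in> c" for s a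
  proof -
    have "s * a \<in> A" using that by (auto simp: c_def mult.commute)
    moreover have "s * a * r \<in> A" if "r \<in> S" for r
    proof -
      have "s * a * r = a * (s * r)" by (simp add: ac_simps)
      also have "\<dots> \<in> A" using \<open>a \<in> c\<close> \<open>s \<in> S\<close> that ring_subset_mult[OF S] by (simp add: c_def)
      finally show ?thesis .
    qed
    ultimately show ?thesis by (simp add: c_def)
  qed
  have c_S: "ideal_in S c"
    using AS c_mult by (auto simp: ideal_in_def c_def distrib_right intro: clA)
  have c_A: "ideal_in A c" using c_S AS by (auto simp: ideal_in_def c_def)
  have Nc: "N \<subseteq> c" using NA ideal_in_rmult[OF ring_subset_UNIV N] by (auto simp: c_def)
  \<comment> \<open>For \<open>s \<in> S\<close> the square and the cube of \<open>x * s\<close> are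
    \<open>x * x\<close> times elements of \<open>S\<close>, hence in \<open>A\<close>; subintegral
    closedness puts \<open>x * s\<close> into \<open>A\<close>.\<close>
  have rad2: "x \<in> c" if "x \<in> S" "x * x \<in> c" for x
  proof -
    have "x * s \<in> A" if s: "s \<in> S" for s
    proof (rule subintegrally_closed_setD[OF subint])
      have "(x * s) ^ 2 = (x * x) * s ^ 2" by (simp add: power_mult_distrib power2_eq_square)
      then show "(x * s) ^ 2 \<in> A"
        using \<open>x * x \<in> c\<close> ring_subset_power[OF S s] by (simp add: c_def)
      have "(x * s) ^ 3 = (x * x) * (x * s ^ 3)" by (simp add: power_mult_distrib power3_eq_cube ac_simps)
      moreover have "x * s ^ 3 \<in> S" by (intro clS \<open>x \<in> S\<close> s)
      ultimately show "(x * s) ^ 3 \<in> A" using \<open>x * x \<in> c\<close> by (simp add: c_def)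
    qed
    then show ?thesis using ring_subset_one[OF S] by (auto simp: c_def) (metis mult.right_neutral)
  qed
  \<comment> \<open>Square roots are iterated along powers of two; \<open>e \<le> 2 ^ e\<close> then
    covers arbitrary exponents.\<close>
  have rad2p: "x \<in> c" if "x \<in> S" "x ^ (2 ^ e) \<in> c" for x e
    using that
  proof (induction e arbitrary: x)
    case (Suc e)
    have "x * x \<in> S" using Suc by (intro clS)
    moreover have "(x * x) ^ (2 ^ e) \<in> c" using Suc.prems
      by (simp add: power_mult flip: power2_eq_square)
    ultimately show ?case using Suc.IH[of "x * x"] rad2 Suc.prems by blast
  qed simp
  have rad: "x \<in> c" if x: "x \<in> S" "x ^ e \<in> c" for x e
  proof -
    have "e \<le> 2 ^ e" by (simp add: less_imp_le)
    then have "x ^ (2 ^ e) = x ^ (2 ^ e - e) * x ^ e" by (simp flip: power_add)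
    also have "\<dots> \<in> c" using x by (intro c_mult clS)
    finally show ?thesis using rad2p x by blast
  qed
  have "1 \<in> c"
  proof (rule ccontr)
    assume "1 \<notin> c"
    then obtain p where p: "prime_in A p" "c \<subseteq> p"
      and pmin: "\<And>Q. prime_in A Q \<Longrightarrow> c \<subseteq> Q \<Longrightarrow> Q \<subseteq> p \<Longrightarrow> Q = p"
      using exists_minimal_prime[OF A c_A] by metis
    have Np: "N \<subseteq> p" using Nc p by blast
    have pA: "p \<subseteq> A" using p by (auto simp: prime_in_def ideal_in_def)
    obtain t w where t: "t \<in> A" "t \<notin> p" and w: "\<And>i. i < n \<Longrightarrow> w i \<in> coeffs_in A"
      and tw: "\<And>q. prime_in S q \<Longrightarrow> q \<inter> A = p \<Longrightarrow> \<exists>k. \<forall>i<n. const t * f i - shift k * w i \<in> coeffs_in q"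
      using fibre_monomial[OF A S AS p(1) Np fS gS fg one f1] by blast
    have rs: "\<exists>k. residue_shift p t w S q k" if "prime_in S q" "q \<inter> A = p" for q
      using tw[OF that] that p Np t w by (auto simp: residue_shift_def)
    then have "\<exists>k. \<forall>q. prime_in S q \<and> q \<inter> A = p \<longrightarrow> residue_shift p t w S q k"
      using uniq by metis
    then obtain k where k: "\<And>q. prime_in S q \<Longrightarrow> q \<inter> A = p \<Longrightarrow> residue_shift p t w S q k" by blast
    \<comment> \<open>The element \<open>x\<close> below lies in every prime of \<open>S\<close>
      over \<open>p\<close>. By minimality of \<open>p\<close> over \<open>c\<close>, a prime of
      \<open>S\<close> that contains \<open>c\<close> and misses \<open>A - p\<close> lies over
      \<open>p\<close>. Therefore \<open>s * x ^ e \<in> c\<close> for some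
      \<open>s \<in> A - p\<close>, and radicality of \<open>c\<close> gives
      \<open>s * x \<in> c\<close>.\<close>
    have lift: "\<exists>s\<in>A - p. s * coef (f i) j \<in> A" if i: "i < n" for i j
    proof -
      define x where "x = t * coef (f i) j - coef (w i) (j - k)"
      have wA: "coef (w i) l \<in> A" for l using w[OF i] by (rule coeffs_inD)
      have xS: "x \<in> S" unfolding x_def
        using t wA AS coeffs_inD[OF fS[OF i]] by (auto intro!: ring_subset_diff[OF S] ring_subset_mult[OF S])
      have xq: "x \<in> q" if "prime_in S q" "q \<inter> A = p" for q
        unfolding x_def by (rule residue_shift_coef[OF k[OF that] i])
      let ?T = "{s * x ^ e |s e. s \<in> A - p}"
      have one: "1 \<in> A - p" using p ring_subset_one[OF A] by (auto simp: prime_in_def)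
      have "?T \<inter> c \<noteq> {}"
      proof
        assume dis: "?T \<inter> c = {}"
        have T1: "1 \<in> ?T" using one by (auto intro!: exI[of _ 1] exI[of _ "0::nat"])
        have Tm: "y * z \<in> ?T" if "y \<in> ?T" "z \<in> ?T" for y z
        proof -
          from that obtain s e s' e' where "y = s * x ^ e" "z = s' * x ^ e'" "s \<in> A - p" "s' \<in> A - p"
            by auto
          moreover from this have "s * s' \<in> A - p"
            using p ring_subset_mult[OF A] by (auto simp: prime_in_def)
          moreover have "s * x ^ e * (s' * x ^ e') = (s * s') * x ^ (e + e')"
            by (simp add: power_add ac_simps)
          ultimately show ?thesis by blast
        qed
        obtain q where q: "prime_in S q" "c \<subseteq> q" "?T \<inter> q = {}"
          using exists_prime_avoiding[OF S c_S dis T1 Tm] by blast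
        have "s \<notin> q" if "s \<in> A - p" for s
        proof -
          have "s = s * x ^ 0" by simp
          then have "s \<in> ?T" using that by blast
          then show ?thesis using q by blast
        qed
        then have "q \<inter> A \<subseteq> p" by blast
        moreover have "c \<subseteq> q \<inter> A" using q by (auto simp: c_def)
        ultimately have "q \<inter> A = p" using pmin ideal_in_restrict[OF A AS q(1)] by blast
        then have "x \<in> q" by (rule xq[OF q(1)])
        moreover have "x = 1 * x ^ 1" by simp
        then have "x \<in> ?T" using one by blast
        ultimately show False using q by blast
      qed
      then obtain s e where s: "s \<in> A - p" and sx: "s * x ^ e \<in> c" by blast
      have "s * x \<in> c"
      proof (rule rad)
        show "s * x \<in> S" using s AS xS by (auto intro: clS)
        have "(s * x) ^ Suc e = (s ^ e * x) * (s * x ^ e)" by (simp add: power_mult_distrib ac_simps)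
        also have "\<dots> \<in> c"
          using s AS by (intro c_mult[OF _ sx] ring_subset_mult[OF S ring_subset_power[OF S] xS]) auto
        finally show "(s * x) ^ Suc e \<in> c" .
      qed
      then have "s * x + s * coef (w i) (j - k) \<in> A" using wA s by (auto simp: c_def intro!: clA)
      then have "(s * t) * coef (f i) j \<in> A" by (simp add: x_def algebra_simps)
      moreover have "s * t \<in> A - p" using s t p ring_subset_mult[OF A] by (auto simp: prime_in_def)
      ultimately show ?thesis by blast
    qed
    define I where "I = Sigma {..<n} (\<lambda>i. Poly_Mapping.keys (f i))"
    have "\<forall>x\<in>I. \<exists>s. s \<in> A - p \<and> s * coef (f (fst x)) (snd x) \<in> A"
      using lift by (auto simp: I_def)
    from bchoice[OF this] obtain s where
      s: "\<And>x. x \<in> I \<Longrightarrow> s x \<in> A - p" "\<And>x. x \<in> I \<Longrightarrow> s x * coef (f (fst x)) (snd x) \<in> A" by blast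
    define \<sigma> where "\<sigma> = prod s I"
    have \<sigma>: "\<sigma> \<in> A - p" unfolding \<sigma>_def using s by (intro prime_in_prod[OF A p(1)])
    have \<sigma>f: "\<sigma> * coef (f i) j \<in> A" if i: "i < n" for i j
    proof (cases "j \<in> Poly_Mapping.keys (f i)")
      case True
      then have x: "(i, j) \<in> I" using i by (simp add: I_def)
      have "\<sigma> = prod s (I - {(i, j)}) * s (i, j)"
        unfolding \<sigma>_def using x by (subst prod.remove[of I "(i, j)"]) (auto simp: I_def mult.commute)
      then have "\<sigma> * coef (f i) j = prod s (I - {(i, j)}) * (s (i, j) * coef (f i) j)" by (simp add: mult.assoc)
      also have "\<dots> \<in> A"
        using s(1) s(2)[OF x] by (intro ring_subset_mult[OF A _ s(2)[OF x, simplified]] ring_subset_prod[OF A]) auto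
      finally show ?thesis .
    next
      case False
      then show ?thesis using ring_subset_zero[OF A] by (simp add: in_keys_iff)
    qed
    \<comment> \<open>Elements with a power of \<open>\<sigma>\<close> as denominator. This ring
      contains the coefficients of the \<open>f i\<close>, hence \<open>S\<close>; as
      \<open>S\<close> is finite over \<open>A\<close>, a single power of \<open>\<sigma>\<close>
      serves for all of \<open>S\<close> and lies in the conductor.\<close>
    define T where "T = {y. \<exists>e. \<sigma> ^ e * y \<in> A}"
    have \<sigma>A: "\<sigma> ^ e \<in> A" for e using \<sigma> by (intro clA) auto
    have up: "\<sigma> ^ (e + d) * y \<in> A" if "\<sigma> ^ e * y \<in> A" for e d y
      using ring_subset_mult[OF A \<sigma>A[of d] that] by (simp add: power_add ac_simps)
    have "ring_subset T"
      unfolding ring_subset_def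
    proof (intro conjI ballI)
      show "1 \<in> T" using \<sigma>A[of 0] by (auto simp: T_def intro!: exI[of _ 0])
      fix x y assume "x \<in> T" "y \<in> T"
      then obtain a b where ab: "\<sigma> ^ a * x \<in> A" "\<sigma> ^ b * y \<in> A" by (auto simp: T_def)
      have "\<sigma> ^ (a + b) * (x - y) = \<sigma> ^ (a + b) * x - \<sigma> ^ (b + a) * y" by (simp add: algebra_simps)
      then have "\<sigma> ^ (a + b) * (x - y) \<in> A" using up[OF ab(1), of b] up[OF ab(2), of a] by (simp only: clA)
      then show "x - y \<in> T" by (auto simp: T_def)
      have "\<sigma> ^ (a + b) * (x * y) = (\<sigma> ^ a * x) * (\<sigma> ^ b * y)" by (simp add: power_add ac_simps)
      then have "\<sigma> ^ (a + b) * (x * y) \<in> A" using ring_subset_mult[OF A ab] by (simp only:)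
      then show "x * y \<in> T" by (auto simp: T_def)
    qed
    moreover have "A \<subseteq> T" by (auto simp: T_def intro!: exI[of _ 0])
    moreover have "f i \<in> coeffs_in T" if "i < n" for i
      using \<sigma>f[OF that] by (auto simp: T_def intro!: coeffs_inI exI[of _ 1])
    ultimately have ST: "S \<subseteq> T" by (rule least)
    have ZS: "Z \<subseteq> S" using Z(2) span_over_base[OF ring_subset_one[OF A]] by auto
    have "\<forall>z\<in>Z. \<exists>e. \<sigma> ^ e * z \<in> A" using ZS ST by (auto simp: T_def)
    from bchoice[OF this] obtain e where e: "\<And>z. z \<in> Z \<Longrightarrow> \<sigma> ^ e z * z \<in> A" by blast
    define d where "d = sum e Z"
    have d: "\<sigma> ^ d * z \<in> A" if z: "z \<in> Z" for z
    proof -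
      have "d = e z + sum e (Z - {z})" unfolding d_def using Z(1) z by (rule sum.remove)
      then show ?thesis using up[OF e[OF z]] by simp
    qed
    have "\<sigma> ^ d * y \<in> A" if "y \<in> S" for y
      using that unfolding Z(2)
    proof (induction rule: span_over.induct)
      case (step a z x)
      have "a * (\<sigma> ^ d * z) + \<sigma> ^ d * x \<in> A"
        by (intro ring_subset_add[OF A] ring_subset_mult[OF A step(1) d[OF step(2)]] step.IH)
      then show ?case by (simp add: algebra_simps)
    qed (simp add: ring_subset_zero[OF A])
    then have "\<sigma> ^ d \<in> c" using \<sigma>A by (simp add: c_def)
    then have "\<sigma> \<in> p" using prime_in_power[OF A p(1)] p(2) \<sigma> by blast
    then show False using \<sigma> by simp
  qed
  then have "S \<subseteq> A" by (auto simp: c_def)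
  then show ?thesis using AS by blast
qed

text \<open>If all \<open>w i\<close> vanished modulo \<open>p\<close>, then \<open>t * f i\<close>
  and hence \<open>f i\<close> would vanish modulo \<open>q\<close>, against
  \<open>\<Sum> f i * g i = 1\<close> modulo \<open>N\<close>.\<close>

lemma residue_shift_w_nonzero:
  assumes S: "ring_subset S" and AS: "A \<subseteq> S" and gS: "\<And>i. i < n \<Longrightarrow> g i \<in> coeffs_in S"
    and fS: "\<And>i. i < n \<Longrightarrow> f i \<in> coeffs_in S" and rs: "residue_shift p t w S q k"
  shows "\<exists>i<n. w i \<notin> coeffs_in p"
proof (rule ccontr)
  have q: "prime_in S q" and qA: "q \<inter> A = p" and t: "t \<in> A" "t \<notin> p" and Np: "N \<subseteq> p"
    using rs by (auto simp: residue_shift_def)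
  have tq: "t \<notin> q" "t \<in> S" using t qA AS by auto
  note Iq = prime_in_ideal[OF q]
  assume "\<not> ?thesis"
  then have w: "\<And>i. i < n \<Longrightarrow> w i \<in> coeffs_in p" by blast
  have "1 \<notin> q" "N \<subseteq> q" using q Np qA by (auto simp: prime_in_def)
  then obtain i where i: "i < n" "f i \<notin> coeffs_in q"
    using coefficients_not_in_proper_ideal[OF S Iq _ _ gS] by blast
  have "coef (f i) j \<in> q" for j
  proof -
    have "coef (w i) (j - k) \<in> q" using coeffs_inD[OF w[OF i(1)]] qA by auto
    from ideal_in_add[OF S Iq residue_shift_coef[OF rs i(1), of j] this]
    have "t * coef (f i) j \<in> q" by simp
    then show ?thesis using q tq coeffs_inD[OF fS[OF i(1)]] by (auto simp: prime_in_def)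
  qed
  then show False using i by (auto simp: coeffs_in_def)
qed

text \<open>Suppose \<open>k < k'\<close> at primes \<open>q\<close>, \<open>q'\<close> over
  \<open>p\<close>. At \<open>q\<close>, \<open>coef (w i) (- k')\<close> corresponds to the
  coefficient of \<open>f i\<close> at the negative exponent \<open>k - k'\<close>, so it vanishes;
  at \<open>q'\<close> it corresponds to the constant term of \<open>f i\<close>. Thus all these
  constant terms vanish modulo \<open>q'\<close>, although \<open>\<Sum> f i * g i\<close> has
  constant term 1 and no \<open>g i\<close> has negative exponents.\<close>

theorem polynomial_pair_trivial:
  assumes subint: "subintegrally_closed_set A"
    and fpos: "\<And>i k. i < n \<Longrightarrow> k < 0 \<Longrightarrow> coef (f i) k = 0"
    and gpos: "\<And>i k. i < n \<Longrightarrow> k < 0 \<Longrightarrow> coef (g i) k = 0"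
    and i: "i < n"
  shows "f i \<in> coeffs_in A" "g i \<in> coeffs_in A"
proof -
  obtain S Z where cr: "coefficient_ring S Z" using exists_coefficient_ring by blast
  note S = coefficient_ringD[OF cr]
  have le: "\<not> k < k'" if rs: "residue_shift p t w S q k" and rs': "residue_shift p t w S q' k'" for p t w q k q' k'
  proof
    assume kk: "k < k'"
    have q: "prime_in S q" "q \<inter> A = p" and q': "prime_in S q'" "q' \<inter> A = p"
      and t: "t \<in> A" "t \<notin> p" and Np: "N \<subseteq> p" and wA: "\<And>i. i < n \<Longrightarrow> w i \<in> coeffs_in A"
      using rs rs' by (auto simp: residue_shift_def)
    note Iq = prime_in_ideal[OF q(1)] and Iq' = prime_in_ideal[OF q'(1)]
    have tq: "t \<in> S" "t \<notin> q'" using t q' S by auto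
    have f0: "coef (f i) 0 \<in> q'" if i: "i < n" for i
    proof -
      have "t * coef (f i) (k - k') - coef (w i) ((k - k') - k) \<in> q" by (rule residue_shift_coef[OF rs i])
      then have "- coef (w i) (- k') \<in> q" using fpos[OF i, of "k - k'"] kk by simp
      then have "coef (w i) (- k') \<in> q" using ideal_in_uminus[OF S(1) Iq] by fastforce
      then have "coef (w i) (- k') \<in> q'" using coeffs_inD[OF wA[OF i]] q q' by blast
      moreover have "t * coef (f i) 0 - coef (w i) (- k') \<in> q'" using residue_shift_coef[OF rs' i, of 0] by simp
      ultimately have "t * coef (f i) 0 \<in> q'" using ideal_in_add[OF S(1) Iq'] by fastforce
      then show ?thesis using q' tq coeffs_inD[OF S(5)[OF i]] by (auto simp: prime_in_def)
    qed
    have fg0: "coef (f i * g i) 0 \<in> q'" if i: "i < n" for i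
    proof -
      have "coef (f i * g i) 0 - coef (f i) 0 * coef (g i) (0 - 0) \<in> {0}"
      proof (rule coef_mult_isolated[of UNIV])
        fix j :: int assume "j \<noteq> 0"
        then show "coef (f i) j \<in> {0} \<or> coef (g i) (0 - j) \<in> {0}"
          using fpos[OF i, of j] gpos[OF i, of "- j"] by (cases "j < 0") auto
      qed (auto simp: ideal_in_def coeffs_in_def)
      then have "coef (f i * g i) 0 = coef (f i) 0 * coef (g i) 0" by simp
      then show ?thesis using ideal_in_rmult[OF S(1) Iq' coeffs_inD[OF S(6)[OF i]] f0[OF i]] by simp
    qed
    have "coef ((\<Sum>i<n. f i * g i) - 1) 0 \<in> q'" using coeffs_inD[OF one] Np q' by blast
    then have 1: "(\<Sum>i<n. coef (f i * g i) 0) - 1 \<in> q'" by (simp add: lookup_minus lookup_sum)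
    have 2: "(\<Sum>i<n. coef (f i * g i) 0) \<in> q'" using fg0 by (intro ideal_in_sum[OF S(1) Iq']) auto
    from ideal_in_diff[OF S(1) Iq' 2 1] have "1 \<in> q'" by simp
    then show False using q' by (simp add: prime_in_def)
  qed
  have "k = k'" if "residue_shift p t w S q k" "residue_shift p t w S q' k'" for p t w q k q' k'
    using le[OF that] le[OF that(2,1)] by simp
  then have "S = A" by (rule coefficient_ring_trivial[OF subint cr])
  then show "f i \<in> coeffs_in A" "g i \<in> coeffs_in A" using S i by auto
qed

text \<open>Since \<open>t ^ m * f i ^ m\<close> has coefficients in \<open>A\<close>, its
  congruences with \<open>X^(m k) * w i ^ m\<close> and \<open>X^(m k') * w i ^ m\<close>, known
  modulo \<open>q\<close> and \<open>q'\<close>, hold modulo \<open>p\<close>. For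
  \<open>k \<noteq> k'\<close> this makes \<open>w i ^ m\<close> invariant under a nonzero shift,
  hence zero modulo \<open>p\<close>, although some \<open>w i\<close> is nonzero there.\<close>

theorem torsion_pair_trivial:
  assumes subint: "subintegrally_closed_set A"
    and m: "m > 0" and pow: "\<And>i. i < n \<Longrightarrow> f i ^ m \<in> coeffs_in A"
    and i: "i < n"
  shows "f i \<in> coeffs_in A" "g i \<in> coeffs_in A"
proof -
  obtain S Z where cr: "coefficient_ring S Z" using exists_coefficient_ring by blast
  note S = coefficient_ringD[OF cr]
  note RA = ring_subset_coeffs_in[OF A] and RS = ring_subset_coeffs_in[OF S(1)]
  have "k = k'" if rs: "residue_shift p t w S q k" and rs': "residue_shift p t w S q' k'" for p t w q k q' k'
  proof (rule ccontr)
    assume kk: "k \<noteq> k'"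
    have p: "prime_in A p" and t: "t \<in> A" "t \<notin> p" and wA: "\<And>i. i < n \<Longrightarrow> w i \<in> coeffs_in A"
      using rs by (auto simp: residue_shift_def)
    note Ip = prime_in_ideal[OF p]
    note Ipc = ideal_in_coeffs_in[OF A Ip]
    obtain i where i: "i < n" "w i \<notin> coeffs_in p"
      using residue_shift_w_nonzero[OF S(1,2) S(6) S(5) rs] by blast
    have shA: "shift k \<in> coeffs_in A" for k
      by (intro single_in_coeffs_in ring_subset_zero[OF A] ring_subset_one[OF A])
    have ctA: "const t \<in> coeffs_in A" using t by (intro single_in_coeffs_in ring_subset_zero[OF A])
    have ASc: "coeffs_in A \<subseteq> coeffs_in S" using S(2) by (rule coeffs_in_mono)
    have key: "const t ^ m * f i ^ m - shift k ^ m * w i ^ m \<in> coeffs_in p"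
      if rs: "residue_shift p t w S q k" for q k
    proof -
      have q: "prime_in S q" "q \<inter> A = p" using rs by (auto simp: residue_shift_def)
      have "const t * f i - shift k * w i \<in> coeffs_in q" using rs i by (auto simp: residue_shift_def)
      then have "(const t * f i) ^ m - (shift k * w i) ^ m \<in> coeffs_in q"
        using ctA shA wA[OF i(1)] S(5)[OF i(1)] ASc
        by (intro power_diff_in_ideal[OF RS ideal_in_coeffs_in[OF S(1) prime_in_ideal[OF q(1)]]]
            ring_subset_mult[OF RS]) auto
      then have 1: "const t ^ m * f i ^ m - shift k ^ m * w i ^ m \<in> coeffs_in q"
        by (simp add: power_mult_distrib)
      have 2: "const t ^ m * f i ^ m - shift k ^ m * w i ^ m \<in> coeffs_in A"
        by (intro ring_subset_diff[OF RA] ring_subset_mult[OF RA] ring_subset_power[OF RA] ctA shA wA pow i)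
      show ?thesis using 1 2 q(2) by (auto simp: coeffs_in_def)
    qed
    define v where "v = w i ^ m"
    have sm: "shift k ^ m = shift (int m * k)" for k
      by (induction m) (auto simp: shift_mult_shift algebra_simps)
    have diff: "shift (int m * k) * v - shift (int m * k') * v \<in> coeffs_in p"
      using ideal_in_diff[OF RA Ipc key[OF rs'] key[OF rs]] by (simp add: v_def sm)
    have "v \<in> coeffs_in p"
    proof (rule shift_invariant_vanishes[OF A Ip])
      show "int m * (k - k') \<noteq> 0" using m kk by simp
      fix j
      show "coef v j - coef v (j + int m * (k - k')) \<in> p"
        using coeffs_inD[OF diff, of "j + int m * k"]
        by (simp add: lookup_minus right_diff_distrib add_diff_eq)
    qed
    then have "w i \<in> coeffs_in p" unfolding v_def
    proof (induction m)
      case 0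
      from coeffs_inD[OF this[unfolded power_0], of 0] show ?case using p by (simp add: prime_in_def)
    next
      case (Suc m)
      then show ?case
        using coeffs_in_prime[OF A p wA[OF i(1)] ring_subset_power[OF RA wA[OF i(1)]], of m] by auto
    qed
    then show False using i by simp
  qed
  then have "S = A" by (rule coefficient_ring_trivial[OF subint cr])
  then show "f i \<in> coeffs_in A" "g i \<in> coeffs_in A" using S i by auto
qed

end

section \<open>Finite extensions of local rings\<close>

lemma ideal_in_cancel:
  assumes "ring_subset S" "ideal_in S I" "x \<in> I" "x - y \<in> I"
  shows "y \<in> I"
  using ideal_in_diff[OF assms] by simp

text \<open>The quotient of \<open>A\<close> by \<open>N\<close> is local with maximal ideal
  \<open>m / N\<close>; no quotient is formed, so inverses are taken up to \<open>N\<close>.\<close>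

definition local_modulo :: "'u::comm_ring_1 set \<Rightarrow> 'u set \<Rightarrow> 'u set \<Rightarrow> bool" where
  "local_modulo N A m \<longleftrightarrow>
     ideal_in A m \<and> 1 \<notin> m \<and> N \<subseteq> m \<and> (\<forall>x\<in>A - m. \<exists>y\<in>A. x * y - 1 \<in> N)"

lemma local_modulo_prime:
  assumes A: "ring_subset A" and N: "ideal_in UNIV N" and m: "local_modulo N A m"
  shows "prime_in A m"
proof -
  have Im: "ideal_in A m" using m by (simp add: local_modulo_def)
  have "y \<in> m" if xy: "x \<in> A" "y \<in> A" "x * y \<in> m" "x \<notin> m" for x y
  proof -
    obtain z where z: "z \<in> A" "x * z - 1 \<in> N" using m xy by (auto simp: local_modulo_def)
    have "y * (x * z - 1) \<in> m"
      using ideal_in_lmult[OF ring_subset_UNIV N _ z(2), of y] m by (auto simp: local_modulo_def)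
    then have "z * (x * y) - y * (x * z - 1) \<in> m"
      by (rule ideal_in_diff[OF A Im ideal_in_lmult[OF A Im z(1) xy(3)]])
    then show ?thesis by (simp add: algebra_simps)
  qed
  then show ?thesis using m by (auto simp: prime_in_def local_modulo_def)
qed

text \<open>If \<open>a \<in> m\<close> were outside \<open>M\<close>, then
  \<open>S = M + a S\<close> would be contained in \<open>M + m S\<close>. Nakayama's lemma gives
  \<open>r \<in> A\<close> with \<open>r - 1 \<in> m\<close> and \<open>r S\<close> inside
  \<open>M\<close>; so \<open>r \<in> M \<inter> A\<close>, which is contained in \<open>m\<close>,
  and \<open>1 \<in> m\<close>.\<close>

lemma maximal_over_local:
  assumes A: "ring_subset A" and m: "local_modulo N A m"
    and S: "ring_subset S" and AS: "A \<subseteq> S" and Z: "finite Z" "S = span_over A Z"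
    and M: "maximal_in S M" and NM: "N \<subseteq> M"
  shows "M \<inter> A = m"
proof -
  note IM = maximal_in_ideal[OF M]
  have Im: "ideal_in A m" and m1: "1 \<notin> m" using m by (auto simp: local_modulo_def)
  have M1: "1 \<notin> M" using M by (simp add: maximal_in_def)
  have sub: "x \<in> m" if x: "x \<in> M" "x \<in> A" for x
  proof (rule ccontr)
    assume "x \<notin> m"
    then obtain y where y: "y \<in> A" "x * y - 1 \<in> N" using m x by (auto simp: local_modulo_def)
    have "x * y \<in> M" using y AS x by (intro ideal_in_rmult[OF S IM]) auto
    then have "1 \<in> M" using y NM by (intro ideal_in_cancel[OF S IM, of "x * y" 1]) auto
    then show False using M1 by simp
  qed
  have "a \<in> M" if a: "a \<in> m" for a
  proof (rule ccontr)
    assume aM: "a \<notin> M"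
    have aA: "a \<in> A" using a by (rule ideal_in_subset[OF A Im])
    then obtain \<mu> s where ms: "\<mu> \<in> M" "s \<in> S" "\<mu> + s * a = 1"
      using maximal_in_unit[OF S M _ aM] AS by blast
    have ZS: "Z \<subseteq> S" using Z(2) span_over_base[OF ring_subset_one[OF A]] by auto
    have aspan: "a * y \<in> span_over m Z" if "y \<in> S" for y
      using that unfolding Z(2)
    proof (induction rule: span_over.induct)
      case (step b z x)
      have "(a * b) * z + a * x \<in> span_over m Z"
        using step ideal_in_rmult[OF A Im step(1) a] by (intro span_over.step)
      then show ?case by (simp add: algebra_simps)
    qed (simp add: span_over.zero)
    have "\<exists>r\<in>A. r - 1 \<in> m \<and> (\<forall>z\<in>Z. r * z \<in> M)"
    proof (rule nakayama[OF A Im Z(1)])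
      show "0 \<in> M" by (rule ideal_in_zero[OF S IM])
      show "x + y \<in> M" if "x \<in> M" "y \<in> M" for x y using that by (rule ideal_in_add[OF S IM])
      show "r * x \<in> M" if "r \<in> A" "x \<in> M" for r x using that AS by (intro ideal_in_lmult[OF S IM]) auto
      show "\<exists>y\<in>span_over m Z. z - y \<in> M" if "z \<in> Z" for z
      proof
        have zS: "z \<in> S" using that ZS by auto
        show "a * (s * z) \<in> span_over m Z" by (intro aspan ring_subset_mult[OF S] ms zS)
        have "z - a * (s * z) = (\<mu> + s * a) * z - a * (s * z)" using ms by simp
        also have "\<dots> = \<mu> * z" by (simp add: algebra_simps)
        also have "\<dots> \<in> M" by (intro ideal_in_rmult[OF S IM] ms zS)
        finally show "z - a * (s * z) \<in> M" .
      qed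
    qed
    then obtain r where r: "r \<in> A" "r - 1 \<in> m" "\<And>z. z \<in> Z \<Longrightarrow> r * z \<in> M" by blast
    have "r * y \<in> M" if "y \<in> S" for y
      using that unfolding Z(2)
    proof (induction rule: span_over.induct)
      case (step b z x)
      have "b * (r * z) + r * x \<in> M"
        using ideal_in_add[OF S IM ideal_in_lmult[OF S IM _ r(3)[OF step(2)]] step.IH] step(1) AS by auto
      then show ?case by (simp add: algebra_simps)
    qed (simp add: ideal_in_zero[OF S IM])
    from this[OF ring_subset_one[OF S]] have "r \<in> M" by simp
    then have "r \<in> m" using r sub by blast
    from ideal_in_diff[OF A Im this r(2)] have "1 \<in> m" by simp
    then show False using m1 by simp
  qed
  then show ?thesis using sub ideal_in_subset[OF A Im] by auto
qed

text \<open>The ideal \<open>M S\<close> is proper by Nakayama's lemma, and a maximal ideal of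
  \<open>S\<close> above it contracts to \<open>M\<close> because \<open>M\<close> is
  maximal.\<close>

lemma lying_over:
  assumes R: "ring_subset R" and S: "ring_subset S" and RS: "R \<subseteq> S"
    and Z: "finite Z" "S = span_over R Z" and M: "maximal_in R M"
  obtains M' where "maximal_in S M'" "M' \<inter> R = M"
proof -
  note IM = maximal_in_ideal[OF M]
  have M1: "1 \<notin> M" using M by (simp add: maximal_in_def)
  let ?J = "span_over M Z"
  have MR: "M \<subseteq> R" using ideal_in_subset[OF R IM] by auto
  have ZS: "Z \<subseteq> S" using Z(2) span_over_base[OF ring_subset_one[OF R]] by auto
  have JS: "?J \<subseteq> S" using Z(2) span_over_mono[OF MR order_refl] by auto
  have MJ: "a * y \<in> ?J" if "a \<in> M" "y \<in> S" for a y
    using that(2) unfolding Z(2)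
  proof (induction rule: span_over.induct)
    case (step b z x)
    have "(a * b) * z + a * x \<in> ?J"
      using step ideal_in_rmult[OF R IM step(1) that(1)] by (intro span_over.step)
    then show ?case by (simp add: algebra_simps)
  qed (simp add: span_over.zero)
  have Jmult: "s * y \<in> ?J" if s: "s \<in> S" and y: "y \<in> ?J" for s y
    using y
  proof (induction rule: span_over.induct)
    case (step a z y)
    have "a * (s * z) \<in> ?J" using step ZS s by (intro MJ ring_subset_mult[OF S]) auto
    then have "a * (s * z) + s * y \<in> ?J" using step by (intro span_over_add)
    then show ?case by (simp add: algebra_simps)
  qed (simp add: span_over.zero)
  have J: "ideal_in S ?J"
    using JS Jmult by (auto simp: ideal_in_def span_over.zero intro: span_over_add)
  have "1 \<notin> ?J"
  proof
    assume 1: "1 \<in> ?J"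
    have "\<exists>r\<in>R. r - 1 \<in> M \<and> (\<forall>z\<in>Z. r * z \<in> {0})"
    proof (rule nakayama[OF R IM Z(1)])
      show "\<exists>y\<in>?J. z - y \<in> {0}" if "z \<in> Z" for z
        using Jmult[OF _ 1, of z] ZS that by (intro bexI[of _ z]) auto
    qed auto
    then obtain r where r: "r \<in> R" "r - 1 \<in> M" "\<And>z. z \<in> Z \<Longrightarrow> r * z = 0" by blast
    have "r * y = 0" if "y \<in> S" for y
      using that unfolding Z(2)
    proof (induction rule: span_over.induct)
      case (step b z x)
      have "r * (b * z + x) = b * (r * z) + r * x" by (simp add: algebra_simps)
      then show ?case using step r by simp
    qed simp
    from this[OF ring_subset_one[OF S]] have "r = 0" by simp
    then have "- 1 \<in> M" using r by simp
    then have "1 \<in> M" using ideal_in_uminus[OF R IM, of "- 1"] by simp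
    then show False using M1 by simp
  qed
  then obtain M' where M': "maximal_in S M'" "?J \<subseteq> M'"
    using exists_maximal_in[OF J] by blast
  note IM' = maximal_in_ideal[OF M'(1)]
  have "M \<subseteq> M' \<inter> R" using MJ[OF _ ring_subset_one[OF S]] M' MR by auto
  moreover have "ideal_in R (M' \<inter> R)"
    using IM' RS by (auto simp: ideal_in_def intro: ring_subset_closed[OF R])
  moreover have "1 \<notin> M' \<inter> R" using M' by (auto simp: maximal_in_def)
  ultimately have "M' \<inter> R = M" using M unfolding maximal_in_def by blast
  then show ?thesis using that M' by blast
qed

lemma span_over_larger_ring:
  assumes A: "ring_subset A" "A \<subseteq> R" "R \<subseteq> S" and S: "ring_subset S" and Z: "S = span_over A Z"
  shows "S = span_over R Z"
proof
  show "S \<subseteq> span_over R Z" unfolding Z by (rule span_over_mono[OF A(2) order_refl])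
  have "Z \<subseteq> S" using Z span_over_base[OF ring_subset_one[OF A(1)]] by auto
  then show "span_over R Z \<subseteq> S"
    using A by (intro span_over_least ring_subset_zero[OF S] ring_subset_add[OF S] ring_subset_mult[OF S]) auto
qed

lemma single_sum: "Poly_Mapping.single k (sum h I) = (\<Sum>i\<in>I. Poly_Mapping.single k (h i))"
  by (induction I rule: infinite_finite_induct) (auto simp: single_add)

context invertible_pair
begin

text \<open>If the generators agree with elements of \<open>A[X, X\<^sup>-\<^sup>1]\<close> modulo all maximal ideals, the
  shifts attached to two primes \<open>q\<close>, \<open>q'\<close> over \<open>p\<close> coincide: \<open>S/q\<close> and \<open>S/q'\<close> are the same
  subring of the residue field of \<open>p\<close>, and a maximal ideal of it sees both shifts.\<close>

lemma coefficient_ring_trivial_if_residually_trivial: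
  assumes subint: "subintegrally_closed_set A" and cr: "coefficient_ring S Z"
    and m: "local_modulo N A m"
    and u: "u \<in> A" "u \<notin> m" and v: "\<And>i. i < n \<Longrightarrow> v i \<in> coeffs_in A"
    and res: "\<And>M i. maximal_in S M \<Longrightarrow> N \<subseteq> M \<Longrightarrow> i < n \<Longrightarrow> const u * f i - v i \<in> coeffs_in M"
  shows "S = A"
proof (rule coefficient_ring_trivial[OF subint cr])
  fix p t w q k q' k'
  assume rs: "residue_shift p t w S q k" and rs': "residue_shift p t w S q' k'"
  note S = coefficient_ringD[OF cr]
  have p: "prime_in A p" and q: "prime_in S q" "q \<inter> A = p" and q': "prime_in S q'" "q' \<inter> A = p"
    and t: "t \<in> A" "t \<notin> p" and Np: "N \<subseteq> p" and wA: "\<And>i. i < n \<Longrightarrow> w i \<in> coeffs_in A"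
    using rs rs' by (auto simp: residue_shift_def)
  note Iq = prime_in_ideal[OF q(1)] and Iq' = prime_in_ideal[OF q'(1)]
  have Im: "ideal_in A m" using m by (simp add: local_modulo_def)
  show "k = k'"
  proof (rule ccontr)
    assume kk: "k \<noteq> k'"
    have "1 \<notin> q" using q by (simp add: prime_in_def)
    then obtain M where M: "maximal_in S M" "q \<subseteq> M" using exists_maximal_in[OF Iq] by blast
    note IM = maximal_in_ideal[OF M(1)]
    have M1: "1 \<notin> M" using M by (simp add: maximal_in_def)
    have NM: "N \<subseteq> M" using Np q M by blast
    have MA: "M \<inter> A = m" by (rule maximal_over_local[OF A m S(1-4) M(1) NM])
    \<comment> \<open>\<open>R\<close> relates \<open>b\<close> to \<open>b'\<close> when their
      classes modulo \<open>q\<close> and \<open>q'\<close> are the same fraction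
      \<open>a / s\<close> in the residue field of \<open>p\<close>. It respects the ring operations
      and relates the coefficient of \<open>f i\<close> at \<open>j + k\<close> to the one at
      \<open>j + k'\<close>.\<close>
    define R where "R = {(b, b'). b \<in> S \<and> b' \<in> S \<and>
      (\<exists>s\<in>A - p. \<exists>a\<in>A. s * b - a \<in> q \<and> s * b' - a \<in> q')}"
    have RI: "(b, b') \<in> R"
      if "b \<in> S" "b' \<in> S" "s \<in> A - p" "a \<in> A" "s * b - a \<in> q" "s * b' - a \<in> q'" for b b' s a
      using that by (auto simp: R_def)
    have pm: "s * s' \<in> A - p" if "s \<in> A - p" "s' \<in> A - p" for s s'
      using that p ring_subset_mult[OF A] by (auto simp: prime_in_def)
    have p1: "1 \<in> A - p" using p ring_subset_one[OF A] by (auto simp: prime_in_def)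
    have RA: "(a, a) \<in> R" if "a \<in> A" for a
      using that S(2) p1 ideal_in_zero[OF S(1) Iq] ideal_in_zero[OF S(1) Iq']
      by (intro RI[of _ _ 1 a]) auto
    have R_diff: "(b - c, b' - c') \<in> R" if "(b, b') \<in> R" "(c, c') \<in> R" for b b' c c'
    proof -
      from that obtain s a r d where *: "b \<in> S" "b' \<in> S" "c \<in> S" "c' \<in> S"
        "s \<in> A - p" "a \<in> A" "s * b - a \<in> q" "s * b' - a \<in> q'"
        "r \<in> A - p" "d \<in> A" "r * c - d \<in> q" "r * c' - d \<in> q'" by (auto simp: R_def)
      have rsS: "r \<in> S" "s \<in> S" using * S(2) by auto
      have "(s * r) * (b - c) - (r * a - s * d) = r * (s * b - a) - s * (r * c - d)"
        by (simp add: algebra_simps)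
      also have "\<dots> \<in> q"
        by (rule ideal_in_diff[OF S(1) Iq ideal_in_lmult[OF S(1) Iq rsS(1) *(7)] ideal_in_lmult[OF S(1) Iq rsS(2) *(11)]])
      finally have 1: "(s * r) * (b - c) - (r * a - s * d) \<in> q" .
      have "(s * r) * (b' - c') - (r * a - s * d) = r * (s * b' - a) - s * (r * c' - d)"
        by (simp add: algebra_simps)
      also have "\<dots> \<in> q'"
        by (rule ideal_in_diff[OF S(1) Iq' ideal_in_lmult[OF S(1) Iq' rsS(1) *(8)] ideal_in_lmult[OF S(1) Iq' rsS(2) *(12)]])
      finally have 2: "(s * r) * (b' - c') - (r * a - s * d) \<in> q'" .
      show ?thesis
        using * by (intro RI[OF _ _ _ _ 1 2] pm ring_subset_diff[OF S(1)] ring_subset_diff[OF A]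
            ring_subset_mult[OF A]) auto
    qed
    have R_mult: "(b * c, b' * c') \<in> R" if "(b, b') \<in> R" "(c, c') \<in> R" for b b' c c'
    proof -
      from that obtain s a r d where *: "b \<in> S" "b' \<in> S" "c \<in> S" "c' \<in> S"
        "s \<in> A - p" "a \<in> A" "s * b - a \<in> q" "s * b' - a \<in> q'"
        "r \<in> A - p" "d \<in> A" "r * c - d \<in> q" "r * c' - d \<in> q'" by (auto simp: R_def)
      have rdS: "r * c \<in> S" "r * c' \<in> S" "a \<in> S" using * S(2) ring_subset_mult[OF S(1)] by auto
      have "(s * r) * (b * c) - a * d = (r * c) * (s * b - a) + a * (r * c - d)"
        by (simp add: algebra_simps)
      also have "\<dots> \<in> q"
        by (rule ideal_in_add[OF S(1) Iq ideal_in_lmult[OF S(1) Iq rdS(1) *(7)] ideal_in_lmult[OF S(1) Iq rdS(3) *(11)]])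
      finally have 1: "(s * r) * (b * c) - a * d \<in> q" .
      have "(s * r) * (b' * c') - a * d = (r * c') * (s * b' - a) + a * (r * c' - d)"
        by (simp add: algebra_simps)
      also have "\<dots> \<in> q'"
        by (rule ideal_in_add[OF S(1) Iq' ideal_in_lmult[OF S(1) Iq' rdS(2) *(8)] ideal_in_lmult[OF S(1) Iq' rdS(3) *(12)]])
      finally have 2: "(s * r) * (b' * c') - a * d \<in> q'" .
      show ?thesis
        using * by (intro RI[OF _ _ _ _ 1 2] pm ring_subset_mult[OF S(1)] ring_subset_mult[OF A]) auto
    qed
    have Rf: "(coef (f i) (j + k), coef (f i) (j + k')) \<in> R" if i: "i < n" for i j
      using residue_shift_coef[OF rs i, of "j + k"] residue_shift_coef[OF rs' i, of "j + k'"] t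
        coeffs_inD[OF S(5)[OF i]] coeffs_inD[OF wA[OF i]]
      by (intro RI[of _ _ t "coef (w i) j"]) auto
    \<comment> \<open>The second projection of \<open>R\<close> is a ring that contains
      \<open>A\<close> and the coefficients of the \<open>f i\<close>; leastness of \<open>S\<close>
      applies.\<close>
    have proj: "\<exists>y. (y, y') \<in> R" if "y' \<in> S" for y'
    proof -
      have "ring_subset {y'. \<exists>y. (y, y') \<in> R}"
        unfolding ring_subset_def using RA[OF ring_subset_one[OF A]] R_diff R_mult by blast
      moreover have "A \<subseteq> {y'. \<exists>y. (y, y') \<in> R}" using RA by blast
      moreover have "f i \<in> coeffs_in {y'. \<exists>y. (y, y') \<in> R}" if "i < n" for i
      proof (rule coeffs_inI)
        fix j
        show "coef (f i) j \<in> {y'. \<exists>y. (y, y') \<in> R}" using Rf[OF that, of "j - k'"] by auto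
      qed
      ultimately have "S \<subseteq> {y'. \<exists>y. (y, y') \<in> R}" by (rule S(7))
      then show ?thesis using that by blast
    qed
    \<comment> \<open>The maximal ideal \<open>M\<close> over \<open>q\<close> is carried along
      \<open>R\<close>. The result is a proper ideal containing \<open>q'\<close>, so a maximal
      ideal \<open>L\<close> above \<open>q'\<close> corresponds to \<open>M\<close>.\<close>
    define M' where "M' = {b'. \<exists>b\<in>M. (b, b') \<in> R}"
    have IM': "ideal_in S M'"
      unfolding ideal_in_def
    proof (intro conjI ballI)
      show "M' \<subseteq> S" by (auto simp: M'_def R_def)
      show "0 \<in> M'" using RA[OF ring_subset_zero[OF A]] ideal_in_zero[OF S(1) IM] by (auto simp: M'_def)
      fix x y assume "x \<in> M'" "y \<in> M'"
      then obtain b c where bc: "b \<in> M" "(b, x) \<in> R" "c \<in> M" "(c, y) \<in> R" by (auto simp: M'_def)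
      have "(0 - c, 0 - y) \<in> R" by (intro R_diff RA ring_subset_zero[OF A] bc)
      from R_diff[OF bc(2) this] have "(b + c, x + y) \<in> R" by simp
      then show "x + y \<in> M'" using ideal_in_add[OF S(1) IM bc(1,3)] by (auto simp: M'_def)
    next
      fix s x assume s: "s \<in> S" and "x \<in> M'"
      then obtain b where b: "b \<in> M" "(b, x) \<in> R" by (auto simp: M'_def)
      obtain y where y: "(y, s) \<in> R" using proj[OF s] by blast
      then have "y * b \<in> M" using b by (intro ideal_in_lmult[OF S(1) IM]) (auto simp: R_def)
      then show "s * x \<in> M'" using R_mult[OF y b(2)] by (auto simp: M'_def)
    qed
    have "1 \<notin> M'"
    proof
      assume "1 \<in> M'"
      then obtain b s a where b: "b \<in> M" "b \<in> S" and s: "s \<in> A - p" "a \<in> A"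
        and sb: "s * b - a \<in> q" "s - a \<in> q'" by (auto simp: M'_def R_def)
      have "s - a \<in> A" using s by (intro ring_subset_diff[OF A]) auto
      then have "s - a \<in> q" using sb q q' by blast
      from ideal_in_diff[OF S(1) Iq sb(1) this] have "s * (b - 1) \<in> q" by (simp add: algebra_simps)
      moreover have "s \<in> S" "s \<notin> q" "b - 1 \<in> S" using s q b S(2) ring_subset_closed[OF S(1)] by auto
      ultimately have "b - 1 \<in> q" using q by (auto simp: prime_in_def)
      then have "b - 1 \<in> M" using M by blast
      then have "1 \<in> M" by (rule ideal_in_cancel[OF S(1) IM b(1)])
      then show False using M1 by simp
    qed
    then obtain L where L: "maximal_in S L" "M' \<subseteq> L" using exists_maximal_in[OF IM'] by blast
    note IL = maximal_in_ideal[OF L(1)]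
    have "q' \<subseteq> M'"
    proof
      fix x assume x: "x \<in> q'"
      have "(0, x) \<in> R"
        using x p1 ring_subset_zero[OF S(1)] ring_subset_zero[OF A] ideal_in_zero[OF S(1) Iq]
          ideal_in_subset[OF S(1) Iq' x]
        by (intro RI[of _ _ 1 0]) auto
      then show "x \<in> M'" using ideal_in_zero[OF S(1) IM] by (auto simp: M'_def)
    qed
    then have NL: "N \<subseteq> L" using Np q' L by blast
    have LA: "L \<inter> A = m" by (rule maximal_over_local[OF A m S(1-4) L(1) NL])
    \<comment> \<open>At \<open>M\<close> the coefficients of \<open>u * f i\<close> are those of
      \<open>v i\<close>. Carried along \<open>R\<close> to \<open>L\<close> they are shifted by
      \<open>k' - k\<close>, and comparison with the hypothesis at \<open>L\<close> makes
      \<open>v i\<close> shift invariant modulo \<open>m\<close>.\<close>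
    have vm: "v i \<in> coeffs_in m" if i: "i < n" for i
    proof (rule shift_invariant_vanishes[OF A Im])
      show "k' - k \<noteq> 0" using kk by simp
      fix j
      have ct: "u * coef (f i) l - coef (v i) l \<in> Q" if "maximal_in S Q" "N \<subseteq> Q" for Q l
        using coeffs_inD[OF res[OF that i], of l] by (simp add: lookup_minus)
      have vA: "coef (v i) l \<in> A" for l by (rule coeffs_inD[OF v[OF i]])
      have "(u * coef (f i) ((j - k) + k) - coef (v i) j, u * coef (f i) ((j - k) + k') - coef (v i) j) \<in> R"
        by (intro R_diff R_mult RA u vA Rf i)
      moreover have "u * coef (f i) ((j - k) + k) - coef (v i) j \<in> M"
        using ct[OF M(1) NM, of j] by simp
      ultimately have "u * coef (f i) ((j - k) + k') - coef (v i) j \<in> L"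
        using L by (auto simp: M'_def)
      then have 1: "u * coef (f i) (j + (k' - k)) - coef (v i) j \<in> L" by (simp add: algebra_simps)
      have "coef (v i) j - coef (v i) (j + (k' - k)) \<in> L"
        using ideal_in_diff[OF S(1) IL ct[OF L(1) NL, of "j + (k' - k)"] 1] by simp
      moreover have "coef (v i) j - coef (v i) (j + (k' - k)) \<in> A"
        by (intro ring_subset_diff[OF A] vA)
      ultimately show "coef (v i) j - coef (v i) (j + (k' - k)) \<in> m" using LA by blast
    qed
    obtain i where i: "i < n" "f i \<notin> coeffs_in M"
      using coefficients_not_in_proper_ideal[OF S(1) IM M1 NM S(6)] by blast
    have "coef (f i) j \<in> M" for j
    proof -
      have "u * coef (f i) j - coef (v i) j \<in> M"
        using coeffs_inD[OF res[OF M(1) NM i(1)], of j] by (simp add: lookup_minus)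
      moreover have "coef (v i) j \<in> M" using coeffs_inD[OF vm[OF i(1)]] MA by blast
      ultimately have "u * coef (f i) j - coef (v i) j + coef (v i) j \<in> M"
        by (rule ideal_in_add[OF S(1) IM])
      then have "u * coef (f i) j \<in> M" by simp
      moreover have "u \<in> S" "u \<notin> M" using u MA S(2) by auto
      ultimately show ?thesis
        using maximal_in_prime[OF S(1) M(1)] coeffs_inD[OF S(5)[OF i(1)]] by (auto simp: prime_in_def)
    qed
    then show False using i by (auto simp: coeffs_in_def)
  qed
qed

text \<open>For orthogonal idempotents with sum 1 this is the unit that equals
  \<open>X^(\<kappa> e)\<close> on the factor of \<open>e\<close>; negating the exponents inverts
  it.\<close>

definition idempotent_monomials :: "'u set \<Rightarrow> ('u \<Rightarrow> int) \<Rightarrow> (int \<Rightarrow>\<^sub>0 'u)" where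
  "idempotent_monomials E \<kappa> = (\<Sum>e\<in>E. Poly_Mapping.single (\<kappa> e) e)"

text \<open>The last clause says that modulo \<open>N\<close> the factor of \<open>e\<close> is
  local or zero: one of \<open>x\<close> and \<open>1 - x\<close> becomes invertible there, as
  witnessed by a product equal to \<open>e\<close>.\<close>

definition splits_off where
  "splits_off S E \<longleftrightarrow> finite E \<and> E \<subseteq> S \<and> (\<forall>e\<in>E. e * e - e \<in> N) \<and>
     (\<forall>e\<in>E. \<forall>e'\<in>E. e \<noteq> e' \<longrightarrow> e * e' \<in> N) \<and> \<Sum>E - 1 \<in> N \<and>
     (\<forall>e\<in>E. \<forall>x\<in>S. \<exists>y\<in>S. x * y - e \<in> N \<or> (1 - x) * y - e \<in> N)"

lemma idempotent_monomials_inverse: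
  assumes E: "splits_off S E"
  shows "idempotent_monomials E \<kappa> * idempotent_monomials E (\<lambda>e. - \<kappa> e) - 1 \<in> coeffs_in N"
proof -
  note U = ring_subset_UNIV
  note NC = ideal_in_coeffs_in[OF U N] and RU = ring_subset_coeffs_in[OF U]
  have E': "finite E" "\<And>e. e \<in> E \<Longrightarrow> e * e - e \<in> N"
    "\<And>e e'. e \<in> E \<Longrightarrow> e' \<in> E \<Longrightarrow> e \<noteq> e' \<Longrightarrow> e * e' \<in> N" "\<Sum>E - 1 \<in> N"
    using E by (auto simp: splits_off_def)
  have sN: "Poly_Mapping.single l a \<in> coeffs_in N" if "a \<in> N" for l a
    using that by (intro single_in_coeffs_in ideal_in_zero[OF U N])
  have "idempotent_monomials E \<kappa> * idempotent_monomials E (\<lambda>e. - \<kappa> e) - 1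
    = (\<Sum>e\<in>E. (\<Sum>e'\<in>E. Poly_Mapping.single (\<kappa> e - \<kappa> e') (e * e')) - const e) + const (\<Sum>E - 1)"
    by (simp add: idempotent_monomials_def sum_product mult_single sum_subtractf single_diff single_sum)
  also have "\<dots> \<in> coeffs_in N"
  proof (intro ideal_in_add[OF RU NC] ideal_in_sum[OF RU NC] sN E'(4))
    fix e assume e: "e \<in> E"
    have "(\<Sum>e'\<in>E. Poly_Mapping.single (\<kappa> e - \<kappa> e') (e * e')) - const e
        = const (e * e - e) + (\<Sum>e'\<in>E - {e}. Poly_Mapping.single (\<kappa> e - \<kappa> e') (e * e'))"
      using E'(1) e by (subst sum.remove[of E e]) (auto simp: single_diff)
    also have "\<dots> \<in> coeffs_in N"
      using e by (intro ideal_in_add[OF RU NC] ideal_in_sum[OF RU NC] sN E'(2,3)) auto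
    finally show "(\<Sum>e'\<in>E. Poly_Mapping.single (\<kappa> e - \<kappa> e') (e * e')) - const e \<in> coeffs_in N" .
  qed
  finally show ?thesis .
qed

end

text \<open>Each maximal ideal of \<open>S\<close> over \<open>N\<close> misses exactly one
  idempotent of \<open>E\<close>, and each idempotent is missed by at most one of them. One unit
  \<open>u\<close> therefore cancels the exponents at all maximal ideals; the generators
  \<open>u * f i\<close> are residually trivial and their coefficient ring is
  \<open>A\<close>.\<close>

lemma (in invertible_pair) local_pair_splits:
  assumes subint: "subintegrally_closed_set A" and m: "local_modulo N A m"
    and idem: "\<And>S Z. ring_subset S \<Longrightarrow> A \<subseteq> S \<Longrightarrow> finite Z \<Longrightarrow> S = span_over A Z \<Longrightarrow> \<exists>E. splits_off S E"
  obtains S E \<kappa> where "splits_off S E"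
    "\<And>i. i < n \<Longrightarrow> idempotent_monomials E \<kappa> * f i \<in> coeffs_in A"
    "\<And>i. i < n \<Longrightarrow> idempotent_monomials E (\<lambda>e. - \<kappa> e) * g i \<in> coeffs_in A"
proof -
  obtain S Z where cr: "coefficient_ring S Z" using exists_coefficient_ring by blast
  note S = coefficient_ringD[OF cr]
  note RA = ring_subset_coeffs_in[OF A] and RS = ring_subset_coeffs_in[OF S(1)]
  note U = ring_subset_UNIV
  note NC = ideal_in_coeffs_in[OF U N] and RU = ring_subset_coeffs_in[OF U]
  have NCm: "x * y \<in> coeffs_in N" "y * x \<in> coeffs_in N" if "y \<in> coeffs_in N" for x y
    using ideal_in_lmult[OF RU NC _ that, of x] ideal_in_rmult[OF RU NC _ that, of x]
    by (auto simp: coeffs_in_def)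
  obtain E where E: "splits_off S E" using idem[OF S(1-4)] by blast
  have E': "finite E" "E \<subseteq> S" "\<And>e. e \<in> E \<Longrightarrow> e * e - e \<in> N"
    "\<And>e e'. e \<in> E \<Longrightarrow> e' \<in> E \<Longrightarrow> e \<noteq> e' \<Longrightarrow> e * e' \<in> N" "\<Sum>E - 1 \<in> N"
    "\<And>e x. e \<in> E \<Longrightarrow> x \<in> S \<Longrightarrow> \<exists>y\<in>S. x * y - e \<in> N \<or> (1 - x) * y - e \<in> N"
    using E by (auto simp: splits_off_def)
  note pm = local_modulo_prime[OF A N m]
  have Nm: "N \<subseteq> m" using m by (simp add: local_modulo_def)
  obtain t w where t: "t \<in> A" "t \<notin> m" and w: "\<And>i. i < n \<Longrightarrow> w i \<in> coeffs_in A"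
    and tw: "\<And>q. prime_in S q \<Longrightarrow> q \<inter> A = m \<Longrightarrow> \<exists>k. \<forall>i<n. const t * f i - shift k * w i \<in> coeffs_in q"
    using fibre_monomial[OF A S(1,2) pm Nm S(5,6) fg one f1] by blast
  define maxi where "maxi M \<longleftrightarrow> maximal_in S M \<and> N \<subseteq> M" for M
  have "\<exists>k. \<forall>i<n. const t * f i - shift k * w i \<in> coeffs_in M" if "maxi M" for M
    using that tw[OF maximal_in_prime[OF S(1)] maximal_over_local[OF A m S(1-4)]] by (auto simp: maxi_def)
  then obtain k where k: "\<And>M i. maxi M \<Longrightarrow> i < n \<Longrightarrow> const t * f i - shift (k M) * w i \<in> coeffs_in M"
    by metis
  \<comment> \<open>Distinct maximal ideals are comaximal, so some \<open>x \<in> M\<close> has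
    \<open>1 - x \<in> M'\<close>. Whichever of the two is invertible on the factor of
    \<open>e\<close> puts \<open>e\<close> into \<open>M\<close> or into \<open>M'\<close>.\<close>
  have unique: "M = M'" if e: "e \<in> E" and M: "maxi M" "e \<notin> M" and M': "maxi M'" "e \<notin> M'" for e M M'
  proof (rule ccontr)
    assume "M \<noteq> M'"
    have mM: "maximal_in S M" "maximal_in S M'" "N \<subseteq> M" "N \<subseteq> M'" using M M' by (auto simp: maxi_def)
    note IM = maximal_in_ideal[OF mM(1)] and IM' = maximal_in_ideal[OF mM(2)]
    have eS: "e \<in> S" using e E' by auto
    have "\<not> M \<subseteq> M'" using \<open>M \<noteq> M'\<close> mM(1,2) unfolding maximal_in_def by blast
    then obtain x0 where x0: "x0 \<in> M" "x0 \<notin> M'" by blast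
    have x0S: "x0 \<in> S" by (rule ideal_in_subset[OF S(1) IM x0(1)])
    obtain y s where ys: "y \<in> M'" "s \<in> S" "y + s * x0 = 1" using maximal_in_unit[OF S(1) mM(2) x0S x0(2)] .
    define x where "x = s * x0"
    have x: "x \<in> M" "1 - x \<in> M'" "x \<in> S"
      using ys x0 x0S ideal_in_lmult[OF S(1) IM ys(2) x0(1)] ring_subset_mult[OF S(1) ys(2) x0S]
      by (auto simp: x_def eq_diff_eq[symmetric])
    from E'(6)[OF e x(3)] obtain z where z: "z \<in> S" "x * z - e \<in> N \<or> (1 - x) * z - e \<in> N" by blast
    from z(2) show False
    proof
      assume "x * z - e \<in> N"
      then have "x * z - e \<in> M" using mM(3) by blast
      then have "e \<in> M" by (rule ideal_in_cancel[OF S(1) IM ideal_in_rmult[OF S(1) IM z(1) x(1)]])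
      then show False using M by simp
    next
      assume "(1 - x) * z - e \<in> N"
      then have "(1 - x) * z - e \<in> M'" using mM(4) by blast
      then have "e \<in> M'" by (rule ideal_in_cancel[OF S(1) IM' ideal_in_rmult[OF S(1) IM' z(1) x(2)]])
      then show False using M' by simp
    qed
  qed
  \<comment> \<open>The sign makes \<open>u\<close> cancel the exponent \<open>k M\<close> at the
    only \<open>M\<close> that misses \<open>e\<close>. An \<open>e\<close> contained in all of them
    receives an arbitrary exponent.\<close>
  define \<kappa> where "\<kappa> e = - k (SOME M. maxi M \<and> e \<notin> M)" for e
  have \<kappa>: "\<kappa> e = - k M" if "e \<in> E" "maxi M" "e \<notin> M" for e M
  proof -
    have "maxi (SOME M. maxi M \<and> e \<notin> M) \<and> e \<notin> (SOME M. maxi M \<and> e \<notin> M)"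
      using that by (intro someI[of "\<lambda>M. maxi M \<and> e \<notin> M" M]) auto
    then have "(SOME M. maxi M \<and> e \<notin> M) = M" using unique that by blast
    then show ?thesis by (simp add: \<kappa>_def)
  qed
  define u where "u = idempotent_monomials E \<kappa>"
  define u' where "u' = idempotent_monomials E (\<lambda>e. - \<kappa> e)"
  have uu': "u * u' - 1 \<in> coeffs_in N" unfolding u_def u'_def by (rule idempotent_monomials_inverse[OF E])
  have uS: "idempotent_monomials E \<kappa>' \<in> coeffs_in S" for \<kappa>'
    unfolding idempotent_monomials_def using E'
    by (intro ring_subset_sum[OF RS] single_in_coeffs_in ring_subset_zero[OF S(1)]) auto
  have u1: "at_one (idempotent_monomials E \<kappa>') - 1 \<in> N" for \<kappa>'
    using E'(5) by (simp add: idempotent_monomials_def at_one_sum)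
  have Nmul: "x * y \<in> N" "y * x \<in> N" if "y \<in> N" for x y
    using ideal_in_lmult[OF U N _ that] ideal_in_rmult[OF U N _ that] by auto
  have at1: "at_one (idempotent_monomials E \<kappa>' * h) \<in> A" if "at_one h \<in> A" for \<kappa>' h
  proof -
    have "at_one (idempotent_monomials E \<kappa>' * h)
        = at_one h + (at_one (idempotent_monomials E \<kappa>') - 1) * at_one h"
      by (simp add: at_one_mult algebra_simps)
    also have "\<dots> \<in> A" using that Nmul(2)[OF u1] NA by (intro ring_subset_add[OF A]) auto
    finally show ?thesis .
  qed
  interpret P: invertible_pair A N "\<lambda>i. u * f i" "\<lambda>i. u' * g i" n
  proof
    show "u * f i * (u' * g j) \<in> coeffs_in A" if "i < n" "j < n" for i j
    proof -
      have "u * f i * (u' * g j) = f i * g j + (u * u' - 1) * (f i * g j)" by (simp add: algebra_simps)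
      also have "\<dots> \<in> coeffs_in A"
        using fg[OF that] NCm(2)[OF uu'] coeffs_in_mono[OF NA] by (intro ring_subset_add[OF RA]) auto
      finally show ?thesis .
    qed
    have *: "u * f i * (u' * g i) = (u * u' - 1) * (f i * g i) + f i * g i" for i
      by (simp add: algebra_simps)
    have "(\<Sum>i<n. u * f i * (u' * g i)) - 1 = (u * u' - 1) * (\<Sum>i<n. f i * g i) + ((\<Sum>i<n. f i * g i) - 1)"
      unfolding * by (simp add: sum.distrib sum_distrib_left)
    also have "\<dots> \<in> coeffs_in N" by (intro ideal_in_add[OF RU NC] one NCm(2) uu')
    finally show "(\<Sum>i<n. u * f i * (u' * g i)) - 1 \<in> coeffs_in N" .
    show "at_one (u * f i) \<in> A" "at_one (u' * g i) \<in> A" if "i < n" for i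
      unfolding u_def u'_def using f1[OF that] g1[OF that] by (auto intro: at1)
  qed (rule A N NA)+
  obtain S' Z' where cr': "P.coefficient_ring S' Z'" using P.exists_coefficient_ring by blast
  note S' = P.coefficient_ringD[OF cr']
  \<comment> \<open>The new generators have their own coefficient ring \<open>S'\<close>. Its
    maximal ideals are lifted to \<open>S\<close>, where the exponents are known.\<close>
  have S'S: "S' \<subseteq> S"
    using S(5) uS by (intro S'(7) S(1,2)) (auto simp: u_def intro!: ring_subset_mult[OF RS])
  have "S' = A"
  proof (rule P.coefficient_ring_trivial_if_residually_trivial[OF subint cr' m t])
    show "w i \<in> coeffs_in A" if "i < n" for i by (rule w[OF that])
    fix M' i assume M': "maximal_in S' M'" "N \<subseteq> M'" and i: "i < n"
    obtain M where M: "maximal_in S M" "M \<inter> S' = M'"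
      using lying_over[OF S'(1) S(1) S'S S(3) span_over_larger_ring[OF A S'(2) S'S S(1,4)] M'(1)] .
    have mM: "maxi M" using M M' by (auto simp: maxi_def)
    note IM = maximal_in_ideal[OF M(1)]
    note IMc = ideal_in_coeffs_in[OF S(1) IM]
    have NM: "N \<subseteq> M" using mM by (simp add: maxi_def)
    have M1: "1 \<notin> M" using M by (simp add: maximal_in_def)
    have "\<exists>e\<in>E. e \<notin> M"
    proof (rule ccontr)
      assume "\<not> ?thesis"
      then have "\<Sum>E \<in> M" by (intro ideal_in_sum[OF S(1) IM]) auto
      then have "1 \<in> M" using E'(5) NM by (intro ideal_in_cancel[OF S(1) IM, of "\<Sum>E" 1]) auto
      then show False using M1 by simp
    qed
    then obtain e where e: "e \<in> E" "e \<notin> M" by blast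
    have eS: "e \<in> S" using e E' by auto
    have prM: "prime_in S M" by (rule maximal_in_prime[OF S(1) M(1)])
    have e1: "e - 1 \<in> M"
    proof -
      have "e * (e - 1) \<in> M" using E'(3)[OF e(1)] NM by (auto simp: algebra_simps)
      then show ?thesis using prM e eS ring_subset_diff[OF S(1) eS ring_subset_one[OF S(1)]]
        by (auto simp: prime_in_def)
    qed
    have other: "e' \<in> M" if "e' \<in> E" "e' \<noteq> e" for e'
      using E'(4)[OF that(1) e(1)] that NM prM e eS E'(2) unfolding prime_in_def by blast
    have sM: "Poly_Mapping.single l a \<in> coeffs_in M" if "a \<in> M" for l a
      using that by (intro single_in_coeffs_in ideal_in_zero[OF S(1) IM])
    have uM: "u - shift (- k M) \<in> coeffs_in M"
    proof -
      have "u - shift (- k M) = Poly_Mapping.single (\<kappa> e) (e - 1) + (\<Sum>e'\<in>E - {e}. Poly_Mapping.single (\<kappa> e') e')"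
        unfolding u_def idempotent_monomials_def
        using E'(1) e \<kappa>[OF e(1) mM e(2)] by (subst sum.remove[of E e]) (auto simp: single_diff)
      also have "\<dots> \<in> coeffs_in M"
        using other e1 by (intro ideal_in_add[OF RS IMc] ideal_in_sum[OF RS IMc] sM) auto
      finally show ?thesis .
    qed
    have ctS: "const t \<in> coeffs_in S" "shift l \<in> coeffs_in S" for l
      using t S(2) by (auto intro!: single_in_coeffs_in ring_subset_zero[OF S(1)] ring_subset_one[OF S(1)])
    have "(u - shift (- k M)) * (const t * f i) + shift (- k M) * (const t * f i - shift (k M) * w i)
        = const t * (u * f i) - (shift (- k M) * shift (k M)) * w i"
      by (simp add: algebra_simps)
    also have "\<dots> = const t * (u * f i) - w i" by (simp add: mult_single)
    finally have "const t * (u * f i) - w i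
        = (u - shift (- k M)) * (const t * f i) + shift (- k M) * (const t * f i - shift (k M) * w i)" ..
    also have "\<dots> \<in> coeffs_in M"
      using uM k[OF mM i] ctS S(5)[OF i]
      by (intro ideal_in_add[OF RS IMc] ideal_in_rmult[OF RS IMc _ uM] ideal_in_lmult[OF RS IMc _ k[OF mM i]]
          ring_subset_mult[OF RS])
    finally have 1: "const t * (u * f i) - w i \<in> coeffs_in M" .
    have "const t * (u * f i) - w i \<in> coeffs_in S'"
    proof -
      have "const t \<in> coeffs_in S'" "w i \<in> coeffs_in S'"
        using t S'(2) w[OF i] coeffs_in_mono[OF S'(2)]
        by (auto intro!: single_in_coeffs_in ring_subset_zero[OF S'(1)])
      then show ?thesis using S'(5)[OF i]
        by (intro ring_subset_diff[OF ring_subset_coeffs_in[OF S'(1)]]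
            ring_subset_mult[OF ring_subset_coeffs_in[OF S'(1)] \<open>const t \<in> coeffs_in S'\<close>])
    qed
    with 1 show "const t * (u * f i) - w i \<in> coeffs_in M'" using M(2) by (auto simp: coeffs_in_def)
  qed
  then show ?thesis using that[OF E, of \<kappa>] S'(5,6) by (simp add: u_def u'_def)
qed

section \<open>Groups of invertible submodules\<close>

lemma ideal_prod_least:
  assumes "\<And>i j. i \<in> I \<Longrightarrow> j \<in> J \<Longrightarrow> i \<otimes>\<^bsub>R\<^esub> j \<in> M" and "\<And>x y. x \<in> M \<Longrightarrow> y \<in> M \<Longrightarrow> x \<oplus>\<^bsub>R\<^esub> y \<in> M"
  shows "ideal_prod R I J \<subseteq> M"
proof
  fix x assume "x \<in> ideal_prod R I J"
  then show "x \<in> M" by (induction rule: ideal_prod.induct) (use assms in auto)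
qed

lemma ideal_prod_mono: "I \<subseteq> I' \<Longrightarrow> J \<subseteq> J' \<Longrightarrow> ideal_prod R I J \<subseteq> ideal_prod R I' J'"
  by (rule ideal_prod_least) (auto intro: ideal_prod.intros)

lemma (in ring) ideal_prod_carrier:
  "I \<subseteq> carrier R \<Longrightarrow> J \<subseteq> carrier R \<Longrightarrow> ideal_prod R I J \<subseteq> carrier R"
  by (rule ideal_prod_least) auto

lemma (in cring) ideal_prod_comm:
  assumes "I \<subseteq> carrier R" "J \<subseteq> carrier R"
  shows "ideal_prod R I J = ideal_prod R J I"
proof -
  have "ideal_prod R I J \<subseteq> ideal_prod R J I" if "I \<subseteq> carrier R" "J \<subseteq> carrier R" for I J
  proof (rule ideal_prod_least)
    fix i j assume "i \<in> I" "j \<in> J"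
    then have "j \<otimes> i \<in> ideal_prod R J I" "i \<otimes> j = j \<otimes> i"
      using that by (auto intro: ideal_prod.prod m_comm)
    then show "i \<otimes> j \<in> ideal_prod R J I" by simp
  qed (rule ideal_prod.sum)
  then show ?thesis using assms by blast
qed

lemma (in cring) ideal_prod_assoc:
  assumes "I \<subseteq> carrier R" "J \<subseteq> carrier R" "K \<subseteq> carrier R"
  shows "ideal_prod R (ideal_prod R I J) K = ideal_prod R I (ideal_prod R J K)"
proof -
  have sub: "ideal_prod R (ideal_prod R I J) K \<subseteq> ideal_prod R I (ideal_prod R J K)"
    if I: "I \<subseteq> carrier R" and J: "J \<subseteq> carrier R" and K: "K \<subseteq> carrier R" for I J K
  proof (rule ideal_prod_least)
    fix x k assume x: "x \<in> ideal_prod R I J" and k: "k \<in> K"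
    from x show "x \<otimes> k \<in> ideal_prod R I (ideal_prod R J K)"
    proof (induction rule: ideal_prod.induct)
      case (prod i j)
      then have "i \<otimes> (j \<otimes> k) \<in> ideal_prod R I (ideal_prod R J K)" using k by (auto intro: ideal_prod.prod)
      moreover have "i \<otimes> (j \<otimes> k) = i \<otimes> j \<otimes> k" using prod k I J K by (auto intro: m_assoc[symmetric])
      ultimately show ?case by simp
    next
      case (sum x y)
      have "x \<in> carrier R" "y \<in> carrier R" "k \<in> carrier R"
        using sum ideal_prod_carrier[OF I J] k K by auto
      then have "(x \<oplus> y) \<otimes> k = x \<otimes> k \<oplus> y \<otimes> k" by (rule l_distr)
      then show ?case using sum by (auto intro: ideal_prod.sum)
    qed
  qed (rule ideal_prod.sum)
  note car = ideal_prod_carrier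
  have "ideal_prod R I (ideal_prod R J K) = ideal_prod R (ideal_prod R K J) I"
    by (simp only: ideal_prod_comm[OF assms(2,3)] ideal_prod_comm[OF assms(1) car[OF assms(3,2)]])
  also have "\<dots> \<subseteq> ideal_prod R K (ideal_prod R J I)" using assms by (intro sub)
  also have "\<dots> = ideal_prod R (ideal_prod R I J) K"
    by (simp only: ideal_prod_comm[OF assms(2,1)] ideal_prod_comm[OF assms(3) car[OF assms(1,2)]])
  finally show ?thesis using sub[OF assms] by blast
qed

lemma subalgebraD:
  assumes "subalgebra A I R"
  shows "I \<subseteq> carrier R" "\<zero>\<^bsub>R\<^esub> \<in> I" "\<And>x y. x \<in> I \<Longrightarrow> y \<in> I \<Longrightarrow> x \<oplus>\<^bsub>R\<^esub> y \<in> I"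
    "\<And>x. x \<in> I \<Longrightarrow> \<ominus>\<^bsub>R\<^esub> x \<in> I" "\<And>a x. a \<in> A \<Longrightarrow> x \<in> I \<Longrightarrow> a \<otimes>\<^bsub>R\<^esub> x \<in> I"
  using subalgebra.axioms(1)[OF assms, THEN subgroup.subset] subalgebra.axioms(1)[OF assms, THEN subgroup.one_closed]
    subalgebra.axioms(1)[OF assms, THEN subgroup.m_closed]
    subalgebra.axioms(1)[OF assms, THEN subgroup.m_inv_closed] subalgebra.smult_closed[OF assms]
  by (auto simp: a_inv_def)

lemma subalgebraI:
  assumes "I \<subseteq> carrier R" "\<zero>\<^bsub>R\<^esub> \<in> I" "\<And>x y. x \<in> I \<Longrightarrow> y \<in> I \<Longrightarrow> x \<oplus>\<^bsub>R\<^esub> y \<in> I"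
    "\<And>x. x \<in> I \<Longrightarrow> \<ominus>\<^bsub>R\<^esub> x \<in> I" "\<And>a x. a \<in> A \<Longrightarrow> x \<in> I \<Longrightarrow> a \<otimes>\<^bsub>R\<^esub> x \<in> I"
  shows "subalgebra A I R"
  by (intro subalgebra.intro subgroup.intro subalgebra_axioms.intro)
    (use assms in \<open>auto simp: a_inv_def\<close>)

text \<open>\<open>V\<close> is a mere set because the image of a module under a ring homomorphism
  is a module over the image ring only; the factor \<open>J\<close> supplies the action of
  \<open>A\<close>.\<close>

lemma (in cring) prod_subalgebra:
  assumes V: "V \<subseteq> carrier R" "V \<noteq> {}" and A: "A \<subseteq> carrier R" and J: "subalgebra A J R"
  shows "subalgebra A (ideal_prod R V J) R"
proof -
  note J = subalgebraD[OF J]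
  obtain x0 where x0: "x0 \<in> V" using V by blast
  have car: "ideal_prod R V J \<subseteq> carrier R" by (rule ideal_prod_carrier[OF V(1) J(1)])
  show ?thesis
  proof (rule subalgebraI[OF car _ ideal_prod.sum])
    have "x0 \<otimes> \<zero> \<in> ideal_prod R V J" by (rule ideal_prod.prod[OF x0 J(2)])
    then show "\<zero> \<in> ideal_prod R V J" using x0 V by (simp add: subset_iff)
    show "\<ominus> x \<in> ideal_prod R V J" if "x \<in> ideal_prod R V J" for x
      using that
    proof (induction rule: ideal_prod.induct)
      case (prod x j)
      have "x \<in> carrier R" "j \<in> carrier R" using prod V J(1) by auto
      then have "\<ominus> (x \<otimes> j) = x \<otimes> (\<ominus> j)" by (simp add: r_minus)
      then show ?case using ideal_prod.prod[OF prod(1) J(4)[OF prod(2)]] by simp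
    next
      case (sum x y)
      then have "\<ominus> (x \<oplus> y) = \<ominus> x \<oplus> \<ominus> y" using car by (intro minus_add) auto
      then show ?case using ideal_prod.sum[OF sum.IH] by simp
    qed
    show "a \<otimes> x \<in> ideal_prod R V J" if a: "a \<in> A" and "x \<in> ideal_prod R V J" for a x
      using that(2)
    proof (induction rule: ideal_prod.induct)
      case (prod x j)
      then have "a \<otimes> (x \<otimes> j) = x \<otimes> (a \<otimes> j)" using V J(1) A a by (intro m_lcomm) auto
      then show ?case using ideal_prod.prod[OF prod(1) J(5)[OF a prod(2)]] by simp
    next
      case (sum x y)
      then have "a \<otimes> (x \<oplus> y) = a \<otimes> x \<oplus> a \<otimes> y" using car a A by (intro r_distr) auto
      then show ?case using ideal_prod.sum[OF sum.IH] by simp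
    qed
  qed
qed

locale ring_extension = cring R for A and R (structure) +
  assumes A: "subcring A R"
begin

lemma A_carrier: "A \<subseteq> carrier R" using subcringE(1)[OF A] .

lemma A_subalgebra: "subalgebra A A R"
  using subcringE[OF A] by (intro subalgebraI) auto

lemma one_in_A: "\<one> \<in> A" using subcringE(3)[OF A] .

lemma A_prod:
  assumes I: "subalgebra A I R" shows "ideal_prod R A I = I"
proof
  note I = subalgebraD[OF I]
  show "ideal_prod R A I \<subseteq> I" using I by (intro ideal_prod_least) auto
  show "I \<subseteq> ideal_prod R A I"
  proof
    fix x assume "x \<in> I"
    then have "\<one> \<otimes> x \<in> ideal_prod R A I" "\<one> \<otimes> x = x" using one_in_A I by (auto intro: ideal_prod.prod)
    then show "x \<in> ideal_prod R A I" by simp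
  qed
qed

lemma prod_A: "subalgebra A I R \<Longrightarrow> ideal_prod R I A = I"
  using A_prod ideal_prod_comm[OF A_carrier, of I] by (auto dest: subalgebraD)

lemma prod_closed: "subalgebra A I R \<Longrightarrow> subalgebra A J R \<Longrightarrow> subalgebra A (ideal_prod R I J) R"
  using A_carrier by (intro prod_subalgebra) (auto dest: subalgebraD)

lemma carrier_inv_submodules: "carrier (inv_submodules A R) = {I. invertible_submodule A R I}"
  and mult_inv_submodules: "monoid.mult (inv_submodules A R) = ideal_prod R"
  and one_inv_submodules: "one (inv_submodules A R) = A"
  by (simp_all add: inv_submodules_def)

lemma invertible_submoduleD: "invertible_submodule A R I \<Longrightarrow> subalgebra A I R"
  by (simp add: invertible_submodule_def)

lemma invertible_submoduleI:
  "subalgebra A I R \<Longrightarrow> subalgebra A J R \<Longrightarrow> ideal_prod R I J = A \<Longrightarrow> invertible_submodule A R I"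
  by (auto simp: invertible_submodule_def)

lemma inv_submodules_group: "comm_group (inv_submodules A R)"
proof (rule comm_groupI, unfold carrier_inv_submodules mult_inv_submodules one_inv_submodules mem_Collect_eq)
  note sc = subalgebraD(1)
  show "invertible_submodule A R A" using A_subalgebra prod_A by (intro invertible_submoduleI)
  fix I assume I: "invertible_submodule A R I"
  then obtain I' where I': "subalgebra A I R" "subalgebra A I' R" "ideal_prod R I I' = A"
    by (auto simp: invertible_submodule_def)
  show "ideal_prod R A I = I" by (rule A_prod[OF I'(1)])
  show "\<exists>J\<in>{I. invertible_submodule A R I}. ideal_prod R J I = A"
  proof (intro bexI[of _ I'] CollectI)
    show "ideal_prod R I' I = A" using I'(3) ideal_prod_comm[OF sc[OF I'(1)] sc[OF I'(2)]] by simp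
    then show "invertible_submodule A R I'" by (rule invertible_submoduleI[OF I'(2,1)])
  qed
  fix J assume J: "invertible_submodule A R J"
  then obtain J' where J': "subalgebra A J R" "subalgebra A J' R" "ideal_prod R J J' = A"
    by (auto simp: invertible_submodule_def)
  show "ideal_prod R I J = ideal_prod R J I" using I' J' by (intro ideal_prod_comm sc)
  show "invertible_submodule A R (ideal_prod R I J)"
  proof (rule invertible_submoduleI)
    show "subalgebra A (ideal_prod R I J) R" "subalgebra A (ideal_prod R J' I') R"
      by (rule prod_closed[OF I'(1) J'(1)], rule prod_closed[OF J'(2) I'(2)])
    note c = sc[OF I'(1)] sc[OF I'(2)] sc[OF J'(1)] sc[OF J'(2)]
    have "ideal_prod R (ideal_prod R I J) (ideal_prod R J' I') = ideal_prod R I (ideal_prod R (ideal_prod R J J') I')"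
      using c by (simp add: ideal_prod_assoc ideal_prod_carrier)
    also have "\<dots> = A" using A_prod[OF I'(2)] I'(3) J'(3) by simp
    finally show "ideal_prod R (ideal_prod R I J) (ideal_prod R J' I') = A" .
  qed
  fix K assume "invertible_submodule A R K"
  then show "ideal_prod R (ideal_prod R I J) K = ideal_prod R I (ideal_prod R J K)"
    by (intro ideal_prod_assoc sc[OF I'(1)] sc[OF J'(1)] sc[OF invertible_submoduleD])
qed

end

section \<open>Extension of submodules along ring homomorphisms\<close>

lemma inv_submodules_simps:
  "carrier (inv_submodules A R) = {I. invertible_submodule A R I}"
  "monoid.mult (inv_submodules A R) = ideal_prod R" "one (inv_submodules A R) = A"
  by (simp_all add: inv_submodules_def)

text \<open>Extension of scalars for submodules. One notion covers constants of Laurent and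
  polynomial rings, evaluation at 1 in either variable, and the maps between Laurent rings over
  \<open>B\<close> and over \<open>B[T]\<close>.\<close>

definition extend_module :: "('a \<Rightarrow> 'c) \<Rightarrow> 'c set \<Rightarrow> ('c, 'd) ring_scheme \<Rightarrow> 'a set \<Rightarrow> 'c set" where
  "extend_module \<phi> A' C I = ideal_prod C (\<phi> ` I) A'"

lemma image_ideal_prod:
  assumes B: "cring B" and C: "cring C" and \<phi>: "\<phi> \<in> ring_hom B C" and I: "I \<subseteq> carrier B" "J \<subseteq> carrier B"
  shows "\<phi> ` ideal_prod B I J = ideal_prod C (\<phi> ` I) (\<phi> ` J)"
proof
  interpret B: cring B by (rule B)
  interpret C: cring C by (rule C)
  have car: "ideal_prod B I J \<subseteq> carrier B" by (rule B.ideal_prod_carrier[OF I])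
  show "\<phi> ` ideal_prod B I J \<subseteq> ideal_prod C (\<phi> ` I) (\<phi> ` J)"
  proof clarify
    fix x assume "x \<in> ideal_prod B I J"
    then show "\<phi> x \<in> ideal_prod C (\<phi> ` I) (\<phi> ` J)"
    proof (induction rule: ideal_prod.induct)
      case (prod i j)
      then have "\<phi> (i \<otimes>\<^bsub>B\<^esub> j) = \<phi> i \<otimes>\<^bsub>C\<^esub> \<phi> j" using I \<phi> by (intro ring_hom_mult) auto
      then show ?case using prod by (auto intro: ideal_prod.prod)
    next
      case (sum x y)
      then have "\<phi> (x \<oplus>\<^bsub>B\<^esub> y) = \<phi> x \<oplus>\<^bsub>C\<^esub> \<phi> y"
        using car by (intro ring_hom_add[OF \<phi>]) blast+
      then show ?case using sum by (auto intro: ideal_prod.sum)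
    qed
  qed
  show "ideal_prod C (\<phi> ` I) (\<phi> ` J) \<subseteq> \<phi> ` ideal_prod B I J"
  proof (rule ideal_prod_least)
    fix x y assume "x \<in> \<phi> ` I" "y \<in> \<phi> ` J"
    then obtain i j where ij: "i \<in> I" "j \<in> J" "x = \<phi> i" "y = \<phi> j" by blast
    then have "\<phi> (i \<otimes>\<^bsub>B\<^esub> j) = x \<otimes>\<^bsub>C\<^esub> y" using I \<phi> by (subst ring_hom_mult[OF \<phi>]) auto
    then show "x \<otimes>\<^bsub>C\<^esub> y \<in> \<phi> ` ideal_prod B I J"
      using ideal_prod.prod[OF ij(1,2), of B] by (metis imageI)
  next
    fix x y assume "x \<in> \<phi> ` ideal_prod B I J" "y \<in> \<phi> ` ideal_prod B I J"
    then obtain i j where ij: "i \<in> ideal_prod B I J" "j \<in> ideal_prod B I J" "x = \<phi> i" "y = \<phi> j" by blast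
    then have "\<phi> (i \<oplus>\<^bsub>B\<^esub> j) = x \<oplus>\<^bsub>C\<^esub> y" using car \<phi> by (subst ring_hom_add[OF \<phi>]) auto
    then show "x \<oplus>\<^bsub>C\<^esub> y \<in> \<phi> ` ideal_prod B I J"
      using ideal_prod.sum[OF ij(1,2)] by (metis imageI)
  qed
qed

locale extension_hom = B: ring_extension A B + C: ring_extension A' C
  for A B A' C and \<phi> +
  assumes hom: "\<phi> \<in> ring_hom B C" and maps: "\<phi> ` A \<subseteq> A'"
begin

lemma \<phi>_carrier: "V \<subseteq> carrier B \<Longrightarrow> \<phi> ` V \<subseteq> carrier C"
  using hom by (auto simp: ring_hom_def)

lemma extend_subalgebra:
  assumes "subalgebra A I B" shows "subalgebra A' (extend_module \<phi> A' C I) C"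
  unfolding extend_module_def using subalgebraD[OF assms]
  by (intro C.prod_subalgebra \<phi>_carrier C.A_carrier C.A_subalgebra) auto

lemma extend_A: "extend_module \<phi> A' C A = A'"
proof -
  have "ideal_prod C (\<phi> ` A) A' \<subseteq> ideal_prod C A' A'" by (rule ideal_prod_mono[OF maps order_refl])
  moreover have "ideal_prod C A' A' = A'" by (rule C.A_prod[OF C.A_subalgebra])
  moreover have "A' \<subseteq> ideal_prod C (\<phi> ` A) A'"
  proof
    fix a assume a: "a \<in> A'"
    have "\<one>\<^bsub>C\<^esub> = \<phi> \<one>\<^bsub>B\<^esub>" using ring_hom_one[OF hom] by simp
    then have "\<one>\<^bsub>C\<^esub> \<in> \<phi> ` A" using B.one_in_A by blast
    then have "\<one>\<^bsub>C\<^esub> \<otimes>\<^bsub>C\<^esub> a \<in> ideal_prod C (\<phi> ` A) A'" using a by (rule ideal_prod.prod)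
    then show "a \<in> ideal_prod C (\<phi> ` A) A'" using a C.A_carrier by (simp add: subset_iff)
  qed
  ultimately show ?thesis by (auto simp: extend_module_def)
qed

lemma extend_mult:
  assumes I: "I \<subseteq> carrier B" and J: "J \<subseteq> carrier B"
  shows "extend_module \<phi> A' C (ideal_prod B I J)
    = ideal_prod C (extend_module \<phi> A' C I) (extend_module \<phi> A' C J)"
proof -
  note c = \<phi>_carrier[OF I] \<phi>_carrier[OF J] C.A_carrier
  let ?I = "\<phi> ` I" and ?J = "\<phi> ` J" and ?p = "ideal_prod C"
  have "?p (?p ?I A') (?p ?J A') = ?p ?I (?p (?p A' ?J) A')"
    using c by (simp add: C.ideal_prod_assoc C.ideal_prod_carrier)
  also have "?p A' ?J = ?p ?J A'" using c by (intro C.ideal_prod_comm)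
  also have "?p ?I (?p (?p ?J A') A') = ?p ?I (?p ?J (?p A' A'))"
    using c by (simp add: C.ideal_prod_assoc C.ideal_prod_carrier)
  also have "?p A' A' = A'" by (rule C.A_prod[OF C.A_subalgebra])
  also have "?p ?I (?p ?J A') = ?p (?p ?I ?J) A'"
    using c by (simp add: C.ideal_prod_assoc C.ideal_prod_carrier)
  finally show ?thesis
    using image_ideal_prod[OF B.is_cring C.is_cring hom I J] by (simp add: extend_module_def)
qed

lemma extend_invertible:
  assumes "invertible_submodule A B I" shows "invertible_submodule A' C (extend_module \<phi> A' C I)"
proof -
  obtain J where J: "subalgebra A I B" "subalgebra A J B" "ideal_prod B I J = A"
    using assms by (auto simp: invertible_submodule_def)
  show ?thesis
    using extend_mult[OF subalgebraD(1)[OF J(1)] subalgebraD(1)[OF J(2)]] J(3) extend_A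
    by (intro C.invertible_submoduleI[OF extend_subalgebra[OF J(1)] extend_subalgebra[OF J(2)]]) simp
qed

lemma extend_hom: "extend_module \<phi> A' C \<in> hom (inv_submodules A B) (inv_submodules A' C)"
proof (rule homI)
  fix I J assume "I \<in> carrier (inv_submodules A B)" "J \<in> carrier (inv_submodules A B)"
  then have I: "invertible_submodule A B I" and J: "invertible_submodule A B J"
    by (auto simp: inv_submodules_simps)
  show "extend_module \<phi> A' C I \<in> carrier (inv_submodules A' C)"
    using extend_invertible[OF I] by (simp add: inv_submodules_simps)
  show "extend_module \<phi> A' C (I \<otimes>\<^bsub>inv_submodules A B\<^esub> J)
      = extend_module \<phi> A' C I \<otimes>\<^bsub>inv_submodules A' C\<^esub> extend_module \<phi> A' C J"
    using extend_mult[OF subalgebraD(1)[OF B.invertible_submoduleD[OF I]]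
        subalgebraD(1)[OF B.invertible_submoduleD[OF J]]]
    by (simp add: inv_submodules_simps)
qed

lemma extend_module_image:
  assumes "I \<subseteq> carrier B" shows "\<phi> ` I \<subseteq> extend_module \<phi> A' C I"
proof
  fix x assume "x \<in> \<phi> ` I"
  then have "x \<otimes>\<^bsub>C\<^esub> \<one>\<^bsub>C\<^esub> \<in> extend_module \<phi> A' C I" "x \<in> carrier C"
    using \<phi>_carrier[OF assms] C.one_in_A by (auto simp: extend_module_def intro: ideal_prod.prod)
  then show "x \<in> extend_module \<phi> A' C I" by simp
qed

end

text \<open>Functoriality: commuting triangles and squares of ring homomorphisms become identities
  between maps of invertible modules.\<close>

lemma extend_compose:
  assumes 1: "extension_hom A B A' C \<phi>" and 2: "extension_hom A' C A'' D \<psi>" and I: "I \<subseteq> carrier B"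
  shows "extend_module \<psi> A'' D (extend_module \<phi> A' C I) = extend_module (\<psi> \<circ> \<phi>) A'' D I"
proof -
  interpret P: extension_hom A B A' C \<phi> by (rule 1)
  interpret Q: extension_hom A' C A'' D \<psi> by (rule 2)
  note c = P.\<phi>_carrier[OF I] P.C.A_carrier Q.C.A_carrier
  have "\<psi> ` ideal_prod C (\<phi> ` I) A' = ideal_prod D (\<psi> ` \<phi> ` I) (\<psi> ` A')"
    by (rule image_ideal_prod[OF P.C.is_cring Q.C.is_cring Q.hom c(1,2)])
  then have "extend_module \<psi> A'' D (extend_module \<phi> A' C I) = ideal_prod D (ideal_prod D (\<psi> ` \<phi> ` I) (\<psi> ` A')) A''"
    by (simp add: extend_module_def)
  also have "\<dots> = ideal_prod D (\<psi> ` \<phi> ` I) (ideal_prod D (\<psi> ` A') A'')"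
    using c by (intro Q.C.ideal_prod_assoc Q.\<phi>_carrier)
  also have "ideal_prod D (\<psi> ` A') A'' = A''" using Q.extend_A by (simp add: extend_module_def)
  finally show ?thesis by (simp add: extend_module_def image_comp)
qed

lemma extend_cong:
  assumes "\<And>x. x \<in> I \<Longrightarrow> \<phi> x = \<psi> x"
  shows "extend_module \<phi> A' C I = extend_module \<psi> A' C I"
  using assms by (simp add: extend_module_def)

lemma (in ring_extension) extend_id:
  assumes "subalgebra A I R" and "\<And>x. x \<in> I \<Longrightarrow> \<phi> x = x"
  shows "extend_module \<phi> A R I = I"
  using assms prod_A by (simp add: extend_module_def)

section \<open>Covers by type-class rings\<close>

text \<open>A surjective homomorphism from a type-class ring. Identities in \<open>R\<close> are
  proved by lifting elements and computing in the type class.\<close>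

definition cover :: "('u::comm_ring_1 \<Rightarrow> 'a) \<Rightarrow> ('a, 'b) ring_scheme \<Rightarrow> bool" where
  "cover \<pi> R \<longleftrightarrow> range \<pi> = carrier R \<and>
     (\<forall>x y. \<pi> (x + y) = \<pi> x \<oplus>\<^bsub>R\<^esub> \<pi> y) \<and> (\<forall>x y. \<pi> (x * y) = \<pi> x \<otimes>\<^bsub>R\<^esub> \<pi> y) \<and>
     \<pi> 0 = \<zero>\<^bsub>R\<^esub> \<and> \<pi> 1 = \<one>\<^bsub>R\<^esub>"

lemma cover_in: "cover \<pi> R \<Longrightarrow> \<pi> x \<in> carrier R"
  unfolding cover_def by blast

lemma cover_obtain:
  assumes "cover \<pi> R" "y \<in> carrier R" obtains x where "y = \<pi> x"
  using assms unfolding cover_def by blast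

lemma cover_simps:
  assumes "cover \<pi> R"
  shows "\<pi> (x + y) = \<pi> x \<oplus>\<^bsub>R\<^esub> \<pi> y" "\<pi> (x * y) = \<pi> x \<otimes>\<^bsub>R\<^esub> \<pi> y" "\<pi> 0 = \<zero>\<^bsub>R\<^esub>" "\<pi> 1 = \<one>\<^bsub>R\<^esub>"
  using assms by (auto simp: cover_def)

lemma cover_cring:
  assumes c: "cover \<pi> R" shows "cring R"
proof (rule cringI)
  note s = cover_simps[OF c, symmetric]
  show "abelian_group R"
  proof (rule abelian_groupI)
    fix x y z assume xyz: "x \<in> carrier R" "y \<in> carrier R" "z \<in> carrier R"
    then obtain a b d where e: "x = \<pi> a" "y = \<pi> b" "z = \<pi> d" by (metis cover_obtain[OF c])
    show "x \<oplus>\<^bsub>R\<^esub> y \<in> carrier R" unfolding e s by (rule cover_in[OF c])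
    show "x \<oplus>\<^bsub>R\<^esub> y \<oplus>\<^bsub>R\<^esub> z = x \<oplus>\<^bsub>R\<^esub> (y \<oplus>\<^bsub>R\<^esub> z)" unfolding e s by (simp add: add.assoc)
    show "x \<oplus>\<^bsub>R\<^esub> y = y \<oplus>\<^bsub>R\<^esub> x" unfolding e s by (simp add: add.commute)
    show "\<zero>\<^bsub>R\<^esub> \<oplus>\<^bsub>R\<^esub> x = x" unfolding e s by simp
    have "\<pi> (- a) \<oplus>\<^bsub>R\<^esub> x = \<zero>\<^bsub>R\<^esub>" unfolding e s by simp
    then show "\<exists>y\<in>carrier R. y \<oplus>\<^bsub>R\<^esub> x = \<zero>\<^bsub>R\<^esub>" using cover_in[OF c] by blast
  qed (use cover_in[OF c, of 0] s in simp)
  show "comm_monoid R"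
  proof (rule comm_monoidI)
    fix x y z assume xyz: "x \<in> carrier R" "y \<in> carrier R" "z \<in> carrier R"
    then obtain a b d where e: "x = \<pi> a" "y = \<pi> b" "z = \<pi> d" by (metis cover_obtain[OF c])
    show "x \<otimes>\<^bsub>R\<^esub> y \<in> carrier R" unfolding e s by (rule cover_in[OF c])
    show "x \<otimes>\<^bsub>R\<^esub> y \<otimes>\<^bsub>R\<^esub> z = x \<otimes>\<^bsub>R\<^esub> (y \<otimes>\<^bsub>R\<^esub> z)" unfolding e s by (simp add: mult.assoc)
    show "x \<otimes>\<^bsub>R\<^esub> y = y \<otimes>\<^bsub>R\<^esub> x" unfolding e s by (simp add: mult.commute)
    show "\<one>\<^bsub>R\<^esub> \<otimes>\<^bsub>R\<^esub> x = x" unfolding e s by simp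
  qed (use cover_in[OF c, of 1] s in simp)
  fix x y z assume xyz: "x \<in> carrier R" "y \<in> carrier R" "z \<in> carrier R"
  then obtain a b d where e: "x = \<pi> a" "y = \<pi> b" "z = \<pi> d" by (metis cover_obtain[OF c])
  show "(x \<oplus>\<^bsub>R\<^esub> y) \<otimes>\<^bsub>R\<^esub> z = x \<otimes>\<^bsub>R\<^esub> z \<oplus>\<^bsub>R\<^esub> y \<otimes>\<^bsub>R\<^esub> z" unfolding e s by (simp add: distrib_right)
qed

lemma cover_uminus:
  assumes c: "cover \<pi> R" shows "\<pi> (- x) = \<ominus>\<^bsub>R\<^esub> \<pi> x"
proof -
  interpret cring R by (rule cover_cring[OF c])
  have "\<pi> (- x) \<oplus>\<^bsub>R\<^esub> \<pi> x = \<zero>\<^bsub>R\<^esub>" by (simp add: cover_simps[OF c, symmetric])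
  then show ?thesis using cover_in[OF c] by (metis minus_equality)
qed

lemma cover_diff:
  assumes c: "cover \<pi> R" shows "\<pi> (x - y) = \<pi> x \<ominus>\<^bsub>R\<^esub> \<pi> y"
  using cover_simps(1)[OF c, of x "- y"] by (simp add: cover_uminus[OF c] a_minus_def)

lemma cover_eq_iff:
  assumes c: "cover \<pi> R" shows "\<pi> x = \<pi> y \<longleftrightarrow> \<pi> (x - y) = \<zero>\<^bsub>R\<^esub>"
proof -
  interpret cring R by (rule cover_cring[OF c])
  show ?thesis using cover_in[OF c] by (simp add: cover_diff[OF c] r_right_minus_eq)
qed

lemma cover_sum:
  assumes c: "cover \<pi> R" shows "finite I \<Longrightarrow> \<pi> (sum f I) = (\<Oplus>\<^bsub>R\<^esub>i\<in>I. \<pi> (f i))"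
proof (induction I rule: finite_induct)
  interpret cring R by (rule cover_cring[OF c])
  case empty
  then show ?case by (simp add: cover_simps[OF c])
next
  interpret cring R by (rule cover_cring[OF c])
  case (insert i I)
  then show ?case by (simp add: cover_simps[OF c] cover_in[OF c] finsum_insert)
qed

lemma cover_power:
  assumes c: "cover \<pi> R" shows "\<pi> (x ^ n) = \<pi> x [^]\<^bsub>R\<^esub> (n::nat)"
proof (induction n)
  interpret cring R by (rule cover_cring[OF c])
  case 0 show ?case by (simp add: cover_simps[OF c])
next
  interpret cring R by (rule cover_cring[OF c])
  case (Suc n)
  have "\<pi> (x ^ Suc n) = \<pi> (x ^ n * x)" by (simp add: mult.commute)
  also have "\<dots> = \<pi> (x ^ n) \<otimes>\<^bsub>R\<^esub> \<pi> x" by (rule cover_simps(2)[OF c])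
  finally show ?case using Suc by simp
qed

lemma ring_hom_by_cover:
  assumes c: "cover \<pi> R" and "\<And>x. \<phi> (\<pi> x) \<in> carrier C"
    and "\<And>x y. \<phi> (\<pi> (x + y)) = \<phi> (\<pi> x) \<oplus>\<^bsub>C\<^esub> \<phi> (\<pi> y)"
    and "\<And>x y. \<phi> (\<pi> (x * y)) = \<phi> (\<pi> x) \<otimes>\<^bsub>C\<^esub> \<phi> (\<pi> y)" and "\<phi> (\<pi> 1) = \<one>\<^bsub>C\<^esub>"
  shows "\<phi> \<in> ring_hom R C"
proof (rule ring_hom_memI)
  fix x y assume "x \<in> carrier R" "y \<in> carrier R"
  then obtain a b where e: "x = \<pi> a" "y = \<pi> b" by (metis cover_obtain[OF c])
  show "\<phi> x \<in> carrier C" "\<phi> (x \<otimes>\<^bsub>R\<^esub> y) = \<phi> x \<otimes>\<^bsub>C\<^esub> \<phi> y" "\<phi> (x \<oplus>\<^bsub>R\<^esub> y) = \<phi> x \<oplus>\<^bsub>C\<^esub> \<phi> y"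
    unfolding e cover_simps[OF c, symmetric] by (rule assms)+
qed (use assms cover_simps(4)[OF c] in simp)

section \<open>Laurent polynomials and polynomials over a covered ring\<close>

definition lp_map :: "('u::comm_ring_1 \<Rightarrow> 'a) \<Rightarrow> (int \<Rightarrow>\<^sub>0 'u) \<Rightarrow> int \<Rightarrow> 'a" where
  "lp_map \<pi> f = (\<lambda>k. \<pi> (coef f k))"

definition up_map :: "('u::comm_ring_1 \<Rightarrow> 'a) \<Rightarrow> (nat \<Rightarrow>\<^sub>0 'u) \<Rightarrow> nat \<Rightarrow> 'a" where
  "up_map \<pi> f = (\<lambda>k. \<pi> (coef f k))"

lemma lift_finite_support:
  fixes p :: "'i \<Rightarrow> 'a"
  assumes c: "cover \<pi> R" and p: "\<And>k. p k \<in> carrier R" "finite {k. p k \<noteq> \<zero>\<^bsub>R\<^esub>}"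
  obtains f where "\<And>k. p k = \<pi> (coef f k)"
proof -
  \<comment> \<open>Zero is lifted to 0, so that the lifted family keeps finite support.\<close>
  have "\<forall>k. \<exists>x. \<pi> x = p k \<and> (p k = \<zero>\<^bsub>R\<^esub> \<longrightarrow> x = 0)"
    using p(1) cover_simps(3)[OF c] cover_obtain[OF c] by metis
  then obtain g where g: "\<And>k. \<pi> (g k) = p k" "\<And>k. p k = \<zero>\<^bsub>R\<^esub> \<Longrightarrow> g k = 0" by metis
  have "finite {k. g k \<noteq> 0}" by (rule finite_subset[OF _ p(2)]) (use g in auto)
  then have "coef (Abs_poly_mapping g) = g" by simp
  then show ?thesis using that[of "Abs_poly_mapping g"] g by simp
qed

lemma finite_support_cover:
  assumes c: "cover \<pi> R" shows "finite {k. \<pi> (coef f k) \<noteq> \<zero>\<^bsub>R\<^esub>}"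
  by (rule finite_subset[OF _ finite_keys[of f]]) (auto simp: in_keys_iff cover_simps[OF c])

lemma cover_lp_map:
  assumes c: "cover \<pi> R" shows "cover (lp_map \<pi>) (LP R)"
proof -
  interpret cring R by (rule cover_cring[OF c])
  note s = cover_simps[OF c] and i = cover_in[OF c]
  have "range (lp_map \<pi>) = carrier (LP R)"
  proof
    show "range (lp_map \<pi>) \<subseteq> carrier (LP R)"
      using i finite_support_cover[OF c] by (auto simp: LP_def lp_map_def)
    show "carrier (LP R) \<subseteq> range (lp_map \<pi>)"
    proof
      fix p assume "p \<in> carrier (LP R)"
      then obtain f where "\<And>k. p k = \<pi> (coef f k)"
        using lift_finite_support[OF c, of p] by (auto simp: LP_def)
      then have "p = lp_map \<pi> f" by (auto simp: lp_map_def)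
      then show "p \<in> range (lp_map \<pi>)" by simp
    qed
  qed
  moreover have "lp_map \<pi> (f * g) = lp_map \<pi> f \<otimes>\<^bsub>LP R\<^esub> lp_map \<pi> g" for f g
  proof
    fix n
    have "lp_map \<pi> (f * g) n = (\<Oplus>\<^bsub>R\<^esub>i\<in>Poly_Mapping.keys f. \<pi> (coef f i) \<otimes>\<^bsub>R\<^esub> \<pi> (coef g (n - i)))"
      by (simp add: lp_map_def coef_mult_keys cover_sum[OF c] s)
    also have "\<dots> = (\<Oplus>\<^bsub>R\<^esub>i\<in>{i. \<pi> (coef f i) \<noteq> \<zero>\<^bsub>R\<^esub>}. \<pi> (coef f i) \<otimes>\<^bsub>R\<^esub> \<pi> (coef g (n - i)))"
      by (rule add.finprod_mono_neutral_cong_left[symmetric])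
        (use i s in \<open>auto simp: in_keys_iff\<close>)
    finally show "lp_map \<pi> (f * g) n = (lp_map \<pi> f \<otimes>\<^bsub>LP R\<^esub> lp_map \<pi> g) n"
      by (simp add: LP_def lp_map_def)
  qed
  ultimately show ?thesis
    by (auto simp: cover_def LP_def lp_map_def lookup_add s lookup_one when_def)
qed

lemma coef_mult_nat:
  fixes f g :: "nat \<Rightarrow>\<^sub>0 'u::comm_ring_1"
  shows "coef (f * g) n = (\<Sum>i\<le>n. coef f i * coef g (n - i))"
proof -
  have inner: "(\<Sum>q. coef g q when n = i + q) = (if i \<le> n then coef g (n - i) else 0)" for i
  proof (cases "i \<le> n")
    case True
    then have "(\<lambda>q. coef g q when n = i + q) = (\<lambda>q. coef g q when q = n - i)"
      by (auto simp: fun_eq_iff when_def)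
    then show ?thesis using True by (simp only: Sum_any_when_equal if_True)
  next
    case False
    then have "(\<lambda>q. coef g q when n = i + q) = (\<lambda>q. 0)" by (auto simp: fun_eq_iff when_def)
    then show ?thesis using False by simp
  qed
  have "coef (f * g) n = (\<Sum>i. coef f i * (if i \<le> n then coef g (n - i) else 0))"
    by (simp add: lookup_mult inner)
  also have "\<dots> = (\<Sum>i\<le>n. coef f i * (if i \<le> n then coef g (n - i) else 0))"
    by (rule Sum_any.expand_superset) (auto split: if_splits)
  also have "\<dots> = (\<Sum>i\<le>n. coef f i * coef g (n - i))" by (rule sum.cong) auto
  finally show ?thesis .
qed

lemma finite_support_bound:
  "finite {k::nat. p k \<noteq> z} \<longleftrightarrow> (\<exists>n. bound z n p)"
proof
  assume "finite {k. p k \<noteq> z}"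
  then obtain n where "\<forall>k\<in>{k. p k \<noteq> z}. k \<le> n" using finite_nat_set_iff_bounded_le by blast
  then have "bound z n p" by (intro bound.intro) (metis (mono_tags) leD mem_Collect_eq)
  then show "\<exists>n. bound z n p" ..
next
  assume "\<exists>n. bound z n p"
  then obtain n where "bound z n p" ..
  then have "{k. p k \<noteq> z} \<subseteq> {..n}" by (auto simp: bound_def intro: leI)
  then show "finite {k. p k \<noteq> z}" using finite_subset by blast
qed

lemma carrier_UP: "carrier (UP R) = {p. (\<forall>k. p k \<in> carrier R) \<and> finite {k. p k \<noteq> \<zero>\<^bsub>R\<^esub>}}"
  by (auto simp: UP_def up_def finite_support_bound)

lemma cover_up_map:
  assumes c: "cover \<pi> R" shows "cover (up_map \<pi>) (UP R)"
proof -
  interpret cring R by (rule cover_cring[OF c])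
  note s = cover_simps[OF c] and i = cover_in[OF c]
  have in_up: "up_map \<pi> f \<in> up R" for f
    using i finite_support_cover[OF c, of f] by (auto simp: up_map_def up_def finite_support_bound)
  have "range (up_map \<pi>) = carrier (UP R)"
  proof
    show "range (up_map \<pi>) \<subseteq> carrier (UP R)" using in_up by (auto simp: UP_def)
    show "carrier (UP R) \<subseteq> range (up_map \<pi>)"
    proof
      fix p assume "p \<in> carrier (UP R)"
      then obtain f where "\<And>k. p k = \<pi> (coef f k)"
        using lift_finite_support[OF c, of p] by (auto simp: carrier_UP)
      then have "p = up_map \<pi> f" by (auto simp: up_map_def)
      then show "p \<in> range (up_map \<pi>)" by simp
    qed
  qed
  moreover have "up_map \<pi> (f * g) = up_map \<pi> f \<otimes>\<^bsub>UP R\<^esub> up_map \<pi> g" for f g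
    using in_up by (auto simp: UP_def fun_eq_iff up_map_def coef_mult_nat cover_sum[OF c] s)
  moreover have "up_map \<pi> (f + g) = up_map \<pi> f \<oplus>\<^bsub>UP R\<^esub> up_map \<pi> g" for f g
    using in_up by (auto simp: UP_def fun_eq_iff up_map_def lookup_add s)
  ultimately show ?thesis
    by (auto simp: cover_def UP_def up_map_def s lookup_one when_def)
qed

subsection \<open>The universal cover\<close>

text \<open>The product of all rings on a type covers each of them. The additional factor \<open>int\<close>
  ensures that the product is not the zero ring.\<close>

typedef ('a, 'b) all_rings =
  "{(F :: ('a, 'b) ring_scheme \<Rightarrow> 'a, k :: int). \<forall>R. if cring R then F R \<in> carrier R else F R = undefined}"
proof -
  have "(\<lambda>R. if cring R then \<zero>\<^bsub>R\<^esub> else undefined, 0) \<in>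
    {(F :: ('a, 'b) ring_scheme \<Rightarrow> 'a, k :: int). \<forall>R. if cring R then F R \<in> carrier R else F R = undefined}"
    by (auto simp: cring_def ring.ring_simprules)
  then show ?thesis by (rule exI)
qed

setup_lifting type_definition_all_rings

instantiation all_rings :: (type, type) comm_ring_1
begin

lift_definition zero_all_rings :: "('a, 'b) all_rings"
  is "(\<lambda>R. if cring R then \<zero>\<^bsub>R\<^esub> else undefined, 0)"
  by (auto simp: cring_def ring.ring_simprules)

lift_definition one_all_rings :: "('a, 'b) all_rings"
  is "(\<lambda>R. if cring R then \<one>\<^bsub>R\<^esub> else undefined, 1)"
  by (auto simp: cring_def ring.ring_simprules)

lift_definition plus_all_rings :: "('a, 'b) all_rings \<Rightarrow> ('a, 'b) all_rings \<Rightarrow> ('a, 'b) all_rings"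
  is "\<lambda>(F, k) (G, l). (\<lambda>R. if cring R then F R \<oplus>\<^bsub>R\<^esub> G R else undefined, k + l)"
  by (auto simp: cring_def ring.ring_simprules split: if_splits)

lift_definition times_all_rings :: "('a, 'b) all_rings \<Rightarrow> ('a, 'b) all_rings \<Rightarrow> ('a, 'b) all_rings"
  is "\<lambda>(F, k) (G, l). (\<lambda>R. if cring R then F R \<otimes>\<^bsub>R\<^esub> G R else undefined, k * l)"
  by (auto simp: cring_def ring.ring_simprules split: if_splits)

lift_definition uminus_all_rings :: "('a, 'b) all_rings \<Rightarrow> ('a, 'b) all_rings"
  is "\<lambda>(F, k). (\<lambda>R. if cring R then \<ominus>\<^bsub>R\<^esub> F R else undefined, - k)"
  by (auto simp: cring_def ring.ring_simprules split: if_splits)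

lift_definition minus_all_rings :: "('a, 'b) all_rings \<Rightarrow> ('a, 'b) all_rings \<Rightarrow> ('a, 'b) all_rings"
  is "\<lambda>(F, k) (G, l). (\<lambda>R. if cring R then F R \<ominus>\<^bsub>R\<^esub> G R else undefined, k - l)"
  by (auto simp: cring_def ring.ring_simprules split: if_splits)

lift_definition component :: "('a, 'b) ring_scheme \<Rightarrow> ('a, 'b) all_rings \<Rightarrow> 'a"
  is "\<lambda>R (F, k). F R" .

lift_definition int_component :: "('a, 'b) all_rings \<Rightarrow> int"
  is "\<lambda>(F, k). k" .

lemma all_rings_eqI:
  assumes "\<And>R. cring R \<Longrightarrow> component R x = component R y" "int_component x = int_component y"
  shows "x = y"
proof -
  have "fst (Rep_all_rings x) R = fst (Rep_all_rings y) R" for R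
  proof (cases "cring R")
    case True
    then show ?thesis using assms(1)[OF True] by (simp add: component.rep_eq split_def)
  next
    case False
    then show ?thesis using Rep_all_rings[of x] Rep_all_rings[of y] by (auto simp: split_def)
  qed
  moreover have "snd (Rep_all_rings x) = snd (Rep_all_rings y)"
    using assms(2) by (simp add: int_component.rep_eq split_def)
  ultimately show ?thesis by (simp add: Rep_all_rings_inject[symmetric] prod_eq_iff fun_eq_iff)
qed

lemma component_carrier: "cring R \<Longrightarrow> component R x \<in> carrier R"
  by transfer auto

lemma component_simps:
  assumes "cring R"
  shows "component R 0 = \<zero>\<^bsub>R\<^esub>" "component R 1 = \<one>\<^bsub>R\<^esub>"
    "component R (x + y) = component R x \<oplus>\<^bsub>R\<^esub> component R y"
    "component R (x * y) = component R x \<otimes>\<^bsub>R\<^esub> component R y"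
    "component R (- x) = \<ominus>\<^bsub>R\<^esub> component R x"
    "component R (x - y) = component R x \<ominus>\<^bsub>R\<^esub> component R y"
  using assms by (transfer, auto)+

lemma int_component_simps:
  "int_component 0 = 0" "int_component 1 = 1" "int_component (x + y) = int_component x + int_component y"
  "int_component (x * y) = int_component x * int_component y"
  "int_component (- x) = - int_component x" "int_component (x - y) = int_component x - int_component y"
  by (transfer, auto)+

instance
proof
  note r = cring.cring_simprules
  note s = component_simps component_carrier int_component_simps
  fix a b c :: "('a, 'b) all_rings"
  show "a + b + c = a + (b + c)" by (rule all_rings_eqI) (simp_all add: s r)
  show "a + b = b + a" by (rule all_rings_eqI) (simp_all add: s r)
  show "0 + a = a" by (rule all_rings_eqI) (simp_all add: s r)
  show "- a + a = 0" by (rule all_rings_eqI) (simp_all add: s r)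
  show "a - b = a + - b" by (rule all_rings_eqI) (simp_all add: s a_minus_def)
  show "a * b * c = a * (b * c)" by (rule all_rings_eqI) (simp_all add: s r)
  show "a * b = b * a" by (rule all_rings_eqI) (simp_all add: s r)
  show "1 * a = a" by (rule all_rings_eqI) (simp_all add: s r)
  show "(a + b) * c = a * c + b * c" by (rule all_rings_eqI) (simp_all add: s r algebra_simps)
  have "int_component (0 :: ('a, 'b) all_rings) \<noteq> int_component (1 :: ('a, 'b) all_rings)"
    by (simp add: int_component_simps)
  then show "(0 :: ('a, 'b) all_rings) \<noteq> 1" by metis
qed

end

lemma cover_component:
  assumes R: "cring R" shows "cover (component R) R"
  unfolding cover_def
proof (intro conjI allI)
  have "component R x \<in> carrier R" for x by (rule component_carrier[OF R])
  moreover have "y \<in> range (component R)" if y: "y \<in> carrier R" for y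
  proof -
    define F where "F S = (if S = R then y else if cring S then \<zero>\<^bsub>S\<^esub> else undefined)" for S
    have "(F, 0) \<in> {(F :: ('a, 'b) ring_scheme \<Rightarrow> 'a, k :: int). \<forall>R. if cring R then F R \<in> carrier R else F R = undefined}"
      using R y by (auto simp: F_def cring_def ring.ring_simprules)
    then have "component R (Abs_all_rings (F, 0)) = y"
      by (simp add: component.rep_eq Abs_all_rings_inverse F_def)
    then show ?thesis by (metis rangeI)
  qed
  ultimately show "range (component R) = carrier R" by auto
qed (auto simp: component_simps[OF R])

section \<open>Rings of integer-valued functions spanned by idempotents are free\<close>

text \<open>The ring of functions generated by \<open>U\<close>. Only products with generators are
  introduced, which keeps inductions short; closure under all products is derived.\<close>

inductive_set fring :: "('p \<Rightarrow> int) set \<Rightarrow> ('p \<Rightarrow> int) set" for U where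
  one: "(\<lambda>_. 1) \<in> fring U"
| add: "f \<in> fring U \<Longrightarrow> g \<in> fring U \<Longrightarrow> (\<lambda>x. f x + g x) \<in> fring U"
| scale: "f \<in> fring U \<Longrightarrow> (\<lambda>x. k * f x) \<in> fring U"
| gen: "e \<in> U \<Longrightarrow> f \<in> fring U \<Longrightarrow> (\<lambda>x. e x * f x) \<in> fring U"

lemma fring_const: "(\<lambda>_. k) \<in> fring U"
  using fring.scale[OF fring.one, of k U] by simp

lemma fring_diff: "f \<in> fring U \<Longrightarrow> g \<in> fring U \<Longrightarrow> (\<lambda>x. f x - g x) \<in> fring U"
  using fring.add[OF _ fring.scale[of g U "-1"]] by simp

lemma fring_sum: "(\<And>i. i \<in> I \<Longrightarrow> f i \<in> fring U) \<Longrightarrow> (\<lambda>x. \<Sum>i\<in>I. f i x) \<in> fring U"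
proof (induction I rule: infinite_finite_induct)
  case (insert i I)
  then have "(\<lambda>x. f i x + (\<Sum>i\<in>I. f i x)) \<in> fring U" by (intro fring.add) auto
  then show ?case using insert by simp
qed (auto simp: fring_const)

lemma fring_mult: "f \<in> fring U \<Longrightarrow> g \<in> fring U \<Longrightarrow> (\<lambda>x. f x * g x) \<in> fring U"
proof (induction rule: fring.induct)
  case (add f h)
  then have "(\<lambda>x. f x * g x + h x * g x) \<in> fring U" by (intro fring.add)
  then show ?case by (simp add: distrib_right)
next
  case (scale f k)
  then have "(\<lambda>x. k * (f x * g x)) \<in> fring U" by (intro fring.scale)
  then show ?case by (simp add: mult.assoc)
next
  case (gen e f)
  then have "(\<lambda>x. f x * g x) \<in> fring U" by blast
  from fring.gen[OF gen(1) this] show ?case by (simp add: mult.assoc)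
qed simp

lemma fring_mono:
  assumes "U \<subseteq> V" shows "fring U \<subseteq> fring V"
proof
  fix f assume "f \<in> fring U"
  then show "f \<in> fring V" by (induction rule: fring.induct) (use assms in \<open>auto intro: fring.intros\<close>)
qed

lemma fring_base: "e \<in> U \<Longrightarrow> e \<in> fring U"
  using fring.gen[OF _ fring.one, of e U] by simp

lemma fring_empty: "f \<in> fring {} \<Longrightarrow> \<exists>k. f = (\<lambda>_. k)"
  by (induction rule: fring.induct) auto

lemma fring_finite_subset: "f \<in> fring U \<Longrightarrow> \<exists>F. finite F \<and> F \<subseteq> U \<and> f \<in> fring F"
proof (induction rule: fring.induct)
  case one
  then show ?case by (intro exI[of _ "{}"]) (auto intro: fring.one)
next
  case (add f g)
  then obtain F G where FG: "finite F" "F \<subseteq> U" "f \<in> fring F" "finite G" "G \<subseteq> U" "g \<in> fring G" by blast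
  then have "f \<in> fring (F \<union> G)" "g \<in> fring (F \<union> G)"
    using fring_mono[of F "F \<union> G"] fring_mono[of G "F \<union> G"] by auto
  then have "(\<lambda>x. f x + g x) \<in> fring (F \<union> G)" by (rule fring.add)
  then show ?case using FG by (intro exI[of _ "F \<union> G"]) auto
next
  case (scale f k)
  then show ?case by (auto intro: fring.scale)
next
  case (gen e f)
  then obtain F where F: "finite F" "F \<subseteq> U" "f \<in> fring F" by blast
  then have "f \<in> fring (insert e F)" using fring_mono[of F "insert e F"] by auto
  then have "(\<lambda>x. e x * f x) \<in> fring (insert e F)" by (intro fring.gen) auto
  then show ?case using F gen by (intro exI[of _ "insert e F"]) auto
qed

definition boolean_valued :: "('p \<Rightarrow> int) set \<Rightarrow> bool" where
  "boolean_valued E \<longleftrightarrow> (\<forall>e\<in>E. \<forall>x. e x = 0 \<or> e x = 1)"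

lemma boolean_valuedD: "boolean_valued E \<Longrightarrow> e \<in> E \<Longrightarrow> e x = 0 \<or> e x = 1"
  by (simp add: boolean_valued_def)

lemma boolean_valued_subset: "boolean_valued E \<Longrightarrow> U \<subseteq> E \<Longrightarrow> boolean_valued U"
  by (auto simp: boolean_valued_def)

text \<open>For sums, \<open>\<phi> (f + g)\<close> is the sum of
  \<open>[f = a] * \<phi> (a + g)\<close> over the finitely many values \<open>a\<close> of
  \<open>f\<close>. The quantifier over \<open>\<phi>\<close> inside the conclusion is what the
  induction uses; it yields the indicators \<open>[f = a]\<close> of level sets as well.\<close>

lemma fring_compose:
  assumes U: "boolean_valued U" and f: "f \<in> fring U"
  shows "finite (range f) \<and> (\<forall>\<phi>. (\<lambda>x. \<phi> (f x)) \<in> fring U)"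
  using f
proof (induction rule: fring.induct)
  case one
  then show ?case by (auto simp: fring_const)
next
  case (add f g)
  have "range (\<lambda>x. f x + g x) \<subseteq> (\<lambda>(a, b). a + b) ` (range f \<times> range g)" by auto
  then have fin: "finite (range (\<lambda>x. f x + g x))" using add.IH by (meson finite_SigmaI finite_imageI finite_subset)
  have "(\<lambda>x. \<phi> (f x + g x)) \<in> fring U" for \<phi> :: "int \<Rightarrow> int"
  proof -
    have "(\<lambda>x. \<Sum>a\<in>range f. of_bool (f x = a) * \<phi> (a + g x)) \<in> fring U"
    proof (intro fring_sum fring_mult)
      fix a
      show "(\<lambda>x. of_bool (f x = a)) \<in> fring U" using add.IH(1) by (auto dest: spec[of _ "\<lambda>y. of_bool (y = a)"])
      show "(\<lambda>x. \<phi> (a + g x)) \<in> fring U" using add.IH(2) by (auto dest: spec[of _ "\<lambda>y. \<phi> (a + y)"])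
    qed
    moreover have "(\<Sum>a\<in>range f. of_bool (f x = a) * \<phi> (a + g x)) = \<phi> (f x + g x)" for x
    proof -
      have "(\<Sum>a\<in>range f. of_bool (f x = a) * \<phi> (a + g x))
          = (\<Sum>a\<in>range f. if a = f x then \<phi> (f x + g x) else 0)"
        by (rule sum.cong) auto
      also have "\<dots> = \<phi> (f x + g x)" using add.IH(1) by (subst sum.delta) auto
      finally show ?thesis .
    qed
    ultimately show ?thesis by simp
  qed
  with fin show ?case by blast
next
  case (scale f k)
  have "range (\<lambda>x. k * f x) = (\<lambda>y. k * y) ` range f" by auto
  then have "finite (range (\<lambda>x. k * f x))" using scale.IH by simp
  moreover have "(\<lambda>x. \<phi> (k * f x)) \<in> fring U" for \<phi> :: "int \<Rightarrow> int"
    using scale.IH by (auto dest: spec[of _ "\<lambda>y. \<phi> (k * y)"])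
  ultimately show ?case by blast
next
  case (gen e f)
  note e = boolean_valuedD[OF U gen(1)]
  have "range (\<lambda>x. e x * f x) \<subseteq> insert 0 (range f)"
  proof clarify
    fix x assume "e x * f x \<notin> range f"
    then show "e x * f x = 0" using e[of x] by auto
  qed
  then have fin: "finite (range (\<lambda>x. e x * f x))" using gen.IH by (meson finite.insertI finite_subset)
  have "(\<lambda>x. \<phi> (e x * f x)) \<in> fring U" for \<phi> :: "int \<Rightarrow> int"
  proof -
    have "(\<lambda>x. \<phi> (f x)) \<in> fring U" using gen.IH by blast
    note 1 = fring.gen[OF gen(1) this]
      and 2 = fring_mult[OF fring_diff[OF fring.one fring_base[OF gen(1)]] fring_const[of "\<phi> 0"]]
    have "(\<lambda>x. e x * \<phi> (f x) + (1 - e x) * \<phi> 0) \<in> fring U" by (rule fring.add[OF 1 2])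
    moreover have "e x * \<phi> (f x) + (1 - e x) * \<phi> 0 = \<phi> (e x * f x)" for x using e[of x] by auto
    ultimately show ?thesis by simp
  qed
  with fin show ?case by blast
qed

text \<open>Since \<open>e * e = e\<close>, the set \<open>fring U + e * fring U\<close> is already
  closed under multiplication by \<open>e\<close>.\<close>

lemma fring_insert:
  assumes e: "\<And>x. e x = 0 \<or> e x = (1 :: int)" and f: "f \<in> fring (insert e U)"
  shows "\<exists>g\<in>fring U. \<exists>h\<in>fring U. f = (\<lambda>x. g x + e x * h x)"
  using f
proof (induction rule: fring.induct)
  case one
  show ?case
    by (rule bexI[OF _ fring.one], rule bexI[OF _ fring_const[of 0]]) simp
next
  case (add f f')
  then obtain g h g' h' where *: "g \<in> fring U" "h \<in> fring U" "f = (\<lambda>x. g x + e x * h x)"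
    "g' \<in> fring U" "h' \<in> fring U" "f' = (\<lambda>x. g' x + e x * h' x)" by blast
  show ?case
    by (rule bexI[OF _ fring.add[OF *(1,4)]], rule bexI[OF _ fring.add[OF *(2,5)]])
      (simp add: * algebra_simps)
next
  case (scale f k)
  then obtain g h where *: "g \<in> fring U" "h \<in> fring U" "f = (\<lambda>x. g x + e x * h x)" by blast
  show ?case
    by (rule bexI[OF _ fring.scale[OF *(1)]], rule bexI[OF _ fring.scale[OF *(2)]])
      (simp add: * algebra_simps)
next
  case (gen d f)
  then obtain g h where *: "g \<in> fring U" "h \<in> fring U" "f = (\<lambda>x. g x + e x * h x)" by blast
  show ?case
  proof (cases "d = e")
    case True
    have eq: "e x * (g x + e x * h x) = 0 + e x * (g x + h x)" for x using e[of x] by auto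
    show ?thesis
      by (rule bexI[OF _ fring_const[of 0]], rule bexI[OF _ fring.add[OF *(1,2)]])
        (simp only: * True eq)
  next
    case False
    then have "d \<in> U" using gen by simp
    then show ?thesis
      by (intro bexI[OF _ fring.gen[OF _ *(1)]] bexI[OF _ fring.gen[OF _ *(2)]])
        (auto simp: * algebra_simps)
  qed
qed

section \<open>Bases of quotients of function rings\<close>

definition lincomb :: "(('p \<Rightarrow> int) \<Rightarrow>\<^sub>0 int) \<Rightarrow> 'p \<Rightarrow> int" where
  "lincomb c x = (\<Sum>s\<in>Poly_Mapping.keys c. Poly_Mapping.lookup c s * s x)"

lemma lincomb_superset:
  assumes "finite S" "Poly_Mapping.keys c \<subseteq> S"
  shows "lincomb c x = (\<Sum>s\<in>S. Poly_Mapping.lookup c s * s x)"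
  unfolding lincomb_def using assms by (intro sum.mono_neutral_left) (auto simp: in_keys_iff)

lemma lincomb_zero [simp]: "lincomb 0 x = 0"
  by (simp add: lincomb_def)

lemma lincomb_add: "lincomb (c + d) x = lincomb c x + lincomb d x"
proof -
  let ?S = "Poly_Mapping.keys c \<union> Poly_Mapping.keys d"
  show ?thesis using keys_add[of c d]
    by (simp add: lincomb_superset[of ?S] lookup_add distrib_right sum.distrib)
qed

lemma lincomb_single [simp]: "lincomb (Poly_Mapping.single s k) x = k * s x"
  by (subst lincomb_superset[of "{s}"]) auto

lemma lincomb_sum: "lincomb (sum c I) x = (\<Sum>i\<in>I. lincomb (c i) x)"
  by (induction I rule: infinite_finite_induct) (auto simp: lincomb_add)

lemma lincomb_in_fring:
  "Poly_Mapping.keys c \<subseteq> fring U \<Longrightarrow> lincomb c \<in> fring U"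
  unfolding lincomb_def by (intro fring_sum fring.scale) auto

text \<open>\<open>S\<close> maps injectively onto a basis of the additive group
  \<open>R / K\<close>. The basis elements serve as their own indices in
  \<open>lincomb\<close>.\<close>

definition basis_modulo :: "('p \<Rightarrow> int) set \<Rightarrow> ('p \<Rightarrow> int) set \<Rightarrow> ('p \<Rightarrow> int) set \<Rightarrow> bool" where
  "basis_modulo S R K \<longleftrightarrow> S \<subseteq> R \<and>
     (\<forall>f\<in>R. \<exists>c. Poly_Mapping.keys c \<subseteq> S \<and> (\<lambda>x. f x - lincomb c x) \<in> K) \<and>
     (\<forall>c. Poly_Mapping.keys c \<subseteq> S \<longrightarrow> lincomb c \<in> K \<longrightarrow> c = 0)"

text \<open>Ideals with torsion-free quotient; torsion in a quotient would prevent it from having a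
  basis.\<close>

definition pure_ideal :: "('p \<Rightarrow> int) set \<Rightarrow> ('p \<Rightarrow> int) set \<Rightarrow> bool" where
  "pure_ideal R K \<longleftrightarrow> K \<subseteq> R \<and> (\<lambda>_. 0) \<in> K \<and>
     (\<forall>f\<in>K. \<forall>g\<in>K. (\<lambda>x. f x + g x) \<in> K) \<and> (\<forall>f\<in>R. \<forall>g\<in>K. (\<lambda>x. f x * g x) \<in> K) \<and>
     (\<forall>f\<in>R. \<forall>n. n \<noteq> 0 \<longrightarrow> (\<lambda>x. n * f x) \<in> K \<longrightarrow> f \<in> K)"

text \<open>The group spanned by \<open>K\<close> and the function 1. The inductive construction
  yields bases modulo this group; 1 is put back afterwards.\<close>

definition with_constants :: "('p \<Rightarrow> int) set \<Rightarrow> ('p \<Rightarrow> int) set" where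
  "with_constants K = {f. \<exists>n. (\<lambda>x. f x - n) \<in> K}"

context
  fixes U :: "('p \<Rightarrow> int) set" and K
  assumes K: "pure_ideal (fring U) K"
begin

lemma pure_zero: "(\<lambda>_. 0) \<in> K"
  using K by (simp add: pure_ideal_def)

lemma pure_add: "f \<in> K \<Longrightarrow> g \<in> K \<Longrightarrow> (\<lambda>x. f x + g x) \<in> K"
  using K by (simp add: pure_ideal_def)

lemma pure_mult: "f \<in> fring U \<Longrightarrow> g \<in> K \<Longrightarrow> (\<lambda>x. f x * g x) \<in> K"
  using K by (simp add: pure_ideal_def)

lemma pure_sum: "(\<And>i. i \<in> I \<Longrightarrow> f i \<in> K) \<Longrightarrow> (\<lambda>x. \<Sum>i\<in>I. f i x) \<in> K"
proof (induction I rule: infinite_finite_induct)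
  case (insert i I)
  then have "(\<lambda>x. f i x + (\<Sum>i\<in>I. f i x)) \<in> K" by (intro pure_add) auto
  then show ?case using insert by simp
qed (auto simp: pure_zero)

lemma pure_divide: "f \<in> fring U \<Longrightarrow> n \<noteq> 0 \<Longrightarrow> (\<lambda>x. n * f x) \<in> K \<Longrightarrow> f \<in> K"
  using K by (simp add: pure_ideal_def)

text \<open>\<open>fring V + K\<close> is pure in \<open>fring U\<close>: compare \<open>n * f\<close> and \<open>g\<close> on the level sets of
  \<open>f\<close> and \<open>g\<close>; a level set on which they differ has its indicator function in \<open>K\<close>.\<close>

lemma subring_plus_ideal_pure:
  assumes U: "boolean_valued U" and V: "V \<subseteq> U" and f: "f \<in> fring U" and g: "g \<in> fring V"
    and n: "n \<noteq> 0" and nfg: "(\<lambda>x. n * f x - g x) \<in> K"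
  shows "\<exists>g'\<in>fring V. (\<lambda>x. f x - g' x) \<in> K"
proof
  \<comment> \<open>Exact division by \<open>n\<close>. The value 0 at other integers is arbitrary:
    a level set on which \<open>g\<close> is not divisible by \<open>n\<close> has its indicator in
    \<open>K\<close>.\<close>
  define \<phi> where "\<phi> c = (if n dvd c then c div n else 0)" for c
  show "(\<lambda>x. \<phi> (g x)) \<in> fring V"
    using fring_compose[OF boolean_valued_subset[OF U V] g] by blast
  have gU: "g \<in> fring U" using g fring_mono[OF V] by auto
  have fin: "finite (range f)" "finite (range g)"
    using fring_compose[OF U f] fring_compose[OF U gU] by auto
  define \<psi> where "\<psi> p x = (of_bool (f x = fst p) * of_bool (g x = snd p) :: int)" for p x
  have \<psi>: "\<psi> p \<in> fring U" for p
    unfolding \<psi>_def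
    using fring_compose[OF U f] fring_compose[OF U gU]
    by (intro fring_mult) (auto dest: spec[of _ "\<lambda>y. of_bool (y = fst p)"] spec[of _ "\<lambda>y. of_bool (y = snd p)"])
  have "(\<lambda>x. (fst p - \<phi> (snd p)) * \<psi> p x) \<in> K" for p
  proof (cases "n * fst p = snd p")
    case True
    then have "snd p = n * fst p" by simp
    then have "\<phi> (snd p) = fst p" using n by (simp add: \<phi>_def)
    then show ?thesis using pure_zero by simp
  next
    case False
    have "(\<lambda>x. \<psi> p x * (n * f x - g x)) \<in> K" by (rule pure_mult[OF \<psi> nfg])
    moreover have "\<psi> p x * (n * f x - g x) = (n * fst p - snd p) * \<psi> p x" for x
      by (auto simp: \<psi>_def)
    ultimately have "(\<lambda>x. (n * fst p - snd p) * \<psi> p x) \<in> K" by simp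
    then have "\<psi> p \<in> K" using False by (intro pure_divide[OF \<psi>]) auto
    then show ?thesis by (rule pure_mult[OF fring_const])
  qed
  then have "(\<lambda>x. \<Sum>p\<in>range f \<times> range g. (fst p - \<phi> (snd p)) * \<psi> p x) \<in> K" by (intro pure_sum)
  moreover have "(\<Sum>p\<in>range f \<times> range g. (fst p - \<phi> (snd p)) * \<psi> p x) = f x - \<phi> (g x)" for x
  proof -
    have "(\<Sum>p\<in>range f \<times> range g. (fst p - \<phi> (snd p)) * \<psi> p x)
        = (\<Sum>p\<in>range f \<times> range g. if p = (f x, g x) then f x - \<phi> (g x) else 0)"
      by (rule sum.cong) (auto simp: \<psi>_def)
    also have "\<dots> = f x - \<phi> (g x)" using fin by (subst sum.delta) auto
    finally show ?thesis .
  qed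
  ultimately show "(\<lambda>x. f x - \<phi> (g x)) \<in> K" by simp
qed

end

context
  fixes E :: "('p \<Rightarrow> int) set" and L :: "(('p \<Rightarrow> int) \<times> ('p \<Rightarrow> int)) set"
  assumes E: "boolean_valued E" and wf: "wf L" and trans: "trans L"
    and total: "\<And>a b. a \<noteq> b \<Longrightarrow> (a, b) \<in> L \<or> (b, a) \<in> L"
begin

text \<open>Generators that precede \<open>e\<close> in the well-order. The rings
  \<open>fring (below e)\<close> form the filtration along which the basis is built.\<close>

definition below where "below e = {d \<in> E. (d, e) \<in> L}"

lemma finite_has_greatest:
  assumes "finite F" "F \<noteq> {}"
  shows "\<exists>m\<in>F. \<forall>d\<in>F. d = m \<or> (d, m) \<in> L"
  using assms
proof (induction F rule: finite_ne_induct)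
  case (insert a F)
  then obtain m where m: "m \<in> F" "\<forall>d\<in>F. d = m \<or> (d, m) \<in> L" by blast
  consider "a = m" | "(a, m) \<in> L" | "(m, a) \<in> L" using total by blast
  then show ?case
  proof cases
    case 3
    have "d = a \<or> (d, a) \<in> L" if d: "d \<in> insert a F" for d
    proof (cases "d = a \<or> d = m")
      case True
      then show ?thesis using 3 by auto
    next
      case False
      then have "(d, m) \<in> L" using d m(2) by auto
      from transD[OF trans this 3] show ?thesis ..
    qed
    then show ?thesis by blast
  qed (use m in blast)+
qed simp

text \<open>The successive quotients of the filtration by the rings \<open>fring (below e)\<close> are again
  quotients of such rings by pure ideals, namely by the \<open>Ke e\<close> below.\<close>

lemma basis_step:
  assumes U: "U \<subseteq> E" "\<And>e. e \<in> U \<Longrightarrow> below e \<subseteq> U" and K: "pure_ideal (fring U) K"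
    and IH: "\<And>e K'. e \<in> U \<Longrightarrow> pure_ideal (fring (below e)) K' \<Longrightarrow> \<exists>S. basis_modulo S (fring (below e)) K'"
  shows "\<exists>S. basis_modulo S (fring U) (with_constants K)"
proof -
  have UB: "boolean_valued U" by (rule boolean_valued_subset[OF E U(1)])
  \<comment> \<open>Multiplication by \<open>e\<close> induces an isomorphism from
    \<open>fring (below e)\<close> modulo \<open>Ke e\<close> onto the quotient of
    \<open>fring (insert e (below e)) + K\<close> by \<open>fring (below e) + K\<close>.\<close>
  define Ke where "Ke e = {r \<in> fring (below e). \<exists>g\<in>fring (below e). (\<lambda>x. e x * r x - g x) \<in> K}" for e
  have sub: "fring (below e) \<subseteq> fring U" if "e \<in> U" for e using U(2)[OF that] by (rule fring_mono)
  have pureKe: "pure_ideal (fring (below e)) (Ke e)" if e: "e \<in> U" for e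
    unfolding pure_ideal_def
  proof (intro conjI ballI allI impI)
    show "Ke e \<subseteq> fring (below e)" by (auto simp: Ke_def)
    show "(\<lambda>_. 0) \<in> Ke e" unfolding Ke_def
      by (intro CollectI conjI fring_const bexI[OF _ fring_const[of 0]]) (simp add: pure_zero[OF K])
    { fix f g assume "f \<in> Ke e" "g \<in> Ke e"
      then obtain a b where *: "f \<in> fring (below e)" "g \<in> fring (below e)" "a \<in> fring (below e)" "b \<in> fring (below e)"
        "(\<lambda>x. e x * f x - a x) \<in> K" "(\<lambda>x. e x * g x - b x) \<in> K" by (auto simp: Ke_def)
      have "(\<lambda>x. e x * (f x + g x) - (a x + b x)) \<in> K"
        using pure_add[OF K *(5,6)] by (simp add: algebra_simps)
      then show "(\<lambda>x. f x + g x) \<in> Ke e" unfolding Ke_def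
        using fring.add[OF *(1,2)] fring.add[OF *(3,4)]
        by (intro CollectI conjI bexI[of _ "\<lambda>x. a x + b x"]) }
    { fix f g assume f: "f \<in> fring (below e)" and "g \<in> Ke e"
      then obtain b where *: "g \<in> fring (below e)" "b \<in> fring (below e)"
        "(\<lambda>x. e x * g x - b x) \<in> K" by (auto simp: Ke_def)
      have "f \<in> fring U" using f sub[OF e] by auto
      from pure_mult[OF K this *(3)] have "(\<lambda>x. e x * (f x * g x) - f x * b x) \<in> K"
        by (simp add: algebra_simps)
      then show "(\<lambda>x. f x * g x) \<in> Ke e" unfolding Ke_def
        using fring_mult[OF f *(1)] fring_mult[OF f *(2)]
        by (intro CollectI conjI bexI[of _ "\<lambda>x. f x * b x"]) }
    { fix f and n :: int assume f: "f \<in> fring (below e)" and n: "n \<noteq> 0" and "(\<lambda>x. n * f x) \<in> Ke e"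
      then obtain g where g: "g \<in> fring (below e)" "(\<lambda>x. e x * (n * f x) - g x) \<in> K" by (auto simp: Ke_def)
      have "(\<lambda>x. e x * f x) \<in> fring U" using f sub[OF e] e by (intro fring.gen) auto
      moreover have "(\<lambda>x. n * (e x * f x) - g x) \<in> K" using g(2) by (simp add: ac_simps)
      ultimately obtain g' where "g' \<in> fring (below e)" "(\<lambda>x. e x * f x - g' x) \<in> K"
        using subring_plus_ideal_pure[OF K UB U(2)[OF e] _ g(1) n, of "\<lambda>x. e x * f x"] by blast
      then show "f \<in> Ke e" using f by (auto simp: Ke_def) }
  qed
  have "\<forall>e\<in>U. \<exists>S. basis_modulo S (fring (below e)) (Ke e)" using IH pureKe by blast
  from bchoice[OF this] obtain Se where Se: "\<And>e. e \<in> U \<Longrightarrow> basis_modulo (Se e) (fring (below e)) (Ke e)" by blast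
  \<comment> \<open>The bases of the successive quotients, lifted along multiplication by
    \<open>e\<close>. The constants at the bottom of the filtration are not represented, whence a
    basis modulo constants.\<close>
  define S where "S = {(\<lambda>x. e x * s x) |e s. e \<in> U \<and> s \<in> Se e}"
  have SeR: "s \<in> fring (below e)" if "e \<in> U" "s \<in> Se e" for e s
    using Se[OF that(1)] that(2) by (auto simp: basis_modulo_def)
  have SU: "S \<subseteq> fring U"
  proof
    fix f assume "f \<in> S"
    then obtain e s where es: "f = (\<lambda>x. e x * s x)" "e \<in> U" "s \<in> Se e" by (auto simp: S_def)
    then show "f \<in> fring U" using SeR[OF es(2,3)] sub[OF es(2)] by (auto intro: fring.gen)
  qed
  define Sp where "Sp = {f. \<exists>c n. Poly_Mapping.keys c \<subseteq> S \<and> (\<lambda>x. f x - lincomb c x - n) \<in> K}"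
  have Sp_add: "(\<lambda>x. f x + g x) \<in> Sp" if "f \<in> Sp" "g \<in> Sp" for f g
  proof -
    from that obtain c d m n where *: "Poly_Mapping.keys c \<subseteq> S" "(\<lambda>x. f x - lincomb c x - m) \<in> K"
      "Poly_Mapping.keys d \<subseteq> S" "(\<lambda>x. g x - lincomb d x - n) \<in> K" by (auto simp: Sp_def)
    have "Poly_Mapping.keys (c + d) \<subseteq> S" using keys_add[of c d] * by blast
    moreover have "(\<lambda>x. (f x + g x) - lincomb (c + d) x - (m + n)) \<in> K"
      using pure_add[OF K *(2,4)] by (simp add: lincomb_add algebra_simps)
    ultimately show ?thesis unfolding Sp_def by blast
  qed
  have Sp_K: "f \<in> Sp" if "f \<in> K" for f
    unfolding Sp_def using that by (intro CollectI exI[of _ 0]) simp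
  have Sp_const: "(\<lambda>_. n) \<in> Sp" for n
    unfolding Sp_def using pure_zero[OF K] by (intro CollectI exI[of _ 0] exI[of _ n]) simp
  \<comment> \<open>A function involves finitely many generators, and the greatest of them has all
    the others below it.\<close>
  have from_below: "f \<in> Sp"
    if f: "f \<in> fring W" and W: "W \<subseteq> U" "\<And>d h. d \<in> W \<Longrightarrow> h \<in> fring (insert d (below d)) \<Longrightarrow> h \<in> Sp" for f W
  proof -
    obtain F where F: "finite F" "F \<subseteq> W" "f \<in> fring F" using fring_finite_subset[OF f] by blast
    show ?thesis
    proof (cases "F = {}")
      case True
      then show ?thesis using F fring_empty Sp_const by blast
    next
      case False
      then obtain m where m: "m \<in> F" "\<forall>d\<in>F. d = m \<or> (d, m) \<in> L" using finite_has_greatest[OF F(1)] by blast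
      have "F \<subseteq> insert m (below m)" using m F W U(1) by (auto simp: below_def)
      then have "f \<in> fring (insert m (below m))" using F fring_mono by blast
      then show ?thesis using W(2) m F by blast
    qed
  qed
  have span_insert: "f \<in> Sp" if "e \<in> U" "f \<in> fring (insert e (below e))" for e f
    using wf that
  proof (induction e arbitrary: f rule: wf_induct_rule)
    case (less e)
    have e01: "e x = 0 \<or> e x = 1" for x using boolean_valuedD[OF UB less.prems(1)] .
    obtain g h where gh: "g \<in> fring (below e)" "h \<in> fring (below e)" "f = (\<lambda>x. g x + e x * h x)"
      using fring_insert[OF e01 less.prems(2)] by blast
    obtain c where c: "Poly_Mapping.keys c \<subseteq> Se e" "(\<lambda>x. h x - lincomb c x) \<in> Ke e"
      using Se[OF less.prems(1)] gh(2) by (auto simp: basis_modulo_def)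
    obtain g' where g': "g' \<in> fring (below e)" "(\<lambda>x. e x * (h x - lincomb c x) - g' x) \<in> K"
      using c(2) by (auto simp: Ke_def)
    have 1: "(\<lambda>x. g x + g' x) \<in> Sp"
    proof (rule from_below[OF fring.add[OF gh(1) g'(1)] U(2)[OF less.prems(1)]])
      fix d h assume d: "d \<in> below e" "h \<in> fring (insert d (below d))"
      then show "h \<in> Sp" using U(2)[OF less.prems(1)] by (intro less.IH) (auto simp: below_def)
    qed
    define d where "d = (\<Sum>s\<in>Poly_Mapping.keys c. Poly_Mapping.single (\<lambda>x. e x * s x) (Poly_Mapping.lookup c s))"
    have "Poly_Mapping.keys d \<subseteq> (\<Union>s\<in>Poly_Mapping.keys c. Poly_Mapping.keys (Poly_Mapping.single (\<lambda>x. e x * s x) (Poly_Mapping.lookup c s)))"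
      unfolding d_def by (rule keys_sum)
    also have "\<dots> \<subseteq> S" using c(1) less.prems(1) by (auto simp: S_def split: if_splits)
    finally have dS: "Poly_Mapping.keys d \<subseteq> S" .
    have ld: "lincomb d x = e x * lincomb c x" for x
      unfolding d_def lincomb_sum lincomb_single by (simp add: lincomb_def sum_distrib_left ac_simps)
    have 2: "lincomb d \<in> Sp"
      unfolding Sp_def using dS pure_zero[OF K] by (intro CollectI exI[of _ d] exI[of _ 0]) simp
    have "(\<lambda>x. (g x + g' x) + lincomb d x + (e x * (h x - lincomb c x) - g' x)) \<in> Sp"
      by (intro Sp_add 1 2 Sp_K g')
    then show ?case by (simp add: gh(3) ld algebra_simps)
  qed
  have span: "f \<in> Sp" if "f \<in> fring U" for f
    using from_below[OF that order_refl] span_insert by blast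
  have indep: "c = 0" if c: "Poly_Mapping.keys c \<subseteq> S" "(\<lambda>x. lincomb c x - n) \<in> K" for c n
  proof (rule ccontr)
    assume "c \<noteq> 0"
    then have ne: "Poly_Mapping.keys c \<noteq> {}" by simp
    have "\<forall>f\<in>S. \<exists>e s. e \<in> U \<and> s \<in> Se e \<and> f = (\<lambda>x. e x * s x)" by (auto simp: S_def)
    from bchoice[OF this] obtain ee where "\<forall>f\<in>S. \<exists>s. ee f \<in> U \<and> s \<in> Se (ee f) \<and> f = (\<lambda>x. ee f x * s x)" ..
    from bchoice[OF this] obtain ss where
      es: "\<And>f. f \<in> S \<Longrightarrow> ee f \<in> U" "\<And>f. f \<in> S \<Longrightarrow> ss f \<in> Se (ee f)"
        "\<And>f. f \<in> S \<Longrightarrow> f = (\<lambda>x. ee f x * ss f x)" by blast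
    let ?k = "Poly_Mapping.keys c"
    \<comment> \<open>Each basis element is written as \<open>ee f * ss f\<close>. In a combination
      that is constant modulo \<open>K\<close>, the terms with the greatest factor
      \<open>ee f = m\<close> yield a combination of elements of \<open>Se m\<close> that lies in
      \<open>Ke m\<close>, so its coefficients vanish.\<close>
    obtain m where m: "m \<in> ee ` ?k" "\<forall>d\<in>ee ` ?k. d = m \<or> (d, m) \<in> L"
      using finite_has_greatest[of "ee ` ?k"] ne by auto
    have mU: "m \<in> U" using m c es by blast
    define T where "T = {f \<in> ?k. ee f = m}"
    have T: "finite T" "T \<subseteq> ?k" "T \<subseteq> S" using c by (auto simp: T_def)
    have Tf: "f = (\<lambda>x. m x * ss f x)" "ss f \<in> Se m" if "f \<in> T" for f
      using es(2,3)[of f] that T by (auto simp: T_def)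
    have inj: "inj_on ss T"
    proof (rule inj_onI)
      fix f g assume "f \<in> T" "g \<in> T" "ss f = ss g"
      then show "f = g" using Tf(1)[of f] Tf(1)[of g] by simp
    qed
    define d where "d = (\<Sum>f\<in>T. Poly_Mapping.single (ss f) (Poly_Mapping.lookup c f))"
    have "Poly_Mapping.keys d \<subseteq> (\<Union>f\<in>T. Poly_Mapping.keys (Poly_Mapping.single (ss f) (Poly_Mapping.lookup c f)))"
      unfolding d_def by (rule keys_sum)
    also have "\<dots> \<subseteq> Se m" using Tf(2) by (auto split: if_splits)
    finally have dS: "Poly_Mapping.keys d \<subseteq> Se m" .
    define rest where "rest x = (\<Sum>f\<in>?k - T. Poly_Mapping.lookup c f * f x)" for x
    have restR: "rest \<in> fring (below m)"
      unfolding rest_def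
    proof (intro fring_sum fring.scale)
      fix f assume f: "f \<in> ?k - T"
      then have fS: "f \<in> S" using c by auto
      have "(ee f, m) \<in> L" using m(2) f by (auto simp: T_def)
      then have em: "ee f \<in> below m" using es(1)[OF fS] U(1) by (auto simp: below_def)
      have "below (ee f) \<subseteq> below m" using em trans by (auto simp: below_def dest: transD)
      then have "ss f \<in> fring (below m)" using SeR[OF es(1)[OF fS] es(2)[OF fS]] fring_mono by blast
      then have "(\<lambda>x. ee f x * ss f x) \<in> fring (below m)" using em by (intro fring.gen)
      then show "f \<in> fring (below m)" using es(3)[OF fS] by simp
    qed
    have ld: "lincomb d x = (\<Sum>f\<in>T. Poly_Mapping.lookup c f * ss f x)" for x
      by (simp add: d_def lincomb_sum)
    have split: "lincomb c x = m x * lincomb d x + rest x" for x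
    proof -
      have "lincomb c x = (\<Sum>f\<in>T. Poly_Mapping.lookup c f * f x) + rest x"
        unfolding lincomb_def rest_def using T by (subst sum.subset_diff[of T]) auto
      also have "(\<Sum>f\<in>T. Poly_Mapping.lookup c f * f x) = (\<Sum>f\<in>T. m x * (Poly_Mapping.lookup c f * ss f x))"
      proof (rule sum.cong)
        fix f assume "f \<in> T"
        then have "f x = m x * ss f x" using Tf(1)[of f] by metis
        then show "Poly_Mapping.lookup c f * f x = m x * (Poly_Mapping.lookup c f * ss f x)" by simp
      qed simp
      finally show ?thesis by (simp add: ld sum_distrib_left)
    qed
    have "lincomb d \<in> Ke m"
      unfolding Ke_def
    proof (intro CollectI conjI bexI)
      show "lincomb d \<in> fring (below m)"
        using dS SeR[OF mU] by (intro lincomb_in_fring) auto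
      show "(\<lambda>x. n - rest x) \<in> fring (below m)" by (intro fring_diff fring_const restR)
      show "(\<lambda>x. m x * lincomb d x - (n - rest x)) \<in> K" using c(2) by (simp add: split algebra_simps)
    qed
    then have d0: "d = 0" using Se[OF mU] dS by (auto simp: basis_modulo_def)
    obtain f0 where f0: "f0 \<in> T" using m by (auto simp: T_def)
    have "Poly_Mapping.lookup d (ss f0) = (\<Sum>f\<in>T. if f = f0 then Poly_Mapping.lookup c f0 else 0)"
      unfolding d_def lookup_sum using inj f0
      by (intro sum.cong) (auto simp: lookup_single when_def inj_on_def)
    also have "\<dots> = Poly_Mapping.lookup c f0" using T f0 by simp
    finally show False using d0 f0 T by (auto simp: in_keys_iff)
  qed
  have "basis_modulo S (fring U) (with_constants K)"
    unfolding basis_modulo_def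
  proof (intro conjI ballI allI impI)
    show "S \<subseteq> fring U" by (rule SU)
    show "\<exists>c. Poly_Mapping.keys c \<subseteq> S \<and> (\<lambda>x. f x - lincomb c x) \<in> with_constants K" if "f \<in> fring U" for f
      using span[OF that] by (auto simp: Sp_def with_constants_def)
    show "c = 0" if "Poly_Mapping.keys c \<subseteq> S" "lincomb c \<in> with_constants K" for c
      using that indep by (auto simp: with_constants_def)
  qed
  then show ?thesis by blast
qed

text \<open>A basis modulo \<open>with_constants K\<close> is completed by the function 1, which has
  infinite order modulo \<open>K\<close> by purity unless it lies in \<open>K\<close>. General pure
  ideals are treated because the recursion produces the ideals \<open>Ke e\<close>.\<close>

lemma basis_below:
  "pure_ideal (fring (below e)) K \<Longrightarrow> \<exists>S. basis_modulo S (fring (below e)) K"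
  using wf
proof (induction e arbitrary: K rule: wf_induct_rule)
  case (less e)
  note K = less.prems
  have "\<exists>S. basis_modulo S (fring (below e)) (with_constants K)"
  proof (rule basis_step[OF _ _ K])
    show "below e \<subseteq> E" by (auto simp: below_def)
    show "below d \<subseteq> below e" if "d \<in> below e" for d using that trans by (auto simp: below_def dest: transD)
    show "\<exists>S. basis_modulo S (fring (below d)) K'" if "d \<in> below e" "pure_ideal (fring (below d)) K'" for d K'
      using that by (intro less.IH) (auto simp: below_def)
  qed
  then obtain S where S: "basis_modulo S (fring (below e)) (with_constants K)" ..
  show ?case
  proof (cases "(\<lambda>_. 1) \<in> K")
    case True
    have "f \<in> K" if "f \<in> with_constants K" for f
    proof -
      from that obtain n where n: "(\<lambda>x. f x - n) \<in> K" by (auto simp: with_constants_def)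
      have "(\<lambda>x. n * 1) \<in> K" by (rule pure_mult[OF K fring_const True])
      from pure_add[OF K n this] show ?thesis by simp
    qed
    moreover have "K \<subseteq> with_constants K" by (auto simp: with_constants_def intro!: exI[of _ 0])
    ultimately have "with_constants K = K" by blast
    then show ?thesis using S by auto
  next
    case False
    let ?one = "(\<lambda>_. 1) :: 'p \<Rightarrow> int"
    have "?one \<notin> S"
    proof
      assume "?one \<in> S"
      moreover have "lincomb (Poly_Mapping.single ?one 1) \<in> with_constants K"
        using pure_zero[OF K] by (auto simp: with_constants_def intro!: exI[of _ 1])
      moreover have "\<forall>c. Poly_Mapping.keys c \<subseteq> S \<longrightarrow> lincomb c \<in> with_constants K \<longrightarrow> c = 0"
        using S by (simp add: basis_modulo_def)
      then have "Poly_Mapping.keys (Poly_Mapping.single ?one (1::int)) \<subseteq> S \<longrightarrow>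
        lincomb (Poly_Mapping.single ?one 1) \<in> with_constants K \<longrightarrow> Poly_Mapping.single ?one (1::int) = 0"
        by (rule spec)
      ultimately have "Poly_Mapping.single ?one (1::int) = 0" by simp
      then have "Poly_Mapping.lookup (Poly_Mapping.single ?one (1::int)) ?one = 0" by simp
      then show False by simp
    qed
    have "basis_modulo (insert ?one S) (fring (below e)) K"
      unfolding basis_modulo_def
    proof (intro conjI ballI allI impI)
      show "insert ?one S \<subseteq> fring (below e)" using S fring.one by (auto simp: basis_modulo_def)
      fix f assume "f \<in> fring (below e)"
      then obtain c where cS: "Poly_Mapping.keys c \<subseteq> S" and "(\<lambda>x. f x - lincomb c x) \<in> with_constants K"
        using S unfolding basis_modulo_def by blast
      then obtain n where n: "(\<lambda>x. f x - lincomb c x - n) \<in> K" by (auto simp: with_constants_def)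
      note c = cS n
      have "Poly_Mapping.keys (c + Poly_Mapping.single ?one n) \<subseteq> insert ?one S"
        using keys_add[of c "Poly_Mapping.single ?one n"] c by (auto split: if_splits)
      moreover have "(\<lambda>x. f x - lincomb (c + Poly_Mapping.single ?one n) x) \<in> K"
        using c(2) by (simp add: lincomb_add algebra_simps)
      ultimately show "\<exists>c. Poly_Mapping.keys c \<subseteq> insert ?one S \<and> (\<lambda>x. f x - lincomb c x) \<in> K" by blast
    next
      fix c assume c: "Poly_Mapping.keys c \<subseteq> insert ?one S" "lincomb c \<in> K"
      define n where "n = Poly_Mapping.lookup c ?one"
      define d where "d = c - Poly_Mapping.single ?one n"
      have "Poly_Mapping.lookup d ?one = 0" by (simp add: d_def n_def lookup_minus)
      then have "?one \<notin> Poly_Mapping.keys d" by (simp add: in_keys_iff)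
      moreover have "Poly_Mapping.keys d \<subseteq> insert ?one S"
        unfolding d_def using keys_diff[of c "Poly_Mapping.single ?one n"] c by (auto split: if_splits)
      ultimately have dS: "Poly_Mapping.keys d \<subseteq> S" by blast
      have cd: "c = d + Poly_Mapping.single ?one n" by (simp add: d_def)
      have lc: "lincomb c = (\<lambda>x. lincomb d x - (- n))" by (simp add: cd lincomb_add fun_eq_iff)
      have "lincomb d \<in> with_constants K"
        using c(2) unfolding lc with_constants_def by (intro CollectI exI[of _ "- n"])
      then have d0: "d = 0" using S dS by (auto simp: basis_modulo_def)
      have "(\<lambda>x. n * 1) \<in> K" using c(2) unfolding lc d0 by simp
      then have "n = 0" using pure_divide[OF K fring.one, of n] False by blast
      then show "c = 0" using cd d0 by simp
    qed
    then show ?thesis by blast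
  qed
qed

end

text \<open>One more step of the recursion, with all generators and the zero ideal. The basis is
  taken modulo constants because constant exponents correspond to powers of \<open>X\<close>, which
  generate the trivial module.\<close>

theorem noebeling:
  fixes E :: "('p \<Rightarrow> int) set"
  assumes E: "boolean_valued E"
  obtains S where "basis_modulo S (fring E) (range (\<lambda>n _. n))"
proof -
  obtain r :: "(('p \<Rightarrow> int) \<times> ('p \<Rightarrow> int)) set" where r: "well_order_on UNIV r"
    using well_order_on by blast
  define L where "L = r - Id"
  have lin: "linear_order_on UNIV r" and wf: "wf L"
    using r by (auto simp: well_order_on_def L_def)
  have tr: "trans r" and as: "antisym r" and tot: "total_on UNIV r"
    using lin by (auto simp: linear_order_on_def partial_order_on_def preorder_on_def)
  have trans: "trans L" using tr as unfolding L_def by (auto simp: trans_def antisym_def)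
  have total: "(a, b) \<in> L \<or> (b, a) \<in> L" if "a \<noteq> b" for a b
    using tot that by (auto simp: total_on_def L_def)
  have "pure_ideal (fring E) {\<lambda>_. 0}"
    by (auto simp: pure_ideal_def fring_const fun_eq_iff)
  then have "\<exists>S. basis_modulo S (fring E) (with_constants {\<lambda>_. 0})"
    using basis_below[OF E wf trans total]
    by (intro basis_step[OF E wf trans total]) (auto simp: below_def[OF E wf trans total])
  moreover have "with_constants {\<lambda>_::'p. 0} = range (\<lambda>n _. n)"
    by (auto simp: with_constants_def fun_eq_iff)
  ultimately show ?thesis using that by auto
qed

section \<open>Evaluation at one and the group \<open>MI A B\<close>\<close>

context
  fixes \<pi> :: "'u::comm_ring_1 \<Rightarrow> 'a" and R :: "('a, 'b) ring_scheme" and A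
  assumes c: "cover \<pi> R" and A: "subcring A R"
begin

lemma ring_extension_of_cover: "ring_extension A R"
  using cover_cring[OF c] A by (intro ring_extension.intro ring_extension_axioms.intro)

lemma ring_subset_preimage: "ring_subset (\<pi> -` A)"
  using subcringE[OF A] cover_simps(2,4)[OF c] cover_diff[OF c]
  by (auto simp: ring_subset_def a_minus_def)

lemma kernel_ideal: "ideal_in UNIV (\<pi> -` {\<zero>\<^bsub>R\<^esub>})"
proof -
  interpret cring R by (rule cover_cring[OF c])
  show ?thesis by (auto simp: ideal_in_def cover_simps[OF c] cover_in[OF c])
qed

lemma kernel_subset: "\<pi> -` {\<zero>\<^bsub>R\<^esub>} \<subseteq> \<pi> -` A"
  using subcringE(2)[OF A] by auto

lemma subintegrally_closed_preimage:
  assumes "subintegrally_closed A R" shows "subintegrally_closed_set (\<pi> -` A)"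
  using assms cover_in[OF c]
  by (auto simp: subintegrally_closed_def subintegrally_closed_set_def cover_power[OF c])

lemma lp_map_in_LP_sub: "lp_map \<pi> f \<in> LP_sub A R \<longleftrightarrow> f \<in> coeffs_in (\<pi> -` A)"
  using finite_support_cover[OF c, of f] by (auto simp: LP_sub_def LP_def lp_map_def coeffs_in_def)

lemma lp_map_vimage: "lp_map \<pi> -` LP_sub A R = coeffs_in (\<pi> -` A)"
  using lp_map_in_LP_sub by auto

lemma lp_map_zero: "lp_map \<pi> -` {\<zero>\<^bsub>LP R\<^esub>} = coeffs_in (\<pi> -` {\<zero>\<^bsub>R\<^esub>})"
  by (auto simp: LP_def lp_map_def coeffs_in_def fun_eq_iff)

lemma up_map_in_poly_sub: "up_map \<pi> f \<in> poly_sub A R \<longleftrightarrow> (\<forall>k. \<pi> (coef f k) \<in> A)"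
  using finite_support_cover[OF c, of f] by (auto simp: poly_sub_def carrier_UP up_map_def)

lemma subcring_by_cover:
  fixes \<rho> :: "'v::comm_ring_1 \<Rightarrow> 'c"
  assumes \<rho>: "cover \<rho> C" and T: "T \<subseteq> carrier C" and P: "ring_subset (\<rho> -` T)"
  shows "subcring T C"
proof -
  interpret C: cring C by (rule cover_cring[OF \<rho>])
  have l: "\<exists>a. x = \<rho> a \<and> a \<in> \<rho> -` T" if "x \<in> T" for x
    using cover_obtain[OF \<rho>, of x] T that by (metis subsetD vimageI2)
  show ?thesis
  proof (intro C.subcringI' C.subringI T)
    show "\<one>\<^bsub>C\<^esub> \<in> T" using ring_subset_one[OF P] cover_simps(4)[OF \<rho>] by simp
    fix x assume "x \<in> T"
    then obtain a where a: "x = \<rho> a" "a \<in> \<rho> -` T" using l by blast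
    then show "\<ominus>\<^bsub>C\<^esub> x \<in> T" using ring_subset_uminus[OF P a(2)] cover_uminus[OF \<rho>, of a] by simp
    fix y assume "y \<in> T"
    then obtain b where b: "y = \<rho> b" "b \<in> \<rho> -` T" using l by blast
    show "x \<otimes>\<^bsub>C\<^esub> y \<in> T" "x \<oplus>\<^bsub>C\<^esub> y \<in> T"
      using ring_subset_mult[OF P a(2) b(2)] ring_subset_add[OF P a(2) b(2)] a b
      by (simp_all add: cover_simps[OF \<rho>])
  qed
qed

lemma subcring_LP_sub: "subcring (LP_sub A R) (LP R)"
proof (rule subcring_by_cover[OF cover_lp_map[OF c]])
  show "LP_sub A R \<subseteq> carrier (LP R)" using subcringE(1)[OF A] by (auto simp: LP_sub_def LP_def)
  show "ring_subset (lp_map \<pi> -` LP_sub A R)"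
    unfolding lp_map_vimage by (rule ring_subset_coeffs_in[OF ring_subset_preimage])
qed

lemma ring_extension_LP: "ring_extension (LP_sub A R) (LP R)"
  using cover_cring[OF cover_lp_map[OF c]] subcring_LP_sub
  by (intro ring_extension.intro ring_extension_axioms.intro)

end

section \<open>The evaluation map and normalised modules\<close>

definition LP_eval :: "('a, 'b) ring_scheme \<Rightarrow> (int \<Rightarrow> 'a) \<Rightarrow> 'a" where
  "LP_eval R p = (\<Oplus>\<^bsub>R\<^esub>k\<in>{k. p k \<noteq> \<zero>\<^bsub>R\<^esub>}. p k)"

lemma LP_eval_lp_map:
  assumes c: "cover \<pi> R" shows "LP_eval R (lp_map \<pi> f) = \<pi> (at_one f)"
proof -
  interpret cring R by (rule cover_cring[OF c])
  have "\<pi> (at_one f) = (\<Oplus>\<^bsub>R\<^esub>k\<in>Poly_Mapping.keys f. \<pi> (coef f k))"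
    by (simp add: at_one_def cover_sum[OF c])
  also have "\<dots> = (\<Oplus>\<^bsub>R\<^esub>k\<in>{k. \<pi> (coef f k) \<noteq> \<zero>\<^bsub>R\<^esub>}. \<pi> (coef f k))"
    by (rule add.finprod_mono_neutral_cong_left[symmetric])
      (use cover_in[OF c] cover_simps[OF c] in \<open>auto simp: in_keys_iff\<close>)
  finally show ?thesis by (simp add: LP_eval_def lp_map_def)
qed

lemma LP_const_cover:
  assumes c: "cover \<pi> R" shows "LP_const R (\<pi> x) = lp_map \<pi> (const x)"
  by (auto simp: LP_const_def lp_map_def lookup_single when_def cover_simps[OF c])

lemma extension_hom_LP_eval:
  assumes c: "cover \<pi> R" and A: "subcring A R"
  shows "extension_hom (LP_sub A R) (LP R) A R (LP_eval R)"
proof (intro extension_hom.intro ring_extension_LP[OF c A] ring_extension_of_cover[OF c A] extension_hom_axioms.intro)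
  note e = LP_eval_lp_map[OF c]
  show "LP_eval R \<in> ring_hom (LP R) R"
    by (rule ring_hom_by_cover[OF cover_lp_map[OF c]])
      (simp_all add: e at_one_add at_one_mult cover_simps[OF c] cover_in[OF c])
  show "LP_eval R ` LP_sub A R \<subseteq> A"
  proof clarify
    fix p assume p: "p \<in> LP_sub A R"
    then have "p \<in> carrier (LP R)" using subcringE(1)[OF subcring_LP_sub[OF c A]] by blast
    then obtain f where f: "p = lp_map \<pi> f" using cover_obtain[OF cover_lp_map[OF c]] by blast
    then have "f \<in> coeffs_in (\<pi> -` A)" using p lp_map_in_LP_sub[OF c A] by simp
    then show "LP_eval R p \<in> A" using at_one_in[OF ring_subset_preimage[OF c A]] by (simp add: f e)
  qed
qed

lemma extension_hom_LP_const:
  assumes c: "cover \<pi> R" and A: "subcring A R"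
  shows "extension_hom A R (LP_sub A R) (LP R) (LP_const R)"
proof (intro extension_hom.intro ring_extension_LP[OF c A] ring_extension_of_cover[OF c A] extension_hom_axioms.intro)
  note e = LP_const_cover[OF c]
  note l = cover_lp_map[OF c]
  show "LP_const R \<in> ring_hom R (LP R)"
    by (rule ring_hom_by_cover[OF c])
      (simp_all add: e single_add const_mult cover_simps[OF l] cover_in[OF l] del: mult_single)
  show "LP_const R ` A \<subseteq> LP_sub A R"
    using subcringE(2)[OF A] by (auto simp: LP_const_def LP_sub_def LP_def)
qed

lemma LP_extend_eq: "LP_extend A R = extend_module (LP_const R) (LP_sub A R) (LP R)"
  by (simp add: fun_eq_iff LP_extend_def extend_module_def)

lemma LP_eval_extend:
  assumes c: "cover \<pi> R" and A: "subcring A R" and I: "invertible_submodule A R I"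
  shows "extend_module (LP_eval R) A R (LP_extend A R I) = I"
proof -
  interpret ring_extension A R by (rule ring_extension_of_cover[OF c A])
  note I = invertible_submoduleD[OF I]
  have "extend_module (LP_eval R) A R (LP_extend A R I) = extend_module (LP_eval R \<circ> LP_const R) A R I"
    unfolding LP_extend_eq
    by (rule extend_compose[OF extension_hom_LP_const[OF c A] extension_hom_LP_eval[OF c A] subalgebraD(1)[OF I]])
  also have "\<dots> = I"
  proof (rule extend_id[OF I])
    fix x assume "x \<in> I"
    then obtain u where "x = \<pi> u" using subalgebraD(1)[OF I] cover_obtain[OF c] by blast
    then show "(LP_eval R \<circ> LP_const R) x = x" by (simp add: LP_const_cover[OF c] LP_eval_lp_map[OF c])
  qed
  finally show ?thesis .
qed

lemma ideal_prod_lifts: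
  assumes c: "cover \<pi> R" and IJ: "I \<subseteq> carrier R" "J \<subseteq> carrier R" and x: "x \<in> ideal_prod R I J"
  shows "\<exists>(n::nat) f g. (\<forall>i<n. \<pi> (f i) \<in> I \<and> \<pi> (g i) \<in> J) \<and> x = \<pi> (\<Sum>i<n. f i * g i)"
proof -
  have "\<exists>xs. (\<forall>(a, b)\<in>set xs. \<pi> a \<in> I \<and> \<pi> b \<in> J) \<and> x = \<pi> (\<Sum>(a, b)\<leftarrow>xs. a * b)" using x
  proof (induction rule: ideal_prod.induct)
    case (prod i j)
    then obtain a b where "i = \<pi> a" "j = \<pi> b" using IJ cover_obtain[OF c] by (metis subsetD)
    then show ?case using prod by (intro exI[of _ "[(a, b)]"]) (simp add: cover_simps[OF c])
  next
    case (sum x y)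
    then obtain xs ys where *: "\<forall>(a, b)\<in>set xs. \<pi> a \<in> I \<and> \<pi> b \<in> J" "x = \<pi> (\<Sum>(a, b)\<leftarrow>xs. a * b)"
      "\<forall>(a, b)\<in>set ys. \<pi> a \<in> I \<and> \<pi> b \<in> J" "y = \<pi> (\<Sum>(a, b)\<leftarrow>ys. a * b)" by blast
    then show ?case by (intro exI[of _ "xs @ ys"]) (auto simp: cover_simps[OF c])
  qed
  then obtain xs where xs: "\<And>a b. (a, b) \<in> set xs \<Longrightarrow> \<pi> a \<in> I \<and> \<pi> b \<in> J" "x = \<pi> (\<Sum>(a, b)\<leftarrow>xs. a * b)"
    by blast
  have "(\<Sum>(a, b)\<leftarrow>xs. a * b) = (\<Sum>i<length xs. fst (xs ! i) * snd (xs ! i))"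
    by (simp add: sum_list_sum_nth atLeast0LessThan split_def)
  moreover have "\<pi> (fst (xs ! i)) \<in> I \<and> \<pi> (snd (xs ! i)) \<in> J" if "i < length xs" for i
    using xs(1)[of "fst (xs ! i)" "snd (xs ! i)"] nth_mem[OF that] by simp
  ultimately show ?thesis using xs(2)
    by (intro exI[of _ "length xs"] exI[of _ "\<lambda>i. fst (xs ! i)"] exI[of _ "\<lambda>i. snd (xs ! i)"]) simp
qed

text \<open>The relation \<open>1 = \<Sum> f i * g i\<close> puts 1 into both \<open>I\<close> and
  \<open>J\<close> once the generators lie in \<open>A\<close>. Then \<open>A\<close> is contained
  in \<open>I\<close>, and \<open>I = I A\<close> is contained in \<open>I J = A\<close>.\<close>

lemma trivial_if_generators_in:
  assumes "ring_extension A R" and c: "cover \<pi> R"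
    and IJ: "subalgebra A I R" "subalgebra A J R" "ideal_prod R I J = A"
    and f: "\<And>i. i < n \<Longrightarrow> \<pi> (f i) \<in> I" and g: "\<And>i. i < n \<Longrightarrow> \<pi> (g i) \<in> J"
    and fA: "\<And>i. i < (n::nat) \<Longrightarrow> \<pi> (f i) \<in> A" and gA: "\<And>i. i < n \<Longrightarrow> \<pi> (g i) \<in> A"
    and one: "\<one>\<^bsub>R\<^esub> = \<pi> (\<Sum>i<n. f i * g i)"
  shows "I = A"
proof -
  interpret ring_extension A R by (rule assms(1))
  note I = subalgebraD[OF IJ(1)] and J = subalgebraD[OF IJ(2)]
  have sum: "\<pi> (sum h K) \<in> L" if L: "subalgebra A L R" and "\<And>i. i \<in> K \<Longrightarrow> \<pi> (h i) \<in> L" for h K and L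
    using that(2) subalgebraD[OF L]
    by (induction K rule: infinite_finite_induct) (auto simp: cover_simps[OF c])
  have fgc: "\<pi> (f i) \<in> carrier R" "\<pi> (g i) \<in> carrier R" for i by (rule cover_in[OF c])+
  have "\<pi> (f i * g i) \<in> I" if "i < n" for i
    using I(5)[OF gA[OF that] f[OF that]] m_comm[OF fgc] by (simp add: cover_simps[OF c])
  then have 1: "\<one>\<^bsub>R\<^esub> \<in> I" unfolding one by (intro sum[OF IJ(1)]) auto
  have "\<pi> (f i * g i) \<in> J" if "i < n" for i
    using J(5)[OF fA[OF that] g[OF that]] by (simp add: cover_simps[OF c])
  then have 2: "\<one>\<^bsub>R\<^esub> \<in> J" unfolding one by (intro sum[OF IJ(2)]) auto
  have "a \<in> I \<and> a \<in> J" if a: "a \<in> A" for a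
  proof -
    have "a \<in> carrier R" using a A_carrier by auto
    then show ?thesis using I(5)[OF a 1] J(5)[OF a 2] by simp
  qed
  then have AI: "A \<subseteq> I" and AJ: "A \<subseteq> J" by auto
  have "I = ideal_prod R I A" by (rule prod_A[OF IJ(1), symmetric])
  also have "\<dots> \<subseteq> ideal_prod R I J" by (rule ideal_prod_mono[OF order_refl AJ])
  finally show ?thesis using AI IJ(3) by blast
qed

locale normalised_module =
  fixes \<pi> :: "'u::comm_ring_1 \<Rightarrow> 'a" and B :: "('a, 'b) ring_scheme" and A I J
  assumes c: "cover \<pi> B" and A: "subcring A B"
    and IJ: "subalgebra (LP_sub A B) I (LP B)" "subalgebra (LP_sub A B) J (LP B)"
      "ideal_prod (LP B) I J = LP_sub A B"
    and I1: "extend_module (LP_eval B) A B I = A"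
begin

sublocale L: ring_extension "LP_sub A B" "LP B" by (rule ring_extension_LP[OF c A])
sublocale E: extension_hom "LP_sub A B" "LP B" A B "LP_eval B" by (rule extension_hom_LP_eval[OF c A])

lemma J1: "extend_module (LP_eval B) A B J = A"
proof -
  note I = subalgebraD(1)[OF IJ(1)] and J = subalgebraD(1)[OF IJ(2)]
  have "A = ideal_prod B A (extend_module (LP_eval B) A B J)"
    using E.extend_mult[OF I J] E.extend_A IJ(3) I1 by simp
  also have "\<dots> = extend_module (LP_eval B) A B J" by (rule E.C.A_prod[OF E.extend_subalgebra[OF IJ(2)]])
  finally show ?thesis by simp
qed

text \<open>The bridge to the lifted setting: a presentation of 1 as a sum of products from
  \<open>I\<close> and \<open>J\<close> is lifted to the cover. Normalisation of both modules at
  \<open>X = 1\<close> yields the conditions on \<open>at_one\<close>.\<close>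

lemma generators:
  "\<exists>n f g. invertible_pair (\<pi> -` A) (\<pi> -` {\<zero>\<^bsub>B\<^esub>}) f g n \<and>
    (\<forall>i<n. lp_map \<pi> (f i) \<in> I \<and> lp_map \<pi> (g i) \<in> J) \<and> \<one>\<^bsub>LP B\<^esub> = lp_map \<pi> (\<Sum>i<n. f i * g i)"
proof -
  note l = cover_lp_map[OF c]
  have I: "I \<subseteq> carrier (LP B)" and J: "J \<subseteq> carrier (LP B)" using IJ subalgebraD(1) by blast+
  have "\<one>\<^bsub>LP B\<^esub> \<in> ideal_prod (LP B) I J" using IJ(3) L.one_in_A by simp
  from ideal_prod_lifts[OF l I J this] obtain n :: nat and f g where
    "(\<forall>i<n. lp_map \<pi> (f i) \<in> I \<and> lp_map \<pi> (g i) \<in> J) \<and> \<one>\<^bsub>LP B\<^esub> = lp_map \<pi> (\<Sum>i<n. f i * g i)"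
    by blast
  then have fg: "\<And>i. i < n \<Longrightarrow> lp_map \<pi> (f i) \<in> I" "\<And>i. i < n \<Longrightarrow> lp_map \<pi> (g i) \<in> J"
    "\<one>\<^bsub>LP B\<^esub> = lp_map \<pi> (\<Sum>i<n. f i * g i)" by auto
  have "invertible_pair (\<pi> -` A) (\<pi> -` {\<zero>\<^bsub>B\<^esub>}) f g n"
  proof
    show "ring_subset (\<pi> -` A)" by (rule ring_subset_preimage[OF c A])
    show "ideal_in UNIV (\<pi> -` {\<zero>\<^bsub>B\<^esub>})" by (rule kernel_ideal[OF c A])
    show "\<pi> -` {\<zero>\<^bsub>B\<^esub>} \<subseteq> \<pi> -` A" by (rule kernel_subset[OF c A])
    show "f i * g j \<in> coeffs_in (\<pi> -` A)" if "i < n" "j < n" for i j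
    proof -
      have "lp_map \<pi> (f i) \<otimes>\<^bsub>LP B\<^esub> lp_map \<pi> (g j) \<in> LP_sub A B"
        using ideal_prod.prod[OF fg(1)[OF that(1)] fg(2)[OF that(2)], of "LP B"] IJ(3) by simp
      then show ?thesis by (simp add: cover_simps[OF l, symmetric] lp_map_in_LP_sub[OF c A])
    qed
    have "lp_map \<pi> ((\<Sum>i<n. f i * g i) - 1) = \<zero>\<^bsub>LP B\<^esub>"
      using fg(3) cover_eq_iff[OF l] cover_simps(4)[OF l] by metis
    then show "(\<Sum>i<n. f i * g i) - 1 \<in> coeffs_in (\<pi> -` {\<zero>\<^bsub>B\<^esub>})"
      using lp_map_zero[OF c A] by blast
    show "at_one (f i) \<in> \<pi> -` A" if "i < n" for i
      using E.extend_module_image[OF I] fg(1)[OF that] I1 by (auto simp: LP_eval_lp_map[OF c, symmetric])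
    show "at_one (g i) \<in> \<pi> -` A" if "i < n" for i
      using E.extend_module_image[OF J] fg(2)[OF that] J1 by (auto simp: LP_eval_lp_map[OF c, symmetric])
  qed
  then show ?thesis using fg by blast
qed

lemma torsion_trivial:
  assumes si: "subintegrally_closed A B" and m: "m > 0"
    and Im: "I [^]\<^bsub>inv_submodules (LP_sub A B) (LP B)\<^esub> (m::nat) = LP_sub A B"
  shows "I = LP_sub A B"
proof -
  note l = cover_lp_map[OF c]
  obtain n f g where P: "invertible_pair (\<pi> -` A) (\<pi> -` {\<zero>\<^bsub>B\<^esub>}) f g n"
    and gen: "\<forall>i<n. lp_map \<pi> (f i) \<in> I \<and> lp_map \<pi> (g i) \<in> J"
    and one: "\<one>\<^bsub>LP B\<^esub> = lp_map \<pi> (\<Sum>i<n. f i * g i)" using generators by blast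
  have fg: "\<And>i. i < n \<Longrightarrow> lp_map \<pi> (f i) \<in> I" "\<And>i. i < n \<Longrightarrow> lp_map \<pi> (g i) \<in> J"
    using gen by auto
  have "lp_map \<pi> (f i ^ k) \<in> I [^]\<^bsub>inv_submodules (LP_sub A B) (LP B)\<^esub> k" if i: "i < n" for i and k :: nat
  proof (induction k)
    case 0
    then show ?case using L.one_in_A by (simp add: cover_simps[OF l] inv_submodules_simps)
  next
    case (Suc k)
    have "lp_map \<pi> (f i ^ Suc k) = lp_map \<pi> (f i ^ k) \<otimes>\<^bsub>LP B\<^esub> lp_map \<pi> (f i)"
      by (simp add: cover_simps(2)[OF l, symmetric] mult.commute)
    then show ?case using ideal_prod.prod[OF Suc fg(1)[OF i], of "LP B"]
      by (simp add: inv_submodules_simps)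
  qed
  then have pow: "f i ^ m \<in> coeffs_in (\<pi> -` A)" if "i < n" for i
    using that Im lp_map_in_LP_sub[OF c A] by metis
  note t = invertible_pair.torsion_pair_trivial[OF P subintegrally_closed_preimage[OF c A si] m pow]
  show ?thesis
    by (rule trivial_if_generators_in[OF L.ring_extension_axioms l IJ fg _ _ one])
      (use t lp_map_in_LP_sub[OF c A] in auto)
qed

end

section \<open>Subintegral closedness of Laurent polynomial rings\<close>

lemma ring_subset_polynomials: "ring_subset {f :: int \<Rightarrow>\<^sub>0 'u::comm_ring_1. \<forall>k<0. coef f k = 0}"
proof -
  have "coef (f * g) k = 0"
    if f: "\<forall>k<0. coef f k = 0" and g: "\<forall>k<0. coef g k = 0" and "k < 0" for f g :: "int \<Rightarrow>\<^sub>0 'u" and k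
    unfolding coef_mult_keys
  proof (rule sum.neutral, rule ballI)
    fix i
    show "coef f i * coef g (k - i) = 0" using f g \<open>k < 0\<close> by (cases "i < 0") auto
  qed
  then show ?thesis by (auto simp: ring_subset_def lookup_minus lookup_one when_def)
qed

text \<open>Schanuel's module: for \<open>b\<^sup>2, b\<^sup>3 \<in> A\<close> the module generated by \<open>1 + b\<close> and \<open>b\<^sup>2\<close> is
  invertible. It is applied to \<open>b = F (X - 1)\<close>, which vanishes at \<open>X = 1\<close>.\<close>

lemma subintegrally_closed_coeffs_in:
  fixes A :: "'u::comm_ring_1 set"
  assumes A: "ring_subset A" and si: "subintegrally_closed_set A"
  shows "subintegrally_closed_set (coeffs_in A)"
  unfolding subintegrally_closed_set_def
proof (intro allI impI, elim conjE)
  fix f :: "int \<Rightarrow>\<^sub>0 'u"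
  assume f2: "f ^ 2 \<in> coeffs_in A" and f3: "f ^ 3 \<in> coeffs_in A"
  note RA = ring_subset_coeffs_in[OF A]
  note cl = ring_subset_closed[OF RA]
  have shA: "shift k \<in> coeffs_in A" for k
    by (intro single_in_coeffs_in ring_subset_zero[OF A] ring_subset_one[OF A])
  \<comment> \<open>A shift turns \<open>f\<close> into a polynomial, so that the criterion for
    pairs without negative exponents can be used.\<close>
  define d where "d = - Min (insert 0 (Poly_Mapping.keys f))"
  define F where "F = shift d * f"
  have Fpos: "coef F k = 0" if "k < 0" for k
  proof (rule ccontr)
    assume "coef F k \<noteq> 0"
    then have "k - d \<in> insert 0 (Poly_Mapping.keys f)" by (simp add: F_def in_keys_iff)
    then have "Min (insert 0 (Poly_Mapping.keys f)) \<le> k - d" by (intro Min_le) auto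
    then show False using that unfolding d_def by linarith
  qed
  define y :: "int \<Rightarrow>\<^sub>0 'u" where "y = shift 1 - 1"
  define a where "a = F * y"
  have yA: "y \<in> coeffs_in A" unfolding y_def by (intro cl(3) shA cl(1))
  have F2: "F ^ 2 \<in> coeffs_in A" "F ^ 3 \<in> coeffs_in A"
    unfolding F_def power_mult_distrib by (intro cl(4) cl(7) shA f2 f3)+
  have a2: "a ^ 2 \<in> coeffs_in A" and a3: "a ^ 3 \<in> coeffs_in A"
    unfolding a_def power_mult_distrib by (intro cl(4) F2 cl(7) yA)+
  note Pol = ring_subset_closed[OF ring_subset_polynomials[where 'u = 'u]]
  let ?Pol = "{f :: int \<Rightarrow>\<^sub>0 'u. \<forall>k<0. coef f k = 0}"
  have "y \<in> ?Pol" by (auto simp: y_def lookup_minus lookup_single lookup_one when_def)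
  moreover have "F \<in> ?Pol" using Fpos by simp
  ultimately have aPol: "a \<in> ?Pol" unfolding a_def by (intro Pol(4))
  define ff where "ff i = (if i = 0 then 1 + a else a ^ 2)" for i :: nat
  \<comment> \<open>The factor \<open>1 + a ^ 2\<close> makes the first product equal to
    \<open>1 - a ^ 4\<close>, which the second product \<open>a ^ 2 * a ^ 2\<close> completes to
    1.\<close>
  define gg where "gg i = (if i = 0 then (1 - a) * (1 + a ^ 2) else a ^ 2)" for i :: nat
  have a1: "at_one a = 0" by (simp add: a_def y_def at_one_mult at_one_diff)
  have e: "(1 + a) * ((1 - a) * (1 + a ^ 2)) = 1 - a ^ 2 * a ^ 2"
    "(1 + a) * a ^ 2 = a ^ 2 + a ^ 3"
    "a ^ 2 * ((1 - a) * (1 + a ^ 2)) = a ^ 2 - a ^ 3 + a ^ 2 * a ^ 2 - a ^ 2 * a ^ 3"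
    by (simp_all add: algebra_simps power2_eq_square power3_eq_cube)
  interpret P: invertible_pair A "{0}" ff gg 2
  proof
    show "ring_subset A" by (rule A)
    show "ideal_in UNIV {0 :: 'u}" by (auto simp: ideal_in_def)
    show "{0} \<subseteq> A" using ring_subset_zero[OF A] by simp
    show "ff i * gg j \<in> coeffs_in A" if "i < 2" "j < 2" for i j
    proof -
      have "(1 + a) * ((1 - a) * (1 + a ^ 2)) \<in> coeffs_in A" "(1 + a) * a ^ 2 \<in> coeffs_in A"
        "a ^ 2 * ((1 - a) * (1 + a ^ 2)) \<in> coeffs_in A" "a ^ 2 * a ^ 2 \<in> coeffs_in A"
        unfolding e by (intro cl(3) cl(6) cl(1) cl(4)[OF a2 a2] cl(4)[OF a2 a3] a2 a3)+
      then show ?thesis by (simp add: ff_def gg_def)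
    qed
    have "(\<Sum>i<2. ff i * gg i) = (1 + a) * ((1 - a) * (1 + a ^ 2)) + a ^ 2 * a ^ 2"
      by (simp add: ff_def gg_def numeral_2_eq_2)
    also have "\<dots> = 1" unfolding e by simp
    finally show "(\<Sum>i<2. ff i * gg i) - 1 \<in> coeffs_in {0}" by (simp add: coeffs_in_def)
    show "at_one (ff i) \<in> A" "at_one (gg i) \<in> A" for i
      using ring_subset_one[OF A] ring_subset_zero[OF A]
      by (simp_all add: ff_def gg_def at_one_add at_one_diff at_one_mult at_one_power a1)
  qed
  have "ff i \<in> ?Pol" "gg i \<in> ?Pol" for i
    unfolding ff_def gg_def using aPol Pol(1) Pol(3)[OF Pol(1) aPol] Pol(6)[OF Pol(1) aPol]
      Pol(7)[OF aPol, of 2] Pol(4)[OF Pol(3)[OF Pol(1) aPol] Pol(6)[OF Pol(1) Pol(7)[OF aPol, of 2]]]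
    by (cases "i = 0"; simp only: if_True if_False simp_thms)+
  then have "ff 0 \<in> coeffs_in A" by (intro P.polynomial_pair_trivial(1)[OF si]) auto
  then have "1 + a - 1 \<in> coeffs_in A" by (intro cl(3) cl(1)) (simp add: ff_def)
  then have aA: "a \<in> coeffs_in A" by simp
  \<comment> \<open>The coefficients of \<open>F\<close> are recovered from
    \<open>a = X F - F\<close> one after the other, starting at the exponent -1, where
    \<open>F\<close> is zero.\<close>
  have ca: "coef a k = coef F (k - 1) - coef F k" for k
  proof -
    have "a = shift 1 * F - F" by (simp add: a_def y_def algebra_simps)
    then show ?thesis by (simp add: lookup_minus)
  qed
  have "coef F (int k - 1) \<in> A" for k
  proof (induction k)
    case 0
    then show ?case using Fpos ring_subset_zero[OF A] by simp
  next
    case (Suc k)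
    have "coef F (int k - 1) - coef a (int k) \<in> A"
      by (rule ring_subset_diff[OF A Suc coeffs_inD[OF aA]])
    then show ?case by (simp add: ca)
  qed
  then have FA: "F \<in> coeffs_in A"
  proof (intro coeffs_inI)
    fix k assume *: "\<And>k. coef F (int k - 1) \<in> A"
    show "coef F k \<in> A"
    proof (cases "k < 0")
      case False
      then show ?thesis using *[of "nat (k + 1)"] by simp
    qed (use Fpos ring_subset_zero[OF A] in simp)
  qed
  have "f = shift (- d) * F" by (simp add: F_def mult_single flip: mult.assoc)
  then show "f \<in> coeffs_in A" using cl(4)[OF shA FA] by simp
qed

section \<open>Exchanging the two variables\<close>

text \<open>A Laurent polynomial in \<open>X\<close> over polynomials in \<open>T\<close> becomes a
  Laurent polynomial in \<open>T\<close> over Laurent polynomials in \<open>X\<close>. Integer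
  exponents for \<open>T\<close> bring the result under \<open>invertible_pair\<close> with base
  ring \<open>A[X,1/X]\<close>; negative powers of \<open>T\<close> do not occur in it.\<close>

definition exchange :: "(int \<Rightarrow>\<^sub>0 (nat \<Rightarrow>\<^sub>0 'u::comm_ring_1)) \<Rightarrow> (int \<Rightarrow>\<^sub>0 (int \<Rightarrow>\<^sub>0 'u))" where
  "exchange x = (\<Sum>i\<in>Poly_Mapping.keys x. \<Sum>j\<in>Poly_Mapping.keys (coef x i).
     Poly_Mapping.single (int j) (Poly_Mapping.single i (coef (coef x i) j)))"

lemma coef_exchange:
  "coef (coef (exchange x) j) i = (if j \<ge> 0 then coef (coef x i) (nat j) else 0)"
proof -
  have "coef (coef (exchange x) j) i = (\<Sum>i'\<in>Poly_Mapping.keys x. \<Sum>j'\<in>Poly_Mapping.keys (coef x i').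
      if i' = i then (if int j' = j then coef (coef x i) j' else 0) else 0)"
    unfolding exchange_def lookup_sum
    by (intro sum.cong refl) (auto simp: lookup_single when_def)
  also have "\<dots> = (\<Sum>i'\<in>Poly_Mapping.keys x. if i' = i then
      (\<Sum>j'\<in>Poly_Mapping.keys (coef x i). if int j' = j then coef (coef x i) j' else 0) else 0)"
    by (intro sum.cong refl) auto
  also have "\<dots> = (\<Sum>j'\<in>Poly_Mapping.keys (coef x i). if int j' = j then coef (coef x i) j' else 0)"
    by (auto simp: in_keys_iff)
  also have "\<dots> = (if j \<ge> 0 then coef (coef x i) (nat j) else 0)"
  proof (cases "j \<ge> 0")
    case True
    then have "(\<Sum>j'\<in>Poly_Mapping.keys (coef x i). if int j' = j then coef (coef x i) j' else 0)
        = (\<Sum>j'\<in>Poly_Mapping.keys (coef x i). if j' = nat j then coef (coef x i) (nat j) else 0)"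
      by (intro sum.cong refl) auto
    also have "\<dots> = coef (coef x i) (nat j)" by (auto simp: in_keys_iff)
    finally show ?thesis using True by simp
  qed (auto intro!: sum.neutral)
  finally show ?thesis .
qed

lemma exchange_eqI:
  assumes "\<And>i j. coef (coef (y :: int \<Rightarrow>\<^sub>0 (int \<Rightarrow>\<^sub>0 'u::comm_ring_1)) j) i = coef (coef z j) i"
  shows "y = z"
  using assms by (intro poly_mapping_eqI)

lemma exchange_inject: "exchange x = exchange y \<longleftrightarrow> x = y"
proof
  assume e: "exchange x = exchange y"
  have "coef (coef x i) j = coef (coef y i) j" for i j
    using coef_exchange[of x "int j" i] coef_exchange[of y "int j" i] e by simp
  then show "x = y" by (intro poly_mapping_eqI)
qed simp

lemma exchange_add: "exchange (x + y) = exchange x + exchange y"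
  by (rule exchange_eqI) (simp add: coef_exchange lookup_add)

lemma exchange_diff: "exchange (x - y) = exchange x - exchange y"
  by (rule exchange_eqI) (simp add: coef_exchange lookup_minus)

lemma exchange_one: "exchange 1 = 1"
  by (rule exchange_eqI) (auto simp: coef_exchange lookup_one when_def)

lemma exchange_sum: "exchange (sum h I) = (\<Sum>i\<in>I. exchange (h i))"
proof (induction I rule: infinite_finite_induct)
  have "exchange 0 = (0 :: int \<Rightarrow>\<^sub>0 (int \<Rightarrow>\<^sub>0 'a))" by (rule exchange_eqI) (simp add: coef_exchange)
  then show "infinite I \<Longrightarrow> exchange (sum h I) = (\<Sum>i\<in>I. exchange (h i))" for I by simp
  show "exchange (sum h {}) = (\<Sum>i\<in>{}. exchange (h i))" by (rule exchange_eqI) (simp add: coef_exchange)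
qed (simp add: exchange_add)

lemma exchange_mult: "exchange (x * y) = exchange x * exchange y"
proof (rule exchange_eqI)
  fix i j
  let ?K = "Poly_Mapping.keys x"
  have sub: "Poly_Mapping.keys (coef (exchange x) b) \<subseteq> ?K" for b
    by (auto simp: in_keys_iff coef_exchange split: if_splits)
  let ?B = "Poly_Mapping.keys (exchange x) \<union> {0..j}"
  have "coef (coef (exchange x * exchange y) j) i
      = (\<Sum>b\<in>?B. \<Sum>a\<in>?K. coef (coef (exchange x) b) a * coef (coef (exchange y) (j - b)) (i - a))"
    by (subst coef_mult_superset[of ?B]) (auto simp: lookup_sum coef_mult_superset[OF _ sub])
  also have "\<dots> = (\<Sum>b\<in>{0..j}. \<Sum>a\<in>?K. coef (coef (exchange x) b) a * coef (coef (exchange y) (j - b)) (i - a))"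
    by (intro sum.mono_neutral_right) (auto simp: coef_exchange)
  also have "\<dots> = (\<Sum>a\<in>?K. \<Sum>b\<in>{0..j}. coef (coef x a) (nat b) * coef (coef y (i - a)) (nat (j - b)))"
    by (subst sum.swap) (auto simp: coef_exchange intro!: sum.cong)
  finally have R: "coef (coef (exchange x * exchange y) j) i
    = (\<Sum>a\<in>?K. \<Sum>b\<in>{0..j}. coef (coef x a) (nat b) * coef (coef y (i - a)) (nat (j - b)))" .
  show "coef (coef (exchange (x * y)) j) i = coef (coef (exchange x * exchange y) j) i"
  proof (cases "j \<ge> 0")
    case True
    have "coef (coef (x * y) i) (nat j) = (\<Sum>a\<in>?K. \<Sum>b\<le>nat j. coef (coef x a) b * coef (coef y (i - a)) (nat j - b))"
      by (simp add: coef_mult_keys lookup_sum coef_mult_nat)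
    also have "\<dots> = (\<Sum>a\<in>?K. \<Sum>b\<in>{0..j}. coef (coef x a) (nat b) * coef (coef y (i - a)) (nat (j - b)))"
    proof (rule sum.cong[OF refl])
      fix a
      show "(\<Sum>b\<le>nat j. coef (coef x a) b * coef (coef y (i - a)) (nat j - b))
          = (\<Sum>b\<in>{0..j}. coef (coef x a) (nat b) * coef (coef y (i - a)) (nat (j - b)))"
        using True by (intro sum.reindex_bij_witness[of _ nat int]) (auto simp: nat_diff_distrib)
    qed
    finally show ?thesis using True R by (simp add: coef_exchange)
  next
    case False
    then show ?thesis by (simp add: R coef_exchange)
  qed
qed

text \<open>After the exchange, \<open>at_one\<close> is the substitution \<open>T = 1\<close>,
  which adds up the coefficients of each inner polynomial.\<close>

lemma coef_at_one_exchange: "coef (at_one (exchange x)) i = (\<Sum>j\<in>Poly_Mapping.keys (coef x i). coef (coef x i) j)"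
proof -
  let ?B = "Poly_Mapping.keys (exchange x) \<union> int ` Poly_Mapping.keys (coef x i)"
  have "coef (at_one (exchange x)) i = (\<Sum>b\<in>?B. coef (coef (exchange x) b) i)"
    by (simp add: at_one_superset[of ?B] lookup_sum)
  also have "\<dots> = (\<Sum>b\<in>int ` Poly_Mapping.keys (coef x i). coef (coef (exchange x) b) i)"
  proof (rule sum.mono_neutral_right)
    show "\<forall>b\<in>?B - int ` Poly_Mapping.keys (coef x i). coef (coef (exchange x) b) i = 0"
    proof
      fix b assume b: "b \<in> ?B - int ` Poly_Mapping.keys (coef x i)"
      show "coef (coef (exchange x) b) i = 0"
      proof (cases "b \<ge> 0")
        case True
        then have "b = int (nat b)" by simp
        then have "nat b \<notin> Poly_Mapping.keys (coef x i)" using b by blast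
        then show ?thesis by (simp add: coef_exchange in_keys_iff)
      qed (simp add: coef_exchange)
    qed
  qed auto
  also have "\<dots> = (\<Sum>j\<in>Poly_Mapping.keys (coef x i). coef (coef x i) j)"
    by (subst sum.reindex) (auto simp: coef_exchange)
  finally show ?thesis .
qed

definition embed_const :: "(int \<Rightarrow>\<^sub>0 'u::comm_ring_1) \<Rightarrow> (int \<Rightarrow>\<^sub>0 (nat \<Rightarrow>\<^sub>0 'u))" where
  "embed_const f = (\<Sum>k\<in>Poly_Mapping.keys f. Poly_Mapping.single k (Poly_Mapping.single 0 (coef f k)))"

lemma coef_embed_const: "coef (embed_const f) i = Poly_Mapping.single 0 (coef f i)"
proof -
  have "coef (embed_const f) i = (\<Sum>k\<in>Poly_Mapping.keys f. if k = i then Poly_Mapping.single 0 (coef f i) else 0)"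
    unfolding embed_const_def lookup_sum by (intro sum.cong refl) (auto simp: lookup_single when_def)
  then show ?thesis by (auto simp: in_keys_iff)
qed

lemma exchange_embed_const: "exchange (embed_const f) = const f"
  by (rule exchange_eqI) (auto simp: coef_exchange coef_embed_const lookup_single when_def)

text \<open>Transferred from \<open>const\<close> through the injective homomorphism
  \<open>exchange\<close>.\<close>

lemma embed_const_hom:
  "embed_const (f + g) = embed_const f + embed_const g"
  "embed_const (f * g) = embed_const f * embed_const g" "embed_const 1 = 1"
  by (simp_all add: exchange_inject[symmetric] exchange_add exchange_mult exchange_embed_const
      exchange_one single_add const_mult del: mult_single)

section \<open>Quotients by a retract\<close>

text \<open>\<open>\<iota>\<close> embeds \<open>H\<close> as a direct factor of \<open>G\<close>
  whose complement is the kernel of \<open>\<epsilon>\<close>; statements about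
  \<open>G Mod N\<close> become statements about this kernel.\<close>

locale group_retract = G: comm_group G + H: comm_group H
  for G (structure) and H and \<iota> \<epsilon> +
  assumes \<iota>: "\<iota> \<in> hom H G" and \<epsilon>: "\<epsilon> \<in> hom G H" and \<epsilon>\<iota>: "\<And>x. x \<in> carrier H \<Longrightarrow> \<epsilon> (\<iota> x) = x"
begin

sublocale I: group_hom H G \<iota> using \<iota> by unfold_locales
sublocale E: group_hom G H \<epsilon> using \<epsilon> by unfold_locales

abbreviation "N \<equiv> \<iota> ` carrier H"

lemma N_subgroup: "subgroup N G" by (rule I.img_is_subgroup)

lemma N_normal: "N \<lhd> G" using N_subgroup by (simp add: G.normal_iff_subgroup)

lemma quotient_comm_group: "comm_group (G Mod N)" by (rule G.abelian_FactGroup[OF N_subgroup])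

definition reduce where "reduce x = x \<otimes> inv (\<iota> (\<epsilon> x))"

lemma reduce: "x \<in> carrier G \<Longrightarrow> reduce x \<in> carrier G" "x \<in> carrier G \<Longrightarrow> \<epsilon> (reduce x) = \<one>\<^bsub>H\<^esub>"
  by (simp_all add: reduce_def \<epsilon>\<iota>)

lemma reduce_eq: "x \<in> carrier G \<Longrightarrow> x = reduce x \<otimes> \<iota> (\<epsilon> x)"
  by (simp add: reduce_def G.m_assoc)

lemma in_N_and_kernel: "x \<in> N \<Longrightarrow> \<epsilon> x = \<one>\<^bsub>H\<^esub> \<Longrightarrow> x = \<one>"
  using \<epsilon>\<iota> by auto

lemma coset_eq_N: "x \<in> carrier G \<Longrightarrow> N #> x = N \<longleftrightarrow> x \<in> N"
  using G.coset_join1[OF _ _ N_subgroup] G.coset_join2[OF _ N_subgroup] subgroup.subset[OF N_subgroup] by blast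

lemma in_N_iff_reduce: "x \<in> carrier G \<Longrightarrow> x \<in> N \<longleftrightarrow> reduce x = \<one>"
proof
  assume x: "x \<in> carrier G"
  show "x \<in> N" if "reduce x = \<one>" using reduce_eq[OF x] that x by auto
  assume "x \<in> N"
  then have "reduce x \<in> N" unfolding reduce_def
    using x by (intro subgroup.m_closed[OF N_subgroup] subgroup.m_inv_closed[OF N_subgroup]) auto
  then show "reduce x = \<one>" using reduce(2)[OF x] by (rule in_N_and_kernel)
qed

text \<open>A coset is represented by its reduced element in the kernel of
  \<open>\<epsilon>\<close>. If a power of it falls into \<open>N\<close>, that power lies in both
  direct factors and is trivial.\<close>

lemma quotient_torsion_free:
  assumes "\<And>x m. x \<in> carrier G \<Longrightarrow> \<epsilon> x = \<one>\<^bsub>H\<^esub> \<Longrightarrow> m > 0 \<Longrightarrow> x [^] (m::nat) = \<one> \<Longrightarrow> x = \<one>"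
  shows "torsion_free_abelian (G Mod N)"
  unfolding torsion_free_abelian_def
proof (intro conjI ballI allI impI quotient_comm_group)
  fix y and m :: nat
  assume "y \<in> carrier (G Mod N)" and m: "0 < m \<and> y [^]\<^bsub>G Mod N\<^esub> m = \<one>\<^bsub>G Mod N\<^esub>"
  then obtain x where x: "x \<in> carrier G" "y = N #> x" by (auto simp: carrier_FactGroup)
  have "N #> (x [^] m) = N"
    using m normal.FactGroup_pow[OF N_normal x(1), of m] x(2) by simp
  then have xm: "x [^] m \<in> N" using coset_eq_N[of "x [^] m"] x by simp
  have "reduce x [^] m = x [^] m \<otimes> inv (\<iota> (\<epsilon> x)) [^] m"
    using x by (simp add: reduce_def G.nat_pow_distrib)
  also have "\<dots> \<in> N"
  proof (rule subgroup.m_closed[OF N_subgroup xm])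
    have "inv (\<iota> (\<epsilon> x)) \<in> N" using x by (intro subgroup.m_inv_closed[OF N_subgroup]) auto
    then show "inv (\<iota> (\<epsilon> x)) [^] m \<in> N"
      by (induction m) (auto intro: subgroup.one_closed[OF N_subgroup] subgroup.m_closed[OF N_subgroup])
  qed
  finally have "reduce x [^] m \<in> N" .
  moreover have "\<epsilon> (reduce x [^] m) = \<one>\<^bsub>H\<^esub>" using reduce[OF x(1)] by (simp add: E.hom_nat_pow)
  ultimately have "reduce x [^] m = \<one>" by (rule in_N_and_kernel)
  then have "reduce x = \<one>" using assms reduce[OF x(1)] m by blast
  then have "x \<in> N" using in_N_iff_reduce[OF x(1)] by simp
  then show "y = \<one>\<^bsub>G Mod N\<^esub>" using coset_eq_N[OF x(1)] x(2) by simp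
qed

end

text \<open>A retraction \<open>\<beta>\<close> with trivial kernel makes \<open>\<alpha>\<close>
  bijective; compatibility of both maps with the subgroups then passes the bijection to the
  quotients.\<close>

lemma quotient_iso:
  assumes G: "comm_group G" and G': "comm_group G'" and N: "subgroup N G" and N': "subgroup N' G'"
    and \<alpha>: "\<alpha> \<in> hom G G'" and \<beta>: "\<beta> \<in> hom G' G" and \<beta>\<alpha>: "\<And>x. x \<in> carrier G \<Longrightarrow> \<beta> (\<alpha> x) = x"
    and ker: "\<And>y. y \<in> carrier G' \<Longrightarrow> \<beta> y = \<one>\<^bsub>G\<^esub> \<Longrightarrow> y = \<one>\<^bsub>G'\<^esub>"
    and maps: "\<alpha> ` N \<subseteq> N'" "\<beta> ` N' \<subseteq> N"
  shows "G Mod N \<cong> G' Mod N'"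
proof -
  interpret R: group_retract G' G \<alpha> \<beta>
    using assms by (intro group_retract.intro group_retract_axioms.intro) auto
  have normal: "N' \<lhd> G'" using N' by (simp add: R.G.normal_iff_subgroup)
  have surj: "\<exists>x\<in>carrier G. y = \<alpha> x" if y: "y \<in> carrier G'" for y
  proof
    have "R.reduce y = \<one>\<^bsub>G'\<^esub>" using R.reduce[OF y] ker by blast
    then show "y = \<alpha> (\<beta> y)" using R.reduce_eq[OF y] y by simp
  qed (use y in simp)
  let ?h = "\<lambda>x. N' #>\<^bsub>G'\<^esub> \<alpha> x"
  have "?h \<in> hom G (G' Mod N')"
    using hom_compose[OF \<alpha> normal.r_coset_hom_Mod[OF normal]] by (simp add: o_def)
  then interpret h: group_hom G "G' Mod N'" ?h
    using R.H.group_axioms normal.factorgroup_is_group[OF normal]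
    by (intro group_hom.intro group_hom_axioms.intro)
  have in_N': "N' #>\<^bsub>G'\<^esub> y = N' \<longleftrightarrow> y \<in> N'" if "y \<in> carrier G'" for y
    using R.G.coset_join1[OF _ that N'] R.G.coset_join2[OF that N'] subgroup.subset[OF N'] by blast
  have "kernel G (G' Mod N') ?h = N"
  proof -
    have \<alpha>N: "\<alpha> x \<in> N' \<longleftrightarrow> x \<in> N" if "x \<in> carrier G" for x
      using maps \<beta>\<alpha>[OF that] by (metis image_subset_iff)
    have "x \<in> kernel G (G' Mod N') ?h \<longleftrightarrow> x \<in> N" for x
    proof (cases "x \<in> carrier G")
      case True
      have "N' #>\<^bsub>G'\<^esub> \<alpha> x = N' \<longleftrightarrow> \<alpha> x \<in> N'" by (rule in_N'[OF R.I.hom_closed[OF True]])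
      then show ?thesis using \<alpha>N[OF True] True by (simp add: kernel_def)
    next
      case False
      then show ?thesis using subgroup.subset[OF N] by (auto simp only: kernel_def)
    qed
    then show ?thesis by blast
  qed
  moreover have "?h ` carrier G = carrier (G' Mod N')"
  proof
    show "?h ` carrier G \<subseteq> carrier (G' Mod N')" by auto
    show "carrier (G' Mod N') \<subseteq> ?h ` carrier G" using surj by (auto simp: carrier_FactGroup)
  qed
  ultimately show ?thesis using h.FactGroup_iso by simp
qed

lemma LP_retract:
  assumes c: "cover \<pi> B" and A: "subcring A B"
  shows "group_retract (inv_submodules (LP_sub A B) (LP B)) (inv_submodules A B)
    (LP_extend A B) (extend_module (LP_eval B) A B)"
proof (intro group_retract.intro group_retract_axioms.intro)
  interpret B: ring_extension A B by (rule ring_extension_of_cover[OF c A])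
  interpret L: ring_extension "LP_sub A B" "LP B" by (rule ring_extension_LP[OF c A])
  show "comm_group (inv_submodules (LP_sub A B) (LP B))" by (rule L.inv_submodules_group)
  show "comm_group (inv_submodules A B)" by (rule B.inv_submodules_group)
  show "LP_extend A B \<in> hom (inv_submodules A B) (inv_submodules (LP_sub A B) (LP B))"
    unfolding LP_extend_eq by (rule extension_hom.extend_hom[OF extension_hom_LP_const[OF c A]])
  show "extend_module (LP_eval B) A B \<in> hom (inv_submodules (LP_sub A B) (LP B)) (inv_submodules A B)"
    by (rule extension_hom.extend_hom[OF extension_hom_LP_eval[OF c A]])
  show "extend_module (LP_eval B) A B (LP_extend A B I) = I" if "I \<in> carrier (inv_submodules A B)" for I
    using that LP_eval_extend[OF c A] by (simp add: inv_submodules_simps)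
qed

lemma exists_normalised_module:
  assumes c: "cover \<pi> B" and A: "subcring A B"
    and I: "I \<in> carrier (inv_submodules (LP_sub A B) (LP B))"
    and I1: "extend_module (LP_eval B) A B I = A"
  shows "\<exists>J. normalised_module \<pi> B A I J"
  using assms by (auto simp: inv_submodules_simps invertible_submodule_def normalised_module_def)

theorem MI_torsion_free:
  assumes c: "cover \<pi> B" and A: "subcring A B" and si: "subintegrally_closed A B"
  shows "torsion_free_abelian (MI A B)"
proof -
  interpret group_retract "inv_submodules (LP_sub A B) (LP B)" "inv_submodules A B"
    "LP_extend A B" "extend_module (LP_eval B) A B" by (rule LP_retract[OF c A])
  show ?thesis unfolding MI_def
  proof (rule quotient_torsion_free)
    fix I and m :: nat
    assume I: "I \<in> carrier (inv_submodules (LP_sub A B) (LP B))"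
      and e: "extend_module (LP_eval B) A B I = \<one>\<^bsub>inv_submodules A B\<^esub>" and m: "m > 0"
      and p: "I [^]\<^bsub>inv_submodules (LP_sub A B) (LP B)\<^esub> m = \<one>\<^bsub>inv_submodules (LP_sub A B) (LP B)\<^esub>"
    obtain J where "normalised_module \<pi> B A I J"
      using exists_normalised_module[OF c A I] e by (auto simp: inv_submodules_simps)
    then have "I = LP_sub A B"
      using normalised_module.torsion_trivial[OF _ si m] p by (simp add: inv_submodules_simps)
    then show "I = \<one>\<^bsub>inv_submodules (LP_sub A B) (LP B)\<^esub>" by (simp add: inv_submodules_simps)
  qed
qed

section \<open>Polynomial extensions\<close>

definition UP_const :: "('a, 'b) ring_scheme \<Rightarrow> 'a \<Rightarrow> nat \<Rightarrow> 'a" where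
  "UP_const R a = (\<lambda>n. if n = 0 then a else \<zero>\<^bsub>R\<^esub>)"

definition UP_eval :: "('a, 'b) ring_scheme \<Rightarrow> (nat \<Rightarrow> 'a) \<Rightarrow> 'a" where
  "UP_eval R p = (\<Oplus>\<^bsub>R\<^esub>k\<in>{k. p k \<noteq> \<zero>\<^bsub>R\<^esub>}. p k)"

definition coef_sum :: "(nat \<Rightarrow>\<^sub>0 'u::comm_ring_1) \<Rightarrow> 'u" where
  "coef_sum f = (\<Sum>k\<in>Poly_Mapping.keys f. coef f k)"

lemma at_one_exchange_const: "at_one (exchange (Poly_Mapping.single 0 f)) = const (coef_sum f)"
  by (rule poly_mapping_eqI) (auto simp: coef_at_one_exchange lookup_single when_def coef_sum_def)

lemma coef_at_one_exchange': "coef (at_one (exchange x)) i = coef_sum (coef x i)"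
  by (simp add: coef_at_one_exchange coef_sum_def)

text \<open>Deduced from \<open>at_one\<close> by way of \<open>exchange\<close> on constants, which
  avoids a second convolution computation.\<close>

lemma coef_sum_hom:
  fixes f g :: "nat \<Rightarrow>\<^sub>0 'u::comm_ring_1"
  shows "coef_sum (f + g) = coef_sum f + coef_sum g" "coef_sum (f * g) = coef_sum f * coef_sum g"
    "coef_sum (1 :: nat \<Rightarrow>\<^sub>0 'u) = 1"
proof -
  have inj: "x = y" if "const x = const y" for x y :: 'u using that by (metis lookup_single_eq)
  have "const (coef_sum (f + g)) = const (coef_sum f + coef_sum g)"
    by (simp add: at_one_exchange_const[symmetric] single_add exchange_add at_one_add)
  then show "coef_sum (f + g) = coef_sum f + coef_sum g" by (rule inj)
  have "Poly_Mapping.single (0::int) (f * g) = Poly_Mapping.single 0 f * Poly_Mapping.single 0 g"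
    by (simp add: mult_single)
  then have "const (coef_sum (f * g)) = const (coef_sum f * coef_sum g)"
    by (simp add: at_one_exchange_const[symmetric] const_mult exchange_mult at_one_mult del: mult_single)
  then show "coef_sum (f * g) = coef_sum f * coef_sum g" by (rule inj)
  show "coef_sum (1 :: nat \<Rightarrow>\<^sub>0 'u) = 1" by (simp add: coef_sum_def)
qed

lemma UP_eval_up_map:
  assumes c: "cover \<pi> R" shows "UP_eval R (up_map \<pi> f) = \<pi> (coef_sum f)"
proof -
  interpret cring R by (rule cover_cring[OF c])
  have "\<pi> (coef_sum f) = (\<Oplus>\<^bsub>R\<^esub>k\<in>Poly_Mapping.keys f. \<pi> (coef f k))"
    by (simp add: coef_sum_def cover_sum[OF c])
  also have "\<dots> = (\<Oplus>\<^bsub>R\<^esub>k\<in>{k. \<pi> (coef f k) \<noteq> \<zero>\<^bsub>R\<^esub>}. \<pi> (coef f k))"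
    by (rule add.finprod_mono_neutral_cong_left[symmetric])
      (use cover_in[OF c] cover_simps[OF c] in \<open>auto simp: in_keys_iff\<close>)
  finally show ?thesis by (simp add: UP_eval_def up_map_def)
qed

lemma UP_const_cover:
  assumes c: "cover \<pi> R" shows "UP_const R (\<pi> x) = up_map \<pi> (Poly_Mapping.single 0 x)"
  by (auto simp: UP_const_def up_map_def lookup_single when_def cover_simps[OF c])

locale covered_extension =
  fixes \<pi> :: "'u::comm_ring_1 \<Rightarrow> 'a" and B :: "('a, 'b) ring_scheme" and A
  assumes c: "cover \<pi> B" and A: "subcring A B"
begin

abbreviation "P \<equiv> poly_sub A B"

lemma cu: "cover (up_map \<pi>) (UP B)" by (rule cover_up_map[OF c])

lemma subcring_P: "subcring P (UP B)"
proof (rule subcring_by_cover[OF c A cu])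
  show "P \<subseteq> carrier (UP B)" using subcringE(1)[OF A] by (auto simp: poly_sub_def carrier_UP)
  have "up_map \<pi> -` P = {f. \<forall>k. coef f k \<in> \<pi> -` A}" using up_map_in_poly_sub[OF c A] by auto
  moreover note S = ring_subset_closed[OF ring_subset_preimage[OF c A]]
  have "ring_subset {f :: nat \<Rightarrow>\<^sub>0 'u. \<forall>k. coef f k \<in> \<pi> -` A}"
    unfolding ring_subset_def
  proof (intro conjI ballI)
    show "1 \<in> {f :: nat \<Rightarrow>\<^sub>0 'u. \<forall>k. coef f k \<in> \<pi> -` A}"
      using S(1,2) by (auto simp: lookup_one when_def)
    fix f g :: "nat \<Rightarrow>\<^sub>0 'u"
    assume f: "f \<in> {f. \<forall>k. coef f k \<in> \<pi> -` A}" and g: "g \<in> {f. \<forall>k. coef f k \<in> \<pi> -` A}"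
    have "coef (f - g) k \<in> \<pi> -` A" "coef (f * g) k \<in> \<pi> -` A" for k
      unfolding lookup_minus coef_mult_nat using f g by (intro S(3) S(8) S(4); blast)+
    then show "f - g \<in> {f. \<forall>k. coef f k \<in> \<pi> -` A}" "f * g \<in> {f. \<forall>k. coef f k \<in> \<pi> -` A}" by auto
  qed
  ultimately show "ring_subset (up_map \<pi> -` P)" by simp
qed

text \<open>Both maps act on coefficients: \<open>\<alpha>\<close> is the inclusion of Laurent
  polynomials over \<open>B\<close> into those over \<open>B[T]\<close>, and \<open>\<beta>\<close>
  is the substitution \<open>T = 1\<close>.\<close>

definition \<alpha> where "\<alpha> p = (\<lambda>i::int. UP_const B (p i))"
definition \<beta> where "\<beta> q = (\<lambda>i::int. UP_eval B (q i))"

abbreviation "l \<equiv> lp_map \<pi>"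
abbreviation "l2 \<equiv> lp_map (up_map \<pi>)"

lemma cl: "cover l (LP B)" by (rule cover_lp_map[OF c])
lemma cl2: "cover l2 (LP (UP B))" by (rule cover_lp_map[OF cu])

lemma \<alpha>_l: "\<alpha> (l f) = l2 (embed_const f)"
  by (simp add: fun_eq_iff \<alpha>_def lp_map_def coef_embed_const UP_const_cover[OF c])

lemma \<beta>_l2: "\<beta> (l2 x) = l (at_one (exchange x))"
  by (simp add: fun_eq_iff \<beta>_def lp_map_def coef_at_one_exchange' UP_eval_up_map[OF c])

lemma l2_in: "l2 x \<in> LP_sub P (UP B) \<longleftrightarrow> exchange x \<in> coeffs_in (coeffs_in (\<pi> -` A))"
proof -
  have "l2 x \<in> LP_sub P (UP B) \<longleftrightarrow> (\<forall>i j. \<pi> (coef (coef x i) j) \<in> A)"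
    using lp_map_in_LP_sub[OF cu subcring_P] up_map_in_poly_sub[OF c A] by (auto simp: coeffs_in_def)
  also have "\<dots> \<longleftrightarrow> exchange x \<in> coeffs_in (coeffs_in (\<pi> -` A))"
  proof
    assume "\<forall>i j. \<pi> (coef (coef x i) j) \<in> A"
    then show "exchange x \<in> coeffs_in (coeffs_in (\<pi> -` A))"
      using ring_subset_zero[OF ring_subset_preimage[OF c A]]
      by (intro coeffs_inI) (auto simp: coef_exchange)
  next
    assume *: "exchange x \<in> coeffs_in (coeffs_in (\<pi> -` A))"
    have "coef (coef (exchange x) (int j)) i \<in> \<pi> -` A" for i j by (intro coeffs_inD *)
    then show "\<forall>i j. \<pi> (coef (coef x i) j) \<in> A" by (simp add: coef_exchange)
  qed
  finally show ?thesis .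
qed

sublocale X\<alpha>: extension_hom "LP_sub A B" "LP B" "LP_sub P (UP B)" "LP (UP B)" \<alpha>
proof (intro extension_hom.intro ring_extension_LP[OF c A] ring_extension_LP[OF cu subcring_P] extension_hom_axioms.intro)
  show "\<alpha> \<in> ring_hom (LP B) (LP (UP B))"
    by (rule ring_hom_by_cover[OF cl]) (simp_all add: \<alpha>_l embed_const_hom cover_simps[OF cl2] cover_in[OF cl2])
  show "\<alpha> ` LP_sub A B \<subseteq> LP_sub P (UP B)"
  proof clarify
    fix p assume p: "p \<in> LP_sub A B"
    then obtain f where f: "p = l f" using cover_obtain[OF cl] subcringE(1)[OF subcring_LP_sub[OF c A]] by blast
    then have "f \<in> coeffs_in (\<pi> -` A)" using p lp_map_in_LP_sub[OF c A] by simp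
    then have "const f \<in> coeffs_in (coeffs_in (\<pi> -` A))"
      using ring_subset_zero[OF ring_subset_coeffs_in[OF ring_subset_preimage[OF c A]]]
      by (intro single_in_coeffs_in)
    then show "\<alpha> p \<in> LP_sub P (UP B)" by (simp add: f \<alpha>_l l2_in exchange_embed_const)
  qed
qed

sublocale X\<beta>: extension_hom "LP_sub P (UP B)" "LP (UP B)" "LP_sub A B" "LP B" \<beta>
proof (intro extension_hom.intro ring_extension_LP[OF c A] ring_extension_LP[OF cu subcring_P] extension_hom_axioms.intro)
  show "\<beta> \<in> ring_hom (LP (UP B)) (LP B)"
    by (rule ring_hom_by_cover[OF cl2])
      (simp_all add: \<beta>_l2 exchange_add exchange_mult exchange_one at_one_add at_one_mult
        cover_simps[OF cl] cover_in[OF cl])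
  show "\<beta> ` LP_sub P (UP B) \<subseteq> LP_sub A B"
  proof clarify
    fix p assume p: "p \<in> LP_sub P (UP B)"
    then obtain x where x: "p = l2 x"
      using cover_obtain[OF cl2] subcringE(1)[OF subcring_LP_sub[OF cu subcring_P]] by blast
    then have "at_one (exchange x) \<in> coeffs_in (\<pi> -` A)"
      using p l2_in by (intro at_one_in[OF ring_subset_coeffs_in[OF ring_subset_preimage[OF c A]]]) auto
    then show "\<beta> p \<in> LP_sub A B" by (simp add: x \<beta>_l2 lp_map_in_LP_sub[OF c A])
  qed
qed

lemma UP_const_hom: "extension_hom A B P (UP B) (UP_const B)"
proof (intro extension_hom.intro ring_extension_of_cover[OF c A] ring_extension_of_cover[OF cu subcring_P] extension_hom_axioms.intro)
  show "UP_const B \<in> ring_hom B (UP B)"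
    by (rule ring_hom_by_cover[OF c])
      (simp_all add: UP_const_cover[OF c] cover_in[OF cu] cover_simps[OF cu, symmetric] single_add mult_single)
  show "UP_const B ` A \<subseteq> P" using subcringE(2)[OF A] by (auto simp: UP_const_def poly_sub_def carrier_UP)
qed

lemma UP_eval_hom: "extension_hom P (UP B) A B (UP_eval B)"
proof (intro extension_hom.intro ring_extension_of_cover[OF c A] ring_extension_of_cover[OF cu subcring_P] extension_hom_axioms.intro)
  show "UP_eval B \<in> ring_hom (UP B) B"
    by (rule ring_hom_by_cover[OF cu])
      (simp_all add: UP_eval_up_map[OF c] cover_in[OF c] cover_simps[OF c] coef_sum_hom)
  show "UP_eval B ` P \<subseteq> A"
  proof clarify
    fix p assume p: "p \<in> P"
    then obtain x where x: "p = up_map \<pi> x" using cover_obtain[OF cu] subcringE(1)[OF subcring_P] by blast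
    then have "coef x k \<in> \<pi> -` A" for k using p up_map_in_poly_sub[OF c A] by auto
    then have "coef_sum x \<in> \<pi> -` A" unfolding coef_sum_def
      by (intro ring_subset_sum[OF ring_subset_preimage[OF c A]])
    then show "UP_eval B p \<in> A" by (simp add: x UP_eval_up_map[OF c])
  qed
qed

text \<open>After the exchange the generators are polynomials in \<open>T\<close> over
  \<open>A[X,1/X]\<close>, their values at \<open>T = 1\<close> lie in this base ring by
  \<open>I1\<close>, and the base ring is again subintegrally closed. The criterion for pairs
  without negative exponents applies.\<close>

lemma \<beta>_kernel:
  assumes si: "subintegrally_closed A B"
    and I: "invertible_submodule (LP_sub P (UP B)) (LP (UP B)) I"
    and I1: "extend_module \<beta> (LP_sub A B) (LP B) I = LP_sub A B"
  shows "I = LP_sub P (UP B)"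
proof -
  obtain J where IJ: "subalgebra (LP_sub P (UP B)) I (LP (UP B))" "subalgebra (LP_sub P (UP B)) J (LP (UP B))"
    "ideal_prod (LP (UP B)) I J = LP_sub P (UP B)" using I by (auto simp: invertible_submodule_def)
  note Ic = subalgebraD(1)[OF IJ(1)] and Jc = subalgebraD(1)[OF IJ(2)]
  have "LP_sub A B = ideal_prod (LP B) (LP_sub A B) (extend_module \<beta> (LP_sub A B) (LP B) J)"
    using X\<beta>.extend_mult[OF Ic Jc] X\<beta>.extend_A IJ(3) I1 by simp
  also have "\<dots> = extend_module \<beta> (LP_sub A B) (LP B) J"
    by (rule ring_extension.A_prod[OF ring_extension_LP[OF c A] X\<beta>.extend_subalgebra[OF IJ(2)]])
  finally have J1: "extend_module \<beta> (LP_sub A B) (LP B) J = LP_sub A B" by simp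
  have "\<one>\<^bsub>LP (UP B)\<^esub> \<in> ideal_prod (LP (UP B)) I J" using IJ(3) ring_extension.one_in_A[OF ring_extension_LP[OF cu subcring_P]] by simp
  from ideal_prod_lifts[OF cl2 Ic Jc this] obtain n :: nat and x y where
    xy: "\<forall>i<n. l2 (x i) \<in> I \<and> l2 (y i) \<in> J" "\<one>\<^bsub>LP (UP B)\<^esub> = l2 (\<Sum>i<n. x i * y i)" by blast
  note RA = ring_subset_preimage[OF c A]
  let ?A = "coeffs_in (\<pi> -` A)" and ?N = "coeffs_in (\<pi> -` {\<zero>\<^bsub>B\<^esub>})"
  interpret Q: invertible_pair ?A ?N "\<lambda>i. exchange (x i)" "\<lambda>i. exchange (y i)" n
  proof
    show "ring_subset ?A" by (rule ring_subset_coeffs_in[OF RA])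
    show "ideal_in UNIV ?N"
      using ideal_in_coeffs_in[OF ring_subset_UNIV kernel_ideal[OF c A]] by (simp add: coeffs_in_def)
    show "?N \<subseteq> ?A" by (rule coeffs_in_mono[OF kernel_subset[OF c A]])
    show "exchange (x i) * exchange (y j) \<in> coeffs_in ?A" if "i < n" "j < n" for i j
    proof -
      have "l2 (x i * y j) \<in> LP_sub P (UP B)"
        using ideal_prod.prod[of "l2 (x i)" I "l2 (y j)" J "LP (UP B)"] xy that IJ(3)
        by (simp add: cover_simps[OF cl2])
      then show ?thesis by (simp add: l2_in exchange_mult)
    qed
    have "l2 ((\<Sum>i<n. x i * y i) - 1) = \<zero>\<^bsub>LP (UP B)\<^esub>"
      using xy(2) cover_eq_iff[OF cl2] cover_simps(4)[OF cl2] by metis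
    then have "\<pi> (coef (coef ((\<Sum>i<n. x i * y i) - 1) i) j) = \<zero>\<^bsub>B\<^esub>" for i j
      by (auto simp: LP_def lp_map_def up_map_def UP_def fun_eq_iff)
    then have "exchange ((\<Sum>i<n. x i * y i) - 1) \<in> coeffs_in ?N"
      using cover_simps(3)[OF c] by (intro coeffs_inI) (simp add: coef_exchange)
    then show "(\<Sum>i<n. exchange (x i) * exchange (y i)) - 1 \<in> coeffs_in ?N"
      by (simp add: exchange_diff exchange_sum exchange_mult exchange_one)
    show "at_one (exchange (x i)) \<in> ?A" if "i < n" for i
      using X\<beta>.extend_module_image[OF Ic] xy that I1
      by (auto simp: lp_map_in_LP_sub[OF c A, symmetric] \<beta>_l2[symmetric])
    show "at_one (exchange (y i)) \<in> ?A" if "i < n" for i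
      using X\<beta>.extend_module_image[OF Jc] xy that J1
      by (auto simp: lp_map_in_LP_sub[OF c A, symmetric] \<beta>_l2[symmetric])
  qed
  have pos: "coef (exchange z) k = 0" if "k < 0" for z :: "int \<Rightarrow>\<^sub>0 (nat \<Rightarrow>\<^sub>0 'u)" and k
    using that by (intro poly_mapping_eqI) (simp add: coef_exchange)
  note si' = subintegrally_closed_coeffs_in[OF RA subintegrally_closed_preimage[OF c A si]]
  note t = Q.polynomial_pair_trivial[OF si' pos pos]
  show ?thesis
    by (rule trivial_if_generators_in[OF ring_extension_LP[OF cu subcring_P] cl2 IJ _ _ _ _ xy(2)])
      (use xy(1) t in \<open>auto simp: l2_in\<close>)
qed

text \<open>The maps \<open>\<alpha>\<close> and \<open>\<beta>\<close> induce inverse bijections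
  between invertible modules of the two Laurent extensions; the inclusion of constants and the
  substitution \<open>T = 1\<close> on \<open>B[T]\<close> make them compatible with the subgroups
  that are factored out.\<close>

theorem MI_polynomial_iso:
  assumes si: "subintegrally_closed A B"
  shows "MI A B \<cong> MI P (UP B)"
proof -
  interpret G: group_retract "inv_submodules (LP_sub A B) (LP B)" "inv_submodules A B"
    "LP_extend A B" "extend_module (LP_eval B) A B" by (rule LP_retract[OF c A])
  interpret G': group_retract "inv_submodules (LP_sub P (UP B)) (LP (UP B))" "inv_submodules P (UP B)"
    "LP_extend P (UP B)" "extend_module (LP_eval (UP B)) P (UP B)" by (rule LP_retract[OF cu subcring_P])
  interpret K: extension_hom A B P "UP B" "UP_const B" by (rule UP_const_hom)
  interpret K': extension_hom P "UP B" A B "UP_eval B" by (rule UP_eval_hom)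
  note hB = extension_hom_LP_const[OF c A] and hU = extension_hom_LP_const[OF cu subcring_P]
  note X\<alpha> = X\<alpha>.extension_hom_axioms and X\<beta> = X\<beta>.extension_hom_axioms
  let ?a = "extend_module \<alpha> (LP_sub P (UP B)) (LP (UP B))"
  let ?b = "extend_module \<beta> (LP_sub A B) (LP B)"
  show ?thesis unfolding MI_def
  proof (rule quotient_iso[OF G.G.comm_group_axioms G'.G.comm_group_axioms G.N_subgroup G'.N_subgroup
        X\<alpha>.extend_hom X\<beta>.extend_hom])
    fix I assume "I \<in> carrier (inv_submodules (LP_sub A B) (LP B))"
    then have I: "subalgebra (LP_sub A B) I (LP B)"
      by (auto simp: inv_submodules_simps invertible_submodule_def)
    have "?b (?a I) = extend_module (\<beta> \<circ> \<alpha>) (LP_sub A B) (LP B) I"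
      by (rule extend_compose[OF X\<alpha> X\<beta> subalgebraD(1)[OF I]])
    also have "\<dots> = I"
    proof (rule X\<alpha>.B.extend_id[OF I])
      fix p assume "p \<in> I"
      then obtain f where "p = l f" using subalgebraD(1)[OF I] cover_obtain[OF cl] by blast
      then show "(\<beta> \<circ> \<alpha>) p = p" by (simp add: \<alpha>_l \<beta>_l2 exchange_embed_const)
    qed
    finally show "?b (?a I) = I" .
  next
    fix I assume "I \<in> carrier (inv_submodules (LP_sub P (UP B)) (LP (UP B)))"
      and "?b I = \<one>\<^bsub>inv_submodules (LP_sub A B) (LP B)\<^esub>"
    then show "I = \<one>\<^bsub>inv_submodules (LP_sub P (UP B)) (LP (UP B))\<^esub>"
      using \<beta>_kernel[OF si] by (simp add: inv_submodules_simps)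
  next
    show "?a ` LP_extend A B ` carrier (inv_submodules A B) \<subseteq> LP_extend P (UP B) ` carrier (inv_submodules P (UP B))"
    proof clarify
      fix I assume "I \<in> carrier (inv_submodules A B)"
      then have Iv: "invertible_submodule A B I" by (simp add: inv_submodules_simps)
      then have Ic: "I \<subseteq> carrier B" by (auto simp: invertible_submodule_def dest: subalgebraD)
      have "?a (LP_extend A B I) = extend_module (\<alpha> \<circ> LP_const B) (LP_sub P (UP B)) (LP (UP B)) I"
        unfolding LP_extend_eq by (rule extend_compose[OF hB X\<alpha> Ic])
      also have "\<dots> = extend_module (LP_const (UP B) \<circ> UP_const B) (LP_sub P (UP B)) (LP (UP B)) I"
      proof (rule extend_cong)
        fix b assume "b \<in> I"
        then obtain u where u: "b = \<pi> u" using Ic cover_obtain[OF c] by blast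
        have "embed_const (const u) = const (Poly_Mapping.single 0 u)"
          by (rule poly_mapping_eqI) (simp add: coef_embed_const lookup_single when_def)
        then show "(\<alpha> \<circ> LP_const B) b = (LP_const (UP B) \<circ> UP_const B) b"
          by (simp add: u LP_const_cover[OF c] LP_const_cover[OF cu] UP_const_cover[OF c] \<alpha>_l)
      qed
      also have "\<dots> = LP_extend P (UP B) (extend_module (UP_const B) P (UP B) I)"
        unfolding LP_extend_eq by (rule extend_compose[OF UP_const_hom hU Ic, symmetric])
      finally show "?a (LP_extend A B I) \<in> LP_extend P (UP B) ` carrier (inv_submodules P (UP B))"
        using K.extend_invertible[OF Iv] by (auto simp: inv_submodules_simps)
    qed
    show "?b ` LP_extend P (UP B) ` carrier (inv_submodules P (UP B)) \<subseteq> LP_extend A B ` carrier (inv_submodules A B)"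
    proof clarify
      fix I assume "I \<in> carrier (inv_submodules P (UP B))"
      then have Iv: "invertible_submodule P (UP B) I" by (simp add: inv_submodules_simps)
      then have Ic: "I \<subseteq> carrier (UP B)" by (auto simp: invertible_submodule_def dest: subalgebraD)
      have "?b (LP_extend P (UP B) I) = extend_module (\<beta> \<circ> LP_const (UP B)) (LP_sub A B) (LP B) I"
        unfolding LP_extend_eq by (rule extend_compose[OF hU X\<beta> Ic])
      also have "\<dots> = extend_module (LP_const B \<circ> UP_eval B) (LP_sub A B) (LP B) I"
      proof (rule extend_cong)
        fix b assume "b \<in> I"
        then obtain u where u: "b = up_map \<pi> u" using Ic cover_obtain[OF cu] by blast
        show "(\<beta> \<circ> LP_const (UP B)) b = (LP_const B \<circ> UP_eval B) b"
          by (simp add: u LP_const_cover[OF c] LP_const_cover[OF cu] UP_eval_up_map[OF c] \<beta>_l2 at_one_exchange_const)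
      qed
      also have "\<dots> = LP_extend A B (extend_module (UP_eval B) A B I)"
        unfolding LP_extend_eq by (rule extend_compose[OF UP_eval_hom hB Ic, symmetric])
      finally show "?b (LP_extend P (UP B) I) \<in> LP_extend A B ` carrier (inv_submodules A B)"
        using K'.extend_invertible[OF Iv] by (auto simp: inv_submodules_simps)
    qed
  qed
qed

end

section \<open>Local rings and idempotents\<close>

text \<open>Orthogonal nonzero idempotents with sum 1 whose factors are local, expressed through
  pairs of elements with sum 1. A list follows the recursion of \<open>RDirProd_list\<close>, and
  nonzero entries make it distinct.\<close>

definition splitting :: "('a, 'b) ring_scheme \<Rightarrow> 'a list \<Rightarrow> bool" where
  "splitting C es \<longleftrightarrow> set es \<subseteq> carrier C \<and> sorted_wrt (\<lambda>e e'. e \<otimes>\<^bsub>C\<^esub> e' = \<zero>\<^bsub>C\<^esub>) es \<and>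
     foldr (\<oplus>\<^bsub>C\<^esub>) es \<zero>\<^bsub>C\<^esub> = \<one>\<^bsub>C\<^esub> \<and>
     (\<forall>e\<in>set es. e \<otimes>\<^bsub>C\<^esub> e = e \<and> e \<noteq> \<zero>\<^bsub>C\<^esub> \<and>
        (\<forall>x\<in>carrier C. \<forall>x'\<in>carrier C. x \<oplus>\<^bsub>C\<^esub> x' = \<one>\<^bsub>C\<^esub> \<longrightarrow>
           (\<exists>y\<in>carrier C. x \<otimes>\<^bsub>C\<^esub> y = e \<or> x' \<otimes>\<^bsub>C\<^esub> y = e)))"

lemma maximalideal_image:
  assumes c: "cover \<pi> L" and M: "maximal_in UNIV M" and ker: "\<pi> -` {\<zero>\<^bsub>L\<^esub>} \<subseteq> M"
  shows "maximalideal (\<pi> ` M) L" and "\<And>x. \<pi> x \<in> \<pi> ` M \<Longrightarrow> x \<in> M"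
proof -
  interpret L: cring L by (rule cover_cring[OF c])
  note U = ring_subset_UNIV
  note I = maximal_in_ideal[OF M]
  show mem: "x \<in> M" if "\<pi> x \<in> \<pi> ` M" for x
  proof -
    from that obtain y where y: "y \<in> M" "\<pi> x = \<pi> y" by blast
    then have "x - y \<in> M" using ker cover_eq_iff[OF c, of x y] by auto
    from ideal_in_add[OF U I this y(1)] show ?thesis by simp
  qed
  have idealI: "ideal (\<pi> ` K) L" if K: "ideal_in UNIV K" for K
  proof (rule idealI[OF L.ring_axioms])
    show "subgroup (\<pi> ` K) (add_monoid L)"
    proof (rule L.add.subgroupI)
      show "\<pi> ` K \<subseteq> carrier L" using cover_in[OF c] by auto
      show "\<pi> ` K \<noteq> {}" using ideal_in_zero[OF U K] by auto
      fix a assume "a \<in> \<pi> ` K"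
      then obtain x where x: "x \<in> K" "a = \<pi> x" by blast
      then show "\<ominus>\<^bsub>L\<^esub> a \<in> \<pi> ` K"
        using ideal_in_uminus[OF U K x(1)] by (simp flip: cover_uminus[OF c])
      fix b assume "b \<in> \<pi> ` K"
      then obtain y where "y \<in> K" "b = \<pi> y" by blast
      then show "a \<oplus>\<^bsub>L\<^esub> b \<in> \<pi> ` K"
        using ideal_in_add[OF U K x(1)] x(2) by (simp flip: cover_simps(1)[OF c])
    qed
    fix a x assume "a \<in> \<pi> ` K" "x \<in> carrier L"
    then obtain b y where ab: "a = \<pi> b" "b \<in> K" "x = \<pi> y" using cover_obtain[OF c] by blast
    then have "\<pi> (y * b) \<in> \<pi> ` K" using ideal_in_lmult[OF U K _ ab(2), of y] by blast
    then show "x \<otimes>\<^bsub>L\<^esub> a \<in> \<pi> ` K" "a \<otimes>\<^bsub>L\<^esub> x \<in> \<pi> ` K"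
      using ab L.m_comm[of a x] cover_in[OF c] by (simp_all add: cover_simps[OF c])
  qed
  show "maximalideal (\<pi> ` M) L"
  proof (rule maximalidealI[OF idealI[OF I]])
    have "1 \<notin> M" using M by (simp add: maximal_in_def)
    then have "\<one>\<^bsub>L\<^esub> \<notin> \<pi> ` M" using mem[of 1] cover_simps(4)[OF c] by auto
    then show "carrier L \<noteq> \<pi> ` M" by auto
    fix J assume J: "ideal J L" "\<pi> ` M \<subseteq> J" "J \<subseteq> carrier L"
    interpret J: ideal J L by (rule J(1))
    have K: "ideal_in UNIV (\<pi> -` J)"
      using J.zero_closed by (auto simp: ideal_in_def cover_simps[OF c] cover_in[OF c] J.I_l_closed)
    have MK: "M \<subseteq> \<pi> -` J" using J(2) by auto
    show "J = \<pi> ` M \<or> J = carrier L"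
    proof (cases "1 \<in> \<pi> -` J")
      case True
      then show ?thesis using J.one_imp_carrier by (simp add: cover_simps[OF c])
    next
      case False
      then have "\<pi> -` J = M" using M K MK unfolding maximal_in_def by blast
      moreover have "\<pi> ` (\<pi> -` J) = J"
        using J(3) cover_obtain[OF c] by (auto simp: image_iff) (metis subsetD)
      ultimately show ?thesis by simp
    qed
  qed
qed

text \<open>An element without inverse generates a proper ideal and so lies in the unique maximal
  ideal; two elements with sum 1 cannot both lie there.\<close>

lemma local_ring_splitting:
  assumes L: "local_ring L" shows "splitting L [\<one>\<^bsub>L\<^esub>]"
proof -
  interpret L: cring L using L by (simp add: local_ring_def)
  obtain \<mm> where \<mm>: "maximalideal \<mm> L" and unique: "\<And>M. maximalideal M L \<Longrightarrow> M = \<mm>"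
    using L by (auto simp: local_ring_def)
  interpret \<mm>: maximalideal \<mm> L by (rule \<mm>)
  note U = ring_subset_UNIV
  have one: "\<one>\<^bsub>L\<^esub> \<notin> \<mm>" using \<mm>.one_imp_carrier \<mm>.I_notcarr by auto
  note c = cover_component[OF L.cring_axioms]
  have nonunit: "x \<in> \<mm>" if x: "x \<in> carrier L" and nu: "\<And>y. y \<in> carrier L \<Longrightarrow> x \<otimes>\<^bsub>L\<^esub> y \<noteq> \<one>\<^bsub>L\<^esub>" for x
  proof -
    define I where "I = {a. \<exists>b\<in>carrier L. component L a = x \<otimes>\<^bsub>L\<^esub> b}"
    have I: "ideal_in UNIV I"
      unfolding ideal_in_def
    proof (intro conjI ballI)
      show "0 \<in> I" using x by (auto simp: I_def cover_simps[OF c] intro!: bexI[of _ "\<zero>\<^bsub>L\<^esub>"])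
      fix a assume "a \<in> I"
      then obtain b where b: "b \<in> carrier L" "component L a = x \<otimes>\<^bsub>L\<^esub> b" by (auto simp: I_def)
      show "a + a' \<in> I" if "a' \<in> I" for a'
      proof -
        from that obtain b' where b': "b' \<in> carrier L" "component L a' = x \<otimes>\<^bsub>L\<^esub> b'" by (auto simp: I_def)
        then show ?thesis unfolding I_def using b x
          by (auto simp: cover_simps[OF c] L.r_distr intro!: bexI[of _ "b \<oplus>\<^bsub>L\<^esub> b'"])
      qed
      show "s * a \<in> I" for s
        unfolding I_def using b x cover_in[OF c, of s]
        by (auto simp: cover_simps[OF c] L.m_lcomm intro!: bexI[of _ "component L s \<otimes>\<^bsub>L\<^esub> b"])
    qed simp
    have "1 \<notin> I"
    proof
      assume "1 \<in> I"
      then obtain b where "b \<in> carrier L" "\<one>\<^bsub>L\<^esub> = x \<otimes>\<^bsub>L\<^esub> b" by (auto simp: I_def cover_simps[OF c])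
      then show False using nu[of b] by simp
    qed
    then obtain M where M: "maximal_in UNIV M" "I \<subseteq> M" using exists_maximal_in[OF I] by blast
    have "component L -` {\<zero>\<^bsub>L\<^esub>} \<subseteq> I" using x by (auto simp: I_def intro!: bexI[of _ "\<zero>\<^bsub>L\<^esub>"])
    then have m: "component L ` M = \<mm>" using maximalideal_image(1)[OF c M(1)] M(2) by (intro unique) blast
    obtain a where a: "x = component L a" using cover_obtain[OF c x] .
    then have "a \<in> I" using x by (auto simp: I_def intro!: bexI[of _ "\<one>\<^bsub>L\<^esub>"])
    then show ?thesis using m M(2) a by blast
  qed
  have "\<exists>y\<in>carrier L. x \<otimes>\<^bsub>L\<^esub> y = \<one>\<^bsub>L\<^esub> \<or> x' \<otimes>\<^bsub>L\<^esub> y = \<one>\<^bsub>L\<^esub>"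
    if "x \<in> carrier L" "x' \<in> carrier L" "x \<oplus>\<^bsub>L\<^esub> x' = \<one>\<^bsub>L\<^esub>" for x x'
    using that nonunit[of x] nonunit[of x'] \<mm>.a_closed[of x x'] one by metis
  moreover have "\<one>\<^bsub>L\<^esub> \<noteq> \<zero>\<^bsub>L\<^esub>" using one \<mm>.zero_closed by metis
  ultimately show ?thesis by (simp add: splitting_def)
qed

lemma splitting_iso:
  assumes C: "ring C" and D: "ring D" and h: "h \<in> ring_iso C D" and es: "splitting C es"
  shows "splitting D (map h es)"
proof -
  interpret C: ring C by (rule C)
  interpret D: ring D by (rule D)
  have hom: "h \<in> ring_hom C D" and bij: "h ` carrier C = carrier D" "inj_on h (carrier C)"
    using h by (auto simp: ring_iso_def bij_betw_def)
  interpret h: ring_hom_ring C D h using hom by unfold_locales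
  have es': "set es \<subseteq> carrier C" using es by (simp add: splitting_def)
  then have sum: "foldr (\<oplus>\<^bsub>C\<^esub>) es \<zero>\<^bsub>C\<^esub> \<in> carrier C \<and>
      foldr (\<oplus>\<^bsub>D\<^esub>) (map h es) \<zero>\<^bsub>D\<^esub> = h (foldr (\<oplus>\<^bsub>C\<^esub>) es \<zero>\<^bsub>C\<^esub>)"
    by (induction es) auto
  have "sorted_wrt (\<lambda>e e'. e \<otimes>\<^bsub>D\<^esub> e' = \<zero>\<^bsub>D\<^esub>) (map h es)"
  proof -
    have "sorted_wrt (\<lambda>e e'. e \<otimes>\<^bsub>C\<^esub> e' = \<zero>\<^bsub>C\<^esub>) es" using es by (simp add: splitting_def)
    then have "sorted_wrt (\<lambda>e e'. h e \<otimes>\<^bsub>D\<^esub> h e' = \<zero>\<^bsub>D\<^esub>) es"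
      by (rule sorted_wrt_mono_rel[rotated]) (use es' in \<open>auto simp: subset_iff simp flip: h.hom_mult\<close>)
    then show ?thesis by (simp add: sorted_wrt_map)
  qed
  moreover have "foldr (\<oplus>\<^bsub>D\<^esub>) (map h es) \<zero>\<^bsub>D\<^esub> = \<one>\<^bsub>D\<^esub>" using sum es by (simp add: splitting_def)
  moreover have "h e \<otimes>\<^bsub>D\<^esub> h e = h e \<and> h e \<noteq> \<zero>\<^bsub>D\<^esub> \<and>
     (\<forall>x\<in>carrier D. \<forall>x'\<in>carrier D. x \<oplus>\<^bsub>D\<^esub> x' = \<one>\<^bsub>D\<^esub> \<longrightarrow>
        (\<exists>y\<in>carrier D. x \<otimes>\<^bsub>D\<^esub> y = h e \<or> x' \<otimes>\<^bsub>D\<^esub> y = h e))" if e: "e \<in> set es" for e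
  proof (intro conjI ballI impI)
    have ec: "e \<in> carrier C" and ee: "e \<otimes>\<^bsub>C\<^esub> e = e" "e \<noteq> \<zero>\<^bsub>C\<^esub>" using e es es' by (auto simp: splitting_def)
    show "h e \<otimes>\<^bsub>D\<^esub> h e = h e" using ec ee by (simp flip: h.hom_mult)
    show "h e \<noteq> \<zero>\<^bsub>D\<^esub>" using ec ee inj_onD[OF bij(2), of e "\<zero>\<^bsub>C\<^esub>"] by auto
    fix x x' assume "x \<in> carrier D" "x' \<in> carrier D" and one: "x \<oplus>\<^bsub>D\<^esub> x' = \<one>\<^bsub>D\<^esub>"
    then obtain a a' where a: "a \<in> carrier C" "x = h a" "a' \<in> carrier C" "x' = h a'" using bij(1) by blast
    then have "h (a \<oplus>\<^bsub>C\<^esub> a') = h \<one>\<^bsub>C\<^esub>" using one by simp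
    then have "a \<oplus>\<^bsub>C\<^esub> a' = \<one>\<^bsub>C\<^esub>" using a inj_onD[OF bij(2)] by auto
    then obtain y where y: "y \<in> carrier C" "a \<otimes>\<^bsub>C\<^esub> y = e \<or> a' \<otimes>\<^bsub>C\<^esub> y = e"
      using es e a(1,3) unfolding splitting_def by blast
    then show "\<exists>y\<in>carrier D. x \<otimes>\<^bsub>D\<^esub> y = h e \<or> x' \<otimes>\<^bsub>D\<^esub> y = h e"
      using a by (intro bexI[of _ "h y"]) (auto simp flip: h.hom_mult)
  qed
  ultimately show ?thesis using es' by (auto simp: splitting_def)
qed

lemma RDirProd_simps:
  "carrier (RDirProd R S) = carrier R \<times> carrier S" "\<one>\<^bsub>RDirProd R S\<^esub> = (\<one>\<^bsub>R\<^esub>, \<one>\<^bsub>S\<^esub>)"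
  "\<zero>\<^bsub>RDirProd R S\<^esub> = (\<zero>\<^bsub>R\<^esub>, \<zero>\<^bsub>S\<^esub>)"
  "(a, b) \<otimes>\<^bsub>RDirProd R S\<^esub> (a', b') = (a \<otimes>\<^bsub>R\<^esub> a', b \<otimes>\<^bsub>S\<^esub> b')"
  "(a, b) \<oplus>\<^bsub>RDirProd R S\<^esub> (a', b') = (a \<oplus>\<^bsub>R\<^esub> a', b \<oplus>\<^bsub>S\<^esub> b')"
  by (simp_all add: RDirProd_def DirProd_def monoid.defs)

lemma splitting_product:
  assumes R: "ring R" and S: "ring S" and es: "splitting R es" and fs: "splitting S fs"
  shows "splitting (RDirProd R S) (map (\<lambda>e. (e, \<zero>\<^bsub>S\<^esub>)) es @ map (\<lambda>f. (\<zero>\<^bsub>R\<^esub>, f)) fs)"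
proof -
  interpret R: ring R by (rule R)
  interpret S: ring S by (rule S)
  have c: "set es \<subseteq> carrier R" "set fs \<subseteq> carrier S" using es fs by (auto simp: splitting_def)
  have 1: "foldr (\<oplus>\<^bsub>R\<^esub>) es \<zero>\<^bsub>R\<^esub> \<in> carrier R \<and> (\<forall>b\<in>carrier S.
      foldr (\<oplus>\<^bsub>RDirProd R S\<^esub>) (map (\<lambda>e. (e, \<zero>\<^bsub>S\<^esub>)) es) (\<zero>\<^bsub>R\<^esub>, b) = (foldr (\<oplus>\<^bsub>R\<^esub>) es \<zero>\<^bsub>R\<^esub>, b))"
    using c(1) by (induction es) (auto simp: RDirProd_simps)
  have 2: "foldr (\<oplus>\<^bsub>S\<^esub>) fs \<zero>\<^bsub>S\<^esub> \<in> carrier S \<and>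
      foldr (\<oplus>\<^bsub>RDirProd R S\<^esub>) (map (\<lambda>f. (\<zero>\<^bsub>R\<^esub>, f)) fs) (\<zero>\<^bsub>R\<^esub>, \<zero>\<^bsub>S\<^esub>) = (\<zero>\<^bsub>R\<^esub>, foldr (\<oplus>\<^bsub>S\<^esub>) fs \<zero>\<^bsub>S\<^esub>)"
    using c(2) by (induction fs) (auto simp: RDirProd_simps)
  have sum: "foldr (\<oplus>\<^bsub>RDirProd R S\<^esub>) (map (\<lambda>e. (e, \<zero>\<^bsub>S\<^esub>)) es @ map (\<lambda>f. (\<zero>\<^bsub>R\<^esub>, f)) fs) \<zero>\<^bsub>RDirProd R S\<^esub>
      = \<one>\<^bsub>RDirProd R S\<^esub>"
    using 1 2 es fs by (simp add: RDirProd_simps splitting_def)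
  have "sorted_wrt (\<lambda>e e'. (e, \<zero>\<^bsub>S\<^esub>) \<otimes>\<^bsub>RDirProd R S\<^esub> (e', \<zero>\<^bsub>S\<^esub>) = \<zero>\<^bsub>RDirProd R S\<^esub>) es"
    by (rule sorted_wrt_mono_rel[of _ "\<lambda>e e'. e \<otimes>\<^bsub>R\<^esub> e' = \<zero>\<^bsub>R\<^esub>"])
      (use es in \<open>auto simp: splitting_def RDirProd_simps\<close>)
  moreover have "sorted_wrt (\<lambda>f f'. (\<zero>\<^bsub>R\<^esub>, f) \<otimes>\<^bsub>RDirProd R S\<^esub> (\<zero>\<^bsub>R\<^esub>, f') = \<zero>\<^bsub>RDirProd R S\<^esub>) fs"
    by (rule sorted_wrt_mono_rel[of _ "\<lambda>e e'. e \<otimes>\<^bsub>S\<^esub> e' = \<zero>\<^bsub>S\<^esub>"])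
      (use fs in \<open>auto simp: splitting_def RDirProd_simps\<close>)
  ultimately have sorted: "sorted_wrt (\<lambda>e e'. e \<otimes>\<^bsub>RDirProd R S\<^esub> e' = \<zero>\<^bsub>RDirProd R S\<^esub>)
      (map (\<lambda>e. (e, \<zero>\<^bsub>S\<^esub>)) es @ map (\<lambda>f. (\<zero>\<^bsub>R\<^esub>, f)) fs)"
    using c by (auto simp: sorted_wrt_append sorted_wrt_map RDirProd_simps subset_iff)
  have el: "e \<otimes>\<^bsub>R\<^esub> e = e" "e \<noteq> \<zero>\<^bsub>R\<^esub>" "e \<in> carrier R"
    "\<exists>y\<in>carrier R. x \<otimes>\<^bsub>R\<^esub> y = e \<or> x' \<otimes>\<^bsub>R\<^esub> y = e"
    if "e \<in> set es" "x \<in> carrier R" "x' \<in> carrier R" "x \<oplus>\<^bsub>R\<^esub> x' = \<one>\<^bsub>R\<^esub>" for e x x'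
    using es that unfolding splitting_def by blast+
  have fl: "e \<otimes>\<^bsub>S\<^esub> e = e" "e \<noteq> \<zero>\<^bsub>S\<^esub>" "e \<in> carrier S"
    "\<exists>y\<in>carrier S. x \<otimes>\<^bsub>S\<^esub> y = e \<or> x' \<otimes>\<^bsub>S\<^esub> y = e"
    if "e \<in> set fs" "x \<in> carrier S" "x' \<in> carrier S" "x \<oplus>\<^bsub>S\<^esub> x' = \<one>\<^bsub>S\<^esub>" for e x x'
    using fs that unfolding splitting_def by blast+
  have "\<exists>y\<in>carrier (RDirProd R S). x \<otimes>\<^bsub>RDirProd R S\<^esub> y = (e, \<zero>\<^bsub>S\<^esub>) \<or> x' \<otimes>\<^bsub>RDirProd R S\<^esub> y = (e, \<zero>\<^bsub>S\<^esub>)"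
    if e: "e \<in> set es" and x: "x \<in> carrier (RDirProd R S)" "x' \<in> carrier (RDirProd R S)"
      "x \<oplus>\<^bsub>RDirProd R S\<^esub> x' = \<one>\<^bsub>RDirProd R S\<^esub>" for e x x'
  proof -
    obtain a b a' b' where ab: "x = (a, b)" "x' = (a', b')" by (cases x; cases x') auto
    then obtain y where "y \<in> carrier R" "a \<otimes>\<^bsub>R\<^esub> y = e \<or> a' \<otimes>\<^bsub>R\<^esub> y = e"
      using el(4)[OF e, of a a'] x by (auto simp: RDirProd_simps)
    then show ?thesis using ab x by (intro bexI[of _ "(y, \<zero>\<^bsub>S\<^esub>)"]) (auto simp: RDirProd_simps)
  qed
  moreover have "\<exists>y\<in>carrier (RDirProd R S). x \<otimes>\<^bsub>RDirProd R S\<^esub> y = (\<zero>\<^bsub>R\<^esub>, e) \<or> x' \<otimes>\<^bsub>RDirProd R S\<^esub> y = (\<zero>\<^bsub>R\<^esub>, e)"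
    if e: "e \<in> set fs" and x: "x \<in> carrier (RDirProd R S)" "x' \<in> carrier (RDirProd R S)"
      "x \<oplus>\<^bsub>RDirProd R S\<^esub> x' = \<one>\<^bsub>RDirProd R S\<^esub>" for e x x'
  proof -
    obtain a b a' b' where ab: "x = (a, b)" "x' = (a', b')" by (cases x; cases x') auto
    then obtain y where "y \<in> carrier S" "b \<otimes>\<^bsub>S\<^esub> y = e \<or> b' \<otimes>\<^bsub>S\<^esub> y = e"
      using fl(4)[OF e, of b b'] x by (auto simp: RDirProd_simps)
    then show ?thesis using ab x by (intro bexI[of _ "(\<zero>\<^bsub>R\<^esub>, y)"]) (auto simp: RDirProd_simps)
  qed
  moreover have "set (map (\<lambda>e. (e, \<zero>\<^bsub>S\<^esub>)) es @ map (\<lambda>f. (\<zero>\<^bsub>R\<^esub>, f)) fs) \<subseteq> carrier (RDirProd R S)"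
    using c by (auto simp: RDirProd_simps)
  moreover have "(e, \<zero>\<^bsub>S\<^esub>) \<otimes>\<^bsub>RDirProd R S\<^esub> (e, \<zero>\<^bsub>S\<^esub>) = (e, \<zero>\<^bsub>S\<^esub>) \<and> (e, \<zero>\<^bsub>S\<^esub>) \<noteq> \<zero>\<^bsub>RDirProd R S\<^esub>" if "e \<in> set es" for e
    using el(1,2)[OF that, of "\<one>\<^bsub>R\<^esub>" "\<zero>\<^bsub>R\<^esub>"] by (simp add: RDirProd_simps)
  moreover have "(\<zero>\<^bsub>R\<^esub>, e) \<otimes>\<^bsub>RDirProd R S\<^esub> (\<zero>\<^bsub>R\<^esub>, e) = (\<zero>\<^bsub>R\<^esub>, e) \<and> (\<zero>\<^bsub>R\<^esub>, e) \<noteq> \<zero>\<^bsub>RDirProd R S\<^esub>" if "e \<in> set fs" for e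
    using fl(1,2)[OF that, of "\<one>\<^bsub>S\<^esub>" "\<zero>\<^bsub>S\<^esub>"] by (simp add: RDirProd_simps)
  ultimately show ?thesis using sum sorted unfolding splitting_def by auto
qed

lemma product_of_local_rings_splits:
  assumes "\<forall>L\<in>set Ls. local_ring L"
  shows "ring (RDirProd_list Ls) \<and> (\<exists>es. splitting (RDirProd_list Ls) es)"
  using assms
proof (induction Ls)
  case Nil
  have "ring (RDirProd_list [])" by (rule RDirProd_list_is_ring) simp
  moreover have "splitting (RDirProd_list []) []" by (simp add: splitting_def monoid.defs)
  ultimately show ?case by blast
next
  case (Cons L Ls)
  then have IH: "ring (RDirProd_list Ls)" and L: "ring L" "splitting L [\<one>\<^bsub>L\<^esub>]"
    using local_ring_splitting by (auto simp: local_ring_def cring_def)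
  obtain es where es: "splitting (RDirProd_list Ls) es" using Cons by auto
  have "ring ((L # Ls) ! i)" if "i < length (L # Ls)" for i
    using Cons.prems nth_mem[OF that] by (auto simp: local_ring_def cring_def)
  then have R: "ring (RDirProd_list (L # Ls))" by (rule RDirProd_list_is_ring)
  then show ?case
    using splitting_iso[OF RDirProd_ring[OF L(1) IH] R RDirProd_list_iso1 splitting_product[OF L(1) IH L(2) es]]
    by blast
qed

lemma finsum_subring:
  assumes R: "cring R" and H: "subcring H R" and F: "finite F" "\<And>x. x \<in> F \<Longrightarrow> f x \<in> H"
  shows "finsum (R\<lparr>carrier := H\<rparr>) f F = finsum R f F"
proof -
  interpret R: cring R by (rule R)
  have HR: "H \<subseteq> carrier R" by (rule subcringE(1)[OF H])
  interpret H: cring "R\<lparr>carrier := H\<rparr>" using R.subcring_iff[OF HR] H by simp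
  show ?thesis using F
  proof (induction F rule: finite_induct)
    case empty
    show ?case by (simp add: H.finsum_empty[simplified])
  next
    case (insert x F)
    have "finsum (R\<lparr>carrier := H\<rparr>) f (insert x F) = f x \<oplus>\<^bsub>R\<^esub> finsum (R\<lparr>carrier := H\<rparr>) f F"
      using insert by (subst H.finsum_insert) auto
    also have "\<dots> = finsum R f (insert x F)"
      using insert HR by (subst R.finsum_insert) (auto simp: subset_iff)
    finally show ?case .
  qed
qed

section \<open>From the Hensel property to idempotents of finite extensions\<close>

context
  fixes \<pi> :: "'u::comm_ring_1 \<Rightarrow> 'a" and B :: "('a, 'b) ring_scheme" and A
  assumes c: "cover \<pi> B" and A: "subcring A B"
begin

lemma local_modulo_cover:
  assumes L: "local_ring (B\<lparr>carrier := A\<rparr>)"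
  shows "\<exists>m. local_modulo (\<pi> -` {\<zero>\<^bsub>B\<^esub>}) (\<pi> -` A) m"
proof
  interpret B: cring B by (rule cover_cring[OF c])
  have AB: "A \<subseteq> carrier B" by (rule subcringE(1)[OF A])
  interpret A: cring "B\<lparr>carrier := A\<rparr>" using L by (simp add: local_ring_def)
  have sp: "\<exists>y\<in>A. x \<otimes>\<^bsub>B\<^esub> y = \<one>\<^bsub>B\<^esub> \<or> x' \<otimes>\<^bsub>B\<^esub> y = \<one>\<^bsub>B\<^esub>" if "x \<in> A" "x' \<in> A" "x \<oplus>\<^bsub>B\<^esub> x' = \<one>\<^bsub>B\<^esub>" for x x'
    using local_ring_splitting[OF L] that by (simp add: splitting_def)
  have ne: "\<one>\<^bsub>B\<^esub> \<noteq> \<zero>\<^bsub>B\<^esub>" using local_ring_splitting[OF L] by (simp add: splitting_def)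
  define m where "m = {a \<in> \<pi> -` A. \<not> (\<exists>y\<in>A. \<pi> a \<otimes>\<^bsub>B\<^esub> y = \<one>\<^bsub>B\<^esub>)}"
  have AD: "x \<in> carrier B" if "x \<in> A" for x using that AB by auto
  note Ac = subcringE[OF A]
  show "local_modulo (\<pi> -` {\<zero>\<^bsub>B\<^esub>}) (\<pi> -` A) m"
    unfolding local_modulo_def ideal_in_def
  proof (intro conjI ballI subsetI)
    show "0 \<in> m" using ne AD Ac(2) by (auto simp: m_def cover_simps[OF c])
    show "a \<in> \<pi> -` A" if "a \<in> m" for a using that by (simp add: m_def)
    show "a + b \<in> m" if a: "a \<in> m" and b: "b \<in> m" for a b
    proof -
      have "False" if y: "y \<in> A" "(\<pi> a \<oplus>\<^bsub>B\<^esub> \<pi> b) \<otimes>\<^bsub>B\<^esub> y = \<one>\<^bsub>B\<^esub>" for y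
      proof -
        have ab: "\<pi> a \<in> A" "\<pi> b \<in> A" using a b by (auto simp: m_def)
        have "\<pi> a \<otimes>\<^bsub>B\<^esub> y \<oplus>\<^bsub>B\<^esub> \<pi> b \<otimes>\<^bsub>B\<^esub> y = \<one>\<^bsub>B\<^esub>" using y ab AD by (simp add: B.l_distr)
        then obtain z where z: "z \<in> A" "\<pi> a \<otimes>\<^bsub>B\<^esub> y \<otimes>\<^bsub>B\<^esub> z = \<one>\<^bsub>B\<^esub> \<or> \<pi> b \<otimes>\<^bsub>B\<^esub> y \<otimes>\<^bsub>B\<^esub> z = \<one>\<^bsub>B\<^esub>"
          using sp[of "\<pi> a \<otimes>\<^bsub>B\<^esub> y" "\<pi> b \<otimes>\<^bsub>B\<^esub> y"] Ac(6) ab y by blast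
        then have "\<pi> a \<otimes>\<^bsub>B\<^esub> (y \<otimes>\<^bsub>B\<^esub> z) = \<one>\<^bsub>B\<^esub> \<or> \<pi> b \<otimes>\<^bsub>B\<^esub> (y \<otimes>\<^bsub>B\<^esub> z) = \<one>\<^bsub>B\<^esub>"
          using ab y AD by (simp add: B.m_assoc)
        then show False using a b Ac(6)[OF y(1) z(1)] by (auto simp: m_def)
      qed
      then show ?thesis using a b Ac(7) by (auto simp: m_def cover_simps[OF c])
    qed
    show "s * a \<in> m" if s: "s \<in> \<pi> -` A" and a: "a \<in> m" for s a
    proof -
      have "False" if y: "y \<in> A" "(\<pi> s \<otimes>\<^bsub>B\<^esub> \<pi> a) \<otimes>\<^bsub>B\<^esub> y = \<one>\<^bsub>B\<^esub>" for y
      proof -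
        have sa: "\<pi> s \<in> A" "\<pi> a \<in> A" using a s by (auto simp: m_def)
        have "\<pi> a \<otimes>\<^bsub>B\<^esub> (\<pi> s \<otimes>\<^bsub>B\<^esub> y) = \<one>\<^bsub>B\<^esub>"
          using y AD[OF sa(1)] AD[OF sa(2)] AD[OF y(1)] by (simp add: B.m_ac)
        then show False using a Ac(6)[OF sa(1) y(1)] by (auto simp: m_def)
      qed
      then show ?thesis using a s Ac(6) by (auto simp: m_def cover_simps[OF c])
    qed
    show "1 \<notin> m" using Ac(3) AD by (auto simp: m_def cover_simps[OF c] intro!: bexI[of _ "\<one>\<^bsub>B\<^esub>"])
    show "a \<in> m" if "a \<in> \<pi> -` {\<zero>\<^bsub>B\<^esub>}" for a using that ne AD Ac(2) by (auto simp: m_def)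
    show "\<exists>y\<in>\<pi> -` A. x * y - 1 \<in> \<pi> -` {\<zero>\<^bsub>B\<^esub>}" if x: "x \<in> \<pi> -` A - m" for x
    proof -
      obtain y where y: "y \<in> A" "\<pi> x \<otimes>\<^bsub>B\<^esub> y = \<one>\<^bsub>B\<^esub>" using x by (auto simp: m_def)
      obtain z where "y = \<pi> z" using cover_obtain[OF c AD[OF y(1)]] .
      then show ?thesis using y cover_eq_iff[OF c, of "x * z" 1]
        by (intro bexI[of _ z]) (auto simp: cover_simps[OF c])
    qed
  qed
qed

lemma finite_algebra_span:
  assumes S: "ring_subset S" "\<pi> -` A \<subseteq> S" and Z: "finite Z" "S = span_over (\<pi> -` A) Z"
  shows "subcring (\<pi> ` S) B" and "finite_algebra (B\<lparr>carrier := A\<rparr>) (B\<lparr>carrier := \<pi> ` S\<rparr>) id"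
    and "\<And>x. \<pi> x \<in> \<pi> ` S \<Longrightarrow> x \<in> S"
proof -
  interpret B: cring B by (rule cover_cring[OF c])
  note RA = ring_subset_preimage[OF c A]
  show mem: "x \<in> S" if "\<pi> x \<in> \<pi> ` S" for x
  proof -
    from that obtain y where y: "y \<in> S" "\<pi> x = \<pi> y" by blast
    then have "\<pi> (x - y) = \<zero>\<^bsub>B\<^esub>" using cover_eq_iff[OF c] by blast
    then have "x - y \<in> S" using kernel_subset[OF c A] S(2) by blast
    from ring_subset_add[OF S(1) this y(1)] show ?thesis by simp
  qed
  have "\<pi> -` (\<pi> ` S) = S" using mem by (intro equalityI subsetI) auto
  then show sub: "subcring (\<pi> ` S) B"
    using S(1) cover_in[OF c] by (intro subcring_by_cover[OF c A c]) auto
  have SB: "\<pi> ` S \<subseteq> carrier B" by (rule subcringE(1)[OF sub])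
  have AS: "A \<subseteq> \<pi> ` S"
  proof
    fix a assume a: "a \<in> A"
    then obtain x where "a = \<pi> x" using cover_obtain[OF c] subcringE(1)[OF A] by blast
    then show "a \<in> \<pi> ` S" using a S(2) by blast
  qed
  have ZS: "Z \<subseteq> S" using span_over_base[OF ring_subset_one[OF RA]] Z(2) by blast
  show "finite_algebra (B\<lparr>carrier := A\<rparr>) (B\<lparr>carrier := \<pi> ` S\<rparr>) id"
    unfolding finite_algebra_def
  proof (intro conjI exI[of _ "\<pi> ` Z"] ballI)
    show "cring (B\<lparr>carrier := \<pi> ` S\<rparr>)" using B.subcring_iff[OF SB] sub by simp
    show "id \<in> ring_hom (B\<lparr>carrier := A\<rparr>) (B\<lparr>carrier := \<pi> ` S\<rparr>)" using AS by (auto simp: ring_hom_def)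
    show "finite (\<pi> ` Z)" using Z by simp
    show "\<pi> ` Z \<subseteq> carrier (B\<lparr>carrier := \<pi> ` S\<rparr>)" using ZS by auto
    fix b assume "b \<in> carrier (B\<lparr>carrier := \<pi> ` S\<rparr>)"
    then obtain s where s: "s \<in> S" "b = \<pi> s" by auto
    then obtain d where d: "\<And>z. d z \<in> \<pi> -` A" "s = (\<Sum>z\<in>Z. d z * z)"
      using span_over_coefficients[OF RA Z(1)] Z(2) by metis
    \<comment> \<open>Distinct generators in \<open>Z\<close> may have the same image in
      \<open>B\<close>; their coefficients are added up along the fibres of
      \<open>\<pi>\<close>.\<close>
    define r where "r y = \<pi> (\<Sum>z | z \<in> Z \<and> \<pi> z = y. d z)" for y
    have rA: "r y \<in> A" for y
      using ring_subset_sum[OF RA, of "{z \<in> Z. \<pi> z = y}" d] d(1) by (simp add: r_def)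
    have ry: "\<pi> (\<Sum>z | z \<in> Z \<and> \<pi> z = y. d z * z) = r y \<otimes>\<^bsub>B\<^esub> y" if y: "y \<in> \<pi> ` Z" for y
    proof -
      have "\<pi> (\<Sum>z | z \<in> Z \<and> \<pi> z = y. d z * z) = (\<Oplus>\<^bsub>B\<^esub>z\<in>{z \<in> Z. \<pi> z = y}. \<pi> (d z) \<otimes>\<^bsub>B\<^esub> y)"
        using Z(1) by (subst cover_sum[OF c]) (auto simp: cover_simps[OF c] cover_in[OF c] intro!: B.finsum_cong')
      also have "\<dots> = r y \<otimes>\<^bsub>B\<^esub> y"
        using Z(1) y cover_in[OF c] by (auto simp: r_def cover_sum[OF c] B.finsum_ldistr)
      finally show ?thesis .
    qed
    have "b = \<pi> (\<Sum>y\<in>\<pi> ` Z. \<Sum>z | z \<in> Z \<and> \<pi> z = y. d z * z)"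
      unfolding s(2) d(2) by (subst sum.image_gen[OF Z(1), of _ \<pi>]) simp
    also have "\<dots> = (\<Oplus>\<^bsub>B\<^esub>y\<in>\<pi> ` Z. r y \<otimes>\<^bsub>B\<^esub> y)"
      using Z(1) ry by (subst cover_sum[OF c]) (auto simp: cover_in[OF c] intro!: B.finsum_cong' simp flip: ry)
    also have "\<dots> = (\<Oplus>\<^bsub>B\<lparr>carrier := \<pi> ` S\<rparr>\<^esub>y\<in>\<pi> ` Z. id (r y) \<otimes>\<^bsub>B\<lparr>carrier := \<pi> ` S\<rparr>\<^esub> y)"
      using Z(1) rA AS ZS subcringE(6)[OF sub]
      by (simp, intro finsum_subring[OF B.cring_axioms sub, symmetric]) blast+
    finally show "\<exists>r\<in>\<pi> ` Z \<rightarrow> carrier (B\<lparr>carrier := A\<rparr>).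
        b = (\<Oplus>\<^bsub>B\<lparr>carrier := \<pi> ` S\<rparr>\<^esub>y\<in>\<pi> ` Z. id (r y) \<otimes>\<^bsub>B\<lparr>carrier := \<pi> ` S\<rparr>\<^esub> y)"
      using rA by (intro bexI[of _ r]) auto
  qed
qed

text \<open>The image of \<open>S\<close> in \<open>B\<close> is a finite algebra over
  \<open>A\<close>, hence a product of local rings. The identities of the factors, transported back
  and lifted to \<open>S\<close>, are the idempotents.\<close>

lemma hensel_splits_off:
  assumes H: "hensel_local (B\<lparr>carrier := A\<rparr>)" and P: "invertible_pair (\<pi> -` A) (\<pi> -` {\<zero>\<^bsub>B\<^esub>}) f g n"
    and S: "ring_subset S" "\<pi> -` A \<subseteq> S" and Z: "finite Z" "S = span_over (\<pi> -` A) Z"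
  shows "\<exists>E. invertible_pair.splits_off (\<pi> -` {\<zero>\<^bsub>B\<^esub>}) S E"
proof -
  interpret B: cring B by (rule cover_cring[OF c])
  note fa = finite_algebra_span[OF S Z]
  let ?C = "B\<lparr>carrier := \<pi> ` S\<rparr>"
  have SB: "\<pi> ` S \<subseteq> carrier B" by (rule subcringE(1)[OF fa(1)])
  have C: "cring ?C" using B.subcring_iff[OF SB] fa(1) by simp
  interpret C: cring ?C by (rule C)
  obtain Ls :: "'a list ring list" where Ls: "\<forall>L\<in>set Ls. local_ring L" "?C \<simeq> RDirProd_list Ls"
    using hensel_localD[OF H fa(2)] by blast
  obtain h where h: "h \<in> ring_iso ?C (RDirProd_list Ls)" using Ls(2) by (auto simp: is_ring_iso_def)
  obtain fs where "splitting (RDirProd_list Ls) fs" and Lr: "ring (RDirProd_list Ls)"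
    using product_of_local_rings_splits[OF Ls(1)] by blast
  from splitting_iso[OF Lr C.ring_axioms ring_iso_set_sym[OF C.ring_axioms h] this(1)]
  obtain es where "splitting ?C es" by blast
  then have es: "set es \<subseteq> \<pi> ` S" "sorted_wrt (\<lambda>e e'. e \<otimes>\<^bsub>B\<^esub> e' = \<zero>\<^bsub>B\<^esub>) es"
    "foldr (\<oplus>\<^bsub>B\<^esub>) es \<zero>\<^bsub>B\<^esub> = \<one>\<^bsub>B\<^esub>" "\<And>e. e \<in> set es \<Longrightarrow> e \<otimes>\<^bsub>B\<^esub> e = e" "\<And>e. e \<in> set es \<Longrightarrow> e \<noteq> \<zero>\<^bsub>B\<^esub>"
    "\<And>e x x'. e \<in> set es \<Longrightarrow> x \<in> \<pi> ` S \<Longrightarrow> x' \<in> \<pi> ` S \<Longrightarrow> x \<oplus>\<^bsub>B\<^esub> x' = \<one>\<^bsub>B\<^esub> \<Longrightarrow>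
      \<exists>y\<in>\<pi> ` S. x \<otimes>\<^bsub>B\<^esub> y = e \<or> x' \<otimes>\<^bsub>B\<^esub> y = e"
    unfolding splitting_def by auto
  define \<sigma> where "\<sigma> b = (SOME x. x \<in> S \<and> \<pi> x = b)" for b
  have \<sigma>: "\<sigma> b \<in> S" "\<pi> (\<sigma> b) = b" if "b \<in> set es" for b
    using someI_ex[of "\<lambda>x. x \<in> S \<and> \<pi> x = b"] that es(1) by (auto simp: \<sigma>_def)
  have orth: "e \<otimes>\<^bsub>B\<^esub> e' = \<zero>\<^bsub>B\<^esub>" if i: "i < length es" "j < length es" "i \<noteq> j" and e: "e = es ! i" "e' = es ! j" for i j e e'
  proof -
    have "e \<in> carrier B" "e' \<in> carrier B" using es(1) SB i e nth_mem by blast+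
    moreover have "i < j \<Longrightarrow> e \<otimes>\<^bsub>B\<^esub> e' = \<zero>\<^bsub>B\<^esub>" "j < i \<Longrightarrow> e' \<otimes>\<^bsub>B\<^esub> e = \<zero>\<^bsub>B\<^esub>"
      using sorted_wrt_nth_less[OF es(2)] i e by auto
    ultimately show ?thesis using i B.m_comm[of e e'] by (metis linorder_neqE_nat)
  qed
  have dist: "distinct es"
    unfolding distinct_conv_nth using orth es(4,5) by (metis nth_mem)
  have "\<pi> (\<Sum>(\<sigma> ` set es)) = \<one>\<^bsub>B\<^esub>"
  proof -
    have inj: "inj_on \<sigma> (set es)" using \<sigma>(2) by (metis inj_onI)
    have "\<pi> (\<Sum>x\<leftarrow>xs. \<sigma> x) = foldr (\<oplus>\<^bsub>B\<^esub>) xs \<zero>\<^bsub>B\<^esub>" if "set xs \<subseteq> set es" for xs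
      using that by (induction xs) (auto simp: cover_simps[OF c] \<sigma>)
    then have "\<pi> (\<Sum>x\<leftarrow>es. \<sigma> x) = \<one>\<^bsub>B\<^esub>" using es(3) by simp
    then show ?thesis using dist inj by (simp add: sum_list_distinct_conv_sum_set sum.reindex)
  qed
  note sum = this
  have eqN: "x - y \<in> \<pi> -` {\<zero>\<^bsub>B\<^esub>} \<longleftrightarrow> \<pi> x = \<pi> y" for x y using cover_eq_iff[OF c] by auto
  have eN: "x \<in> \<pi> -` {\<zero>\<^bsub>B\<^esub>} \<longleftrightarrow> \<pi> x = \<zero>\<^bsub>B\<^esub>" for x by auto
  have "\<exists>y\<in>S. \<pi> x \<otimes>\<^bsub>B\<^esub> \<pi> y = e \<or> \<pi> (1 - x) \<otimes>\<^bsub>B\<^esub> \<pi> y = e" if "e \<in> set es" "x \<in> S" for e x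
  proof -
    have "\<pi> x \<oplus>\<^bsub>B\<^esub> \<pi> (1 - x) = \<one>\<^bsub>B\<^esub>" by (simp flip: cover_simps(1)[OF c] add: cover_simps(4)[OF c])
    then show ?thesis
      using es(6)[OF that(1), of "\<pi> x" "\<pi> (1 - x)"] ring_subset_diff[OF S(1) ring_subset_one[OF S(1)] that(2)] that(2)
      by blast
  qed
  moreover have "e \<otimes>\<^bsub>B\<^esub> e' = \<zero>\<^bsub>B\<^esub>" if "e \<in> set es" "e' \<in> set es" "e \<noteq> e'" for e e'
    using orth that by (metis in_set_conv_nth)
  ultimately have "invertible_pair.splits_off (\<pi> -` {\<zero>\<^bsub>B\<^esub>}) S (\<sigma> ` set es)"
    unfolding invertible_pair.splits_off_def[OF P] eqN
    using \<sigma> es(4) sum by (auto simp: cover_simps[OF c])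
  then show ?thesis by blast
qed

end

section \<open>Laurent polynomials that are residually monomials\<close>

text \<open>Reflects that the quotient by \<open>N\<close>, which is \<open>B\<close> in the
  application, is reduced and nonzero. The index type is open so that all primes can be used in
  general and a single one for a domain.\<close>

locale residual_family =
  fixes N :: "'u::comm_ring_1 set" and P :: "'p \<Rightarrow> 'u set"
  assumes N: "ideal_in UNIV N" and prime: "\<And>q. prime_in UNIV (P q)" and Inter: "(\<Inter>q. P q) = N"
begin

lemma N_sub: "a \<in> N \<Longrightarrow> a \<in> P q" using Inter by auto

lemma idealP: "ideal_in UNIV (P q)" by (rule prime_in_ideal[OF prime])

lemma one_notin: "1 \<notin> P q" using prime[of q] by (simp add: prime_in_def)

lemma primeP: "a * b \<in> P q \<Longrightarrow> a \<in> P q \<or> b \<in> P q" using prime[of q] by (auto simp: prime_in_def)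

lemma coeffs_N: "(\<And>q. x \<in> coeffs_in (P q)) \<Longrightarrow> x \<in> coeffs_in N"
  using Inter by (auto simp: coeffs_in_def)

lemma coeffs_ideal: "ideal_in UNIV (coeffs_in (P q))"
  using ideal_in_coeffs_in[OF ring_subset_UNIV idealP] by (simp add: coeffs_in_def)

lemmas CP = ideal_in_closed[OF ring_subset_UNIV coeffs_ideal]
lemmas IP = ideal_in_closed[OF ring_subset_UNIV idealP]

lemma singleP: "a \<in> P q \<Longrightarrow> Poly_Mapping.single k a \<in> coeffs_in (P q)"
  by (rule single_in_coeffs_in[OF IP(1)])

text \<open>\<open>f\<close> is the function of exponents. It determines \<open>x\<close> modulo
  \<open>N\<close>, and addition of exponents corresponds to multiplication.\<close>

definition monomial_along :: "(int \<Rightarrow>\<^sub>0 'u) \<Rightarrow> ('p \<Rightarrow> int) \<Rightarrow> bool" where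
  "monomial_along x f \<longleftrightarrow> (\<forall>q. x - shift (f q) \<in> coeffs_in (P q))"

lemma monomial_mult:
  assumes "monomial_along x f" "monomial_along y g"
  shows "monomial_along (x * y) (\<lambda>q. f q + g q)"
  unfolding monomial_along_def
proof
  fix q
  have "x * y - shift (f q + g q) = (x - shift (f q)) * y + shift (f q) * (y - shift (g q))"
    by (simp add: algebra_simps mult_single)
  then show "x * y - shift (f q + g q) \<in> coeffs_in (P q)"
    using CP(2)[OF CP(4)[OF UNIV_I, of "x - shift (f q)" q y] CP(3)[OF UNIV_I, of "y - shift (g q)" q "shift (f q)"]] assms
    by (simp add: monomial_along_def)
qed

lemma monomial_unique:
  assumes "monomial_along x f" "monomial_along y f" shows "x - y \<in> coeffs_in N"
proof (rule coeffs_N)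
  fix q
  have "x - shift (f q) - (y - shift (f q)) \<in> coeffs_in (P q)"
    using assms CP(6)[of "x - shift (f q)" q "y - shift (f q)"] by (simp add: monomial_along_def)
  then show "x - y \<in> coeffs_in (P q)" by simp
qed

lemma monomial_shift: "monomial_along (shift k) (\<lambda>_. k)"
  using CP(1) by (simp add: monomial_along_def)

lemma monomial_power: "monomial_along x f \<Longrightarrow> monomial_along (x ^ k) (\<lambda>q. int k * f q)"
proof (induction k)
  case 0
  then show ?case using monomial_shift[of 0] by simp
next
  case (Suc k)
  then show ?case using monomial_mult[OF Suc.prems Suc.IH[OF Suc.prems]] by (simp add: algebra_simps)
qed

definition idem where "idem = {e. e * e - e \<in> N}"

definition indicator_of :: "'u \<Rightarrow> 'p \<Rightarrow> int" where "indicator_of e q = (if e \<in> P q then 0 else 1)"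

abbreviation "IE \<equiv> indicator_of ` idem"

lemma boolean_IE: "boolean_valued IE"
  by (auto simp: boolean_valued_def indicator_of_def)

lemma idem_residue: assumes "e \<in> idem" "e \<notin> P q" shows "1 - e \<in> P q"
proof -
  have "e * (1 - e) = - (e * e - e)" by (simp add: algebra_simps)
  then have "e * (1 - e) \<in> P q" using IP(5)[of "e * e - e" q] N_sub[of "e * e - e" q] assms(1) by (simp add: idem_def)
  then show ?thesis using primeP assms(2) by blast
qed

text \<open>The combination equals \<open>x\<close> where the idempotent \<open>e\<close> is 1, and
  it equals 1 elsewhere.\<close>

lemma monomial_indicator:
  assumes e: "e \<in> idem" and x: "monomial_along x f"
  shows "monomial_along (const e * x + const (1 - e)) (\<lambda>q. indicator_of e q * f q)"
  unfolding monomial_along_def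
proof
  fix q
  have c: "const (1 - e) = 1 - const e" by (simp add: single_diff)
  show "const e * x + const (1 - e) - shift (indicator_of e q * f q) \<in> coeffs_in (P q)"
  proof (cases "e \<in> P q")
    case True
    have "const e * x + const (1 - e) - shift (indicator_of e q * f q) = const e * (x - 1)"
      using True by (simp add: indicator_of_def c algebra_simps)
    then show ?thesis using CP(4)[OF UNIV_I singleP[OF True]] by metis
  next
    case False
    have "const e * x + const (1 - e) - shift (indicator_of e q * f q) = (x - shift (f q)) + const (1 - e) * (1 - x)"
      using False by (simp add: indicator_of_def c algebra_simps)
    also have "\<dots> \<in> coeffs_in (P q)"
      using x by (intro CP(2) CP(4)[OF UNIV_I singleP[OF idem_residue[OF e False]]]) (simp add: monomial_along_def)
    finally show ?thesis .
  qed
qed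

text \<open>An inverse is carried along, so that multiplication by negative integers is available in
  the induction.\<close>

lemma monomial_exists:
  assumes "f \<in> fring IE"
  shows "\<exists>x y. monomial_along x f \<and> monomial_along y (\<lambda>q. - f q)"
  using assms
proof (induction rule: fring.induct)
  case one
  show ?case using monomial_shift[of 1] monomial_shift[of "-1"] by blast
next
  case (add f g)
  then obtain x y x' y' where "monomial_along x f" "monomial_along y (\<lambda>q. - f q)"
    "monomial_along x' g" "monomial_along y' (\<lambda>q. - g q)" by blast
  then have "monomial_along (x * x') (\<lambda>q. f q + g q)" "monomial_along (y * y') (\<lambda>q. - f q + - g q)"
    by (simp_all only: monomial_mult)
  then show ?case by (intro exI[of _ "x * x'"] exI[of _ "y * y'"]) (simp add: algebra_simps)
next
  case (scale f k)
  then obtain x y where xy: "monomial_along x f" "monomial_along y (\<lambda>q. - f q)" by blast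
  show ?case
  proof (cases "k \<ge> 0")
    case True
    then show ?thesis using monomial_power[OF xy(1), of "nat k"] monomial_power[OF xy(2), of "nat k"] by auto
  next
    case False
    then show ?thesis using monomial_power[OF xy(1), of "nat (- k)"] monomial_power[OF xy(2), of "nat (- k)"]
      by auto
  qed
next
  case (gen e f)
  then obtain e' x y where e': "e' \<in> idem" "e = indicator_of e'"
    and xy: "monomial_along x f" "monomial_along y (\<lambda>q. - f q)" by blast
  show ?case using monomial_indicator[OF e'(1) xy(1)] monomial_indicator[OF e'(1) xy(2)] e'(2) by auto
qed

lemma monomial_at_one: assumes "monomial_along x f" shows "at_one x - 1 \<in> N"
proof -
  have "at_one (x - shift (f q)) \<in> P q" for q
    using assms by (intro at_one_in_ideal[OF ring_subset_UNIV idealP]) (simp add: monomial_along_def)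
  then show ?thesis using Inter by (auto simp: at_one_diff)
qed

lemma monomial_coef: "monomial_along x f \<Longrightarrow> coef x n - (if f q = n then 1 else 0) \<in> P q"
  unfolding monomial_along_def coeffs_in_def
  by (auto simp: lookup_minus lookup_single when_def)

lemma monomial_coef_idem:
  assumes x: "monomial_along x f" shows "coef x n * coef x n - coef x n \<in> N"
proof -
  have "coef x n * coef x n - coef x n \<in> P q" for q
  proof (cases "f q = n")
    case True
    have "coef x n * coef x n - coef x n = coef x n * (coef x n - 1)" by (simp add: algebra_simps)
    then show ?thesis using IP(3)[OF UNIV_I, of "coef x n - 1" q "coef x n"] monomial_coef[OF x, of n q] True by simp
  next
    case False
    have "coef x n * coef x n - coef x n = (coef x n - 1) * coef x n" by (simp add: algebra_simps)
    then show ?thesis using IP(3)[OF UNIV_I, of "coef x n" q "coef x n - 1"] monomial_coef[OF x, of n q] False by simp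
  qed
  then show ?thesis using Inter by blast
qed

text \<open>The coefficients of \<open>x\<close> are 0 or 1 at each prime, hence idempotent modulo
  \<open>N\<close>. In a local ring such elements are 0 or 1 altogether, so a single exponent
  occurs.\<close>

lemma monomial_over_local:
  assumes A: "ring_subset A" and m: "local_modulo N A m" and x: "x \<in> coeffs_in A" "monomial_along x f"
  shows "\<exists>k. f = (\<lambda>_. k)"
proof -
  note NI = ideal_in_closed[OF ring_subset_UNIV N]
  have dich: "coef x n \<in> N \<or> 1 - coef x n \<in> N" for n
  proof -
    define a where "a = coef x n"
    have a: "a \<in> A" "a * a - a \<in> N" using coeffs_inD[OF x(1)] monomial_coef_idem[OF x(2)] by (auto simp: a_def)
    show ?thesis
    proof (cases "a \<in> m")
      case False
      then obtain y where y: "a * y - 1 \<in> N" using m a(1) by (auto simp: local_modulo_def)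
      \<comment> \<open>An invertible idempotent is 1: modulo \<open>N\<close>, \<open>a - 1\<close>
        equals \<open>(a * a - a) * y\<close>. The second case does the same for
        \<open>1 - a\<close>.\<close>
      have "1 - a = (a - 1) * (a * y - 1) - y * (a * a - a)" by (simp add: algebra_simps)
      also have "\<dots> \<in> N" by (intro NI(6) NI(3) UNIV_I y a(2))
      finally show ?thesis by (simp add: a_def)
    next
      case True
      have "1 - a \<notin> m"
      proof
        assume "1 - a \<in> m"
        then have "1 - a + a \<in> m" using m True by (intro ideal_in_add[OF A]) (auto simp: local_modulo_def)
        then show False using m by (simp add: local_modulo_def)
      qed
      then obtain y where y: "(1 - a) * y - 1 \<in> N"
        using m ring_subset_diff[OF A ring_subset_one[OF A] a(1)] by (auto simp: local_modulo_def)
      have "a = - (a * ((1 - a) * y - 1) + y * (a * a - a))" by (simp add: algebra_simps)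
      also have "\<dots> \<in> N" by (intro NI(5) NI(2) NI(3) UNIV_I y a(2))
      finally show ?thesis by (simp add: a_def)
    qed
  qed
  have "f q = n" if n: "1 - coef x n \<in> N" for n q
  proof (rule ccontr)
    assume "f q \<noteq> n"
    then have "coef x n \<in> P q" using monomial_coef[OF x(2), of n q] by simp
    then have "1 - coef x n + coef x n \<in> P q" using N_sub[OF n] by (intro IP(2))
    then show False using one_notin by simp
  qed
  moreover have "\<exists>n. 1 - coef x n \<in> N"
  proof (rule ccontr)
    fix q
    assume "\<nexists>n. 1 - coef x n \<in> N"
    then have "coef x (f q) \<in> P q" using dich N_sub by blast
    moreover have "coef x (f q) - 1 \<in> P q" using monomial_coef[OF x(2), of "f q" q] by simp
    ultimately have "coef x (f q) - (coef x (f q) - 1) \<in> P q" by (rule IP(6))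
    then show False using one_notin[of q] by simp
  qed
  ultimately show ?thesis by (metis ext)
qed

text \<open>At \<open>q\<close> exactly one idempotent of \<open>E\<close> is nonzero: at least one
  because the sum is 1, at most one by orthogonality. It is 1 there, and only its monomial
  remains.\<close>

lemma monomial_idempotent_monomials:
  assumes pair: "invertible_pair A N g h n" and E: "invertible_pair.splits_off N S E"
  shows "monomial_along (invertible_pair.idempotent_monomials E \<kappa>) (\<lambda>q. \<Sum>e\<in>E. indicator_of e q * \<kappa> e)"
  unfolding monomial_along_def
proof
  fix q
  let ?M = "invertible_pair.idempotent_monomials E \<kappa>"
  have M: "?M = (\<Sum>e\<in>E. Poly_Mapping.single (\<kappa> e) e)"
    by (simp add: invertible_pair.idempotent_monomials_def[OF pair])
  have E': "finite E" "E \<subseteq> idem" "\<And>e e'. e \<in> E \<Longrightarrow> e' \<in> E \<Longrightarrow> e \<noteq> e' \<Longrightarrow> e * e' \<in> N" "\<Sum>E - 1 \<in> N"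
    using E by (auto simp: invertible_pair.splits_off_def[OF pair] idem_def)
  have "\<exists>e\<in>E. e \<notin> P q"
  proof (rule ccontr)
    assume "\<not> ?thesis"
    then have "\<Sum>E \<in> P q" by (intro IP(7)) auto
    then have "\<Sum>E - (\<Sum>E - 1) \<in> P q" by (rule IP(6)[OF _ N_sub[OF E'(4)]])
    then show False using one_notin[of q] by simp
  qed
  then obtain d where d: "d \<in> E" "d \<notin> P q" by blast
  have other: "e \<in> P q" if "e \<in> E - {d}" for e
    using primeP[of e d q] N_sub[OF E'(3)[of e d]] that d by blast
  have "(\<Sum>e\<in>E. indicator_of e q * \<kappa> e) = \<kappa> d"
    using E'(1) d other by (subst sum.remove[of E d]) (auto simp: indicator_of_def)
  moreover have "?M - shift (\<kappa> d)
      = (\<Sum>e\<in>E - {d}. Poly_Mapping.single (\<kappa> e) e) - Poly_Mapping.single (\<kappa> d) (1 - d)"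
    unfolding M using E'(1) d by (subst sum.remove[of E d]) (auto simp: single_diff)
  moreover have "\<dots> \<in> coeffs_in (P q)"
    using other d E'(2) by (intro CP(6) CP(7) singleP idem_residue) auto
  ultimately show "?M - shift (\<Sum>e\<in>E. indicator_of e q * \<kappa> e) \<in> coeffs_in (P q)" by simp
qed

lemma sum_indicators_in_fring:
  assumes pair: "invertible_pair A N g h n" and E: "invertible_pair.splits_off N S E"
  shows "(\<lambda>q. \<Sum>e\<in>E. indicator_of e q * \<kappa> e) \<in> fring IE"
proof (rule fring_sum)
  fix e assume "e \<in> E"
  then have "indicator_of e \<in> IE" using E by (auto simp: invertible_pair.splits_off_def[OF pair] idem_def)
  then show "(\<lambda>q. indicator_of e q * \<kappa> e) \<in> fring IE" by (rule fring.gen[OF _ fring_const])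
qed

end

text \<open>An element outside the radical ideal \<open>N\<close> has no power in \<open>N\<close>,
  so some prime over \<open>N\<close> avoids all its powers.\<close>

lemma exists_residual_family:
  fixes N :: "'u::comm_ring_1 set"
  assumes N: "ideal_in UNIV N" and 1: "1 \<notin> N" and reduced: "\<And>x. x * x \<in> N \<Longrightarrow> x \<in> N"
  shows "\<exists>P :: 'u set \<Rightarrow> 'u set. residual_family N P"
proof -
  note U = ring_subset_UNIV
  have sq: "x ^ (2 ^ k) \<in> N \<Longrightarrow> x \<in> N" for x and k :: nat
  proof (induction k)
    case (Suc k)
    then show ?case using reduced[of "x ^ 2 ^ k"] by (simp add: power_mult power2_eq_square mult.commute flip: power_add mult_2)
  qed simp
  have pow: "x \<in> N" if "x ^ k \<in> N" for x k
  proof (rule sq[of x k])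
    have "x ^ (2 ^ k) = x ^ (2 ^ k - k) * x ^ k" by (simp flip: power_add)
    then show "x ^ (2 ^ k) \<in> N" using ideal_in_lmult[OF U N UNIV_I that] by simp
  qed
  obtain q0 where q0: "prime_in UNIV q0" "N \<subseteq> q0"
    using exists_prime_avoiding[OF U N, of "{1}"] 1 by auto
  \<comment> \<open>All sets of ring elements serve as indices; \<open>q0\<close> is the default for
    those that are not primes over \<open>N\<close>.\<close>
  define P where "P q = (if prime_in UNIV q \<and> N \<subseteq> q then q else q0)" for q
  have P: "prime_in UNIV (P q)" "N \<subseteq> P q" for q using q0 by (auto simp: P_def)
  have avoid: "\<exists>q. a \<notin> P q" if "a \<notin> N" for a
  proof -
    have "range (\<lambda>k. a ^ k) \<inter> N = {}" using pow that by auto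
    moreover have "1 \<in> range (\<lambda>k. a ^ k)" by (rule range_eqI[of _ _ 0]) simp
    moreover have "x * y \<in> range (\<lambda>k. a ^ k)" if "x \<in> range (\<lambda>k. a ^ k)" "y \<in> range (\<lambda>k. a ^ k)" for x y
      using that by (auto simp flip: power_add)
    ultimately obtain q where "prime_in UNIV q" "N \<subseteq> q" "range (\<lambda>k. a ^ k) \<inter> q = {}"
      using exists_prime_avoiding[OF U N] by metis
    then show ?thesis using rangeI[of "\<lambda>k. a ^ k" 1] by (intro exI[of _ q]) (auto simp: P_def)
  qed
  have "residual_family N P"
  proof
    show "ideal_in UNIV N" by (rule N)
    show "prime_in UNIV (P q)" for q by (rule P)
    show "(\<Inter>q. P q) = N"
    proof (intro equalityI subsetI)
      fix a assume a: "a \<in> (\<Inter>q. P q)"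
      show "a \<in> N" by (rule ccontr) (use avoid a in blast)
    qed (use P(2) in blast)
  qed
  then show ?thesis by blast
qed

section \<open>Principal modules\<close>

context ring_extension
begin

definition principal where "principal u = (\<lambda>a. u \<otimes> a) ` A"

lemma principal_subalgebra: assumes u: "u \<in> carrier R" shows "subalgebra A (principal u) R"
proof -
  note Ac = subcringE[OF A]
  have Ad: "a \<in> A \<Longrightarrow> a \<in> carrier R" for a using A_carrier by auto
  show ?thesis
  proof (rule subalgebraI)
    show "principal u \<subseteq> carrier R" using u Ad by (auto simp: principal_def)
    show "\<zero> \<in> principal u" using u Ac(2) by (auto simp: principal_def image_iff intro!: bexI[of _ \<zero>])
    show "x \<oplus> y \<in> principal u" if "x \<in> principal u" "y \<in> principal u" for x y
    proof -
      from that obtain a b where "a \<in> A" "b \<in> A" "x = u \<otimes> a" "y = u \<otimes> b" by (auto simp: principal_def)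
      then show ?thesis unfolding principal_def using u Ad Ac(7)
        by (intro image_eqI[of _ _ "a \<oplus> b"]) (auto simp: r_distr)
    qed
    show "\<ominus> x \<in> principal u" if "x \<in> principal u" for x
    proof -
      from that obtain a where "a \<in> A" "x = u \<otimes> a" by (auto simp: principal_def)
      then show ?thesis unfolding principal_def using u Ad Ac(5)
        by (intro image_eqI[of _ _ "\<ominus> a"]) (auto simp: r_minus)
    qed
    show "b \<otimes> x \<in> principal u" if "b \<in> A" "x \<in> principal u" for b x
    proof -
      from that obtain a where "a \<in> A" "x = u \<otimes> a" by (auto simp: principal_def)
      then show ?thesis unfolding principal_def using u Ad that Ac(6)
        by (intro image_eqI[of _ _ "b \<otimes> a"]) (auto simp: m_lcomm)
    qed
  qed
qed

lemma principal_mult: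
  assumes u: "u \<in> carrier R" and v: "v \<in> carrier R"
  shows "ideal_prod R (principal u) (principal v) = principal (u \<otimes> v)"
proof
  note Ac = subcringE[OF A]
  have Ad: "a \<in> A \<Longrightarrow> a \<in> carrier R" for a using A_carrier by auto
  note uv = subalgebraD[OF principal_subalgebra[OF m_closed[OF u v]]]
  show "ideal_prod R (principal u) (principal v) \<subseteq> principal (u \<otimes> v)"
  proof (rule ideal_prod_least[OF _ uv(3)])
    fix x y assume "x \<in> principal u" "y \<in> principal v"
    then obtain a b where "a \<in> A" "b \<in> A" "x = u \<otimes> a" "y = v \<otimes> b" by (auto simp: principal_def)
    then show "x \<otimes> y \<in> principal (u \<otimes> v)" unfolding principal_def using u v Ad Ac(6)
      by (intro image_eqI[of _ _ "a \<otimes> b"]) (auto simp: m_ac)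
  qed
  show "principal (u \<otimes> v) \<subseteq> ideal_prod R (principal u) (principal v)"
  proof
    fix x assume "x \<in> principal (u \<otimes> v)"
    then obtain a where a: "a \<in> A" "x = u \<otimes> v \<otimes> a" by (auto simp: principal_def)
    have "u \<in> principal u" unfolding principal_def using u one_in_A by (intro image_eqI[of _ _ \<one>]) auto
    moreover have "v \<otimes> a \<in> principal v" unfolding principal_def using a(1) by (rule imageI)
    ultimately have "u \<otimes> (v \<otimes> a) \<in> ideal_prod R (principal u) (principal v)" by (rule ideal_prod.prod)
    then show "x \<in> ideal_prod R (principal u) (principal v)" using a u v Ad by (simp add: m_assoc)
  qed
qed

lemma principal_unit_in_A:
  assumes u: "u \<in> A" and v: "v \<in> A" and uv: "u \<otimes> v = \<one>" shows "principal u = A"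
proof
  have Ad: "a \<in> A \<Longrightarrow> a \<in> carrier R" for a using A_carrier by auto
  note Ac = subcringE(6)[OF A]
  show "principal u \<subseteq> A" using u Ac by (auto simp: principal_def)
  show "A \<subseteq> principal u"
  proof
    fix a assume a: "a \<in> A"
    have "u \<otimes> (v \<otimes> a) = a" using uv u v a Ad by (simp flip: m_assoc)
    then show "a \<in> principal u" unfolding principal_def using Ac[OF v a] by (metis imageI)
  qed
qed

lemma principal_invertible:
  assumes u: "u \<in> carrier R" and v: "v \<in> carrier R" and uv: "u \<otimes> v = \<one>"
  shows "invertible_submodule A R (principal u)"
  by (rule invertible_submoduleI[OF principal_subalgebra[OF u] principal_subalgebra[OF v]])
    (use principal_mult[OF u v] principal_unit_in_A[OF one_in_A one_in_A] uv in simp)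

end

lemma (in extension_hom) extend_principal:
  assumes u: "u \<in> carrier B" and "\<phi> u = \<one>\<^bsub>C\<^esub>"
  shows "extend_module \<phi> A' C (B.principal u) = A'"
proof -
  have "\<phi> (u \<otimes>\<^bsub>B\<^esub> a) = \<phi> a" if "a \<in> A" for a
  proof -
    have "a \<in> carrier B" "\<phi> a \<in> carrier C" using that B.A_carrier \<phi>_carrier[of "{a}"] by auto
    then show ?thesis using ring_hom_mult[OF hom u] assms(2) by simp
  qed
  then have "\<phi> ` B.principal u = \<phi> ` A" by (force simp: B.principal_def image_iff)
  then show ?thesis using extend_A by (simp add: extend_module_def)
qed

section \<open>The group \<open>MI A B\<close> over a Hensel local ring\<close>

text \<open>\<open>\<Phi>\<close> identifies \<open>G\<close> with the functions modulo constants,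
  which have a basis by Noebeling's theorem.\<close>

lemma free_abelian_by_functions:
  fixes \<Phi> :: "('p \<Rightarrow> int) \<Rightarrow> 'g" and G :: "('g, 'h) monoid_scheme"
  assumes G: "comm_group G" and E: "boolean_valued E"
    and add: "\<And>f g. f \<in> fring E \<Longrightarrow> g \<in> fring E \<Longrightarrow> \<Phi> (\<lambda>x. f x + g x) = \<Phi> f \<otimes>\<^bsub>G\<^esub> \<Phi> g"
    and surj: "\<Phi> ` fring E = carrier G"
    and ker: "\<And>f. f \<in> fring E \<Longrightarrow> \<Phi> f = \<one>\<^bsub>G\<^esub> \<longleftrightarrow> (\<exists>k. f = (\<lambda>_. k))"
  shows "free_abelian G"
proof -
  interpret G: comm_group G by (rule G)
  obtain S where "basis_modulo S (fring E) (range (\<lambda>n _. n))" using noebeling[OF E] .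
  then have S: "S \<subseteq> fring E" "\<And>f. f \<in> fring E \<Longrightarrow> \<exists>c n. Poly_Mapping.keys c \<subseteq> S \<and> (\<lambda>x. f x - lincomb c x) = (\<lambda>_. n)"
    "\<And>c n. Poly_Mapping.keys c \<subseteq> S \<Longrightarrow> lincomb c = (\<lambda>_. n) \<Longrightarrow> c = 0"
    unfolding basis_modulo_def by (blast, blast, blast)
  let ?F = "free_Abelian_group S"
  define h where "h c = \<Phi> (lincomb c)" for c
  have lin: "lincomb c \<in> fring E" if "Poly_Mapping.keys c \<subseteq> S" for c
    using that S(1) by (intro lincomb_in_fring) blast
  have "h \<in> hom ?F G"
  proof (rule homI)
    fix c d assume cd: "c \<in> carrier ?F" "d \<in> carrier ?F"
    show "h c \<in> carrier G" using lin cd(1) surj by (auto simp: h_def)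
    have "lincomb (c + d) = (\<lambda>x. lincomb c x + lincomb d x)" by (simp add: fun_eq_iff lincomb_add)
    then show "h (c \<otimes>\<^bsub>?F\<^esub> d) = h c \<otimes>\<^bsub>G\<^esub> h d" using add lin cd by (simp add: h_def)
  qed
  then interpret h: group_hom ?F G h
    by (intro group_hom.intro group_hom_axioms.intro group_free_Abelian_group G.group_axioms)
  have inj: "inj_on h (carrier ?F)"
    unfolding h.inj_on_one_iff using ker lin S(3) by (auto simp: h_def)
  moreover have "h ` carrier ?F = carrier G"
  proof
    show "h ` carrier ?F \<subseteq> carrier G" by auto
    show "carrier G \<subseteq> h ` carrier ?F"
    proof
      fix y assume "y \<in> carrier G"
      then obtain f where f: "f \<in> fring E" "y = \<Phi> f" using surj by blast
      obtain c n where c: "Poly_Mapping.keys c \<subseteq> S" "(\<lambda>x. f x - lincomb c x) = (\<lambda>_. n)" using S(2)[OF f(1)] by blast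
      have "f = (\<lambda>x. lincomb c x + (\<lambda>_. n) x)" using fun_cong[OF c(2)] by (simp add: fun_eq_iff algebra_simps)
      then have "y = h c \<otimes>\<^bsub>G\<^esub> \<Phi> (\<lambda>_. n)" using add[OF lin[OF c(1)] fring_const, of n] f(2) by (simp add: h_def)
      also have "\<Phi> (\<lambda>_. n) = \<one>\<^bsub>G\<^esub>" using ker[OF fring_const] by blast
      finally show "y \<in> h ` carrier ?F" using c(1) by auto
    qed
  qed
  ultimately have "h \<in> iso ?F G" using h.homh by (auto simp: iso_def bij_betw_def)
  then have 1: "G \<cong> ?F" using group.iso_sym[of ?F G] by (auto simp: is_iso_def)
  have hs: "h (frag_of s) = \<Phi> s" for s
  proof -
    have "lincomb (frag_of s) = s" using lincomb_single[of s 1] by (simp add: fun_eq_iff)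
    then show ?thesis by (simp add: h_def)
  qed
  \<comment> \<open>The basis consists of functions, whereas \<open>free_abelian\<close> asks for an
    index set in the type of \<open>G\<close>; it is moved there along
    \<open>\<Phi>\<close>.\<close>
  have "inj_on \<Phi> S"
  proof (rule inj_onI)
    fix s t assume "s \<in> S" "t \<in> S" "\<Phi> s = \<Phi> t"
    then have "frag_of s = frag_of t" using hs inj_onD[OF inj, of "frag_of s" "frag_of t"] by simp
    then show "s = t" by (simp only: frag_of_eq)
  qed
  then have "S \<approx> \<Phi> ` S" by (rule eqpoll_sym[OF inj_on_image_eqpoll_self])
  then have "?F \<cong> free_Abelian_group (\<Phi> ` S)" by (simp add: isomorphic_free_Abelian_groups)
  then have "G \<cong> free_Abelian_group (\<Phi> ` S)" using 1 iso_trans by blast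
  then show ?thesis using G by (auto simp: free_abelian_def)
qed

lemma (in comm_monoid) mult_interchange:
  "a \<in> carrier G \<Longrightarrow> x \<in> carrier G \<Longrightarrow> b \<in> carrier G \<Longrightarrow> y \<in> carrier G \<Longrightarrow>
    a \<otimes> x \<otimes> (b \<otimes> y) = a \<otimes> b \<otimes> (x \<otimes> y)"
  by (simp add: m_ac)

locale hensel_extension = covered_extension \<pi> B A + residual_family "\<pi> -` {\<zero>\<^bsub>B\<^esub>}" P
  for \<pi> :: "'u::comm_ring_1 \<Rightarrow> 'a" and B :: "('a, 'b) ring_scheme" and A and P :: "'p \<Rightarrow> 'u set" +
  assumes si: "subintegrally_closed A B" and hensel: "hensel_local (B\<lparr>carrier := A\<rparr>)"
begin

interpretation G: group_retract "inv_submodules (LP_sub A B) (LP B)" "inv_submodules A B"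
  "LP_extend A B" "extend_module (LP_eval B) A B" by (rule LP_retract[OF c A])

text \<open>The module generated by a unit with exponents \<open>f\<close>. The choice of the unit
  is immaterial, as the exponents determine it modulo the kernel.\<close>

definition module_of where "module_of f = X\<alpha>.B.principal (l (SOME x. monomial_along x f))"

lemma l_eq: "x - y \<in> coeffs_in (\<pi> -` {\<zero>\<^bsub>B\<^esub>}) \<Longrightarrow> l x = l y"
  using cover_eq_iff[OF cl, of x y] lp_map_zero[OF c A] by blast

lemma module_of_eq: assumes "monomial_along x f" shows "module_of f = X\<alpha>.B.principal (l x)"
  using l_eq[OF monomial_unique[OF assms someI[of "\<lambda>x. monomial_along x f", OF assms]]]
  by (simp add: module_of_def)

lemma module_of_add:
  assumes "f \<in> fring IE" "g \<in> fring IE"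
  shows "module_of (\<lambda>q. f q + g q) = ideal_prod (LP B) (module_of f) (module_of g)"
proof -
  obtain x y where x: "monomial_along x f" and y: "monomial_along y g" using assms monomial_exists by blast
  show ?thesis
    unfolding module_of_eq[OF x] module_of_eq[OF y] module_of_eq[OF monomial_mult[OF x y]]
    using X\<alpha>.B.principal_mult[OF cover_in[OF cl] cover_in[OF cl]] by (simp add: cover_simps[OF cl])
qed

lemma module_of_const: "module_of (\<lambda>_. k) = LP_sub A B"
proof -
  have s: "l (shift j) \<in> LP_sub A B" for j
    using ring_subset_zero[OF ring_subset_preimage[OF c A]] ring_subset_one[OF ring_subset_preimage[OF c A]]
    by (simp add: lp_map_in_LP_sub[OF c A] single_in_coeffs_in)
  have "l (shift k) \<otimes>\<^bsub>LP B\<^esub> l (shift (- k)) = \<one>\<^bsub>LP B\<^esub>"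
    by (simp add: mult_single flip: cover_simps[OF cl])
  then show ?thesis unfolding module_of_eq[OF monomial_shift] by (rule X\<alpha>.B.principal_unit_in_A[OF s s])
qed

lemma module_of_invertible:
  assumes "f \<in> fring IE" shows "module_of f \<in> carrier (inv_submodules (LP_sub A B) (LP B))"
proof -
  obtain x y where xy: "monomial_along x f" "monomial_along y (\<lambda>q. - f q)" using assms monomial_exists by blast
  have "monomial_along (x * y) (\<lambda>_. 0)" using monomial_mult[OF xy] by simp
  then have "l (x * y) = l 1" using l_eq[OF monomial_unique[OF _ monomial_shift]] by simp
  then have "l x \<otimes>\<^bsub>LP B\<^esub> l y = \<one>\<^bsub>LP B\<^esub>" by (simp add: cover_simps[OF cl])
  then show ?thesis using X\<alpha>.B.principal_invertible[OF cover_in[OF cl] cover_in[OF cl]]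
    by (simp add: module_of_eq[OF xy(1)] inv_submodules_simps)
qed

text \<open>The generator takes the value 1 at \<open>X = 1\<close>. If the module is extended from
  some \<open>I\<close>, evaluation shows \<open>I = A\<close>, so the generator lies in
  \<open>A[X,1/X]\<close>, and over a local ring its exponents are constant.\<close>

lemma module_of_trivial:
  assumes f: "f \<in> fring IE" and t: "module_of f \<in> G.N" shows "\<exists>k. f = (\<lambda>_. k)"
proof -
  obtain x where x: "monomial_along x f" using f monomial_exists by blast
  interpret ev: extension_hom "LP_sub A B" "LP B" A B "LP_eval B" by (rule extension_hom_LP_eval[OF c A])
  have "\<pi> (at_one x) = \<pi> 1" using monomial_at_one[OF x] cover_eq_iff[OF c] by blast
  then have "extend_module (LP_eval B) A B (module_of f) = A"
    unfolding module_of_eq[OF x]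
    by (intro ev.extend_principal cover_in[OF cl]) (simp add: LP_eval_lp_map[OF c] cover_simps[OF c])
  moreover obtain I where I: "I \<in> carrier (inv_submodules A B)" "module_of f = LP_extend A B I" using t by blast
  ultimately have "module_of f = LP_extend A B A"
    using LP_eval_extend[OF c A] by (simp add: inv_submodules_simps)
  also have "\<dots> = LP_sub A B"
    unfolding LP_extend_eq by (rule extension_hom.extend_A[OF extension_hom_LP_const[OF c A]])
  finally have "X\<alpha>.B.principal (l x) = LP_sub A B" by (simp add: module_of_eq[OF x])
  moreover have "l x \<otimes>\<^bsub>LP B\<^esub> \<one>\<^bsub>LP B\<^esub> \<in> X\<alpha>.B.principal (l x)"
    unfolding X\<alpha>.B.principal_def using X\<alpha>.B.one_in_A by (rule imageI)
  ultimately have "l x \<in> LP_sub A B" using cover_in[OF cl, of x] by simp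
  then have xA: "x \<in> coeffs_in (\<pi> -` A)" by (simp add: lp_map_in_LP_sub[OF c A])
  have "local_ring (B\<lparr>carrier := A\<rparr>)" using hensel by (simp add: hensel_local_def)
  then obtain m where "local_modulo (\<pi> -` {\<zero>\<^bsub>B\<^esub>}) (\<pi> -` A) m" using local_modulo_cover[OF c A] by blast
  then show ?thesis using monomial_over_local[OF ring_subset_preimage[OF c A] _ xA x] by blast
qed

text \<open>Multiplication by the unit built from idempotents turns \<open>I\<close> into a module
  with generators over \<open>A\<close>, hence into the trivial one. So \<open>I\<close> is
  generated by the inverse unit, which has exponent \<open>- \<kappa> e\<close> on the factor of
  \<open>e\<close>.\<close>

lemma normalised_is_module_of:
  assumes I: "I \<in> carrier (inv_submodules (LP_sub A B) (LP B))"
    and I1: "extend_module (LP_eval B) A B I = A"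
  shows "\<exists>f\<in>fring IE. I = module_of f"
proof -
  obtain J where "normalised_module \<pi> B A I J" using exists_normalised_module[OF c A I I1] by blast
  then interpret NM: normalised_module \<pi> B A I J .
  obtain n f g where pair: "invertible_pair (\<pi> -` A) (\<pi> -` {\<zero>\<^bsub>B\<^esub>}) f g n"
    and gen: "\<forall>i<n. l (f i) \<in> I \<and> l (g i) \<in> J" and one: "\<one>\<^bsub>LP B\<^esub> = l (\<Sum>i<n. f i * g i)"
    using NM.generators by blast
  interpret Q: invertible_pair "\<pi> -` A" "\<pi> -` {\<zero>\<^bsub>B\<^esub>}" f g n by (rule pair)
  have "local_ring (B\<lparr>carrier := A\<rparr>)" using hensel by (simp add: hensel_local_def)
  then obtain m where m: "local_modulo (\<pi> -` {\<zero>\<^bsub>B\<^esub>}) (\<pi> -` A) m" using local_modulo_cover[OF c A] by blast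
  have "\<exists>S E \<kappa>. Q.splits_off S E \<and>
      (\<forall>i<n. Q.idempotent_monomials E \<kappa> * f i \<in> coeffs_in (\<pi> -` A)) \<and>
      (\<forall>i<n. Q.idempotent_monomials E (\<lambda>e. - \<kappa> e) * g i \<in> coeffs_in (\<pi> -` A))"
  proof (rule Q.local_pair_splits[OF subintegrally_closed_preimage[OF c A si] m])
    show "\<exists>E. Q.splits_off S E"
      if "ring_subset S" "\<pi> -` A \<subseteq> S" "finite Z" "S = span_over (\<pi> -` A) Z" for S Z
      by (rule hensel_splits_off[OF c A hensel pair that])
  qed blast
  then obtain S E \<kappa> where E: "Q.splits_off S E"
    and f: "\<And>i. i < n \<Longrightarrow> Q.idempotent_monomials E \<kappa> * f i \<in> coeffs_in (\<pi> -` A)"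
    and g: "\<And>i. i < n \<Longrightarrow> Q.idempotent_monomials E (\<lambda>e. - \<kappa> e) * g i \<in> coeffs_in (\<pi> -` A)"
    by blast
  let ?u = "Q.idempotent_monomials E \<kappa>" and ?v = "Q.idempotent_monomials E (\<lambda>e. - \<kappa> e)"
  have "l (?u * ?v) = l 1" by (rule l_eq[OF Q.idempotent_monomials_inverse[OF E]])
  then have uv: "l ?u \<otimes>\<^bsub>LP B\<^esub> l ?v = \<one>\<^bsub>LP B\<^esub>" by (simp add: cover_simps[OF cl])
  note lc = cover_in[OF cl]
  note pu = X\<alpha>.B.principal_subalgebra[OF lc, of ?u] and pv = X\<alpha>.B.principal_subalgebra[OF lc, of ?v]
  note sc = subalgebraD(1)
  have mem: "l x \<in> X\<alpha>.B.principal (l x)" for x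
    unfolding X\<alpha>.B.principal_def using lc[of x] X\<alpha>.B.one_in_A by (intro image_eqI[of _ _ "\<one>\<^bsub>LP B\<^esub>"]) auto
  have puv: "ideal_prod (LP B) (X\<alpha>.B.principal (l ?u)) (X\<alpha>.B.principal (l ?v)) = LP_sub A B"
    using X\<alpha>.B.principal_mult[OF lc lc, of ?u ?v] uv X\<alpha>.B.principal_unit_in_A[OF X\<alpha>.B.one_in_A X\<alpha>.B.one_in_A] by simp
  define I' where "I' = ideal_prod (LP B) (X\<alpha>.B.principal (l ?u)) I"
  define J' where "J' = ideal_prod (LP B) (X\<alpha>.B.principal (l ?v)) J"
  have I': "subalgebra (LP_sub A B) I' (LP B)" and J': "subalgebra (LP_sub A B) J' (LP B)"
    unfolding I'_def J'_def by (intro X\<alpha>.B.prod_closed pu pv NM.IJ)+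
  have inv: "X\<alpha>.B.principal (l ?u) \<in> carrier (inv_submodules (LP_sub A B) (LP B))"
    "X\<alpha>.B.principal (l ?v) \<in> carrier (inv_submodules (LP_sub A B) (LP B))"
    using X\<alpha>.B.invertible_submoduleI[OF pu pv puv] X\<alpha>.B.invertible_submoduleI[OF pv pu] puv
      X\<alpha>.B.ideal_prod_comm[OF sc[OF pu] sc[OF pv]] by (simp_all add: inv_submodules_simps)
  have J: "J \<in> carrier (inv_submodules (LP_sub A B) (LP B))"
    using X\<alpha>.B.invertible_submoduleI[OF NM.IJ(2,1)] NM.IJ(3) X\<alpha>.B.ideal_prod_comm[OF sc[OF NM.IJ(1)] sc[OF NM.IJ(2)]]
    by (simp add: inv_submodules_simps)
  have "ideal_prod (LP B) I' J' = LP_sub A B"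
  proof -
    have "I' \<otimes>\<^bsub>inv_submodules (LP_sub A B) (LP B)\<^esub> J'
      = (X\<alpha>.B.principal (l ?u) \<otimes>\<^bsub>inv_submodules (LP_sub A B) (LP B)\<^esub> X\<alpha>.B.principal (l ?v))
        \<otimes>\<^bsub>inv_submodules (LP_sub A B) (LP B)\<^esub> (I \<otimes>\<^bsub>inv_submodules (LP_sub A B) (LP B)\<^esub> J)"
      using G.G.mult_interchange[OF inv(1) I inv(2) J] by (simp add: I'_def J'_def inv_submodules_simps)
    then show ?thesis using puv NM.IJ(3) X\<alpha>.B.A_prod[OF X\<alpha>.B.A_subalgebra] by (simp add: inv_submodules_simps)
  qed
  note IJ' = I' J' this
  have gen': "l (?u * f i) \<in> I'" "l (?v * g i) \<in> J'" if "i < n" for i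
    unfolding I'_def J'_def cover_simps(2)[OF cl] using gen that by (intro ideal_prod.prod mem; blast)+
  have one': "\<one>\<^bsub>LP B\<^esub> = l (\<Sum>i<n. (?u * f i) * (?v * g i))"
  proof -
    have "(\<Sum>i<n. (?u * f i) * (?v * g i)) = (?u * ?v) * (\<Sum>i<n. f i * g i)"
      by (simp add: sum_distrib_left mult_ac)
    then have "l (\<Sum>i<n. (?u * f i) * (?v * g i)) = (l ?u \<otimes>\<^bsub>LP B\<^esub> l ?v) \<otimes>\<^bsub>LP B\<^esub> l (\<Sum>i<n. f i * g i)"
      by (simp only: cover_simps(2)[OF cl])
    then show ?thesis unfolding uv one[symmetric] by simp
  qed
  have "I' = LP_sub A B"
    by (rule trivial_if_generators_in[OF X\<alpha>.B.ring_extension_axioms cl IJ' gen' _ _ one'])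
      (use f g lp_map_in_LP_sub[OF c A] in auto)
  then have "X\<alpha>.B.principal (l ?v) = ideal_prod (LP B) (X\<alpha>.B.principal (l ?v)) I'"
    using X\<alpha>.B.prod_A[OF pv] by simp
  also have "\<dots> = ideal_prod (LP B) (ideal_prod (LP B) (X\<alpha>.B.principal (l ?u)) (X\<alpha>.B.principal (l ?v))) I"
    unfolding I'_def using X\<alpha>.B.ideal_prod_assoc[OF sc[OF pv] sc[OF pu] sc[OF NM.IJ(1)]]
      X\<alpha>.B.ideal_prod_comm[OF sc[OF pu] sc[OF pv]] by simp
  also have "\<dots> = I" using puv X\<alpha>.B.A_prod[OF NM.IJ(1)] by simp
  finally have "I = X\<alpha>.B.principal (l ?v)" by simp
  then show ?thesis
    using module_of_eq[OF monomial_idempotent_monomials[OF pair E]] sum_indicators_in_fring[OF pair E]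
    by (metis (no_types, lifting))
qed

abbreviation GL where "GL \<equiv> inv_submodules (LP_sub A B) (LP B)"

definition mi_class where
  "mi_class f = r_coset GL G.N (module_of f)"

lemma mi_class_add:
  assumes "f \<in> fring IE" "g \<in> fring IE"
  shows "mi_class (\<lambda>q. f q + g q) = mi_class f \<otimes>\<^bsub>MI A B\<^esub> mi_class g"
  using normal.rcos_sum[OF G.N_normal module_of_invertible[OF assms(1)] module_of_invertible[OF assms(2)]]
  by (simp add: mi_class_def MI_def FactGroup_def module_of_add[OF assms] inv_submodules_simps)

lemma one_MI: "\<one>\<^bsub>MI A B\<^esub> = G.N" by (simp add: MI_def)

lemma mi_class_trivial_iff:
  assumes f: "f \<in> fring IE" shows "mi_class f = \<one>\<^bsub>MI A B\<^esub> \<longleftrightarrow> (\<exists>k. f = (\<lambda>_. k))"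
proof -
  have "mi_class f = \<one>\<^bsub>MI A B\<^esub> \<longleftrightarrow> module_of f \<in> G.N"
    unfolding mi_class_def one_MI by (rule G.coset_eq_N[OF module_of_invertible[OF f]])
  also have "\<dots> \<longleftrightarrow> (\<exists>k. f = (\<lambda>_. k))"
  proof
    assume "\<exists>k. f = (\<lambda>_. k)"
    then show "module_of f \<in> G.N"
      using module_of_const subgroup.one_closed[OF G.N_subgroup] by (auto simp: inv_submodules_simps)
  qed (rule module_of_trivial[OF f])
  finally show ?thesis .
qed

text \<open>Each class contains its reduced representative, which is normalised at
  \<open>X = 1\<close>.\<close>

lemma mi_class_surj: "mi_class ` fring IE = carrier (MI A B)"
proof
  show "mi_class ` fring IE \<subseteq> carrier (MI A B)"
    using module_of_invertible by (auto simp: mi_class_def MI_def carrier_FactGroup)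
  show "carrier (MI A B) \<subseteq> mi_class ` fring IE"
  proof
    fix y assume "y \<in> carrier (MI A B)"
    then obtain I where I: "I \<in> carrier (GL)"
      "y = r_coset GL G.N I" by (auto simp: MI_def carrier_FactGroup)
    have r: "G.reduce I \<in> carrier (GL)"
      "extend_module (LP_eval B) A B (G.reduce I) = A"
      using G.reduce[OF I(1)] by (simp_all add: inv_submodules_simps)
    obtain f where f: "f \<in> fring IE" "G.reduce I = module_of f" using normalised_is_module_of[OF r] by blast
    have e: "LP_extend A B (extend_module (LP_eval B) A B I) \<in> G.N"
      by (rule imageI[OF G.E.hom_closed[OF I(1)]])
    have "y = r_coset GL G.N (G.reduce I)"
    proof -
      have ec: "LP_extend A B (extend_module (LP_eval B) A B I) \<in> carrier (GL)"
        using subgroup.subset[OF G.N_subgroup] e by blast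
      have "I = LP_extend A B (extend_module (LP_eval B) A B I)
          \<otimes>\<^bsub>GL\<^esub> G.reduce I"
        using G.reduce_eq[OF I(1)] G.G.m_comm[OF r(1) ec] by simp
      then have "y = r_coset GL G.N
          (LP_extend A B (extend_module (LP_eval B) A B I) \<otimes>\<^bsub>GL\<^esub> G.reduce I)"
        using I(2) by simp
      also have "\<dots> = r_coset GL G.N (G.reduce I)"
        using G.G.coset_mult_assoc[OF subgroup.subset[OF G.N_subgroup] ec r(1)] G.G.coset_join2[OF ec G.N_subgroup e]
        by simp
      finally show ?thesis .
    qed
    then show "y \<in> mi_class ` fring IE" using f by (simp add: mi_class_def)
  qed
qed

lemma comm_group_MI: "comm_group (MI A B)"
  unfolding MI_def by (rule G.quotient_comm_group)

theorem MI_free: "free_abelian (MI A B)"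
  by (rule free_abelian_by_functions[OF comm_group_MI boolean_IE mi_class_add mi_class_surj mi_class_trivial_iff])

text \<open>With a single prime every exponent function is constant, and constants give the trivial
  class.\<close>

theorem MI_trivial:
  assumes "\<And>q q'. P q = P q'" shows "trivial_group (MI A B)"
proof -
  have "\<exists>k. f = (\<lambda>_. k)" if "f \<in> fring IE" for f
    using that
  proof (induction rule: fring.induct)
    case (gen e f)
    obtain e' where "e = indicator_of e'" using gen(1) by blast
    then have e: "e q = e q'" for q q' using assms[of q q'] by (simp add: indicator_of_def)
    obtain k where k: "f = (\<lambda>_. k)" using gen by blast
    show ?case
    proof (intro exI ext)
      show "e q * f q = e undefined * k" for q using e[of q undefined] k by simp
    qed
  qed auto
  then have "carrier (MI A B) \<subseteq> {\<one>\<^bsub>MI A B\<^esub>}" using mi_class_surj mi_class_trivial_iff by blast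
  moreover have g: "group (MI A B)" using comm_group_MI by (rule comm_group.axioms(2))
  ultimately show ?thesis using monoid.one_closed[OF group.is_monoid[OF g]] by (auto simp: trivial_group_def)
qed

end

text \<open>If \<open>b * b = 0\<close>, then \<open>b ^ 3 = b ^ 2\<close>, so
  \<open>b = a ^ 2 = a ^ 3\<close> for some \<open>a\<close>. Consequently
  \<open>b = a * b = a ^ 2 * b = b * b = 0\<close>.\<close>

lemma seminormal_reduced:
  assumes "cring B" and sn: "seminormal B" and b: "b \<in> carrier B" "b \<otimes>\<^bsub>B\<^esub> b = \<zero>\<^bsub>B\<^esub>"
  shows "b = \<zero>\<^bsub>B\<^esub>"
proof -
  interpret cring B by (rule assms(1))
  have "b [^]\<^bsub>B\<^esub> (3::nat) = b [^]\<^bsub>B\<^esub> (2::nat)" using b by (simp add: numeral_eq_Suc)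
  then obtain a where a: "a \<in> carrier B" "b = a [^]\<^bsub>B\<^esub> (2::nat)" "b = a [^]\<^bsub>B\<^esub> (3::nat)"
    using sn b(1) unfolding seminormal_def by blast
  have "b = a \<otimes>\<^bsub>B\<^esub> b" using a by (metis nat_pow_Suc numeral_3_eq_3 numeral_2_eq_2 m_comm nat_pow_closed)
  then have "b = a \<otimes>\<^bsub>B\<^esub> (a \<otimes>\<^bsub>B\<^esub> b)" by simp
  also have "\<dots> = b \<otimes>\<^bsub>B\<^esub> b" using a(1,2) b(1) by (simp add: numeral_eq_Suc flip: m_assoc)
  finally show ?thesis using b by simp
qed

theorem proposition3p5:
  fixes A :: "'a set" and B :: "('a, 'b) ring_scheme"
  assumes "cring B" and "subcring A B"
    and "subintegrally_closed A B"
  shows "MI A B \<cong> MI (poly_sub A B) (UP B) \<and>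
    (seminormal B \<longrightarrow> torsion_free_abelian (MI A B)) \<and>
    (seminormal B \<and> hensel_local (B\<lparr>carrier := A\<rparr>) \<longrightarrow> free_abelian (MI A B)) \<and>
    (seminormal B \<and> domain B \<and> hensel_local (B\<lparr>carrier := A\<rparr>) \<longrightarrow> trivial_group (MI A B))"
proof -
  note B = assms(1) and A = assms(2) and si = assms(3)
  interpret B: cring B by (rule B)
  define \<pi> where "\<pi> = component B"
  have c: "cover \<pi> B" unfolding \<pi>_def by (rule cover_component[OF B])
  interpret C: covered_extension \<pi> B A by (rule covered_extension.intro[OF c A])
  note kI = kernel_ideal[OF c A]
  \<comment> \<open>A local ring is not the zero ring, and \<open>A\<close> shares 0 and 1 with
    \<open>B\<close>. Primes over the kernel exist only when these differ.\<close>
  have nontrivial: "\<one>\<^bsub>B\<^esub> \<noteq> \<zero>\<^bsub>B\<^esub>" if "hensel_local (B\<lparr>carrier := A\<rparr>)"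
    using that local_ring_splitting[of "B\<lparr>carrier := A\<rparr>"] by (simp add: hensel_local_def splitting_def)
  have "free_abelian (MI A B)" if sn: "seminormal B" and h: "hensel_local (B\<lparr>carrier := A\<rparr>)"
  proof -
    have "\<exists>P :: ('a, 'b) all_rings set \<Rightarrow> ('a, 'b) all_rings set. residual_family (\<pi> -` {\<zero>\<^bsub>B\<^esub>}) P"
    proof (rule exists_residual_family[OF kI])
      show "1 \<notin> \<pi> -` {\<zero>\<^bsub>B\<^esub>}" using nontrivial[OF h] by (simp add: cover_simps[OF c])
      show "x \<in> \<pi> -` {\<zero>\<^bsub>B\<^esub>}" if "x * x \<in> \<pi> -` {\<zero>\<^bsub>B\<^esub>}" for x
        using that seminormal_reduced[OF B sn cover_in[OF c]] by (simp add: cover_simps[OF c])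
    qed
    then obtain P :: "('a, 'b) all_rings set \<Rightarrow> ('a, 'b) all_rings set" where "residual_family (\<pi> -` {\<zero>\<^bsub>B\<^esub>}) P" by blast
    then interpret hensel_extension \<pi> B A P
      using si h C.covered_extension_axioms by (intro hensel_extension.intro hensel_extension_axioms.intro)
    show ?thesis by (rule MI_free)
  qed
  moreover have "trivial_group (MI A B)" if dom: "domain B" and h: "hensel_local (B\<lparr>carrier := A\<rparr>)"
  proof -
    have "prime_in UNIV (\<pi> -` {\<zero>\<^bsub>B\<^esub>})"
      using kI nontrivial[OF h] domain.integral[OF dom] cover_in[OF c]
      by (auto simp: prime_in_def cover_simps[OF c])
    \<comment> \<open>In a domain the zero ideal is prime, so a family with one member
      suffices.\<close>
    then have "residual_family (\<pi> -` {\<zero>\<^bsub>B\<^esub>}) (\<lambda>_::unit. \<pi> -` {\<zero>\<^bsub>B\<^esub>})"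
      using kI by unfold_locales auto
    then interpret hensel_extension \<pi> B A "\<lambda>_::unit. \<pi> -` {\<zero>\<^bsub>B\<^esub>}"
      using si h C.covered_extension_axioms by (intro hensel_extension.intro hensel_extension_axioms.intro)
    show ?thesis by (rule MI_trivial) simp
  qed
  ultimately show ?thesis using C.MI_polynomial_iso[OF si] MI_torsion_free[OF c A si] by blast
qed

end
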